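(* There exist an absolute margin $d_*>1$ and constants $C_1>0$ and $\vartheta\in(0,1)$ such that the following holds. Let $\mu\ge0$, let $\Gamma\in L^\infty(J_{d_*};\mathbb C^{2\times2})$ with $\|\Gamma\|_{L^\infty(J_{d_*})}\le\mu$, and let $w$ be a weak finite-energy solution on $J_{d_*}$ of $w_{tt}+w_t-A_0w=C^*\Gamma(t)Cw$. Then \[ \|w(0)\|_{\mathcal H}^2\le C_1\exp\bigl(C_1(1+\mu^2)\bigr)\,\mathcal M_{d_*}(w)^{2(1-\vartheta)}\,\|Cw\|_{L^2(J_{d_*})}^{2\vartheta}. \]
   Context: Let $\omega(\varphi)=(\sin\varphi)^{1/2}$, $\mathcal H=L^2((0,\pi),\omega\,d\varphi)$, $\mathfrak a_0[f,g]=4\int_0^\pi\omega f'\,\overline{g'}\,d\varphi$ with form domain $\mathcal V=\{f\in\mathcal H:f\in H^1_{\mathrm{loc}}(0,\pi),\int_0^\pi\omega|f'|^2d\varphi<\infty\}$, $\|f\|_{\mathcal V}^2=\mathfrak a_0[f,f]+\|f\|_{\mathcal H}^2$, and $\mathcal V^*$ the (anti)dual with pivot $\mathcal H$. $A_0$ is the operator of the form $\mathfrak a_0$ (also viewed as a bounded map $\mathcal V\to\mathcal V^*$), $A_0f=-4\omega^{-1}(\omega f')'$. Elements of $\mathcal V$ have endpoint values depending continuously on $f\in\mathcal V$; the trace operator is $C:\mathcal V\to\mathbb C^2$, $Cf=(f(0),f(\pi))^{\mathsf T}$, with dual $C^*:\mathbb C^2\to\mathcal V^*$. For $d>1$ put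 $J_d=(-d,1+d)$ and $\mathcal M_d(w)=\sup_{t\in J_d}\|w(t)\|_{\mathcal H}$; $\|Cw\|_{L^2(J_d)}$ is the $L^2(J_d;\mathbb C^2)$ norm. Weak finite-energy solution on a bounded interval $J$ of $w_{tt}+w_t-A_0w=C^*\Gamma(t)Cw$: $w\in L^2(J;\mathcal V)\cap H^1(J;\mathcal H)$, $w_{tt}\in L^2(J;\mathcal V^* )$, and for every $\psi\in C_c^\infty(J;\mathcal V)$, $\int_J\bigl(\langle w_{tt},\psi\rangle_{\mathcal V^*,\mathcal V}+(w_t,\psi)_{\mathcal H}-\mathfrak a_0[w,\psi]-(\Gamma Cw,C\psi)_{\mathbb C^2}\bigr)dt=0$. Such $w$ belongs to $C(\overline J;\mathcal H)$. *)

theory Defs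
  imports "HOL-Analysis.Analysis"
begin

section \<open>Vector-valued functions of one real variable\<close>

text \<open>
  The library's Bochner integral needs a second countable target type. The two definitions
  below are the usual ones (approximation by simple functions) for an arbitrary normed target;
  \<open>bochner_integral_is\<close> repeats the definition of \<^const>\<open>has_bochner_integral\<close>, with Borel
  measurability replaced by strong measurability.
\<close>

definition strongly_measurable :: "'s measure \<Rightarrow> ('s \<Rightarrow> 'b::real_normed_vector) \<Rightarrow> bool" where
  "strongly_measurable M f \<longleftrightarrow>
     (\<exists>s. (\<forall>n::nat. simple_function M (s n)) \<and> (AE x in M. (\<lambda>n. s n x) \<longlonglongrightarrow> f x))"

definition bochner_integral_is ::
    "'s measure \<Rightarrow> ('s \<Rightarrow> 'b::real_normed_vector) \<Rightarrow> 'b \<Rightarrow> bool" where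
  "bochner_integral_is M f I \<longleftrightarrow>
     strongly_measurable M f \<and>
     (\<exists>s. (\<forall>n::nat. Bochner_Integration.simple_bochner_integrable M (s n)) \<and>
          (\<lambda>n. \<integral>\<^sup>+x. ennreal (norm (f x - s n x)) \<partial>M) \<longlonglongrightarrow> 0 \<and>
          (\<lambda>n. Bochner_Integration.simple_bochner_integral M (s n)) \<longlonglongrightarrow> I)"

definition bochner_L2 :: "real set \<Rightarrow> (real \<Rightarrow> 'b::real_normed_vector) \<Rightarrow> bool" where
  "bochner_L2 J f \<longleftrightarrow>
     strongly_measurable (lebesgue_on J) f \<and> integrable (lebesgue_on J) (\<lambda>t. (norm (f t))\<^sup>2)"

definition smooth :: "(real \<Rightarrow> 'b::real_normed_vector) \<Rightarrow> bool" where
  "smooth f \<longleftrightarrow>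
     (\<exists>D. D 0 = f \<and> (\<forall>(n::nat) t. (D n has_vector_derivative D (Suc n) t) (at t)))"

text \<open>\<open>test_function J f\<close> is \<open>f \<in> C\<^sub>c\<^sup>\<infinity>(J; X)\<close>, extended by zero to the whole line.\<close>

definition test_function :: "real set \<Rightarrow> (real \<Rightarrow> 'b::real_normed_vector) \<Rightarrow> bool" where
  "test_function J f \<longleftrightarrow>
     smooth f \<and> (\<exists>K. compact K \<and> K \<subseteq> J \<and> (\<forall>t. t \<notin> K \<longrightarrow> f t = 0))"

text \<open>\<open>bochner_weak_deriv J u v\<close>: \<open>u' = v\<close> in the sense of vector-valued distributions on \<open>J\<close>.\<close>

definition bochner_weak_deriv ::
    "real set \<Rightarrow> (real \<Rightarrow> 'b::real_normed_vector) \<Rightarrow> (real \<Rightarrow> 'b) \<Rightarrow> bool" where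
  "bochner_weak_deriv J u v \<longleftrightarrow>
     (\<forall>\<eta> :: real \<Rightarrow> real. test_function J \<eta> \<longrightarrow>
        (\<exists>I. bochner_integral_is (lebesgue_on J) (\<lambda>t. deriv \<eta> t *\<^sub>R u t) (- I) \<and>
             bochner_integral_is (lebesgue_on J) (\<lambda>t. \<eta> t *\<^sub>R v t) I))"


section \<open>The weighted space \<open>\<H> = L\<^sup>2((0,\<pi>), \<omega> d\<phi>)\<close>\<close>

definition omega :: "real \<Rightarrow> real" where
  "omega \<phi> = sqrt (sin \<phi>)"

definition omega_measure :: "real measure" where
  "omega_measure = density (lebesgue_on {0<..<pi}) (\<lambda>\<phi>. ennreal (omega \<phi>))"

definition L2_omega :: "(real \<Rightarrow> complex) set" where
  "L2_omega = {f. f \<in> borel_measurable omega_measure \<and>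
                  integrable omega_measure (\<lambda>\<phi>. (cmod (f \<phi>))\<^sup>2)}"

lemma omega_pos: "\<phi> \<in> {0<..<pi} \<Longrightarrow> 0 < omega \<phi>"
  by (simp add: omega_def sin_gt_zero)

lemma omega_borel [measurable]: "omega \<in> borel_measurable borel"
  unfolding omega_def by measurable

lemma omega_measurable: "(\<lambda>\<phi>. ennreal (omega \<phi>)) \<in> borel_measurable (lebesgue_on {0<..<pi})"
proof -
  have "omega \<in> borel_measurable lebesgue"
    by (rule measurable_completion) simp
  then have "omega \<in> borel_measurable (lebesgue_on {0<..<pi})"
    by (rule measurable_restrict_space1)
  then show ?thesis by measurable
qed

lemma sets_omega_measure: "sets omega_measure = sets (lebesgue_on {0<..<pi})"
  by (simp add: omega_measure_def)

lemma AE_omega_measure: "(AE \<phi> in omega_measure. P \<phi>) \<longleftrightarrow> (AE \<phi> in lebesgue_on {0<..<pi}. P \<phi>)"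
proof -
  have "(AE \<phi> in omega_measure. P \<phi>) \<longleftrightarrow>
        (AE \<phi> in lebesgue_on {0<..<pi}. 0 < ennreal (omega \<phi>) \<longrightarrow> P \<phi>)"
    unfolding omega_measure_def by (rule AE_density[OF omega_measurable])
  also have "\<dots> \<longleftrightarrow> (AE \<phi> in lebesgue_on {0<..<pi}. P \<phi>)"
    by (rule AE_cong) (auto simp: space_restrict_space omega_pos)
  finally show ?thesis .
qed

lemma L2_omega_measurable: "f \<in> L2_omega \<Longrightarrow> f \<in> borel_measurable omega_measure"
  by (simp add: L2_omega_def)

lemma L2_omega_zero: "(\<lambda>_. 0) \<in> L2_omega"
  by (simp add: L2_omega_def)

lemma L2_omega_scale: "f \<in> L2_omega \<Longrightarrow> (\<lambda>\<phi>. c * f \<phi>) \<in> L2_omega"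
  by (auto simp: L2_omega_def norm_mult power_mult_distrib)

lemma L2_omega_scale': "f \<in> L2_omega \<Longrightarrow> (\<lambda>\<phi>. f \<phi> * c) \<in> L2_omega"
  using L2_omega_scale[of f c] by (simp add: mult.commute)

lemma L2_omega_add:
  assumes "f \<in> L2_omega" "g \<in> L2_omega"
  shows "(\<lambda>\<phi>. f \<phi> + g \<phi>) \<in> L2_omega"
proof -
  have m [measurable]: "f \<in> borel_measurable omega_measure" "g \<in> borel_measurable omega_measure"
    using assms by (auto simp: L2_omega_def)
  have "integrable omega_measure (\<lambda>\<phi>. 2 * (cmod (f \<phi>))\<^sup>2 + 2 * (cmod (g \<phi>))\<^sup>2)"
    using assms by (auto simp: L2_omega_def)
  then have "integrable omega_measure (\<lambda>\<phi>. (cmod (f \<phi> + g \<phi>))\<^sup>2)"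
  proof (rule Bochner_Integration.integrable_bound)
    show "AE \<phi> in omega_measure. norm ((cmod (f \<phi> + g \<phi>))\<^sup>2)
            \<le> norm (2 * (cmod (f \<phi>))\<^sup>2 + 2 * (cmod (g \<phi>))\<^sup>2)"
    proof (rule AE_I2)
      fix \<phi>
      have "(cmod (f \<phi> + g \<phi>))\<^sup>2 \<le> (cmod (f \<phi>) + cmod (g \<phi>))\<^sup>2"
        by (rule power_mono) (auto simp: norm_triangle_ineq)
      also have "\<dots> \<le> 2 * (cmod (f \<phi>))\<^sup>2 + 2 * (cmod (g \<phi>))\<^sup>2"
        using sum_squares_bound[of "cmod (f \<phi>)" "cmod (g \<phi>)"]
        by (simp add: power2_sum)
      finally show "norm ((cmod (f \<phi> + g \<phi>))\<^sup>2) \<le> norm (2 * (cmod (f \<phi>))\<^sup>2 + 2 * (cmod (g \<phi>))\<^sup>2)"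
        by simp
    qed
  qed measurable
  then show ?thesis by (simp add: L2_omega_def)
qed

lemma L2_omega_mult_cnj:
  assumes "f \<in> L2_omega" "g \<in> L2_omega"
  shows "integrable omega_measure (\<lambda>\<phi>. f \<phi> * cnj (g \<phi>))"
proof -
  have m [measurable]: "f \<in> borel_measurable omega_measure" "g \<in> borel_measurable omega_measure"
    using assms by (auto simp: L2_omega_def)
  have [measurable]: "(\<lambda>\<phi>. cnj (g \<phi>)) \<in> borel_measurable omega_measure"
    by (rule measurable_compose[OF m(2)]) (intro borel_measurable_continuous_onI continuous_intros)
  have "integrable omega_measure (\<lambda>\<phi>. (cmod (f \<phi>))\<^sup>2 + (cmod (g \<phi>))\<^sup>2)"
    using assms by (auto simp: L2_omega_def)
  then show ?thesis
  proof (rule Bochner_Integration.integrable_bound)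
    show "AE \<phi> in omega_measure. norm (f \<phi> * cnj (g \<phi>)) \<le> norm ((cmod (f \<phi>))\<^sup>2 + (cmod (g \<phi>))\<^sup>2)"
    proof (rule AE_I2)
      fix \<phi>
      have "2 * (cmod (f \<phi>) * cmod (g \<phi>)) \<le> (cmod (f \<phi>))\<^sup>2 + (cmod (g \<phi>))\<^sup>2"
        using sum_squares_bound[of "cmod (f \<phi>)" "cmod (g \<phi>)"] by simp
      moreover have "0 \<le> cmod (f \<phi>) * cmod (g \<phi>)" by simp
      ultimately have "cmod (f \<phi>) * cmod (g \<phi>) \<le> (cmod (f \<phi>))\<^sup>2 + (cmod (g \<phi>))\<^sup>2" by linarith
      then show "norm (f \<phi> * cnj (g \<phi>)) \<le> norm ((cmod (f \<phi>))\<^sup>2 + (cmod (g \<phi>))\<^sup>2)"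
        by (simp add: norm_mult)
    qed
  qed measurable
qed

definition L2_omega_rel :: "(real \<Rightarrow> complex) \<Rightarrow> (real \<Rightarrow> complex) \<Rightarrow> bool" where
  "L2_omega_rel f g \<longleftrightarrow> f \<in> L2_omega \<and> g \<in> L2_omega \<and> (AE \<phi> in omega_measure. f \<phi> = g \<phi>)"

quotient_type hspace = "real \<Rightarrow> complex" / partial: L2_omega_rel
proof (rule part_equivpI)
  show "\<exists>f. L2_omega_rel f f"
    using L2_omega_zero by (auto simp: L2_omega_rel_def)
  show "symp L2_omega_rel"
    by (rule sympI) (auto simp: L2_omega_rel_def)
  show "transp L2_omega_rel"
    by (rule transpI) (auto simp: L2_omega_rel_def elim: AE_mp)
qed

text \<open>The inner product is linear in the first and antilinear in the second argument.\<close>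

lift_definition hinner :: "hspace \<Rightarrow> hspace \<Rightarrow> complex"
  is "\<lambda>f g. \<integral>\<phi>. f \<phi> * cnj (g \<phi>) \<partial>omega_measure"
proof -
  fix f f' g g'
  assume *: "L2_omega_rel f f'" "L2_omega_rel g g'"
  then have "AE \<phi> in omega_measure. f \<phi> * cnj (g \<phi>) = f' \<phi> * cnj (g' \<phi>)"
    by (auto simp: L2_omega_rel_def)
  moreover have "integrable omega_measure (\<lambda>\<phi>. f \<phi> * cnj (g \<phi>))"
      "integrable omega_measure (\<lambda>\<phi>. f' \<phi> * cnj (g' \<phi>))"
    using * by (auto simp: L2_omega_rel_def intro: L2_omega_mult_cnj)
  ultimately show "(\<integral>\<phi>. f \<phi> * cnj (g \<phi>) \<partial>omega_measure) = (\<integral>\<phi>. f' \<phi> * cnj (g' \<phi>) \<partial>omega_measure)"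
    by (intro integral_cong_AE) (auto dest: borel_measurable_integrable)
qed

lift_definition hscale :: "complex \<Rightarrow> hspace \<Rightarrow> hspace"
  is "\<lambda>c f \<phi>. c * f \<phi>"
  by (auto simp: L2_omega_rel_def L2_omega_scale)

instantiation hspace :: real_vector
begin

lift_definition zero_hspace :: hspace is "\<lambda>_. 0"
  by (auto simp: L2_omega_rel_def L2_omega_zero)

lift_definition plus_hspace :: "hspace \<Rightarrow> hspace \<Rightarrow> hspace" is "\<lambda>f g \<phi>. f \<phi> + g \<phi>"
  by (auto simp: L2_omega_rel_def L2_omega_add)

definition scaleR_hspace :: "real \<Rightarrow> hspace \<Rightarrow> hspace" where
  "scaleR_hspace r f = hscale (complex_of_real r) f"

definition uminus_hspace :: "hspace \<Rightarrow> hspace" where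
  "uminus_hspace f = hscale (- 1) f"

definition minus_hspace :: "hspace \<Rightarrow> hspace \<Rightarrow> hspace" where
  "minus_hspace f g = f + hscale (- 1) g"

instance
proof
  fix a b c :: hspace and r s :: real
  show "a + b + c = a + (b + c)"
    by transfer (auto simp: L2_omega_rel_def L2_omega_add add.assoc)
  show "a + b = b + a"
    by transfer (auto simp: L2_omega_rel_def L2_omega_add add.commute)
  show "0 + a = a"
    by transfer (auto simp: L2_omega_rel_def)
  show "- a + a = 0"
    unfolding uminus_hspace_def
    by transfer (auto simp: L2_omega_rel_def L2_omega_zero)
  show "a - b = a + - b"
    unfolding uminus_hspace_def minus_hspace_def ..
  show "r *\<^sub>R (a + b) = r *\<^sub>R a + r *\<^sub>R b"
    unfolding scaleR_hspace_def
    by transfer (auto simp: L2_omega_rel_def algebra_simps intro!: L2_omega_add L2_omega_scale L2_omega_scale')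
  show "(r + s) *\<^sub>R a = r *\<^sub>R a + s *\<^sub>R a"
    unfolding scaleR_hspace_def
    by transfer (auto simp: L2_omega_rel_def algebra_simps intro!: L2_omega_add L2_omega_scale L2_omega_scale')
  show "r *\<^sub>R s *\<^sub>R a = (r * s) *\<^sub>R a"
    unfolding scaleR_hspace_def
    by transfer (auto simp: L2_omega_rel_def mult.assoc intro!: L2_omega_scale)
  show "1 *\<^sub>R a = a"
    unfolding scaleR_hspace_def
    by transfer (auto simp: L2_omega_rel_def)
qed

end

lemma hinner_add_left: "hinner (a + b) c = hinner a c + hinner b c"
  by transfer (auto simp: L2_omega_rel_def distrib_right L2_omega_mult_cnj)

lemma hinner_scale_left: "hinner (hscale z a) b = z * hinner a b"
  by transfer (auto simp: L2_omega_rel_def mult.assoc)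

lemma hinner_commute: "hinner a b = cnj (hinner b a)"
  by transfer (auto simp: Bochner_Integration.integral_cnj[symmetric] mult.commute)

lemma hinner_self: "hinner a a = complex_of_real (Re (hinner a a))" "0 \<le> Re (hinner a a)"
proof -
  have "Im (hinner a a) = 0"
    using hinner_commute[of a a] by (metis cnj.simps(2) equal_neg_zero)
  then show "hinner a a = complex_of_real (Re (hinner a a))"
    by (simp add: complex_eq_iff)
  show "0 \<le> Re (hinner a a)"
  proof transfer
    fix f assume "L2_omega_rel f f"
    have "(\<integral>\<phi>. f \<phi> * cnj (f \<phi>) \<partial>omega_measure) = 
        (\<integral>\<phi>. complex_of_real ((cmod (f \<phi>))\<^sup>2) \<partial>omega_measure)"
      by (simp only: complex_norm_square)
    also have "\<dots> = complex_of_real (\<integral>\<phi>. (cmod (f \<phi>))\<^sup>2 \<partial>omega_measure)"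
      by (rule integral_complex_of_real)
    finally show "0 \<le> Re (\<integral>\<phi>. f \<phi> * cnj (f \<phi>) \<partial>omega_measure)" by simp
  qed
qed

lemma hinner_self_eq_0: "Re (hinner a a) = 0 \<longleftrightarrow> a = 0"
proof transfer
  fix f assume "L2_omega_rel f f"
  then have f: "f \<in> L2_omega" by (simp add: L2_omega_rel_def)
  have "(\<integral>\<phi>. f \<phi> * cnj (f \<phi>) \<partial>omega_measure) = 
      (\<integral>\<phi>. complex_of_real ((cmod (f \<phi>))\<^sup>2) \<partial>omega_measure)"
    by (simp only: complex_norm_square)
  also have "\<dots> = complex_of_real (\<integral>\<phi>. (cmod (f \<phi>))\<^sup>2 \<partial>omega_measure)"
    by (rule integral_complex_of_real)
  finally have "Re (\<integral>\<phi>. f \<phi> * cnj (f \<phi>) \<partial>omega_measure) = (\<integral>\<phi>. (cmod (f \<phi>))\<^sup>2 \<partial>omega_measure)"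
    by simp
  moreover have "(\<integral>\<phi>. (cmod (f \<phi>))\<^sup>2 \<partial>omega_measure) = 0 \<longleftrightarrow>
      (AE \<phi> in omega_measure. (cmod (f \<phi>))\<^sup>2 = 0)"
    using f by (intro integral_nonneg_eq_0_iff_AE) (auto simp: L2_omega_def)
  ultimately show "Re (\<integral>\<phi>. f \<phi> * cnj (f \<phi>) \<partial>omega_measure) = 0 \<longleftrightarrow> L2_omega_rel f (\<lambda>_. 0)"
    using f by (simp add: L2_omega_rel_def L2_omega_zero)
qed

instantiation hspace :: real_inner
begin

definition inner_hspace :: "hspace \<Rightarrow> hspace \<Rightarrow> real" where
  "inner_hspace f g = Re (hinner f g)"

definition norm_hspace :: "hspace \<Rightarrow> real" where
  "norm_hspace f = sqrt (inner f f)"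

definition sgn_hspace :: "hspace \<Rightarrow> hspace" where
  "sgn_hspace f = f /\<^sub>R norm f"

definition dist_hspace :: "hspace \<Rightarrow> hspace \<Rightarrow> real" where
  "dist_hspace f g = norm (f - g)"

definition uniformity_hspace :: "(hspace \<times> hspace) filter" where
  "uniformity_hspace = (INF e\<in>{0<..}. principal {(x, y). dist x y < e})"

definition open_hspace :: "hspace set \<Rightarrow> bool" where
  "open_hspace U \<longleftrightarrow> (\<forall>x\<in>U. eventually (\<lambda>(x', y). x' = x \<longrightarrow> y \<in> U) uniformity)"

instance
proof
  fix x y z :: hspace and r :: real and U :: "hspace set"
  show "dist x y = norm (x - y)" by (rule dist_hspace_def)
  show "sgn x = x /\<^sub>R norm x" by (rule sgn_hspace_def)
  show "uniformity = (INF e\<in>{0<..}. principal {(x, y :: hspace). dist x y < e})"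
    by (rule uniformity_hspace_def)
  show "open U \<longleftrightarrow> (\<forall>x\<in>U. eventually (\<lambda>(x', y). x' = x \<longrightarrow> y \<in> U) uniformity)"
    by (rule open_hspace_def)
  show "inner x y = inner y x"
    unfolding inner_hspace_def by (metis complex_cnj hinner_commute complex.sel(1) cnj.simps(1))
  show "inner (x + y) z = inner x z + inner y z"
    by (simp add: inner_hspace_def hinner_add_left)
  show "inner (r *\<^sub>R x) y = r * inner x y"
    by (simp add: inner_hspace_def scaleR_hspace_def hinner_scale_left)
  show "0 \<le> inner x x"
    by (simp add: inner_hspace_def hinner_self(2))
  show "inner x x = 0 \<longleftrightarrow> x = 0"
    by (simp add: inner_hspace_def hinner_self_eq_0)
  show "norm x = sqrt (inner x x)" by (rule norm_hspace_def)
qed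

end

lemma cmod_hinner_le: "cmod (hinner f g) \<le> 2 * (norm f * norm g)"
proof -
  have 1: "\<bar>Re (hinner f g)\<bar> \<le> norm f * norm g"
    using Cauchy_Schwarz_ineq2[of f g] by (simp add: inner_hspace_def)
  have "norm (hscale \<i> f) = norm f"
  proof -
    have "hinner (hscale \<i> f) (hscale \<i> f) = hinner f f"
      using hinner_commute[of f "hscale \<i> f"]
      by (metis (no_types, opaque_lifting) hinner_scale_left hinner_commute complex_cnj_mult
          complex_cnj_cnj complex_cnj_i mult_minus_left mult_minus_right minus_minus
          mult.assoc i_squared mult_minus1)
    then show ?thesis by (simp add: norm_hspace_def inner_hspace_def)
  qed
  moreover have "Re (hinner (hscale \<i> f) g) = - Im (hinner f g)"
    by (simp add: hinner_scale_left)
  ultimately have 2: "\<bar>Im (hinner f g)\<bar> \<le> norm f * norm g"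
    using Cauchy_Schwarz_ineq2[of "hscale \<i> f" g] by (simp add: inner_hspace_def)
  show ?thesis
    using cmod_le[of "hinner f g"] 1 2 by linarith
qed


section \<open>The form domain \<open>\<V>\<close>\<close>

text \<open>
  Weak derivatives on \<open>(0,\<pi>)\<close>. Since \<open>\<omega>\<close> is bounded below on compact subsets of \<open>(0,\<pi>)\<close>,
  elements of \<open>\<H>\<close> are locally square integrable (see \<open>L2_omega_imp_L2_loc\<close>). Hence, for
  \<open>f \<in> \<H>\<close>, the conditions \<open>f \<in> H\<^sup>1\<^sub>l\<^sub>o\<^sub>c(0,\<pi>)\<close> and \<open>\<integral> \<omega> |f'|\<^sup>2 < \<infinity>\<close> say exactly that the
  distributional derivative of \<open>f\<close> is represented by an element of \<open>\<H>\<close>.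
\<close>

lemma L2_omega_imp_L2_loc:
  assumes f: "f \<in> L2_omega" and K: "compact K" "K \<subseteq> {0<..<pi}"
  shows "set_integrable (lebesgue_on {0<..<pi}) K (\<lambda>\<phi>. (cmod (f \<phi>))\<^sup>2)"
proof (cases "K = {}")
  case False
  have "continuous_on K omega"
    unfolding omega_def by (intro continuous_intros)
  then obtain x where x: "x \<in> K" "\<forall>y\<in>K. omega x \<le> omega y"
    using continuous_attains_inf[OF K(1) False] by blast
  define c where "c = omega x"
  have c: "0 < c" using x K omega_pos by (auto simp: c_def)
  have fm [measurable]: "f \<in> borel_measurable (lebesgue_on {0<..<pi})"
    using L2_omega_measurable[OF f] by (simp add: omega_measure_def)
  have om [measurable]: "omega \<in> borel_measurable (lebesgue_on {0<..<pi})"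
  proof -
    have "omega \<in> borel_measurable lebesgue"
      by (rule measurable_completion) simp
    then show ?thesis by (rule measurable_restrict_space1)
  qed
  have "K \<in> sets lebesgue" using K(1) by (simp add: compact_imp_closed)
  then have Km [measurable]: "K \<in> sets (lebesgue_on {0<..<pi})"
    using K(2) by (simp add: sets_restrict_space_iff)
  have "integrable (lebesgue_on {0<..<pi}) (\<lambda>\<phi>. omega \<phi> *\<^sub>R (cmod (f \<phi>))\<^sup>2)"
  proof (rule integrable_density[THEN iffD1])
    show "(\<lambda>\<phi>. (cmod (f \<phi>))\<^sup>2) \<in> borel_measurable (lebesgue_on {0<..<pi})"
      "omega \<in> borel_measurable (lebesgue_on {0<..<pi})" by measurable
    show "AE \<phi> in lebesgue_on {0<..<pi}. 0 \<le> omega \<phi>"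
      by (rule AE_I2) (auto simp: space_restrict_space less_imp_le omega_pos)
    show "integrable (density (lebesgue_on {0<..<pi}) (\<lambda>\<phi>. ennreal (omega \<phi>))) (\<lambda>\<phi>. (cmod (f \<phi>))\<^sup>2)"
      using f by (simp add: L2_omega_def omega_measure_def)
  qed
  then have "integrable (lebesgue_on {0<..<pi}) (\<lambda>\<phi>. (1 / c) * (omega \<phi> *\<^sub>R (cmod (f \<phi>))\<^sup>2))"
    by simp
  then show ?thesis
    unfolding set_integrable_def
  proof (rule Bochner_Integration.integrable_bound)
    show "AE \<phi> in lebesgue_on {0<..<pi}. norm (indicat_real K \<phi> *\<^sub>R (cmod (f \<phi>))\<^sup>2)
        \<le> norm ((1 / c) * (omega \<phi> *\<^sub>R (cmod (f \<phi>))\<^sup>2))"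
    proof (rule AE_I2)
      fix \<phi> assume "\<phi> \<in> space (lebesgue_on {0<..<pi})"
      then have p: "0 < omega \<phi>" by (auto simp: space_restrict_space omega_pos)
      show "norm (indicat_real K \<phi> *\<^sub>R (cmod (f \<phi>))\<^sup>2) \<le> norm ((1 / c) * (omega \<phi> *\<^sub>R (cmod (f \<phi>))\<^sup>2))"
      proof (cases "\<phi> \<in> K")
        case True
        then have "c \<le> omega \<phi>" using x by (auto simp: c_def)
        then have "c * (cmod (f \<phi>))\<^sup>2 \<le> omega \<phi> * (cmod (f \<phi>))\<^sup>2"
          by (rule mult_right_mono) simp
        then show ?thesis using True c p by (simp add: abs_mult field_simps)
      qed simp
    qed
  qed measurable
qed (simp add: set_integrable_def)

definition weak_deriv_fun :: "(real \<Rightarrow> complex) \<Rightarrow> (real \<Rightarrow> complex) \<Rightarrow> bool" where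
  "weak_deriv_fun f g \<longleftrightarrow>
     (\<forall>\<eta> :: real \<Rightarrow> complex. test_function {0<..<pi} \<eta> \<longrightarrow>
        (\<exists>I. has_bochner_integral (lebesgue_on {0<..<pi})
               (\<lambda>\<phi>. f \<phi> * vector_derivative \<eta> (at \<phi>)) (- I) \<and>
             has_bochner_integral (lebesgue_on {0<..<pi}) (\<lambda>\<phi>. g \<phi> * \<eta> \<phi>) I))"

lemma smoothD:
  fixes \<eta> :: "real \<Rightarrow> complex"
  assumes "smooth \<eta>"
  shows "continuous_on UNIV \<eta>" "continuous_on UNIV (\<lambda>\<phi>. vector_derivative \<eta> (at \<phi>))"
proof -
  obtain D where D: "D 0 = \<eta>"
    "\<And>n t. (D n has_vector_derivative D (Suc n) t) (at t)"
    using assms unfolding smooth_def by blast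
  have c: "continuous_on UNIV (D n)" for n
    using D(2) by (auto intro!: continuous_at_imp_continuous_on has_vector_derivative_continuous)
  show "continuous_on UNIV \<eta>" using c[of 0] D(1) by simp
  have "vector_derivative \<eta> (at \<phi>) = D 1 \<phi>" for \<phi>
    using D(2)[of 0 \<phi>] D(1) by (auto intro: vector_derivative_at)
  then show "continuous_on UNIV (\<lambda>\<phi>. vector_derivative \<eta> (at \<phi>))"
    using c[of 1] by simp
qed

lemma continuous_on_imp_measurable_lebesgue_on:
  fixes \<eta> :: "real \<Rightarrow> complex"
  assumes "continuous_on UNIV \<eta>"
  shows "\<eta> \<in> borel_measurable (lebesgue_on {0<..<pi})"
  by (rule continuous_imp_measurable_on_sets_lebesgue)
     (auto intro: continuous_on_subset[OF assms])

lemma has_bochner_integral_rel_cong: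
  assumes "L2_omega_rel f f'" and [measurable]: "h \<in> borel_measurable (lebesgue_on {0<..<pi})"
  shows "has_bochner_integral (lebesgue_on {0<..<pi}) (\<lambda>\<phi>. f \<phi> * h \<phi>) I \<longleftrightarrow>
         has_bochner_integral (lebesgue_on {0<..<pi}) (\<lambda>\<phi>. f' \<phi> * h \<phi>) I"
proof (rule has_bochner_integral_cong_AE)
  have [measurable]: "f \<in> borel_measurable (lebesgue_on {0<..<pi})"
      "f' \<in> borel_measurable (lebesgue_on {0<..<pi})"
    using assms(1) by (auto simp: L2_omega_rel_def L2_omega_def omega_measure_def)
  show "(\<lambda>\<phi>. f \<phi> * h \<phi>) \<in> borel_measurable (lebesgue_on {0<..<pi})"
    "(\<lambda>\<phi>. f' \<phi> * h \<phi>) \<in> borel_measurable (lebesgue_on {0<..<pi})" by measurable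
  have "AE \<phi> in lebesgue_on {0<..<pi}. f \<phi> = f' \<phi>"
    using assms(1) by (simp add: L2_omega_rel_def AE_omega_measure)
  then show "AE \<phi> in lebesgue_on {0<..<pi}. f \<phi> * h \<phi> = f' \<phi> * h \<phi>" by auto
qed

lift_definition weak_deriv :: "hspace \<Rightarrow> hspace \<Rightarrow> bool" is weak_deriv_fun
proof -
  fix f f' g g' assume *: "L2_omega_rel f f'" "L2_omega_rel g g'"
  have "test_function {0<..<pi} \<eta> \<Longrightarrow>
      (\<lambda>\<phi>. vector_derivative \<eta> (at \<phi>)) \<in> borel_measurable (lebesgue_on {0<..<pi}) \<and>
      \<eta> \<in> borel_measurable (lebesgue_on {0<..<pi})" for \<eta> :: "real \<Rightarrow> complex"
    by (auto simp: test_function_def intro!: continuous_on_imp_measurable_lebesgue_on smoothD)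
  then show "weak_deriv_fun f g = weak_deriv_fun f' g'"
    unfolding weak_deriv_fun_def
    using has_bochner_integral_rel_cong[OF *(1)] has_bochner_integral_rel_cong[OF *(2)]
    by (intro all_cong1 imp_cong refl ex_cong1 conj_cong) blast+
qed

lemma weak_deriv_0: "weak_deriv 0 0"
  by transfer (auto simp: weak_deriv_fun_def intro!: exI[of _ 0])

lemma weak_deriv_add:
  "weak_deriv f g \<Longrightarrow> weak_deriv f' g' \<Longrightarrow> weak_deriv (f + f') (g + g')"
proof transfer
  fix f g f' g'
  assume a: "weak_deriv_fun f g" "weak_deriv_fun f' g'"
  show "weak_deriv_fun (\<lambda>\<phi>. f \<phi> + f' \<phi>) (\<lambda>\<phi>. g \<phi> + g' \<phi>)"
    unfolding weak_deriv_fun_def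
  proof (intro allI impI)
    fix \<eta> :: "real \<Rightarrow> complex" assume t: "test_function {0<..<pi} \<eta>"
    obtain I I' where
      "has_bochner_integral (lebesgue_on {0<..<pi}) (\<lambda>\<phi>. f \<phi> * vector_derivative \<eta> (at \<phi>)) (- I)"
      "has_bochner_integral (lebesgue_on {0<..<pi}) (\<lambda>\<phi>. g \<phi> * \<eta> \<phi>) I"
      "has_bochner_integral (lebesgue_on {0<..<pi}) (\<lambda>\<phi>. f' \<phi> * vector_derivative \<eta> (at \<phi>)) (- I')"
      "has_bochner_integral (lebesgue_on {0<..<pi}) (\<lambda>\<phi>. g' \<phi> * \<eta> \<phi>) I'"
      using a t unfolding weak_deriv_fun_def by blast
    note h = has_bochner_integral_add[OF this(1,3)] has_bochner_integral_add[OF this(2,4)]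
    show "\<exists>I. has_bochner_integral (lebesgue_on {0<..<pi})
               (\<lambda>\<phi>. (f \<phi> + f' \<phi>) * vector_derivative \<eta> (at \<phi>)) (- I) \<and>
             has_bochner_integral (lebesgue_on {0<..<pi}) (\<lambda>\<phi>. (g \<phi> + g' \<phi>) * \<eta> \<phi>) I"
      using h by (intro exI[of _ "I + I'"]) (simp add: distrib_right)
  qed
qed

lemma weak_deriv_scale: "weak_deriv f g \<Longrightarrow> weak_deriv (hscale c f) (hscale c g)"
proof transfer
  fix f g and c
  assume a: "weak_deriv_fun f g"
  show "weak_deriv_fun (\<lambda>\<phi>. c * f \<phi>) (\<lambda>\<phi>. c * g \<phi>)"
    unfolding weak_deriv_fun_def
  proof (intro allI impI)
    fix \<eta> :: "real \<Rightarrow> complex" assume t: "test_function {0<..<pi} \<eta>"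
    obtain I where
      "has_bochner_integral (lebesgue_on {0<..<pi}) (\<lambda>\<phi>. f \<phi> * vector_derivative \<eta> (at \<phi>)) (- I)"
      "has_bochner_integral (lebesgue_on {0<..<pi}) (\<lambda>\<phi>. g \<phi> * \<eta> \<phi>) I"
      using a t unfolding weak_deriv_fun_def by blast
    note h = this[THEN has_bochner_integral_mult_right[where c = c]]
    show "\<exists>I. has_bochner_integral (lebesgue_on {0<..<pi})
               (\<lambda>\<phi>. c * f \<phi> * vector_derivative \<eta> (at \<phi>)) (- I) \<and>
             has_bochner_integral (lebesgue_on {0<..<pi}) (\<lambda>\<phi>. c * g \<phi> * \<eta> \<phi>) I"
      using h by (intro exI[of _ "c * I"]) (simp add: mult.assoc)
  qed
qed

text \<open>
  \<open>\<V>\<close> is represented by the graph of the weak derivative: an element is the pair \<open>(f, f')\<close>,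
  whose second component is determined by the first because weak derivatives are unique
  almost everywhere.
\<close>

typedef vspace = "{(f, f'). weak_deriv f f'}"
  using weak_deriv_0 by auto

definition emb :: "vspace \<Rightarrow> hspace" where
  "emb f = fst (Rep_vspace f)"

definition vderiv :: "vspace \<Rightarrow> hspace" where
  "vderiv f = snd (Rep_vspace f)"

definition vscale :: "complex \<Rightarrow> vspace \<Rightarrow> vspace" where
  "vscale c f = Abs_vspace (hscale c (emb f), hscale c (vderiv f))"

lemma weak_deriv_vderiv: "weak_deriv (emb f) (vderiv f)"
  using Rep_vspace[of f] by (auto simp: emb_def vderiv_def)

lemma emb_Abs: "weak_deriv f f' \<Longrightarrow> emb (Abs_vspace (f, f')) = f"
  and vderiv_Abs: "weak_deriv f f' \<Longrightarrow> vderiv (Abs_vspace (f, f')) = f'"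
  by (simp_all add: emb_def vderiv_def Abs_vspace_inverse)

definition form_a0 :: "vspace \<Rightarrow> vspace \<Rightarrow> complex" where
  "form_a0 f g = 4 * hinner (vderiv f) (vderiv g)"

lemma vspace_eqI: "emb f = emb g \<Longrightarrow> vderiv f = vderiv g \<Longrightarrow> f = g"
  by (simp add: emb_def vderiv_def prod_eq_iff Rep_vspace_inject[symmetric])

instantiation vspace :: real_vector
begin

definition zero_vspace :: vspace where
  "zero_vspace = Abs_vspace (0, 0)"

definition plus_vspace :: "vspace \<Rightarrow> vspace \<Rightarrow> vspace" where
  "plus_vspace f g = Abs_vspace (emb f + emb g, vderiv f + vderiv g)"

definition scaleR_vspace :: "real \<Rightarrow> vspace \<Rightarrow> vspace" where
  "scaleR_vspace r f = vscale (complex_of_real r) f"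

definition uminus_vspace :: "vspace \<Rightarrow> vspace" where
  "uminus_vspace f = vscale (- 1) f"

definition minus_vspace :: "vspace \<Rightarrow> vspace \<Rightarrow> vspace" where
  "minus_vspace f g = f + vscale (- 1) g"

lemma vspace_ops:
  "emb 0 = 0" "vderiv 0 = 0"
  "emb (f + g) = emb f + emb g" "vderiv (f + g) = vderiv f + vderiv g"
  "emb (vscale c f) = hscale c (emb f)" "vderiv (vscale c f) = hscale c (vderiv f)"
  by (simp_all add: zero_vspace_def plus_vspace_def vscale_def emb_Abs vderiv_Abs
      weak_deriv_0 weak_deriv_add weak_deriv_scale weak_deriv_vderiv)

lemma hscale_real: "hscale (complex_of_real r) f = r *\<^sub>R f" "hscale (- 1) f = - f"
  by (simp_all add: scaleR_hspace_def uminus_hspace_def)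

instance
proof
  fix a b c :: vspace and r s :: real
  note defs = scaleR_vspace_def uminus_vspace_def minus_vspace_def
  show "a + b + c = a + (b + c)" by (rule vspace_eqI) (simp_all add: vspace_ops)
  show "a + b = b + a" by (rule vspace_eqI) (simp_all add: vspace_ops)
  show "0 + a = a" by (rule vspace_eqI) (simp_all add: vspace_ops)
  show "- a + a = 0" by (rule vspace_eqI) (simp_all add: vspace_ops defs hscale_real)
  show "a - b = a + - b" by (simp add: defs)
  show "r *\<^sub>R (a + b) = r *\<^sub>R a + r *\<^sub>R b"
    by (rule vspace_eqI) (simp_all add: vspace_ops defs hscale_real scaleR_add_right)
  show "(r + s) *\<^sub>R a = r *\<^sub>R a + s *\<^sub>R a"
    unfolding defs by (rule vspace_eqI) (simp_all only: vspace_ops hscale_real scaleR_add_left)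
  show "r *\<^sub>R s *\<^sub>R a = (r * s) *\<^sub>R a"
    unfolding defs by (rule vspace_eqI) (simp_all only: vspace_ops hscale_real scaleR_scaleR)
  show "1 *\<^sub>R a = a"
    unfolding defs by (rule vspace_eqI) (simp_all only: vspace_ops hscale_real scaleR_one)
qed

end

lemma emb_scaleR: "emb (r *\<^sub>R f) = r *\<^sub>R emb f" "vderiv (r *\<^sub>R f) = r *\<^sub>R vderiv f"
  by (simp_all add: scaleR_vspace_def vspace_ops hscale_real)

instantiation vspace :: real_inner
begin

definition inner_vspace :: "vspace \<Rightarrow> vspace \<Rightarrow> real" where
  "inner_vspace f g = Re (form_a0 f g + hinner (emb f) (emb g))"

definition norm_vspace :: "vspace \<Rightarrow> real" where
  "norm_vspace f = sqrt (inner f f)"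

definition sgn_vspace :: "vspace \<Rightarrow> vspace" where
  "sgn_vspace f = f /\<^sub>R norm f"

definition dist_vspace :: "vspace \<Rightarrow> vspace \<Rightarrow> real" where
  "dist_vspace f g = norm (f - g)"

definition uniformity_vspace :: "(vspace \<times> vspace) filter" where
  "uniformity_vspace = (INF e\<in>{0<..}. principal {(x, y). dist x y < e})"

definition open_vspace :: "vspace set \<Rightarrow> bool" where
  "open_vspace U \<longleftrightarrow> (\<forall>x\<in>U. eventually (\<lambda>(x', y). x' = x \<longrightarrow> y \<in> U) uniformity)"

lemma inner_vspace_alt: "inner f g = 4 * inner (vderiv f) (vderiv g) + inner (emb f) (emb g)"
  by (simp add: inner_vspace_def inner_hspace_def form_a0_def)

instance
proof
  fix x y z :: vspace and r :: real and U :: "vspace set"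
  show "dist x y = norm (x - y)" by (rule dist_vspace_def)
  show "sgn x = x /\<^sub>R norm x" by (rule sgn_vspace_def)
  show "uniformity = (INF e\<in>{0<..}. principal {(x, y :: vspace). dist x y < e})"
    by (rule uniformity_vspace_def)
  show "open U \<longleftrightarrow> (\<forall>x\<in>U. eventually (\<lambda>(x', y). x' = x \<longrightarrow> y \<in> U) uniformity)"
    by (rule open_vspace_def)
  show "inner x y = inner y x"
    by (simp add: inner_vspace_alt inner_commute)
  show "inner (x + y) z = inner x z + inner y z"
    by (simp add: inner_vspace_alt vspace_ops inner_add_left)
  show "inner (r *\<^sub>R x) y = r * inner x y"
    by (simp add: inner_vspace_alt emb_scaleR algebra_simps)
  show "0 \<le> inner x x"
    by (simp add: inner_vspace_alt)
  show "inner x x = 0 \<longleftrightarrow> x = 0"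
  proof
    assume "inner x x = 0"
    then have "inner (vderiv x) (vderiv x) = 0" "inner (emb x) (emb x) = 0"
      using inner_ge_zero[of "vderiv x"] inner_ge_zero[of "emb x"]
      unfolding inner_vspace_alt by linarith+
    then show "x = 0" by (intro vspace_eqI) (simp_all add: vspace_ops)
  qed (simp add: inner_vspace_alt vspace_ops)
  show "norm x = sqrt (inner x x)" by (rule norm_vspace_def)
qed

end

lemma norm_vspace_sq: "complex_of_real ((norm f)\<^sup>2) = form_a0 f f + complex_of_real ((norm (emb f))\<^sup>2)"
  by (simp add: power2_norm_eq_inner inner_vspace_alt form_a0_def inner_hspace_def hinner_self(1)[symmetric])

lemma norm_emb_le: "norm (emb f) \<le> norm f"
  by (simp add: norm_eq_sqrt_inner inner_vspace_alt)

text \<open>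
  \<open>endpoint_trace f = (f(0), f(\<pi>))\<close>: the endpoint values of the representative of \<open>f\<close> that is
  continuous on \<open>[0,\<pi>]\<close>.
\<close>

lift_definition represents :: "hspace \<Rightarrow> (real \<Rightarrow> complex) \<Rightarrow> bool"
  is "\<lambda>f u. AE \<phi> in lebesgue_on {0<..<pi}. u \<phi> = f \<phi>"
  by (auto simp: L2_omega_rel_def AE_omega_measure fun_eq_iff elim: AE_mp)

definition endpoint_trace :: "vspace \<Rightarrow> complex ^ 2" where
  "endpoint_trace f = (THE z. \<exists>u. continuous_on {0..pi} u \<and> represents (emb f) u \<and> z = vector [u 0, u pi])"

definition cinner2 :: "complex ^ 2 \<Rightarrow> complex ^ 2 \<Rightarrow> complex" where
  "cinner2 z y = (\<Sum>i\<in>UNIV. z $ i * cnj (y $ i))"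


section \<open>The antidual \<open>\<V>\<^sup>*\<close> and weak finite-energy solutions\<close>

text \<open>
  \<open>\<V>\<^sup>*\<close> consists of the antilinear elements of the space of bounded real-linear maps
  \<open>\<V> \<Rightarrow> \<complex>\<close>; its norm is the operator norm, and \<open>\<langle>F, \<psi>\<rangle>\<close> is \<open>blinfun_apply F \<psi>\<close>.
\<close>

definition antidual :: "(vspace \<Rightarrow>\<^sub>L complex) set" where
  "antidual = {F. \<forall>c v. blinfun_apply F (vscale c v) = cnj c * blinfun_apply F v}"

text \<open>The embedding \<open>\<H> \<rightarrow> \<V>\<^sup>*\<close> of the pivot space.\<close>

definition pivot :: "hspace \<Rightarrow> vspace \<Rightarrow>\<^sub>L complex" where
  "pivot h = Blinfun (\<lambda>v. hinner h (emb v))"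

lemma bounded_linear_pivot: "bounded_linear (\<lambda>v. hinner h (emb v))"
proof (rule bounded_linear_intro)
  fix x y :: vspace and r :: real
  have add: "hinner h (a + b) = hinner h a + hinner h b" for a b
    by (metis hinner_commute hinner_add_left complex_cnj_add)
  have scale: "hinner h (hscale c a) = cnj c * hinner h a" for c a
    by (metis hinner_commute hinner_scale_left complex_cnj_mult)
  show "hinner h (emb (x + y)) = hinner h (emb x) + hinner h (emb y)"
    by (simp add: vspace_ops add)
  show "hinner h (emb (r *\<^sub>R x)) = r *\<^sub>R hinner h (emb x)"
    by (simp add: emb_scaleR hscale_real(1)[symmetric] scale scaleR_conv_of_real)
  have "norm (hinner h (emb x)) \<le> 2 * (norm h * norm (emb x))"
    by (rule cmod_hinner_le)
  also have "\<dots> \<le> 2 * (norm h * norm x)"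
    using norm_emb_le[of x] by (simp add: mult_left_mono)
  finally show "norm (hinner h (emb x)) \<le> norm x * (2 * norm h)" by (simp add: mult_ac)
qed

lemma pivot_apply: "blinfun_apply (pivot h) v = hinner h (emb v)"
  by (simp add: pivot_def bounded_linear_Blinfun_apply bounded_linear_pivot)

lemma pivot_in_antidual: "pivot h \<in> antidual"
  unfolding antidual_def
  by (auto simp: pivot_apply vspace_ops) (metis hinner_commute hinner_scale_left complex_cnj_mult)

text \<open>
  A solution is a map \<open>w :: real \<Rightarrow> vspace\<close>, of which only the almost everywhere class on \<open>J\<close>
  matters.
\<close>

definition weak_solution :: "real set \<Rightarrow> (real \<Rightarrow> complex ^ 2 ^ 2) \<Rightarrow> (real \<Rightarrow> vspace) \<Rightarrow> bool" where
  "weak_solution J \<Gamma> w \<longleftrightarrow>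
     bochner_L2 J w \<and> bochner_L2 J (\<lambda>t. emb (w t)) \<and>
     (\<exists>w\<^sub>t w\<^sub>t\<^sub>t.
        bochner_L2 J w\<^sub>t \<and> bochner_weak_deriv J (\<lambda>t. emb (w t)) w\<^sub>t \<and>
        bochner_L2 J w\<^sub>t\<^sub>t \<and> (AE t in lebesgue_on J. w\<^sub>t\<^sub>t t \<in> antidual) \<and>
        bochner_weak_deriv J (\<lambda>t. pivot (w\<^sub>t t)) w\<^sub>t\<^sub>t \<and>
        (\<forall>\<psi> :: real \<Rightarrow> vspace. test_function J \<psi> \<longrightarrow>
           (\<integral>t. (blinfun_apply (w\<^sub>t\<^sub>t t) (\<psi> t) + hinner (w\<^sub>t t) (emb (\<psi> t)) - form_a0 (w t) (\<psi> t)
                 - cinner2 (\<Gamma> t *v endpoint_trace (w t)) (endpoint_trace (\<psi> t))) \<partial>lebesgue_on J) = 0))"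

text \<open>
  The representative of \<open>w\<close> in \<open>C(closure J; \<H>)\<close>; its values on \<open>closure J\<close> are unique. It gives
  the meaning to pointwise values such as \<open>w(0)\<close>.
\<close>

definition cont_rep :: "real set \<Rightarrow> (real \<Rightarrow> vspace) \<Rightarrow> real \<Rightarrow> hspace" where
  "cont_rep J w = (SOME u. continuous_on (closure J) u \<and> (AE t in lebesgue_on J. u t = emb (w t)))"

definition J_int :: "real \<Rightarrow> real set" where
  "J_int d = {- d<..<1 + d}"

definition sup_norm :: "real \<Rightarrow> (real \<Rightarrow> vspace) \<Rightarrow> real" where
  "sup_norm d w = (SUP t\<in>J_int d. norm (cont_rep (J_int d) w t))"

definition trace_norm :: "real \<Rightarrow> (real \<Rightarrow> vspace) \<Rightarrow> real" where
  "trace_norm d w = sqrt (\<integral>t. (norm (endpoint_trace (w t)))\<^sup>2 \<partial>lebesgue_on (J_int d))"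

text \<open>
  \<open>Linf_bound J \<Gamma> \<mu>\<close>: \<open>\<Gamma> \<in> L\<^sup>\<infinity>(J; \<complex>\<^sup>2\<^sup>\<times>\<^sup>2)\<close> with norm at most \<open>\<mu>\<close>, where matrices carry the
  operator norm induced by the Euclidean norm of \<open>\<complex>\<^sup>2\<close>.
\<close>

definition Linf_bound :: "real set \<Rightarrow> (real \<Rightarrow> complex ^ 2 ^ 2) \<Rightarrow> real \<Rightarrow> bool" where
  "Linf_bound J \<Gamma> \<mu> \<longleftrightarrow>
     \<Gamma> \<in> borel_measurable (lebesgue_on J) \<and>
     (AE t in lebesgue_on J. onorm (\<lambda>z. \<Gamma> t *v z) \<le> \<mu>)"

end

theory Submission
  imports Defs
begin

text \<open>
  Write \<open>w\<^sub>t\<^sub>t + w\<^sub>t + 4 \<omega>\<^sup>-\<^sup>1 (\<omega> w\<^sub>\<phi>)\<^sub>\<phi>\<close> for the left-hand side: the equation is elliptic in \<open>(t, \<phi>)\<close>, and the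
  boundary operator is the natural boundary condition \<open>4 \<omega> w\<^sub>\<phi> = (\<Gamma> C w)\<^sub>1\<close> at \<open>\<phi> = 0\<close> and
  \<open>- 4 \<omega> w\<^sub>\<phi> = (\<Gamma> C w)\<^sub>2\<close> at \<open>\<phi> = \<pi>\<close>. So the trace \<open>C w\<close> controls the full Cauchy data \<open>(w, \<omega> w\<^sub>\<phi>)\<close> on
  both lateral sides, in \<open>L\<^sup>2\<close> and up to the factor \<open>(1 + \<mu>\<^sup>2)\<^sup>1\<^sup>/\<^sup>2\<close>. The claim is then Hoelder stability of the
  lateral Cauchy problem for a fixed elliptic operator. The coefficient \<open>\<Gamma>\<close> is not seen by the
  interior estimate at all, hence it enters only through that factor, which the exponential swallows.

  The half \<open>0 \<le> \<phi> \<le> \<pi>/2\<close> is recovered from the data at \<open>0\<close>, and the other half, by the reflection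
  \<open>\<phi> \<mapsto> \<pi> - \<phi>\<close>, from the data at \<open>\<pi>\<close>. In the coordinate \<open>x\<close> with \<open>dx = d\<phi> / \<omega>\<close>, which is finite over
  \<open>(0, \<pi>)\<close>, the equation reads \<open>U\<^sub>x\<^sub>x + a (U\<^sub>t\<^sub>t + U\<^sub>t) = 0\<close> with \<open>a = sin \<phi> / 4\<close>. It degenerates at \<open>x = 0\<close>,
  but there \<open>a\<close> is Lipschitz and increasing, and this sign is the one that a Carleman weight
  \<open>\<rho> = -(B x - x\<^sup>2/2) - \<beta> t\<^sup>2\<close> needs: \<open>carleman_estimate\<close> holds for large \<open>\<tau>\<close> with weight \<open>e\<^sup>2\<^sup>\<tau>\<^sup>\<rho>\<close>. Past
  the midpoint \<open>a\<close> decreases, but slightly beyond it the loss is still absorbed, which leaves room for a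
  cutoff in \<open>x\<close>. The weight is larger on the region of interest (\<open>x\<close> up to the midpoint, \<open>t\<close> near
  \<open>0\<close>) than on the support of the commutator terms, provided that the time interval is long: this is
  why the margin \<open>d\<close> is large. A Caccioppoli inequality bounds the commutator terms by the
  \<open>\<H>\<close>-norm, and optimising \<open>\<tau>\<close> gives the power law (\<open>holder_from_exponential_weights\<close>,
  \<open>sideways_holder\<close>).

  A weak solution has to be regularised before any of this applies. It is enough to convolve in \<open>t\<close>:
  the coefficients of the differential operator do not depend on \<open>t\<close>, and once the solution is smooth in \<open>t\<close> the
  equation itself gives the regularity in \<open>\<phi>\<close>. Testing with \<open>\<eta>(t) v\<close>, where \<open>v\<close> is an explicit ramp in
  \<open>\<phi>\<close>, yields an integral formula for the mollified solution (\<open>ramp_identity\<close>) which can be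
  differentiated classically, and the constant function as \<open>v\<close> identifies the flux at \<open>\<pi>\<close>. As \<open>t \<mapsto> \<Gamma>(t) C w(t)\<close>
  is mollified as one function, a merely bounded and measurable \<open>\<Gamma>\<close> causes no commutator. Since
  mollification contracts \<open>L\<^sup>2\<close> and \<open>w\<close> is continuous into \<open>\<H>\<close>, the estimate survives the limit
  (\<open>cont_rep_holder\<close>).
\<close>

section \<open>Integrals over space-time rectangles\<close>

text \<open>
  Functions of \<open>(t, x)\<close> are kept curried, so that slices in either variable and the derivatives along
  them can be written without projections.
\<close>
definition cont2 :: "real \<Rightarrow> real \<Rightarrow> (real \<Rightarrow> real \<Rightarrow> real) \<Rightarrow> bool" where
  "cont2 T L f \<longleftrightarrow> continuous_on (cbox (-T,0) (T,L)) (\<lambda>q. f (fst q) (snd q))"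

definition dint :: "real \<Rightarrow> real \<Rightarrow> (real \<Rightarrow> real \<Rightarrow> real) \<Rightarrow> real" where
  "dint T L f = integral (cbox (-T,0) (T,L)) (\<lambda>q. f (fst q) (snd q))"

lemma mem_rect: "q \<in> cbox (-T,0) (T,L) \<longleftrightarrow> fst q \<in> {-T..T} \<and> snd q \<in> {0..L}" for T L :: real
  by (cases q) (simp add: cbox_Pair_eq)

lemma dint_iterated:
  assumes "cont2 T L f"
  shows "dint T L f = integral {-T..T} (\<lambda>t. integral {0..L} (f t))"
    and "dint T L f = integral {0..L} (\<lambda>x. integral {-T..T} (\<lambda>t. f t x))"
proof -
  have c: "continuous_on (cbox (-T,0) (T,L)) (\<lambda>(t,x). f t x)"
    using assms by (simp add: cont2_def case_prod_unfold)
  show 1: "dint T L f = integral {-T..T} (\<lambda>t. integral {0..L} (f t))"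
    using integral_integrable_2dim[OF c] integral_prod_continuous[OF c]
    by (simp add: dint_def case_prod_unfold)
  show "dint T L f = integral {0..L} (\<lambda>x. integral {-T..T} (\<lambda>t. f t x))"
    using 1 integral_swap_continuous[OF c] by simp
qed

lemma dint_dx:
  assumes "0 \<le> L" "cont2 T L F" "cont2 T L Fx"
    and d: "\<And>t x. t \<in> {-T..T} \<Longrightarrow> x \<in> {0<..<L} \<Longrightarrow> (F t has_real_derivative Fx t x) (at x)"
  shows "dint T L Fx = integral {-T..T} (\<lambda>t. F t L - F t 0)"
proof -
  have "integral {0..L} (Fx t) = F t L - F t 0" if t: "t \<in> {-T..T}" for t
  proof (rule integral_unique, rule fundamental_theorem_of_calculus_interior)
    show "continuous_on {0..L} (F t)"
      using t by (intro continuous_on_compose2[OF assms(2)[unfolded cont2_def], of _ "\<lambda>x. (t,x)", simplified])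
        (auto intro!: continuous_intros simp: cbox_Pair_eq)
  qed (use assms t in \<open>auto simp: has_real_derivative_iff_has_vector_derivative[symmetric]\<close>)
  then show ?thesis
    unfolding dint_iterated(1)[OF assms(3)] by (intro integral_cong) auto
qed

lemma dint_dt:
  assumes "0 \<le> T" "cont2 T L G" "cont2 T L Gt"
    and d: "\<And>t x. t \<in> {-T<..<T} \<Longrightarrow> x \<in> {0..L} \<Longrightarrow> ((\<lambda>t. G t x) has_real_derivative Gt t x) (at t)"
    and z: "\<And>x. x \<in> {0..L} \<Longrightarrow> G T x = G (-T) x"
  shows "dint T L Gt = 0"
proof -
  have "integral {-T..T} (\<lambda>t. Gt t x) = G T x - G (-T) x" if x: "x \<in> {0..L}" for x
  proof (rule integral_unique, rule fundamental_theorem_of_calculus_interior)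
    show "continuous_on {-T..T} (\<lambda>t. G t x)"
      using x by (intro continuous_on_compose2[OF assms(2)[unfolded cont2_def], of _ "\<lambda>t. (t,x)", simplified])
        (auto intro!: continuous_intros simp: cbox_Pair_eq)
  qed (use assms x in \<open>auto simp: has_real_derivative_iff_has_vector_derivative[symmetric]\<close>)
  then have "integral {0..L} (\<lambda>x. integral {-T..T} (\<lambda>t. Gt t x)) = integral {0..L} (\<lambda>x. 0)"
    using z by (intro integral_cong) auto
  then show ?thesis
    unfolding dint_iterated(2)[OF assms(3)] by simp
qed

lemma dint_integrable: "cont2 T L f \<Longrightarrow> (\<lambda>q. f (fst q) (snd q)) integrable_on cbox (-T,0) (T,L)"
  unfolding cont2_def by (rule integrable_continuous)

lemma dint_mono:
  assumes "cont2 T L f" "cont2 T L g"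
    and "\<And>t x. t \<in> {-T..T} \<Longrightarrow> x \<in> {0..L} \<Longrightarrow> f t x \<le> g t x"
  shows "dint T L f \<le> dint T L g"
  unfolding dint_def using assms
  by (intro integral_le dint_integrable) (auto simp: cbox_Pair_eq)

lemma dint_add: "cont2 T L f \<Longrightarrow> cont2 T L g \<Longrightarrow> dint T L (\<lambda>t x. f t x + g t x) = dint T L f + dint T L g"
  unfolding dint_def using dint_integrable integral_add by blast

lemma dint_cmult: "dint T L (\<lambda>t x. c * f t x) = c * dint T L f"
  unfolding dint_def by simp

lemma dint_nonneg:
  assumes "cont2 T L f" "\<And>t x. t \<in> {-T..T} \<Longrightarrow> x \<in> {0..L} \<Longrightarrow> 0 \<le> f t x"
  shows "0 \<le> dint T L f"
  unfolding dint_def using assms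
  by (intro integral_nonneg dint_integrable) (auto simp: cbox_Pair_eq)

lemma cont2_x:
  fixes T L :: real
  assumes "continuous_on {0..L} a"
  shows "continuous_on (cbox (-T,0) (T,L)) (\<lambda>q. a (snd q))"
proof (rule continuous_on_compose2[OF assms])
  show "continuous_on (cbox (-T,0) (T,L)) snd"
    by (rule linear_continuous_on) (rule bounded_linear_snd)
qed (rule image_subsetI, simp only: mem_rect)

lemma cont2_t:
  fixes T L :: real
  assumes "continuous_on {-T..T} a"
  shows "continuous_on (cbox (-T,0) (T,L)) (\<lambda>q. a (fst q))"
proof (rule continuous_on_compose2[OF assms])
  show "continuous_on (cbox (-T,0) (T,L)) fst"
    by (rule linear_continuous_on) (rule bounded_linear_fst)
qed (rule image_subsetI, simp only: mem_rect)

section \<open>A Carleman estimate for a degenerate elliptic operator\<close>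

text \<open>
  Pointwise positivity behind the Carleman estimate. Here \<open>p = - \<rho>\<^sub>x\<close> and \<open>b = \<rho>\<^sub>t\<close> for the weight \<open>\<rho>\<close>.
  The cross term is absorbed because \<open>a'\<^sup>2 \<le> a/4\<close>: where the operator degenerates,
  its coefficient varies only at the rate \<open>\<surd>a\<close>. The coefficient of \<open>yt\<^sup>2\<close> is \<open>a' p + a\<close> up to small terms, so it
  stays nonnegative even where \<open>a\<close> decreases, as long as \<open>a' p \<ge> - a/4\<close>. The large term in \<open>\<tau>\<close> comes from \<open>p \<ge> 1\<close>.
\<close>
lemma carleman_quadratic_form:
  fixes a a' p b \<beta> \<tau> y yt yx :: real
  assumes a: "0 \<le> a" "a \<le> 1/4" "a'\<^sup>2 \<le> a/4" and p: "1 \<le> p" "- a/4 \<le> a' * p"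
    and b: "b\<^sup>2 \<le> 1/4" and \<beta>: "0 < \<beta>" "\<beta> \<le> 1/4"
  shows "2*yx\<^sup>2 + a/2*yt\<^sup>2 + \<tau>\<^sup>2/2*y\<^sup>2 \<le>
     (3 + 2*\<beta>*a)*yx\<^sup>2 + 2*a'*b*yx*yt + (a'*p + a*(1-2*\<beta>*a))*yt\<^sup>2
     + \<tau>\<^sup>2*(2*p\<^sup>2 - a'*p*b\<^sup>2 - (p\<^sup>2+a*b\<^sup>2)*(1+2*\<beta>*a) - 4*\<beta>*a\<^sup>2*b\<^sup>2)*y\<^sup>2"
proof -
  have ba: "\<beta>*a \<le> 1/16" "0 \<le> \<beta>*a" using mult_mono[of \<beta> "1/4" a "1/4"] a \<beta> by auto
  have ab: "a'\<^sup>2*b\<^sup>2 \<le> a/16" using mult_mono[of "a'\<^sup>2" "a/4" "b\<^sup>2" "1/4"] a b by auto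
  have c1: "- yx\<^sup>2 - a/16*yt\<^sup>2 \<le> 2*a'*b*yx*yt"
  proof -
    have "0 \<le> (yx + a'*b*yt)\<^sup>2" by simp
    also have "\<dots> = yx\<^sup>2 + 2*a'*b*yx*yt + (a'\<^sup>2*b\<^sup>2)*yt\<^sup>2" by (simp add: power2_eq_square algebra_simps)
    also have "(a'\<^sup>2*b\<^sup>2)*yt\<^sup>2 \<le> a/16*yt\<^sup>2" by (rule mult_right_mono[OF ab]) simp
    finally show ?thesis by linarith
  qed
  have "a*(2*\<beta>*a) \<le> a*(1/8)" by (rule mult_left_mono) (use ba a in auto)
  then have "a/2 + a/16 \<le> a'*p + a*(1-2*\<beta>*a)" using p a by (simp add: algebra_simps)
  then have c2: "(a/2 + a/16)*yt\<^sup>2 \<le> (a'*p + a*(1-2*\<beta>*a))*yt\<^sup>2" by (rule mult_right_mono) simp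
  have c3: "3*yx\<^sup>2 \<le> (3 + 2*\<beta>*a)*yx\<^sup>2" using ba by (intro mult_right_mono) auto
  have pp: "p \<le> p\<^sup>2" "1 \<le> p\<^sup>2" using p self_le_power[of p 2] one_le_power[of p 2] by auto
  have a1: "a' \<le> 1/4"
  proof (rule ccontr)
    assume "\<not> a' \<le> 1/4"
    then have "(1/4)\<^sup>2 < a'\<^sup>2" by (intro power_strict_mono) auto
    then show False using a by (simp add: power2_eq_square)
  qed
  have d1: "a'*p \<le> p\<^sup>2/4" using mult_right_mono[OF a1, of p] pp p by linarith
  have d2: "(a'*p)*b\<^sup>2 \<le> (p\<^sup>2/4)*(b\<^sup>2)" by (rule mult_right_mono[OF d1]) simp
  have d3: "(p\<^sup>2/4)*(b\<^sup>2) \<le> (p\<^sup>2/4)*(1/4)" by (rule mult_left_mono[OF b]) simp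
  have d4: "a*b\<^sup>2 \<le> 1/16" "0 \<le> a*b\<^sup>2" using mult_mono[of a "1/4" "b\<^sup>2" "1/4"] a b by auto
  have d5: "(p\<^sup>2+a*b\<^sup>2)*(1+2*\<beta>*a) \<le> (p\<^sup>2+1/16)*(1+1/8)"
    using ba d4 by (intro mult_mono) auto
  have d6: "4*\<beta>*a\<^sup>2*b\<^sup>2 \<le> 1/64"
    using mult_mono[of "\<beta>*a" "1/16" "a*b\<^sup>2" "1/16"] ba d4 by (auto simp: power2_eq_square algebra_simps)
  have "1/2 \<le> 2*p\<^sup>2 - a'*p*b\<^sup>2 - (p\<^sup>2+a*b\<^sup>2)*(1+2*\<beta>*a) - 4*\<beta>*a\<^sup>2*b\<^sup>2"
    using d2 d3 d5 d6 pp by (simp add: algebra_simps)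
  then have "\<tau>\<^sup>2*(1/2)*y\<^sup>2 \<le> \<tau>\<^sup>2*(2*p\<^sup>2 - a'*p*b\<^sup>2 - (p\<^sup>2+a*b\<^sup>2)*(1+2*\<beta>*a) - 4*\<beta>*a\<^sup>2*b\<^sup>2)*y\<^sup>2"
    by (intro mult_right_mono mult_left_mono) auto
  then show ?thesis using c1 c2 c3 by (simp add: algebra_simps)
qed

text \<open>
  Completing the square in \<open>N\<close>. The lower-order part of the conjugated operator costs a quarter of the
  positive quadratic form, which is where \<open>\<tau> \<ge> 16\<close> comes from.
\<close>
lemma carleman_multiplier:
  fixes S N f e :: real
  assumes a: "0 \<le> a" "a \<le> 1/4" and b: "b\<^sup>2 \<le> 1/4" and e: "0 \<le> e" "e \<le> 9/8" and \<tau>: "16 \<le> \<tau>"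
    and S: "S = f - a*(yt - \<tau>*b*y) - \<tau>*(N + e*y)"
  shows "S*N \<le> (1/\<tau>)*f\<^sup>2 + a/4*yt\<^sup>2 + \<tau>\<^sup>2/4*y\<^sup>2"
proof -
  define h where "h = f - a*(yt - \<tau>*b*y) - \<tau>*e*y"
  have \<tau>0: "0 < \<tau>" using \<tau> by simp
  have "S*N = h*N - \<tau>*N\<^sup>2" by (simp add: S h_def power2_eq_square algebra_simps)
  also have "\<dots> \<le> h\<^sup>2/(4*\<tau>)"
  proof -
    have "0 \<le> (2*\<tau>*N - h)\<^sup>2" by simp
    then have "4*\<tau>*(h*N - \<tau>*N\<^sup>2) \<le> h\<^sup>2" by (simp add: power2_eq_square algebra_simps)
    then show ?thesis using \<tau>0 by (simp add: field_simps)
  qed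
  also have "h\<^sup>2 \<le> 4*f\<^sup>2 + 4*(a*yt)\<^sup>2 + 4*(a*\<tau>*b*y)\<^sup>2 + 4*(\<tau>*e*y)\<^sup>2"
  proof -
    have gen: "(u - v + w - z)\<^sup>2 \<le> 4 * u\<^sup>2 + 4 * v\<^sup>2 + 4 * w\<^sup>2 + 4 * z\<^sup>2" for u v w z :: real
    proof -
      have "0 \<le> (u+v)\<^sup>2 + (u-w)\<^sup>2 + (u+z)\<^sup>2 + (v+w)\<^sup>2 + (v-z)\<^sup>2 + (w+z)\<^sup>2" by simp
      then show ?thesis by (simp add: power2_eq_square algebra_simps)
    qed
    have "h = f - a*yt + a*\<tau>*b*y - \<tau>*e*y" by (simp add: h_def algebra_simps)
    then show ?thesis using gen by simp
  qed
  finally have "S*N \<le> (4*f\<^sup>2 + 4*(a*yt)\<^sup>2 + 4*(a*\<tau>*b*y)\<^sup>2 + 4*(\<tau>*e*y)\<^sup>2)/(4*\<tau>)"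
    using \<tau>0 by (simp add: divide_right_mono)
  also have "\<dots> = (1/\<tau>)*f\<^sup>2 + a\<^sup>2*yt\<^sup>2/\<tau> + \<tau>*(a\<^sup>2*b\<^sup>2 + e\<^sup>2)*y\<^sup>2"
    using \<tau>0 by (simp add: field_simps power2_eq_square)
  also have "a\<^sup>2*yt\<^sup>2/\<tau> \<le> a/4*yt\<^sup>2"
  proof -
    have "a\<^sup>2 \<le> a*(1/4)" unfolding power2_eq_square using a by (intro mult_left_mono) auto
    then have "a\<^sup>2*yt\<^sup>2 \<le> a/4*yt\<^sup>2" by (intro mult_right_mono) auto
    moreover have "a\<^sup>2*yt\<^sup>2/\<tau> \<le> a\<^sup>2*yt\<^sup>2/1" using \<tau> by (intro divide_left_mono) auto
    ultimately show ?thesis by linarith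
  qed
  also have "\<tau>*(a\<^sup>2*b\<^sup>2 + e\<^sup>2)*y\<^sup>2 \<le> \<tau>\<^sup>2/4*y\<^sup>2"
  proof -
    have "a\<^sup>2 \<le> (1/4)\<^sup>2" "e\<^sup>2 \<le> (9/8)\<^sup>2" using a e by (auto intro!: power_mono)
    then have "a\<^sup>2*b\<^sup>2 \<le> (1/16)*(1/4)" "e\<^sup>2 \<le> 2"
      using mult_mono[OF _ b, of "a\<^sup>2" "1/16"] by (auto simp: power2_eq_square)
    then have "a\<^sup>2*b\<^sup>2 + e\<^sup>2 \<le> 4" by linarith
    also have "\<dots> \<le> \<tau>/4" using \<tau> by simp
    finally have "\<tau>*(a\<^sup>2*b\<^sup>2 + e\<^sup>2) \<le> \<tau>*(\<tau>/4)" using \<tau>0 by (intro mult_left_mono) auto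
    then show ?thesis by (intro mult_right_mono) (auto simp: power2_eq_square)
  qed
  finally show ?thesis by simp
qed

text \<open>
  The multiplier identity. \<open>S\<close> is the symmetric principal part of the conjugated operator, \<open>N\<close> the
  multiplier \<open>- 2 (\<rho>\<^sub>x \<partial>\<^sub>x + a \<rho>\<^sub>t \<partial>\<^sub>t) - 2\<close>, with \<open>q = \<rho>\<^sub>x\<close> and \<open>b = \<rho>\<^sub>t\<close>. The two brackets on the left are the
  \<open>x\<close>-derivative and the \<open>t\<close>-derivative of explicit fluxes, so after integration only
  the boundary terms at \<open>x = 0\<close> survive. The zeroth-order part of \<open>N\<close> is chosen so that both \<open>yx\<^sup>2\<close> and
  \<open>\<tau>\<^sup>2 y\<^sup>2\<close> get positive coefficients.
\<close>
lemma carleman_divergence_identity: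
  fixes y yt yx ytt yxx yxt a a' q b \<beta> \<tau> :: real
  defines "V \<equiv> q\<^sup>2 + a*b\<^sup>2"
  defines "S \<equiv> yxx + a*ytt + \<tau>\<^sup>2*V*y"
  defines "N \<equiv> - 2*(q*yx + a*b*yt) - 2*y"
  shows "(- yx\<^sup>2 - 2*q*yx*yxx - 2*b*(a'*yx*yt + a*yxx*yt + a*yx*yxt) + (a'*q + a)*yt\<^sup>2 + 2*a*q*yt*yxt
           - 2*yx\<^sup>2 - 2*y*yxx - \<tau>\<^sup>2*((2*q + a'*b\<^sup>2)*q + V)*y\<^sup>2 - 2*\<tau>\<^sup>2*V*q*y*yx)
       + (- 2*\<beta>*a*yx\<^sup>2 + 2*a*b*yx*yxt - 2*a*q*(ytt*yx + yt*yxt) + 2*\<beta>*a\<^sup>2*yt\<^sup>2 - 2*a\<^sup>2*b*yt*ytt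
           - 2*a*(yt\<^sup>2 + y*ytt) - \<tau>\<^sup>2*(- 4*\<beta>*a\<^sup>2*b\<^sup>2 - 2*\<beta>*a*V)*y\<^sup>2 - 2*\<tau>\<^sup>2*V*a*b*y*yt)
     = S*N - ((3 + 2*\<beta>*a)*yx\<^sup>2 + 2*a'*b*yx*yt + (a'*(-q) + a*(1-2*\<beta>*a))*yt\<^sup>2
        + \<tau>\<^sup>2*(2*q\<^sup>2 - a'*(-q)*b\<^sup>2 - V*(1+2*\<beta>*a) - 4*\<beta>*a\<^sup>2*b\<^sup>2)*y\<^sup>2)"
  unfolding V_def S_def N_def by (simp add: power2_eq_square algebra_simps)

text \<open>
  With \<open>y = e\<^sup>\<tau>\<^sup>\<rho> v\<close> and \<open>\<rho> = - (B x - x\<^sup>2/2) - \<beta> t\<^sup>2\<close>, the expression \<open>P\<close> is \<open>e\<^sup>\<tau>\<^sup>\<rho> (v\<^sub>x\<^sub>x + a v\<^sub>t\<^sub>t + a v\<^sub>t)\<close>. As \<open>a\<close> vanishes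
  at \<open>x = 0\<close>, no \<open>t\<close>-derivative of \<open>y\<close> occurs in the boundary term there, so it is made of the Cauchy data only.
\<close>
lemma carleman_estimate:
  fixes y yt yx ytt yxx yxt :: "real \<Rightarrow> real \<Rightarrow> real" and a a' :: "real \<Rightarrow> real"
  assumes T: "0 < T" and L: "0 < L"
    and cont: "cont2 T L y" "cont2 T L yt" "cont2 T L yx" "cont2 T L ytt" "cont2 T L yxx" "cont2 T L yxt"
    and dx: "\<And>t x. t \<in> {-T..T} \<Longrightarrow> x \<in> {0<..<L} \<Longrightarrow> ((\<lambda>x. y t x) has_real_derivative yx t x) (at x)"
      "\<And>t x. t \<in> {-T..T} \<Longrightarrow> x \<in> {0<..<L} \<Longrightarrow> ((\<lambda>x. yx t x) has_real_derivative yxx t x) (at x)"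
      "\<And>t x. t \<in> {-T..T} \<Longrightarrow> x \<in> {0<..<L} \<Longrightarrow> ((\<lambda>x. yt t x) has_real_derivative yxt t x) (at x)"
    and dt: "\<And>t x. t \<in> {-T<..<T} \<Longrightarrow> x \<in> {0..L} \<Longrightarrow> ((\<lambda>t. y t x) has_real_derivative yt t x) (at t)"
      "\<And>t x. t \<in> {-T<..<T} \<Longrightarrow> x \<in> {0..L} \<Longrightarrow> ((\<lambda>t. yt t x) has_real_derivative ytt t x) (at t)"
      "\<And>t x. t \<in> {-T<..<T} \<Longrightarrow> x \<in> {0..L} \<Longrightarrow> ((\<lambda>t. yx t x) has_real_derivative yxt t x) (at t)"
    and vt: "\<And>x. x \<in> {0..L} \<Longrightarrow> y T x = 0" "\<And>x. x \<in> {0..L} \<Longrightarrow> yt T x = 0" "\<And>x. x \<in> {0..L} \<Longrightarrow> yx T x = 0"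
      "\<And>x. x \<in> {0..L} \<Longrightarrow> y (-T) x = 0" "\<And>x. x \<in> {0..L} \<Longrightarrow> yt (-T) x = 0" "\<And>x. x \<in> {0..L} \<Longrightarrow> yx (-T) x = 0"
    and vL: "\<And>t. t \<in> {-T..T} \<Longrightarrow> y t L = 0" "\<And>t. t \<in> {-T..T} \<Longrightarrow> yt t L = 0" "\<And>t. t \<in> {-T..T} \<Longrightarrow> yx t L = 0"
    and a_cont: "continuous_on {0..L} a" "continuous_on {0..L} a'"
    and a_deriv: "\<And>x. x \<in> {0<..<L} \<Longrightarrow> (a has_real_derivative a' x) (at x)"
    and a0: "a 0 = 0"
    and a: "\<And>x. x \<in> {0..L} \<Longrightarrow> 0 \<le> a x \<and> a x \<le> 1/4 \<and> (a' x)\<^sup>2 \<le> a x/4 \<and> - a x/4 \<le> a' x * (B - x)"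
    and B: "1 + L \<le> B" and \<beta>: "0 < \<beta>" "\<beta> \<le> 1/4" "2*\<beta>*T \<le> 1/2" and \<tau>: "16 \<le> \<tau>"
  defines "P \<equiv> (\<lambda>t x. yxx t x - 2*\<tau>*(x-B)*yx t x - \<tau>*y t x + \<tau>\<^sup>2*(x-B)\<^sup>2*y t x
      + a x*(ytt t x - 2*\<tau>*(-2*\<beta>*t)*yt t x + 2*\<tau>*\<beta>*y t x + \<tau>\<^sup>2*(-2*\<beta>*t)\<^sup>2*y t x)
      + a x*(yt t x - \<tau>*(-2*\<beta>*t)*y t x))"
  shows "dint T L (\<lambda>t x. a x/4*(yt t x)\<^sup>2 + \<tau>\<^sup>2/4*(y t x)\<^sup>2)
     \<le> (1/\<tau>) * dint T L (\<lambda>t x. (P t x)\<^sup>2)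
       + integral {-T..T} (\<lambda>t. B*(yx t 0)\<^sup>2 - 2*y t 0*yx t 0 + \<tau>\<^sup>2*B^3*(y t 0)\<^sup>2)"
proof -
  note c = cont[unfolded cont2_def] cont2_x[OF a_cont(1)] cont2_x[OF a_cont(2)]
  \<comment> \<open>the \<open>x\<close>-flux of the multiplier identity and its derivative; \<open>G\<close> and \<open>Gt\<close> are the \<open>t\<close>-flux\<close>
  define F where "F = (\<lambda>t x. - (x-B)*(yx t x)\<^sup>2 - 2*(-2*\<beta>*t)*(a x*yx t x*yt t x) + a x*(x-B)*(yt t x)\<^sup>2 - 2*y t x*yx t x
     - \<tau>\<^sup>2*(((x-B)\<^sup>2 + a x*(-2*\<beta>*t)\<^sup>2)*(x-B))*(y t x)\<^sup>2)"
  define Fx where "Fx = (\<lambda>t x. let q = x-B; b = -2*\<beta>*t; V = q\<^sup>2 + a x*b\<^sup>2 in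
     - (yx t x)\<^sup>2 - 2*q*yx t x*yxx t x - 2*b*(a' x*yx t x*yt t x + a x*yxx t x*yt t x + a x*yx t x*yxt t x)
     + (a' x*q + a x)*(yt t x)\<^sup>2 + 2*a x*q*yt t x*yxt t x
     - 2*(yx t x)\<^sup>2 - 2*y t x*yxx t x - \<tau>\<^sup>2*((2*q + a' x*b\<^sup>2)*q + V)*(y t x)\<^sup>2 - 2*\<tau>\<^sup>2*V*q*y t x*yx t x)"
  define G where "G = (\<lambda>t x. let q = x-B; b = -2*\<beta>*t; V = q\<^sup>2 + a x*b\<^sup>2 in
     a x*b*(yx t x)\<^sup>2 - 2*a x*q*(yt t x*yx t x) - (a x)\<^sup>2*b*(yt t x)\<^sup>2 - 2*a x*(y t x*yt t x) - \<tau>\<^sup>2*(V*a x*b)*(y t x)\<^sup>2)"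
  define Gt where "Gt = (\<lambda>t x. let q = x-B; b = -2*\<beta>*t; V = q\<^sup>2 + a x*b\<^sup>2 in
     - 2*\<beta>*a x*(yx t x)\<^sup>2 + 2*a x*b*yx t x*yxt t x - 2*a x*q*(ytt t x*yx t x + yt t x*yxt t x) + 2*\<beta>*(a x)\<^sup>2*(yt t x)\<^sup>2
     - 2*(a x)\<^sup>2*b*yt t x*ytt t x - 2*a x*((yt t x)\<^sup>2 + y t x*ytt t x)
     - \<tau>\<^sup>2*(- 4*\<beta>*(a x)\<^sup>2*b\<^sup>2 - 2*\<beta>*a x*V)*(y t x)\<^sup>2 - 2*\<tau>\<^sup>2*V*a x*b*y t x*yt t x)"
  have cF: "cont2 T L F" and cFx: "cont2 T L Fx" and cG: "cont2 T L G" and cGt: "cont2 T L Gt"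
    unfolding cont2_def F_def Fx_def G_def Gt_def Let_def by (intro continuous_intros c)+
  have dint3: "dint T L (\<lambda>t x. f t x + g t x + h t x) = dint T L f + dint T L g + dint T L h"
    if "cont2 T L f" "cont2 T L g" "cont2 T L h" for f g h
    using dint_add[of T L "\<lambda>t x. f t x + g t x" h] dint_add[of T L f g] that
    by (simp add: cont2_def continuous_on_add)
  have cFG: "cont2 T L (\<lambda>t x. Fx t x + Gt t x)"
    using cFx cGt unfolding cont2_def by (intro continuous_on_add)
  have cP: "cont2 T L (\<lambda>t x. (P t x)\<^sup>2)"
    unfolding cont2_def P_def by (intro continuous_intros c)
  have cl: "cont2 T L (\<lambda>t x. a x/4*(yt t x)\<^sup>2 + \<tau>\<^sup>2/4*(y t x)\<^sup>2)"
    unfolding cont2_def by (intro continuous_intros c) auto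
  have iF: "dint T L Fx = integral {-T..T} (\<lambda>t. F t L - F t 0)"
  proof (rule dint_dx[OF _ cF cFx])
    fix t x assume t: "t \<in> {-T..T}" and x: "x \<in> {0<..<L}"
    show "(F t has_real_derivative Fx t x) (at x)"
      unfolding F_def Fx_def Let_def
      by (rule derivative_eq_intros dx[OF t x] a_deriv[OF x] refl)+
         (simp add: power2_eq_square algebra_simps)
  qed (use L in simp)
  have iG: "dint T L Gt = 0"
  proof (rule dint_dt[OF _ cG cGt])
    fix t x assume t: "t \<in> {-T<..<T}" and x: "x \<in> {0..L}"
    show "((\<lambda>t. G t x) has_real_derivative Gt t x) (at t)"
      unfolding G_def Gt_def Let_def
      by (rule derivative_eq_intros dt[OF t x] refl)+
         (simp add: power2_eq_square algebra_simps)
  next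
    fix x assume x: "x \<in> {0..L}"
    show "G T x = G (-T) x" by (simp add: G_def Let_def vt[OF x])
  qed (use T in simp)
  have "dint T L (\<lambda>t x. (Fx t x + Gt t x) + (a x/4*(yt t x)\<^sup>2 + \<tau>\<^sup>2/4*(y t x)\<^sup>2)) \<le> dint T L (\<lambda>t x. (1/\<tau>)*(P t x)\<^sup>2)"
  proof (rule dint_mono)
    show "cont2 T L (\<lambda>t x. (Fx t x + Gt t x) + (a x/4*(yt t x)\<^sup>2 + \<tau>\<^sup>2/4*(y t x)\<^sup>2))"
      using cFG cl unfolding cont2_def by (rule continuous_on_add)
    show "cont2 T L (\<lambda>t x. (1/\<tau>)*(P t x)\<^sup>2)"
      using cP unfolding cont2_def by (intro continuous_on_mult continuous_on_const)
    fix t x assume t: "t \<in> {-T..T}" and x: "x \<in> {0..L}"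
    define q where "q = x - B"
    define b where "b = -2*\<beta>*t"
    define S where "S = yxx t x + a x*ytt t x + \<tau>\<^sup>2*(q\<^sup>2 + a x*b\<^sup>2)*y t x"
    define N where "N = - 2*(q*yx t x + a x*b*yt t x) - 2*y t x"
    have "\<bar>2*\<beta>*t\<bar> \<le> 2*\<beta>*T" using t \<beta> by (auto simp: abs_mult)
    then have "\<bar>b\<bar> \<le> 1/2" using \<beta> unfolding b_def by linarith
    then have b: "b\<^sup>2 \<le> 1/4" using power_mono[of "\<bar>b\<bar>" "1/2" 2] by (simp add: power_divide)
    have ba: "\<beta>*a x \<le> 1/16" "0 \<le> \<beta>*a x"
      using mult_mono[of \<beta> "1/4" "a x" "1/4"] \<beta> a[OF x] by auto
    have id: "Fx t x + Gt t x = S*N - ((3 + 2*\<beta>*a x)*(yx t x)\<^sup>2 + 2*a' x*b*yx t x*yt t x + (a' x*(-q) + a x*(1-2*\<beta>*a x))*(yt t x)\<^sup>2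
        + \<tau>\<^sup>2*(2*q\<^sup>2 - a' x*(-q)*b\<^sup>2 - (q\<^sup>2 + a x*b\<^sup>2)*(1+2*\<beta>*a x) - 4*\<beta>*(a x)\<^sup>2*b\<^sup>2)*(y t x)\<^sup>2)"
      unfolding Fx_def Gt_def Let_def S_def N_def q_def[symmetric] b_def[symmetric]
      by (rule carleman_divergence_identity)
    have "S*N \<le> (1/\<tau>)*(P t x)\<^sup>2 + a x/4*(yt t x)\<^sup>2 + \<tau>\<^sup>2/4*(y t x)\<^sup>2"
    proof (rule carleman_multiplier[where b=b and e="1 + 2*\<beta>*a x"])
      show "S = P t x - a x*(yt t x - \<tau>*b*y t x) - \<tau>*(N + (1 + 2*\<beta>*a x)*y t x)"
        unfolding S_def P_def N_def q_def[symmetric] b_def[symmetric]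
        by (simp add: power2_eq_square algebra_simps)
    qed (use a[OF x] b ba \<tau> in auto)
    moreover have "2*(yx t x)\<^sup>2 + a x/2*(yt t x)\<^sup>2 + \<tau>\<^sup>2/2*(y t x)\<^sup>2 \<le>
       (3 + 2*\<beta>*a x)*(yx t x)\<^sup>2 + 2*a' x*b*yx t x*yt t x + (a' x*(-q) + a x*(1-2*\<beta>*a x))*(yt t x)\<^sup>2
     + \<tau>\<^sup>2*(2*(-q)\<^sup>2 - a' x*(-q)*b\<^sup>2 - ((-q)\<^sup>2+a x*b\<^sup>2)*(1+2*\<beta>*a x) - 4*\<beta>*(a x)\<^sup>2*b\<^sup>2)*(y t x)\<^sup>2"
      by (rule carleman_quadratic_form) (use a[OF x] x B b \<beta> in \<open>auto simp: q_def\<close>)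
    ultimately show "(Fx t x + Gt t x) + (a x/4*(yt t x)\<^sup>2 + \<tau>\<^sup>2/4*(y t x)\<^sup>2) \<le> (1/\<tau>)*(P t x)\<^sup>2"
      unfolding id power2_minus using zero_le_power2[of "yx t x"] by linarith
  qed
  also have "dint T L (\<lambda>t x. (Fx t x + Gt t x) + (a x/4*(yt t x)\<^sup>2 + \<tau>\<^sup>2/4*(y t x)\<^sup>2))
     = dint T L Fx + dint T L Gt + dint T L (\<lambda>t x. a x/4*(yt t x)\<^sup>2 + \<tau>\<^sup>2/4*(y t x)\<^sup>2)"
    by (rule dint3[OF cFx cGt cl])
  finally have *: "dint T L (\<lambda>t x. a x/4*(yt t x)\<^sup>2 + \<tau>\<^sup>2/4*(y t x)\<^sup>2) \<le> (1/\<tau>) * dint T L (\<lambda>t x. (P t x)\<^sup>2) - dint T L Fx"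
    using iG by (simp only: dint_cmult)
  have "dint T L Fx = integral {-T..T} (\<lambda>t. - 1 * (B*(yx t 0)\<^sup>2 - 2*y t 0*yx t 0 + \<tau>\<^sup>2*B^3*(y t 0)\<^sup>2))"
    unfolding iF
  proof (rule integral_cong)
    fix t assume t: "t \<in> {-T..T}"
    show "F t L - F t 0 = - 1 * (B*(yx t 0)\<^sup>2 - 2*y t 0*yx t 0 + \<tau>\<^sup>2*B^3*(y t 0)\<^sup>2)"
      by (simp add: F_def vL[OF t] a0 power2_eq_square power3_eq_cube algebra_simps)
  qed
  then show ?thesis using * unfolding integral_mult_right by linarith
qed

section \<open>Cutoff functions with two derivatives\<close>

text \<open>
  Both one-sided derivatives vanish at the clipping points, so that a polynomial step can be extended by
  constants without losing differentiability.
\<close>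
lemma clip_has_derivative:
  fixes F F' :: "real \<Rightarrow> real"
  assumes F: "\<And>s. (F has_real_derivative F' s) (at s)" and z: "F' 0 = 0" "F' 1 = 0"
  shows "((\<lambda>s. F (max 0 (min 1 s))) has_real_derivative F' (max 0 (min 1 s))) (at s)"
proof (cases "0 < s \<and> s < 1")
  case True
  have "(F has_real_derivative F' s) (at s)" by (rule F)
  then have "((\<lambda>s. F (max 0 (min 1 s))) has_real_derivative F' s) (at s)"
    by (rule has_field_derivative_transform_within_open[of _ _ _ "{0<..<1}"]) (use True in auto)
  then show ?thesis using True by simp
next
  case False
  define c where "c = max 0 (min 1 s)"
  have m0: "(*) 0 = (\<lambda>h::real. 0)" by auto
  have c0: "F' c = 0" using False z by (auto simp: c_def max_def min_def)
  have "((\<lambda>s. F (max 0 (min 1 s))) has_derivative (\<lambda>h. 0)) (at s)"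
    unfolding has_derivative_at_alt
  proof (intro conjI allI impI)
    fix e :: real assume e: "0 < e"
    have "(F has_derivative (\<lambda>h. 0)) (at c)"
      using F[of c] unfolding c0 has_field_derivative_def m0 .
    then obtain d where d: "0 < d" "\<And>u. norm (u - c) < d \<Longrightarrow> norm (F u - F c - 0) \<le> e * norm (u - c)"
      unfolding has_derivative_at_alt using e by blast
    show "\<exists>d>0. \<forall>y. norm (y - s) < d \<longrightarrow>
        norm (F (max 0 (min 1 y)) - F (max 0 (min 1 s)) - 0) \<le> e * norm (y - s)"
    proof (intro exI[of _ d] conjI allI impI d)
      fix y assume y: "norm (y - s) < d"
      have l: "norm (max 0 (min 1 y) - c) \<le> norm (y - s)" by (auto simp: c_def max_def min_def)
      then have "norm (F (max 0 (min 1 y)) - F c - 0) \<le> e * norm (max 0 (min 1 y) - c)"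
        using y by (intro d) linarith
      also have "\<dots> \<le> e * norm (y - s)" using l e by (intro mult_left_mono) auto
      finally show "norm (F (max 0 (min 1 y)) - F (max 0 (min 1 s)) - 0) \<le> e * norm (y - s)"
        by (simp add: c_def)
    qed
  qed simp
  then show ?thesis unfolding has_field_derivative_def c_def[symmetric] c0 m0 .
qed

definition cutoff :: "real \<Rightarrow> real \<Rightarrow> (real \<Rightarrow> real) \<Rightarrow> (real \<Rightarrow> real) \<Rightarrow> (real \<Rightarrow> real) \<Rightarrow> real \<Rightarrow> bool" where
  "cutoff u v f f' f'' k \<longleftrightarrow> (\<forall>s. (f has_real_derivative f' s) (at s)) \<and> (\<forall>s. (f' has_real_derivative f'' s) (at s)) \<and>
     continuous_on UNIV f'' \<and> (\<forall>s. 0 \<le> f s \<and> f s \<le> 1 \<and> \<bar>f' s\<bar> \<le> k \<and> \<bar>f'' s\<bar> \<le> k) \<and>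
     (\<forall>s\<le>u. f s = 1 \<and> f' s = 0 \<and> f'' s = 0) \<and> (\<forall>s\<ge>v. f s = 0 \<and> f' s = 0 \<and> f'' s = 0)"

lemma cutoff_exists:
  assumes "u < v"
  shows "\<exists>f f' f'' k. cutoff u v f f' f'' k"
proof -
  define c where "c = (\<lambda>s::real. max 0 (min 1 s))"
  \<comment> \<open>the quintic step, whose first two derivatives vanish at both ends\<close>
  define F where "F = (\<lambda>s::real. 1 - (10 * s^3 - 15 * s^4 + 6 * s^5))"
  define F' where "F' = (\<lambda>s::real. - 30 * s^2 * (1-s)^2)"
  define F'' where "F'' = (\<lambda>s::real. - 60 * s * (1-s) * (1-2 * s))"
  define r where "r = 1/(v-u)"
  have r: "0 < r" using assms by (simp add: r_def)
  define l where "l = (\<lambda>s. r*(s-u))"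
  have dF: "(F has_real_derivative F' s) (at s)" "(F' has_real_derivative F'' s) (at s)" for s
    unfolding F_def F'_def F''_def
    by (rule derivative_eq_intros refl | simp add: power2_eq_square power3_eq_cube algebra_simps eval_nat_numeral)+
  have dl: "(l has_real_derivative r) (at s)" for s
    unfolding l_def by (auto intro!: derivative_eq_intros)
  have d1: "((\<lambda>s. F (c s)) has_real_derivative F' (c s)) (at s)" for s
    unfolding c_def by (rule clip_has_derivative[OF dF(1)]) (auto simp: F'_def)
  have d2: "((\<lambda>s. F' (c s)) has_real_derivative F'' (c s)) (at s)" for s
    unfolding c_def by (rule clip_has_derivative[OF dF(2)]) (auto simp: F''_def)
  have c01: "0 \<le> c s" "c s \<le> 1" for s by (auto simp: c_def)
  have cl: "s \<le> u \<Longrightarrow> c (l s) = 0" "v \<le> s \<Longrightarrow> c (l s) = 1" for s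
    using assms by (auto simp: c_def l_def r_def max_def min_def field_simps)
  have F01: "0 \<le> F s \<and> F s \<le> 1" if "0 \<le> s" "s \<le> 1" for s
  proof -
    have "F s = (1-s)^3 * (1 + 3 * s + 6 * s\<^sup>2)" unfolding F_def
      by (simp add: power2_eq_square power3_eq_cube algebra_simps eval_nat_numeral)
    moreover have "1 - F s = s^3 * (1 + 3*(1-s) + 6*(1-s)\<^sup>2)" unfolding F_def
      by (simp add: power2_eq_square power3_eq_cube algebra_simps eval_nat_numeral)
    ultimately show ?thesis using that
      by (smt (verit) mult_nonneg_nonneg zero_le_power zero_le_power2)
  qed
  have F'b: "\<bar>F' s\<bar> \<le> 30" "\<bar>F'' s\<bar> \<le> 60" if "0 \<le> s" "s \<le> 1" for s
  proof -
    have "s\<^sup>2 \<le> 1" "(1-s)\<^sup>2 \<le> 1" using that by (auto intro: power_le_one)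
    then have "s\<^sup>2*(1-s)\<^sup>2 \<le> 1" by (intro mult_le_one) auto
    then show "\<bar>F' s\<bar> \<le> 30" by (simp add: F'_def abs_mult)
    have "s*(1-s) \<le> 1" using that by (intro mult_le_one) auto
    then have "s*(1-s)*\<bar>1-2 * s\<bar> \<le> 1" using that by (intro mult_le_one) auto
    then show "\<bar>F'' s\<bar> \<le> 60" using that by (simp add: F''_def abs_mult)
  qed
  define k where "k = 30*r + 60*r\<^sup>2"
  show ?thesis
  proof (intro exI)
    show "cutoff u v (\<lambda>s. F (c (l s))) (\<lambda>s. F' (c (l s)) * r) (\<lambda>s. F'' (c (l s)) * r * r) k"
      unfolding cutoff_def
    proof (intro conjI allI impI)
      fix s
      show "((\<lambda>s. F (c (l s))) has_real_derivative F' (c (l s)) * r) (at s)"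
        by (rule DERIV_chain2[OF d1 dl])
      show "((\<lambda>s. F' (c (l s)) * r) has_real_derivative F'' (c (l s)) * r * r) (at s)"
        by (rule DERIV_cmult_right, rule DERIV_chain2[OF d2 dl])
      show "\<bar>F' (c (l s)) * r\<bar> \<le> k"
        using mult_right_mono[OF F'b(1)[OF c01], of r "l s"] r by (simp add: abs_mult k_def add_increasing2)
      show "\<bar>F'' (c (l s)) * r * r\<bar> \<le> k"
        using mult_right_mono[OF F'b(2)[OF c01], of "r*r" "l s"] r by (simp add: abs_mult k_def power2_eq_square add_increasing)
      show "continuous_on UNIV (\<lambda>s. F'' (c (l s)) * r * r)"
        unfolding F''_def c_def l_def by (intro continuous_intros)
      show "0 \<le> F (c (l s))" "F (c (l s)) \<le> 1" using F01[OF c01] by auto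
    qed (auto simp: cl F_def F'_def F''_def)
  qed
qed

lemma cutoff_sym:
  assumes "cutoff u v f f' f'' k" "0 \<le> u" "u < v"
  shows "\<exists>g g' g'' K. (\<forall>s. (g has_real_derivative g' s) (at s)) \<and> (\<forall>s. (g' has_real_derivative g'' s) (at s)) \<and>
     continuous_on UNIV g'' \<and> (\<forall>s. 0 \<le> g s \<and> g s \<le> 1 \<and> \<bar>g' s\<bar> \<le> K \<and> \<bar>g'' s\<bar> \<le> K) \<and>
     (\<forall>s. \<bar>s\<bar> \<le> u \<longrightarrow> g s = 1 \<and> g' s = 0 \<and> g'' s = 0) \<and> (\<forall>s. \<bar>s\<bar> \<ge> v \<longrightarrow> g s = 0 \<and> g' s = 0 \<and> g'' s = 0)"
proof (intro exI)
  note f = assms(1)[unfolded cutoff_def]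
  have k0: "0 \<le> k" using f by (meson abs_ge_zero order_trans)
  \<comment> \<open>one factor cuts off to the right, the other one to the left; they never vary at the same point\<close>
  define g where "g = (\<lambda>s. f s * f (-s))"
  define g' where "g' = (\<lambda>s. f' s * f (-s) - f s * f' (-s))"
  define g'' where "g'' = (\<lambda>s. f'' s * f (-s) - 2 * (f' s * f' (-s)) + f s * f'' (-s))"
  have mn: "((\<lambda>s. h (-s)) has_real_derivative - h' (-s)) (at s)"
    if "\<And>s. (h has_real_derivative h' s) (at s)" for h h' :: "real \<Rightarrow> real" and s
    using DERIV_chain2[OF that DERIV_minus[OF DERIV_ident], of s UNIV] by simp
  have d: "(f has_real_derivative f' s) (at s)" "(f' has_real_derivative f'' s) (at s)"
      "((\<lambda>s. f (-s)) has_real_derivative - f' (-s)) (at s)"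
      "((\<lambda>s. f' (-s)) has_real_derivative - f'' (-s)) (at s)" for s
    using f mn[of f f'] mn[of f' f''] by auto
  have c: "continuous_on UNIV f" "continuous_on UNIV f'" "continuous_on UNIV f''"
    using d(1,2) f by (auto intro!: continuous_at_imp_continuous_on DERIV_isCont)
  have cm: "continuous_on UNIV (\<lambda>s. h (-s))" if "continuous_on UNIV h" for h :: "real \<Rightarrow> real"
    by (rule continuous_on_compose2[OF that]) (auto intro!: continuous_intros)
  have ab: "\<bar>f s\<bar> \<le> 1" "\<bar>f' s\<bar> \<le> k" "\<bar>f'' s\<bar> \<le> k" for s using f by auto
  have p: "\<bar>x*y\<bar> \<le> B*C" if "\<bar>x\<bar> \<le> B" "\<bar>y\<bar> \<le> C" for x y B C :: real
    unfolding abs_mult using that by (intro mult_mono) auto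
  show "(\<forall>s. (g has_real_derivative g' s) (at s)) \<and> (\<forall>s. (g' has_real_derivative g'' s) (at s)) \<and>
     continuous_on UNIV g'' \<and> (\<forall>s. 0 \<le> g s \<and> g s \<le> 1 \<and> \<bar>g' s\<bar> \<le> 2*k+2*k*k \<and> \<bar>g'' s\<bar> \<le> 2*k+2*k*k) \<and>
     (\<forall>s. \<bar>s\<bar> \<le> u \<longrightarrow> g s = 1 \<and> g' s = 0 \<and> g'' s = 0) \<and> (\<forall>s. \<bar>s\<bar> \<ge> v \<longrightarrow> g s = 0 \<and> g' s = 0 \<and> g'' s = 0)"
  proof (intro conjI allI impI)
    fix s
    show "(g has_real_derivative g' s) (at s)" "(g' has_real_derivative g'' s) (at s)"
      unfolding g_def g'_def g''_def by (auto intro!: derivative_eq_intros d)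
    show "continuous_on UNIV g''"
      unfolding g''_def by (intro continuous_intros c cm)
    show "0 \<le> g s" "g s \<le> 1" using f by (auto simp: g_def intro!: mult_le_one)
    have kk: "0 \<le> k*k" by simp
    show "\<bar>g' s\<bar> \<le> 2*k+2*k*k"
      using p[OF ab(2)[of s] ab(1)[of "-s"]] p[OF ab(1)[of s] ab(2)[of "-s"]] kk unfolding g'_def by linarith
    show "\<bar>g'' s\<bar> \<le> 2*k+2*k*k"
      using p[OF ab(3)[of s] ab(1)[of "-s"]] p[OF ab(1)[of s] ab(3)[of "-s"]] p[OF ab(2)[of s] ab(2)[of "-s"]]
      unfolding g''_def by linarith
    { assume s: "\<bar>s\<bar> \<le> u"
      then have "f s = 1" "f (-s) = 1" "f' s = 0" "f' (-s) = 0" "f'' s = 0" "f'' (-s) = 0" using f by auto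
      then show "g s = 1" "g' s = 0" "g'' s = 0" by (auto simp: g_def g'_def g''_def) }
    { assume s: "v \<le> \<bar>s\<bar>"
      then have "s \<ge> v \<or> -s \<ge> v" "s \<ge> v \<Longrightarrow> - s \<le> u" "-s \<ge> v \<Longrightarrow> s \<le> u" using assms(2,3) by auto
      then show "g s = 0" "g' s = 0" "g'' s = 0"
        using f by (auto simp: g_def g'_def g''_def) }
  qed
qed

section \<open>Interior energy estimate\<close>

definition elliptic_solution ::
  "real \<Rightarrow> real \<Rightarrow> (real \<Rightarrow> real) \<Rightarrow> (real \<Rightarrow> real \<Rightarrow> real) \<Rightarrow> (real \<Rightarrow> real \<Rightarrow> real) \<Rightarrow> (real \<Rightarrow> real \<Rightarrow> real) \<Rightarrow>
    (real \<Rightarrow> real \<Rightarrow> real) \<Rightarrow> (real \<Rightarrow> real \<Rightarrow> real) \<Rightarrow> (real \<Rightarrow> real \<Rightarrow> real) \<Rightarrow> bool" where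
  "elliptic_solution T L a U Ut Ux Utt Uxx Uxt \<longleftrightarrow>
     cont2 T L U \<and> cont2 T L Ut \<and> cont2 T L Ux \<and> cont2 T L Utt \<and> cont2 T L Uxx \<and> cont2 T L Uxt \<and>
     (\<forall>t\<in>{-T..T}. \<forall>x\<in>{0<..<L}. ((\<lambda>x. U t x) has_real_derivative Ux t x) (at x) \<and>
        ((\<lambda>x. Ux t x) has_real_derivative Uxx t x) (at x) \<and> ((\<lambda>x. Ut t x) has_real_derivative Uxt t x) (at x)) \<and>
     (\<forall>t\<in>{-T<..<T}. \<forall>x\<in>{0..L}. ((\<lambda>t. U t x) has_real_derivative Ut t x) (at t) \<and>
        ((\<lambda>t. Ut t x) has_real_derivative Utt t x) (at t) \<and> ((\<lambda>t. Ux t x) has_real_derivative Uxt t x) (at t)) \<and>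
     (\<forall>t\<in>{-T..T}. \<forall>x\<in>{0..L}. Uxx t x + a x * (Utt t x + Ut t x) = 0)"

text \<open>
  Multiply the equation by \<open>(c z)\<^sup>2 U\<close> and integrate by parts. The condition \<open>z'\<^sup>2 \<le> K a\<close> keeps the commutator
  in \<open>x\<close> bounded by the weighted norm \<open>\<integral> a U\<^sup>2\<close>, the only norm that is available near the degenerate side.
\<close>
lemma caccioppoli:
  assumes sol: "elliptic_solution T L a U Ut Ux Utt Uxx Uxt" and T: "0 < T" and L: "0 < L"
    and a: "continuous_on {0..L} a" "\<And>x. x \<in> {0..L} \<Longrightarrow> 0 \<le> a x"
    and c: "\<And>s. (c has_real_derivative c' s) (at s)" "continuous_on UNIV c'" "\<And>s. \<bar>c s\<bar> \<le> 1" "\<And>s. (c' s)\<^sup>2 \<le> K" "c T = 0" "c (-T) = 0"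
    and z: "\<And>s. (z has_real_derivative z' s) (at s)" "continuous_on UNIV z'" "\<And>s. \<bar>z s\<bar> \<le> 1"
      "\<And>x. x \<in> {0..L} \<Longrightarrow> (z' x)\<^sup>2 \<le> K * a x" "z L = 0"
  shows "dint T L (\<lambda>t x. (c t * z x)\<^sup>2 * ((Ux t x)\<^sup>2 + a x * (Ut t x)\<^sup>2)) \<le>
     (12 * K + 2) * dint T L (\<lambda>t x. a x * (U t x)\<^sup>2) + integral {-T..T} (\<lambda>t. (U t 0)\<^sup>2 + (Ux t 0)\<^sup>2)"
proof -
  note s = sol[unfolded elliptic_solution_def]
  have cc: "continuous_on UNIV c" "continuous_on UNIV z"
    using c(1) z(1) by (auto intro!: continuous_at_imp_continuous_on DERIV_isCont)
  have cx: "continuous_on (cbox (-T,0) (T,L)) (\<lambda>q. U (fst q) (snd q))"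
     "continuous_on (cbox (-T,0) (T,L)) (\<lambda>q. Ut (fst q) (snd q))"
     "continuous_on (cbox (-T,0) (T,L)) (\<lambda>q. Ux (fst q) (snd q))"
     "continuous_on (cbox (-T,0) (T,L)) (\<lambda>q. Utt (fst q) (snd q))"
     "continuous_on (cbox (-T,0) (T,L)) (\<lambda>q. Uxx (fst q) (snd q))"
    using s by (auto simp: cont2_def)
  note cs = cx cont2_x[OF a(1)]
     cont2_t[OF continuous_on_subset[OF cc(1)], OF subset_UNIV] cont2_t[OF continuous_on_subset[OF c(2)], OF subset_UNIV]
     cont2_x[OF continuous_on_subset[OF cc(2)], OF subset_UNIV] cont2_x[OF continuous_on_subset[OF z(2)], OF subset_UNIV]
  define F where "F = (\<lambda>t x. (c t * z x)\<^sup>2 * (U t x * Ux t x))"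
  define Fx where "Fx = (\<lambda>t x. 2 * (c t * z x) * (c t * z' x) * (U t x * Ux t x) + (c t * z x)\<^sup>2 * ((Ux t x)\<^sup>2 + U t x * Uxx t x))"
  define G where "G = (\<lambda>t x. a x * ((c t * z x)\<^sup>2 * (U t x * Ut t x)))"
  define Gt where "Gt = (\<lambda>t x. a x * (2 * (c t * z x) * (c' t * z x) * (U t x * Ut t x) + (c t * z x)\<^sup>2 * ((Ut t x)\<^sup>2 + U t x * Utt t x)))"
  define E where "E = (\<lambda>t x. (c t * z x)\<^sup>2 * ((Ux t x)\<^sup>2 + a x * (Ut t x)\<^sup>2))"
  define D where "D = (\<lambda>t x. a x * (U t x)\<^sup>2)"
  have ct: "cont2 T L F" "cont2 T L Fx" "cont2 T L G" "cont2 T L Gt" "cont2 T L E" "cont2 T L D"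
    unfolding cont2_def F_def Fx_def G_def Gt_def E_def D_def by (intro continuous_intros cs)+
  have iF: "dint T L Fx = integral {-T..T} (\<lambda>t. F t L - F t 0)"
  proof (rule dint_dx[OF _ ct(1,2)])
    fix t x assume t: "t \<in> {-T..T}" and x: "x \<in> {0<..<L}"
    have d: "((\<lambda>x. U t x) has_real_derivative Ux t x) (at x)" "((\<lambda>x. Ux t x) has_real_derivative Uxx t x) (at x)"
      using s t x by auto
    show "(F t has_real_derivative Fx t x) (at x)"
      unfolding F_def Fx_def
      by (rule derivative_eq_intros d z(1) refl)+ (simp add: power2_eq_square algebra_simps)
  qed (use L in simp)
  have iG: "dint T L Gt = 0"
  proof (rule dint_dt[OF _ ct(3,4)])
    fix t x assume t: "t \<in> {-T<..<T}" and x: "x \<in> {0..L}"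
    have d: "((\<lambda>t. U t x) has_real_derivative Ut t x) (at t)" "((\<lambda>t. Ut t x) has_real_derivative Utt t x) (at t)"
      using s t x by auto
    show "((\<lambda>t. G t x) has_real_derivative Gt t x) (at t)"
      unfolding G_def Gt_def
      by (rule derivative_eq_intros d c(1) refl)+ (simp add: power2_eq_square algebra_simps)
  qed (use T c in \<open>auto simp: G_def\<close>)
  have "dint T L E \<le> dint T L (\<lambda>t x. 2 * (Fx t x + Gt t x) + (12*K+2) * D t x)"
  proof (rule dint_mono)
    show "cont2 T L (\<lambda>t x. 2 * (Fx t x + Gt t x) + (12*K+2) * D t x)"
      using ct unfolding cont2_def by (intro continuous_intros) auto
    fix t x assume t: "t \<in> {-T..T}" and x: "x \<in> {0..L}"
    have pde: "Uxx t x = - a x * (Utt t x + Ut t x)" using s t x by (auto simp: algebra_simps eq_neg_iff_add_eq_0)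
    define h where "h = c t * z x"
    define p where "p = c t * z' x"
    define q where "q = c' t * z x"
    have am: "\<bar>u\<bar> \<le> 1 \<Longrightarrow> (u * v)\<^sup>2 \<le> v\<^sup>2" for u v :: real
      by (simp add: power_mult_distrib mult_left_le_one_le abs_square_le_1)
    have p: "p\<^sup>2 \<le> K * a x" using am[OF c(3), of t "z' x"] z(4)[OF x] unfolding p_def by linarith
    have q: "q\<^sup>2 \<le> K" using am[OF z(3), of x "c' t"] c(4)[of t] unfolding q_def by (simp add: mult.commute)
    have h: "h\<^sup>2 \<le> 1" using c(3)[of t] z(3)[of x] by (simp add: h_def abs_square_le_1 abs_mult mult_le_one)
    have a0: "0 \<le> a x" using a x by auto
    have id: "Fx t x + Gt t x = E t x + 2 * h * p * (U t x * Ux t x) + a x * (2 * h * q * (U t x * Ut t x) - h\<^sup>2 * (U t x * Ut t x))"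
      unfolding Fx_def Gt_def E_def h_def p_def q_def pde by (simp add: power2_eq_square algebra_simps)
    have 1: "- (1/2) * (h * Ux t x)\<^sup>2 - 2 * (p * U t x)\<^sup>2 \<le> 2 * h * p * (U t x * Ux t x)"
    proof -
      have "0 \<le> (h * Ux t x + 2 * (p * U t x))\<^sup>2" by simp
      then show ?thesis by (simp add: power2_eq_square algebra_simps)
    qed
    have 2: "- (1/4) * (h * Ut t x)\<^sup>2 - 4 * (q * U t x)\<^sup>2 \<le> 2 * h * q * (U t x * Ut t x)"
    proof -
      have "0 \<le> (h * Ut t x + 4 * (q * U t x))\<^sup>2" by simp
      then show ?thesis by (simp add: power2_eq_square algebra_simps)
    qed
    have 3: "- (1/4) * (h * Ut t x)\<^sup>2 - (h * U t x)\<^sup>2 \<le> - (h\<^sup>2 * (U t x * Ut t x))"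
    proof -
      have "0 \<le> (h * Ut t x - 2 * (h * U t x))\<^sup>2" by simp
      then show ?thesis by (simp add: power2_eq_square algebra_simps)
    qed
    have m1: "(p * U t x)\<^sup>2 \<le> K * D t x"
      using mult_right_mono[OF p, of "(U t x)\<^sup>2"] by (simp add: D_def power_mult_distrib mult.assoc)
    have m2: "a x * (q * U t x)\<^sup>2 \<le> K * D t x"
      using mult_left_mono[OF mult_right_mono[OF q, of "(U t x)\<^sup>2"] a0] by (simp add: D_def power_mult_distrib algebra_simps)
    have m3: "a x * (h * U t x)\<^sup>2 \<le> D t x"
      using mult_left_mono[OF mult_right_mono[OF h, of "(U t x)\<^sup>2"] a0] by (simp add: D_def power_mult_distrib algebra_simps)
    have "a x * (- (1/2) * (h * Ut t x)\<^sup>2 - 4 * (q * U t x)\<^sup>2 - (h * U t x)\<^sup>2) \<le>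
       a x * (2 * h * q * (U t x * Ut t x) - h\<^sup>2 * (U t x * Ut t x))"
      using 2 3 a0 by (intro mult_left_mono) auto
    moreover have "E t x = (h * Ux t x)\<^sup>2 + a x * (h * Ut t x)\<^sup>2"
      by (simp add: E_def h_def power2_eq_square algebra_simps)
    ultimately show "E t x \<le> 2 * (Fx t x + Gt t x) + (12*K+2) * D t x"
      unfolding id using 1 m1 m2 m3 by (simp add: algebra_simps)
  qed (use ct in auto)
  also have "\<dots> = 2 * dint T L Fx + (12*K+2) * dint T L D"
    using ct iG by (simp add: dint_add dint_cmult cont2_def continuous_intros)
  also have "2 * dint T L Fx \<le> integral {-T..T} (\<lambda>t. (U t 0)\<^sup>2 + (Ux t 0)\<^sup>2)"
  proof -
    have c0: "continuous_on {-T..T} (\<lambda>t. f t 0)" if "continuous_on (cbox (-T,0) (T,L)) (\<lambda>q. f (fst q) (snd q))" for f :: "real \<Rightarrow> real \<Rightarrow> real"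
      using L by (intro continuous_on_compose2[OF that, of _ "\<lambda>t. (t,0)", simplified])
        (auto intro!: continuous_intros simp: cbox_Pair_eq)
    have "integral {-T..T} (\<lambda>t. 2 * (F t L - F t 0)) \<le> integral {-T..T} (\<lambda>t. (U t 0)\<^sup>2 + (Ux t 0)\<^sup>2)"
    proof (rule integral_le)
      fix t assume t: "t \<in> {-T..T}"
      define h where "h = c t * z 0"
      have "(\<bar>c t\<bar> * \<bar>z 0\<bar>)\<^sup>2 \<le> 1" using c(3)[of t] z(3)[of 0] by (intro power_le_one mult_le_one) auto
      then have h: "h\<^sup>2 \<le> 1" by (simp add: h_def power_mult_distrib)
      have "- (2 * (U t 0 * Ux t 0)) \<le> (U t 0)\<^sup>2 + (Ux t 0)\<^sup>2"
        using zero_le_power2[of "U t 0 + Ux t 0"] by (simp add: power2_sum)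
      then have "h\<^sup>2 * (- (2 * (U t 0 * Ux t 0))) \<le> h\<^sup>2 * ((U t 0)\<^sup>2 + (Ux t 0)\<^sup>2)" by (intro mult_left_mono) auto
      also have "\<dots> \<le> 1 * ((U t 0)\<^sup>2 + (Ux t 0)\<^sup>2)" by (rule mult_right_mono[OF h]) simp
      finally show "2 * (F t L - F t 0) \<le> (U t 0)\<^sup>2 + (Ux t 0)\<^sup>2"
        by (simp add: F_def z(5) h_def[symmetric])
    qed (intro integrable_continuous_interval continuous_intros c0 cs ct(1)[unfolded cont2_def];
         use L ct(1) in \<open>auto simp: F_def z(5) intro!: continuous_intros c0 cs continuous_on_subset[OF cc(1)]\<close>)+
    then show ?thesis unfolding iF by (simp only: integral_mult_right)
  qed
  finally show ?thesis by (simp add: E_def D_def)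
qed

section \<open>The weighted estimate for cut-off solutions\<close>

lemma dint_mono_domain:
  assumes "cont2 T L f" "T' \<le> T" "L' \<le> L"
    and "\<And>t x. t \<in> {-T..T} \<Longrightarrow> x \<in> {0..L} \<Longrightarrow> 0 \<le> f t x"
  shows "dint T' L' f \<le> dint T L f"
proof -
  have sub: "cbox (-T',0) (T',L') \<subseteq> cbox (-T,0) (T,L)"
    using assms(2,3) by (auto simp: cbox_Pair_eq)
  show ?thesis
    unfolding dint_def
  proof (rule integral_subset_le[OF sub])
    show "(\<lambda>q. f (fst q) (snd q)) integrable_on cbox (-T,0) (T,L)" by (rule dint_integrable[OF assms(1)])
    show "(\<lambda>q. f (fst q) (snd q)) integrable_on cbox (-T',0) (T',L')"
      by (rule integrable_on_subcbox[OF dint_integrable[OF assms(1)] sub])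
  qed (use assms(4) mem_rect in blast)
qed

text \<open>Passes from space-time integrals to the slice \<open>t = 0\<close>: \<open>U(0)\<^sup>2\<close> is the integral of \<open>- d/dt ((1-t) U\<^sup>2)\<close> over \<open>[0,1]\<close>.\<close>
lemma slice_bound:
  assumes cu: "cont2 T L U" "cont2 T L Ut" and T: "1 < T" and L: "0 < L'" "L' \<le> L"
    and d: "\<And>t x. t \<in> {-T<..<T} \<Longrightarrow> x \<in> {0..L} \<Longrightarrow> ((\<lambda>t. U t x) has_real_derivative Ut t x) (at t)"
    and a: "continuous_on {0..L} a" "\<And>x. x \<in> {0..L} \<Longrightarrow> 0 \<le> a x"
    and Q: "cont2 T L Q" "\<And>t x. t \<in> {-T..T} \<Longrightarrow> x \<in> {0..L} \<Longrightarrow> 0 \<le> Q t x"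
      "\<And>t x. t \<in> {0..1} \<Longrightarrow> x \<in> {0..L'} \<Longrightarrow> k * (a x * (2 * (U t x)\<^sup>2 + (Ut t x)\<^sup>2)) \<le> Q t x"
    and k: "0 \<le> k"
  shows "k * integral {0..L'} (\<lambda>x. a x * (U 0 x)\<^sup>2) \<le> dint T L Q"
proof -
  have sl: "continuous_on {u..v} (\<lambda>t. f t x)" if "cont2 T L f" "x \<in> {0..L}" "-T \<le> u" "v \<le> T" for f x u v
    using that by (intro continuous_on_compose2[OF that(1)[unfolded cont2_def], of _ "\<lambda>t. (t,x)", simplified])
      (auto intro!: continuous_intros simp: cbox_Pair_eq)
  have slx: "continuous_on {0..L'} (\<lambda>x. f 0 x)" if "cont2 T L f" for f
    using T L by (intro continuous_on_compose2[OF that(1)[unfolded cont2_def], of _ "\<lambda>x. (0,x)", simplified])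
      (auto intro!: continuous_intros simp: cbox_Pair_eq)
  have pt: "k * (a x * (U 0 x)\<^sup>2) \<le> integral {-T..T} (\<lambda>t. Q t x)" if x: "x \<in> {0..L'}" for x
  proof -
    have xL: "x \<in> {0..L}" using x L by auto
    define g where "g = (\<lambda>t. k * a x * ((U t x)\<^sup>2 - 2 * (1-t) * U t x * Ut t x))"
    have "(g has_integral (- (k * a x * (1-1) * (U 1 x)\<^sup>2) - (- (k * a x * (1-0) * (U 0 x)\<^sup>2)))) {0..1}"
    proof (rule fundamental_theorem_of_calculus_interior)
      show "continuous_on {0..1} (\<lambda>t. - (k * a x * (1-t) * (U t x)\<^sup>2))"
        using T by (intro continuous_intros sl cu xL) auto
      fix t :: real assume "t \<in> {0<..<1}"
      then have "((\<lambda>t. U t x) has_real_derivative Ut t x) (at t)" using d[of t x] T xL by auto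
      then show "((\<lambda>t. - (k * a x * (1-t) * (U t x)\<^sup>2)) has_vector_derivative g t) (at t)"
        unfolding has_real_derivative_iff_has_vector_derivative[symmetric] g_def
        by (auto intro!: derivative_eq_intros simp: power2_eq_square algebra_simps)
    qed simp
    then have "k * (a x * (U 0 x)\<^sup>2) = integral {0..1} g" by (simp add: integral_unique)
    also have "\<dots> \<le> integral {0..1} (\<lambda>t. Q t x)"
    proof (rule integral_le)
      show "g integrable_on {0..1}" using \<open>(g has_integral _) _\<close> by blast
      show "(\<lambda>t. Q t x) integrable_on {0..1}"
        using T by (intro integrable_continuous_interval sl Q xL) auto
      fix t :: real assume t: "t \<in> {0..1}"
      have "- (2 * (1-t) * U t x * Ut t x) \<le> (1-t)\<^sup>2 * (U t x)\<^sup>2 + (Ut t x)\<^sup>2"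
        using zero_le_power2[of "(1-t) * U t x + Ut t x"] by (simp add: power2_eq_square algebra_simps)
      moreover have "(1-t)\<^sup>2 * (U t x)\<^sup>2 \<le> 1 * (U t x)\<^sup>2" using t by (intro mult_right_mono power_le_one) auto
      ultimately have "(U t x)\<^sup>2 - 2 * (1-t) * U t x * Ut t x \<le> 2 * (U t x)\<^sup>2 + (Ut t x)\<^sup>2" by linarith
      then have "g t \<le> k * (a x * (2 * (U t x)\<^sup>2 + (Ut t x)\<^sup>2))"
        unfolding g_def mult.assoc[of k] using k a(2)[OF xL] by (intro mult_left_mono)
      also have "\<dots> \<le> Q t x" by (rule Q(3)[OF t x])
      finally show "g t \<le> Q t x" .
    qed
    also have "\<dots> \<le> integral {-T..T} (\<lambda>t. Q t x)"
      using T xL by (intro integral_subset_le integrable_continuous_interval sl Q(1)) (auto intro!: Q(2))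
    finally show ?thesis .
  qed
  have ci: "continuous_on {0..L} (\<lambda>x. integral {-T..T} (\<lambda>t. Q t x))"
  proof -
    have "continuous_on (cbox 0 L) (\<lambda>x. integral (cbox (-T) T) (\<lambda>t. Q t x))"
    proof (rule integral_continuous_on_param)
      show "continuous_on (cbox 0 L \<times> cbox (-T) T) (\<lambda>(x,t). Q t x)"
        unfolding case_prod_unfold
        by (intro continuous_on_compose2[OF Q(1)[unfolded cont2_def], of _ "\<lambda>q. (snd q, fst q)", simplified])
          (auto intro!: continuous_intros simp: cbox_Pair_eq)
    qed
    then show ?thesis by simp
  qed
  have "k * integral {0..L'} (\<lambda>x. a x * (U 0 x)\<^sup>2) = integral {0..L'} (\<lambda>x. k * (a x * (U 0 x)\<^sup>2))" by simp
  also have "\<dots> \<le> integral {0..L'} (\<lambda>x. integral {-T..T} (\<lambda>t. Q t x))"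
    using L by (intro integral_le integrable_continuous_interval continuous_intros slx cu pt
        continuous_on_subset[OF a(1)] continuous_on_subset[OF ci]) auto
  also have "\<dots> \<le> integral {0..L} (\<lambda>x. integral {-T..T} (\<lambda>t. Q t x))"
    using L T by (intro integral_subset_le integrable_continuous_interval continuous_on_subset[OF ci])
      (auto intro!: integral_nonneg integrable_continuous_interval sl Q(1) Q(2))
  also have "\<dots> = dint T L Q" using dint_iterated(2)[OF Q(1)] by simp
  finally show ?thesis .
qed

text \<open>
  The Carleman estimate for \<open>e\<^sup>\<tau>\<^sup>\<rho> \<kappa>(t) \<zeta>(x) U\<close>. Below, \<open>m\<close> is a lower bound for \<open>\<rho>\<close> where the conclusion is wanted, and
  \<open>m'\<close> an upper bound where a derivative of a cutoff is nonzero. On that set the commutator is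
  dominated by the density \<open>H\<close>, because \<open>\<zeta>'\<close> lives where \<open>a\<close> is bounded below and \<open>\<kappa>'\<close> is accompanied by
  a factor \<open>a\<close>.
\<close>
lemma sideways_carleman:
  fixes U Ut Ux Utt Uxx Uxt :: "real \<Rightarrow> real \<Rightarrow> real" and a a' :: "real \<Rightarrow> real"
  assumes sol: "elliptic_solution T L a U Ut Ux Utt Uxx Uxt"
    and x: "0 < x1" "x1 < x2" "x2 < x3" "x3 < L" and T: "4 < T"
    and a_cont: "continuous_on {0..L} a" "continuous_on {0..L} a'"
    and a_deriv: "\<And>x. x \<in> {0<..<L} \<Longrightarrow> (a has_real_derivative a' x) (at x)"
    and a0: "a 0 = 0"
    and a: "\<And>x. x \<in> {0..L} \<Longrightarrow> 0 \<le> a x \<and> a x \<le> 1/4 \<and> (a' x)\<^sup>2 \<le> a x/4"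
    and a3: "\<And>x. x \<in> {0..x3} \<Longrightarrow> - a x/4 \<le> a' x * (B - x)"
    and B: "1 + L \<le> B" and \<beta>: "0 < \<beta>" "\<beta> \<le> 1/4" "2*\<beta>*T \<le> 1/2" and \<tau>: "16 \<le> \<tau>"
    and \<zeta>: "cutoff x2 x3 \<zeta> \<zeta>' \<zeta>'' kz" and \<zeta>K: "\<And>x. x \<in> {0..L} \<Longrightarrow> (\<zeta>' x)\<^sup>2 \<le> K * a x \<and> (\<zeta>'' x)\<^sup>2 \<le> K * a x"
    and \<kappa>: "\<And>s. (\<kappa> has_real_derivative \<kappa>' s) (at s)" "\<And>s. (\<kappa>' has_real_derivative \<kappa>'' s) (at s)"
      "continuous_on UNIV \<kappa>''" "\<And>s. 0 \<le> \<kappa> s \<and> \<kappa> s \<le> 1 \<and> (\<kappa>' s)\<^sup>2 \<le> K \<and> (\<kappa>'' s)\<^sup>2 \<le> K"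
      "\<And>s. \<bar>s\<bar> \<le> T - 2 \<Longrightarrow> \<kappa> s = 1 \<and> \<kappa>' s = 0 \<and> \<kappa>'' s = 0"
      "\<And>s. \<bar>s\<bar> \<ge> T - 1 \<Longrightarrow> \<kappa> s = 0 \<and> \<kappa>' s = 0 \<and> \<kappa>'' s = 0"
    and m: "\<And>t x. t \<in> {0..1} \<Longrightarrow> x \<in> {0..x1} \<Longrightarrow> m \<le> - (B*x - x\<^sup>2/2) - \<beta>*t\<^sup>2"
    and m': "\<And>t x. t \<in> {-T..T} \<Longrightarrow> x \<in> {0..x3} \<Longrightarrow> x2 \<le> x \<or> T - 2 \<le> \<bar>t\<bar> \<Longrightarrow> - (B*x - x\<^sup>2/2) - \<beta>*t\<^sup>2 \<le> m'"
    and H: "cont2 T x3 H" "\<And>t x. t \<in> {-T..T} \<Longrightarrow> x \<in> {0..x3} \<Longrightarrow> 0 \<le> H t x"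
       "\<And>t x. t \<in> {-T..T} \<Longrightarrow> x \<in> {0..x3} \<Longrightarrow> \<bar>t\<bar> \<le> T - 1 \<Longrightarrow> a x * (U t x)\<^sup>2 + (Ux t x)\<^sup>2 + a x * (Ut t x)\<^sup>2 \<le> H t x"
  shows "exp (2*\<tau>*m) * integral {0..x1} (\<lambda>x. a x * (U 0 x)\<^sup>2)
     \<le> 216 * (1 + K) * exp (2*\<tau>*m') * dint T x3 H
       + 48 * B^3 * \<tau>\<^sup>2 * integral {-T..T} (\<lambda>t. (U t 0)\<^sup>2 + (Ux t 0)\<^sup>2)"
proof -
  note s = sol[unfolded elliptic_solution_def]
  note z = \<zeta>[unfolded cutoff_def]
  define R where "R = cbox (-T,0::real) (T,x3)"
  have T0: "0 < T" and x30: "0 < x3" and K0: "0 \<le> K" using T x \<kappa>(4)[of 0] by (auto intro: order_trans[OF zero_le_power2])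
  have RL: "R \<subseteq> cbox (-T,0) (T,L)" unfolding R_def using x by (auto simp: cbox_Pair_eq)
  have cx: "continuous_on R (\<lambda>q. U (fst q) (snd q))"
     "continuous_on R (\<lambda>q. Ut (fst q) (snd q))"
     "continuous_on R (\<lambda>q. Ux (fst q) (snd q))"
     "continuous_on R (\<lambda>q. Utt (fst q) (snd q))"
     "continuous_on R (\<lambda>q. Uxx (fst q) (snd q))"
     "continuous_on R (\<lambda>q. Uxt (fst q) (snd q))"
    using s RL by (auto simp: cont2_def intro: continuous_on_subset)
  have zc: "continuous_on UNIV \<zeta>" "continuous_on UNIV \<zeta>'" "continuous_on UNIV \<zeta>''" "continuous_on UNIV \<kappa>" "continuous_on UNIV \<kappa>'"
    using z \<kappa>(1,2) by (auto intro!: continuous_at_imp_continuous_on DERIV_isCont)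
  have ac3: "continuous_on {0..x3} a" "continuous_on {0..x3} a'"
    using a_cont x by (auto intro: continuous_on_subset)
  have ctt: "continuous_on R (\<lambda>q. h (fst q))" if "continuous_on UNIV h" for h :: "real \<Rightarrow> real"
    unfolding R_def by (rule cont2_t[OF continuous_on_subset[OF that subset_UNIV]])
  have cxx: "continuous_on R (\<lambda>q. h (snd q))" if "continuous_on UNIV h" for h :: "real \<Rightarrow> real"
    unfolding R_def by (rule cont2_x[OF continuous_on_subset[OF that subset_UNIV]])
  note cs = cx cxx[OF zc(1)] cxx[OF zc(2)] cxx[OF zc(3)] ctt[OF zc(4)] ctt[OF zc(5)] ctt[OF \<kappa>(3)]
    cont2_x[OF ac3(1), of T, folded R_def]
  define E where "E = (\<lambda>t x. exp (\<tau> * (- (B*x - x\<^sup>2/2) - \<beta>*t\<^sup>2)))"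
  have Ex: "((\<lambda>x. E t x) has_real_derivative \<tau>*(x-B)*E t x) (at x)" for t x
    unfolding E_def by (rule derivative_eq_intros refl | simp add: algebra_simps)+
  have Et: "((\<lambda>t. E t x) has_real_derivative \<tau>*(-2*\<beta>*t)*E t x) (at t)" for t x
    unfolding E_def by (rule derivative_eq_intros refl | simp)+
  have cE: "continuous_on R (\<lambda>q. E (fst q) (snd q))"
    unfolding E_def by (intro continuous_intros) auto
  define u where "u = (\<lambda>t x. \<kappa> t * \<zeta> x * U t x)"
  define ux where "ux = (\<lambda>t x. \<kappa> t * (\<zeta>' x * U t x + \<zeta> x * Ux t x))"
  define uxx where "uxx = (\<lambda>t x. \<kappa> t * (\<zeta>'' x * U t x + 2 * \<zeta>' x * Ux t x + \<zeta> x * Uxx t x))"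
  define ut where "ut = (\<lambda>t x. \<zeta> x * (\<kappa>' t * U t x + \<kappa> t * Ut t x))"
  define utt where "utt = (\<lambda>t x. \<zeta> x * (\<kappa>'' t * U t x + 2 * \<kappa>' t * Ut t x + \<kappa> t * Utt t x))"
  define uxt where "uxt = (\<lambda>t x. \<kappa>' t * (\<zeta>' x * U t x + \<zeta> x * Ux t x) + \<kappa> t * (\<zeta>' x * Ut t x + \<zeta> x * Uxt t x))"
  define y where "y = (\<lambda>t x. E t x * u t x)"
  define yx where "yx = (\<lambda>t x. E t x * (ux t x + \<tau>*(x-B)*u t x))"
  define yxx where "yxx = (\<lambda>t x. E t x * (uxx t x + 2*\<tau>*(x-B)*ux t x + (\<tau> + \<tau>\<^sup>2*(x-B)\<^sup>2)*u t x))"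
  define yt where "yt = (\<lambda>t x. E t x * (ut t x + \<tau>*(-2*\<beta>*t)*u t x))"
  define ytt where "ytt = (\<lambda>t x. E t x * (utt t x + 2*\<tau>*(-2*\<beta>*t)*ut t x + (- 2*\<tau>*\<beta> + \<tau>\<^sup>2*(-2*\<beta>*t)\<^sup>2)*u t x))"
  define yxt where "yxt = (\<lambda>t x. E t x * (uxt t x + \<tau>*(x-B)*ut t x + \<tau>*(-2*\<beta>*t)*(ux t x + \<tau>*(x-B)*u t x)))"
  define f where "f = (\<lambda>t x. uxx t x + a x * utt t x + a x * ut t x)"
  have cu: "continuous_on R (\<lambda>q. u (fst q) (snd q))" "continuous_on R (\<lambda>q. ux (fst q) (snd q))" "continuous_on R (\<lambda>q. uxx (fst q) (snd q))"
     "continuous_on R (\<lambda>q. ut (fst q) (snd q))" "continuous_on R (\<lambda>q. utt (fst q) (snd q))" "continuous_on R (\<lambda>q. uxt (fst q) (snd q))"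
    unfolding u_def ux_def uxx_def ut_def utt_def uxt_def by (intro continuous_intros cs)+
  have cy: "cont2 T x3 y" "cont2 T x3 yt" "cont2 T x3 yx" "cont2 T x3 ytt" "cont2 T x3 yxx" "cont2 T x3 yxt"
    unfolding cont2_def R_def[symmetric] y_def yx_def yxx_def yt_def ytt_def yxt_def by (intro continuous_intros cu cE)+
  have dz: "(\<zeta> has_real_derivative \<zeta>' s) (at s)" "(\<zeta>' has_real_derivative \<zeta>'' s) (at s)" for s using z by auto
  have sz: "s \<le> x2 \<Longrightarrow> \<zeta> s = 1 \<and> \<zeta>' s = 0 \<and> \<zeta>'' s = 0" "x3 \<le> s \<Longrightarrow> \<zeta> s = 0 \<and> \<zeta>' s = 0 \<and> \<zeta>'' s = 0" for s using z by auto
  have z1: "\<bar>\<zeta> s\<bar> \<le> 1" "\<bar>\<kappa> s\<bar> \<le> 1" for s using z \<kappa>(4)[of s] by auto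
  have carl: "dint T x3 (\<lambda>t x. a x/4*(yt t x)\<^sup>2 + \<tau>\<^sup>2/4*(y t x)\<^sup>2)
     \<le> (1/\<tau>) * dint T x3 (\<lambda>t x. (yxx t x - 2*\<tau>*(x-B)*yx t x - \<tau>*y t x + \<tau>\<^sup>2*(x-B)\<^sup>2*y t x
      + a x*(ytt t x - 2*\<tau>*(-2*\<beta>*t)*yt t x + 2*\<tau>*\<beta>*y t x + \<tau>\<^sup>2*(-2*\<beta>*t)\<^sup>2*y t x)
      + a x*(yt t x - \<tau>*(-2*\<beta>*t)*y t x))\<^sup>2)
       + integral {-T..T} (\<lambda>t. B*(yx t 0)\<^sup>2 - 2*y t 0*yx t 0 + \<tau>\<^sup>2*B^3*(y t 0)\<^sup>2)"
  proof (rule carleman_estimate[where yxt = yxt, OF T0 x30 cy _ _ _ _ _ _ _ _ _ _ _ _ _ _ _ ac3 _ a0 _ _ \<beta> \<tau>])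
    fix t x assume t: "t \<in> {-T..T}" and xx: "x \<in> {0<..<x3}"
    then have xL: "x \<in> {0<..<L}" using x by auto
    have d: "((\<lambda>x. U t x) has_real_derivative Ux t x) (at x)" "((\<lambda>x. Ux t x) has_real_derivative Uxx t x) (at x)"
       "((\<lambda>x. Ut t x) has_real_derivative Uxt t x) (at x)" using s t xL by auto
    have d2: "((\<lambda>x. u t x) has_real_derivative ux t x) (at x)" "((\<lambda>x. ux t x) has_real_derivative uxx t x) (at x)"
       "((\<lambda>x. ut t x) has_real_derivative uxt t x) (at x)"
      unfolding u_def ux_def uxx_def ut_def uxt_def
      by (rule derivative_eq_intros d dz refl | simp add: algebra_simps)+
    show "((\<lambda>x. y t x) has_real_derivative yx t x) (at x)" "((\<lambda>x. yx t x) has_real_derivative yxx t x) (at x)"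
       "((\<lambda>x. yt t x) has_real_derivative yxt t x) (at x)"
      unfolding y_def yx_def yxx_def yt_def yxt_def
      by ((rule derivative_eq_intros d2 Ex refl)+, simp add: algebra_simps power2_eq_square)+
  next
    fix t x assume t: "t \<in> {-T<..<T}" and xx: "x \<in> {0..x3}"
    then have xL: "x \<in> {0..L}" using x by auto
    have d: "((\<lambda>t. U t x) has_real_derivative Ut t x) (at t)" "((\<lambda>t. Ut t x) has_real_derivative Utt t x) (at t)"
       "((\<lambda>t. Ux t x) has_real_derivative Uxt t x) (at t)" using s t xL by auto
    have d2: "((\<lambda>t. u t x) has_real_derivative ut t x) (at t)" "((\<lambda>t. ut t x) has_real_derivative utt t x) (at t)"
       "((\<lambda>t. ux t x) has_real_derivative uxt t x) (at t)"
      unfolding u_def ux_def ut_def utt_def uxt_def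
      by (rule derivative_eq_intros d \<kappa>(1,2) refl | simp add: algebra_simps)+
    show "((\<lambda>t. y t x) has_real_derivative yt t x) (at t)" "((\<lambda>t. yt t x) has_real_derivative ytt t x) (at t)"
       "((\<lambda>t. yx t x) has_real_derivative yxt t x) (at t)"
      unfolding y_def yx_def ytt_def yt_def yxt_def
      by ((rule derivative_eq_intros d2 Et refl)+, simp add: algebra_simps power2_eq_square)+
  next
    have "\<kappa> T = 0" "\<kappa>' T = 0" "\<kappa> (-T) = 0" "\<kappa>' (-T) = 0" using \<kappa>(6)[of T] \<kappa>(6)[of "-T"] T by auto
    then show "y T x = 0" "yt T x = 0" "yx T x = 0" "y (-T) x = 0" "yt (-T) x = 0" "yx (-T) x = 0" for x
      by (simp_all add: y_def yt_def yx_def u_def ut_def ux_def)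
  next
    show "y t x3 = 0" "yt t x3 = 0" "yx t x3 = 0" for t
      using sz(2)[of x3] by (simp_all add: y_def yt_def yx_def u_def ut_def ux_def)
  next
    fix x assume "x \<in> {0<..<x3}" then show "(a has_real_derivative a' x) (at x)" using x a_deriv by auto
  next
    fix x assume "x \<in> {0..x3}"
    then show "0 \<le> a x \<and> a x \<le> 1/4 \<and> (a' x)\<^sup>2 \<le> a x/4 \<and> - a x/4 \<le> a' x * (B - x)" using a[of x] a3[of x] x by auto
  next
    show "1 + x3 \<le> B" using B x by simp
  qed
  define P where "P = (\<lambda>t x. (E t x * f t x)\<^sup>2)"
  have Peq: "(\<lambda>t x. (yxx t x - 2*\<tau>*(x-B)*yx t x - \<tau>*y t x + \<tau>\<^sup>2*(x-B)\<^sup>2*y t x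
      + a x*(ytt t x - 2*\<tau>*(-2*\<beta>*t)*yt t x + 2*\<tau>*\<beta>*y t x + \<tau>\<^sup>2*(-2*\<beta>*t)\<^sup>2*y t x)
      + a x*(yt t x - \<tau>*(-2*\<beta>*t)*y t x))\<^sup>2) = P"
    unfolding P_def fun_eq_iff f_def y_def yx_def yxx_def yt_def ytt_def
    by (intro allI arg_cong[where f="\<lambda>v. v\<^sup>2"]) (simp add: algebra_simps power2_eq_square)
  have cP: "cont2 T x3 P"
    unfolding cont2_def R_def[symmetric] P_def f_def by (intro continuous_intros cs cu cE)
  have cH: "cont2 T x3 (\<lambda>t x. 27 * (1 + K) * exp (2*\<tau>*m') * H t x)"
    using H(1) unfolding cont2_def by (intro continuous_intros)
  have "dint T x3 P \<le> dint T x3 (\<lambda>t x. 27 * (1 + K) * exp (2*\<tau>*m') * H t x)"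
  proof (rule dint_mono[OF cP cH])
    fix t x assume t: "t \<in> {-T..T}" and xx: "x \<in> {0..x3}"
    then have xL: "x \<in> {0..L}" using x by auto
    have a01: "0 \<le> a x" "a x \<le> 1/4" using a[OF xL] by auto
    have pde: "Uxx t x = - a x * (Utt t x + Ut t x)" using s t xL by (auto simp: algebra_simps eq_neg_iff_add_eq_0)
    \<comment> \<open>the equation cancels all terms in which no cutoff is differentiated\<close>
    have fe: "f t x = (\<kappa> t * \<zeta>'' x + a x * (\<zeta> x * \<kappa>'' t) + a x * (\<zeta> x * \<kappa>' t)) * U t x + 2 * (\<kappa> t * \<zeta>' x) * Ux t x + 2 * a x * (\<zeta> x * \<kappa>' t) * Ut t x"
      unfolding f_def uxx_def utt_def ut_def pde by (simp add: algebra_simps)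
    show "P t x \<le> 27 * (1 + K) * exp (2*\<tau>*m') * H t x"
    proof (cases "\<bar>t\<bar> \<le> T - 1 \<and> (x2 \<le> x \<or> T - 2 \<le> \<bar>t\<bar>)")
      case False
      then have "\<kappa> t = 0 \<and> \<kappa>' t = 0 \<and> \<kappa>'' t = 0 \<or> (\<zeta>' x = 0 \<and> \<zeta>'' x = 0 \<and> \<kappa>' t = 0 \<and> \<kappa>'' t = 0)"
        using \<kappa>(5)[of t] \<kappa>(6)[of t] sz(1)[of x] by auto
      then have "P t x = 0" by (auto simp: P_def fe)
      then show ?thesis using H(2)[OF t xx] K0 by simp
    next
      case True
      have e: "(E t x)\<^sup>2 \<le> exp (2*\<tau>*m')"
      proof -
        have "(E t x)\<^sup>2 = exp (2*(\<tau> * (- (B*x - x\<^sup>2/2) - \<beta>*t\<^sup>2)))" by (simp add: E_def exp_double)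
        also have "\<dots> \<le> exp (2*(\<tau>*m'))" using m'[OF t xx] True \<tau> by (simp add: mult_left_mono)
        finally show ?thesis by (simp add: mult.assoc)
      qed
      have am: "\<bar>v\<bar> \<le> 1 \<Longrightarrow> w\<^sup>2 \<le> c \<Longrightarrow> (v * w)\<^sup>2 \<le> c" for v w c :: real
        using mult_left_le_one_le[of "w\<^sup>2" "v\<^sup>2"] by (simp add: power_mult_distrib abs_square_le_1)
      have b1: "(\<kappa> t * \<zeta>'' x)\<^sup>2 \<le> K * a x" "(\<kappa> t * \<zeta>' x)\<^sup>2 \<le> K * a x" "(\<zeta> x * \<kappa>'' t)\<^sup>2 \<le> K" "(\<zeta> x * \<kappa>' t)\<^sup>2 \<le> K"
        using \<zeta>K[OF xL] \<kappa>(4)[of t] z1 by (auto intro!: am)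
      have Ka: "K * a x \<le> K" "(a x)\<^sup>2 \<le> a x" using K0 a01 by (auto simp: power2_eq_square intro: mult_left_le mult_left_le_one_le)
      have aK: "(a x * v)\<^sup>2 \<le> K * a x" if "v\<^sup>2 \<le> K" for v
        using mult_mono[OF Ka(2) that] a01 by (simp add: power_mult_distrib mult.commute)
      have sq3: "(p + q + r)\<^sup>2 \<le> 3 * (p\<^sup>2 + q\<^sup>2 + r\<^sup>2)" for p q r :: real
        using zero_le_power2[of "p-q"] zero_le_power2[of "p-r"] zero_le_power2[of "q-r"] by (simp add: power2_eq_square algebra_simps)
      have cU: "(\<kappa> t * \<zeta>'' x + a x * (\<zeta> x * \<kappa>'' t) + a x * (\<zeta> x * \<kappa>' t))\<^sup>2 \<le> 9 * (K * a x)"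
      proof (rule order_trans[OF sq3])
        have "3 * ((\<kappa> t * \<zeta>'' x)\<^sup>2 + (a x * (\<zeta> x * \<kappa>'' t))\<^sup>2 + (a x * (\<zeta> x * \<kappa>' t))\<^sup>2)
            \<le> 3 * (K * a x + K * a x + K * a x)"
          by (intro mult_left_mono add_mono b1 aK) auto
        then show "3 * ((\<kappa> t * \<zeta>'' x)\<^sup>2 + (a x * (\<zeta> x * \<kappa>'' t))\<^sup>2 + (a x * (\<zeta> x * \<kappa>' t))\<^sup>2) \<le> 9 * (K * a x)"
          by simp
      qed
      have t1: "((\<kappa> t * \<zeta>'' x + a x * (\<zeta> x * \<kappa>'' t) + a x * (\<zeta> x * \<kappa>' t)) * U t x)\<^sup>2 \<le> 9 * (K * a x) * (U t x)\<^sup>2"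
        using mult_right_mono[OF cU, of "(U t x)\<^sup>2"] by (simp add: power_mult_distrib)
      have t2: "(2 * (\<kappa> t * \<zeta>' x) * Ux t x)\<^sup>2 \<le> 4 * K * (Ux t x)\<^sup>2"
      proof -
        have "(\<kappa> t * \<zeta>' x)\<^sup>2 \<le> K" using b1(2) Ka(1) by linarith
        then have "(\<kappa> t * \<zeta>' x)\<^sup>2 * (Ux t x)\<^sup>2 \<le> K * (Ux t x)\<^sup>2" by (rule mult_right_mono) simp
        then show ?thesis by (simp add: power_mult_distrib)
      qed
      have t3: "(2 * a x * (\<zeta> x * \<kappa>' t) * Ut t x)\<^sup>2 \<le> 4 * (K * a x) * (Ut t x)\<^sup>2"
        using mult_right_mono[OF aK[OF b1(4)], of "(Ut t x)\<^sup>2"] by (simp add: power_mult_distrib)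
      have "(f t x)\<^sup>2 \<le> 3 * (9 * (K * a x) * (U t x)\<^sup>2 + 4 * K * (Ux t x)\<^sup>2 + 4 * (K * a x) * (Ut t x)\<^sup>2)"
        unfolding fe by (rule order_trans[OF sq3], intro mult_left_mono add_mono t1 t2 t3) simp
      also have "\<dots> \<le> 27 * K * (a x * (U t x)\<^sup>2 + (Ux t x)\<^sup>2 + a x * (Ut t x)\<^sup>2)"
        using K0 a01 by (simp add: algebra_simps)
      also have "\<dots> \<le> 27 * K * H t x" using K0 H(3)[OF t xx] True by (intro mult_left_mono) auto
      finally have ff: "(f t x)\<^sup>2 \<le> 27 * K * H t x" .
      have "P t x = (E t x)\<^sup>2 * (f t x)\<^sup>2" by (simp add: P_def power_mult_distrib)
      also have "\<dots> \<le> exp (2*\<tau>*m') * (27 * K * H t x)" using e ff by (intro mult_mono) auto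
      also have "\<dots> \<le> 27 * (1 + K) * exp (2*\<tau>*m') * H t x"
        using H(2)[OF t xx] by (simp add: algebra_simps)
      finally show ?thesis .
    qed
  qed
  also have "\<dots> = 27 * (1 + K) * exp (2*\<tau>*m') * dint T x3 H" by (rule dint_cmult)
  finally have Pb: "dint T x3 P \<le> 27 * (1 + K) * exp (2*\<tau>*m') * dint T x3 H" .
  have Hn: "0 \<le> 27 * (1 + K) * exp (2*\<tau>*m') * dint T x3 H" using dint_nonneg[OF H(1,2)] K0 by simp
  have "(1/\<tau>) * dint T x3 P \<le> (1/\<tau>) * (27 * (1 + K) * exp (2*\<tau>*m') * dint T x3 H)"
    using Pb \<tau> by (intro mult_left_mono) auto
  also have "\<dots> \<le> 1 * (27 * (1 + K) * exp (2*\<tau>*m') * dint T x3 H)"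
    using Hn \<tau> by (intro mult_right_mono) auto
  finally have Pb2: "(1/\<tau>) * dint T x3 P \<le> 27 * (1 + K) * exp (2*\<tau>*m') * dint T x3 H" by simp
  have at0: "continuous_on {-T..T} (\<lambda>t. f t 0)" if "cont2 T x3 f" for f :: "real \<Rightarrow> real \<Rightarrow> real"
    using x30 by (intro continuous_on_compose2[OF that[unfolded cont2_def], of _ "\<lambda>t. (t,0)", simplified])
      (auto intro!: continuous_intros simp: cbox_Pair_eq)
  have cU3: "cont2 T x3 U" "cont2 T x3 Ux" "cont2 T x3 Ut" using cx unfolding cont2_def R_def by auto
  have Bd: "integral {-T..T} (\<lambda>t. B*(yx t 0)\<^sup>2 - 2*y t 0*yx t 0 + \<tau>\<^sup>2*B^3*(y t 0)\<^sup>2)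
     \<le> integral {-T..T} (\<lambda>t. 6*B^3*\<tau>\<^sup>2 * ((U t 0)\<^sup>2 + (Ux t 0)\<^sup>2))"
  proof (rule integral_le)
    show "(\<lambda>t. B*(yx t 0)\<^sup>2 - 2*y t 0*yx t 0 + \<tau>\<^sup>2*B^3*(y t 0)\<^sup>2) integrable_on {-T..T}"
      "(\<lambda>t. 6*B^3*\<tau>\<^sup>2 * ((U t 0)\<^sup>2 + (Ux t 0)\<^sup>2)) integrable_on {-T..T}"
      by (intro integrable_continuous_interval continuous_intros at0 cy cU3)+
    fix t assume t: "t \<in> {-T..T}"
    define e where "e = E t 0 * \<kappa> t"
    have "E t 0 \<le> 1" "0 \<le> E t 0" using \<tau> \<beta> by (auto simp: E_def)
    then have e1: "0 \<le> e" "e \<le> 1" using \<kappa>(4)[of t] by (auto simp: e_def intro!: mult_le_one)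
    then have e2: "e\<^sup>2 \<le> 1" by (simp add: power_le_one)
    define v where "v = - (\<tau>*B*U t 0) + Ux t 0"
    have yy: "y t 0 = e * U t 0" "yx t 0 = e * v"
      using sz(1)[of 0] x by (simp_all add: y_def yx_def u_def ux_def e_def v_def algebra_simps)
    have B1: "1 \<le> B" using B x by simp
    have v2: "v\<^sup>2 \<le> 2*(\<tau>\<^sup>2*B\<^sup>2*(U t 0)\<^sup>2) + 2*(Ux t 0)\<^sup>2"
      using zero_le_power2[of "\<tau>*B*U t 0 + Ux t 0"] unfolding v_def by (simp add: power2_eq_square algebra_simps)
    have "B*(yx t 0)\<^sup>2 - 2*y t 0*yx t 0 + \<tau>\<^sup>2*B^3*(y t 0)\<^sup>2 = e\<^sup>2 * (B * v\<^sup>2 - 2*(U t 0 * v) + \<tau>\<^sup>2*B^3*(U t 0)\<^sup>2)"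
      unfolding yy by (simp add: power2_eq_square algebra_simps)
    also have "\<dots> \<le> e\<^sup>2 * (6*B^3*\<tau>\<^sup>2 * ((U t 0)\<^sup>2 + (Ux t 0)\<^sup>2))"
    proof (rule mult_left_mono)
      have "- (2*(U t 0 * v)) \<le> (U t 0)\<^sup>2 + v\<^sup>2"
        using zero_le_power2[of "U t 0 + v"] by (simp add: power2_sum algebra_simps)
      moreover have "(B+1) * v\<^sup>2 \<le> (2*B)*(2*(\<tau>\<^sup>2*B\<^sup>2*(U t 0)\<^sup>2) + 2*(Ux t 0)\<^sup>2)"
        using B1 v2 by (intro mult_mono) auto
      moreover have "(U t 0)\<^sup>2 \<le> (\<tau>\<^sup>2*B^3)*(U t 0)\<^sup>2"
      proof -
        have "1*1 \<le> \<tau>\<^sup>2*B^3" using \<tau> B1 by (intro mult_mono one_le_power) auto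
        then show ?thesis using mult_right_mono[of 1 "\<tau>\<^sup>2*B^3" "(U t 0)\<^sup>2"] by simp
      qed
      moreover have "B*(Ux t 0)\<^sup>2 \<le> (\<tau>\<^sup>2*B^3)*(Ux t 0)\<^sup>2"
      proof -
        have "1*B \<le> \<tau>\<^sup>2*B^3" using \<tau> B1 self_le_power[of B 3] by (intro mult_mono one_le_power) auto
        then show ?thesis by (intro mult_right_mono) auto
      qed
      moreover have "0 \<le> (\<tau>\<^sup>2*B^3)*(Ux t 0)\<^sup>2" using B1 by simp
      moreover have "(2*B)*(2*(\<tau>\<^sup>2*B\<^sup>2*(U t 0)\<^sup>2) + 2*(Ux t 0)\<^sup>2) = 4*((\<tau>\<^sup>2*B^3)*(U t 0)\<^sup>2) + 4*(B*(Ux t 0)\<^sup>2)"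
        by (simp add: power2_eq_square power3_eq_cube algebra_simps)
      moreover have "6*B^3*\<tau>\<^sup>2 * ((U t 0)\<^sup>2 + (Ux t 0)\<^sup>2) = 6*((\<tau>\<^sup>2*B^3)*(U t 0)\<^sup>2) + 6*((\<tau>\<^sup>2*B^3)*(Ux t 0)\<^sup>2)"
        by (simp add: algebra_simps)
      moreover have "(B+1) * v\<^sup>2 = B * v\<^sup>2 + v\<^sup>2" by (simp add: algebra_simps)
      ultimately show "B * v\<^sup>2 - 2*(U t 0 * v) + \<tau>\<^sup>2*B^3*(U t 0)\<^sup>2 \<le> 6*B^3*\<tau>\<^sup>2 * ((U t 0)\<^sup>2 + (Ux t 0)\<^sup>2)"
        by linarith
    qed simp
    also have "\<dots> \<le> 1 * (6*B^3*\<tau>\<^sup>2 * ((U t 0)\<^sup>2 + (Ux t 0)\<^sup>2))"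
      using e2 B1 by (intro mult_right_mono) auto
    finally show "B*(yx t 0)\<^sup>2 - 2*y t 0*yx t 0 + \<tau>\<^sup>2*B^3*(y t 0)\<^sup>2 \<le> 6*B^3*\<tau>\<^sup>2 * ((U t 0)\<^sup>2 + (Ux t 0)\<^sup>2)" by simp
  qed
  have "exp (2*\<tau>*m)/8 * integral {0..x1} (\<lambda>x. a x * (U 0 x)\<^sup>2) \<le> dint T x3 (\<lambda>t x. a x/4*(yt t x)\<^sup>2 + \<tau>\<^sup>2/4*(y t x)\<^sup>2)"
  proof (rule slice_bound[OF cU3(1,3)])
    show "cont2 T x3 (\<lambda>t x. a x/4*(yt t x)\<^sup>2 + \<tau>\<^sup>2/4*(y t x)\<^sup>2)"
      unfolding cont2_def R_def[symmetric] using cy cs(13) unfolding cont2_def R_def[symmetric] by (intro continuous_intros) auto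
    fix t x assume t: "t \<in> {0..1::real}" and xx: "x \<in> {0..x1}"
    have xL: "x \<in> {0..L}" using x xx by auto
    have a01: "0 \<le> a x" "a x \<le> 1/4" using a[OF xL] by auto
    have one: "\<kappa> t = 1" "\<kappa>' t = 0" "\<zeta> x = 1" using \<kappa>(5)[of t] sz(1)[of x] t T xx x by auto
    define b where "b = -2*\<beta>*t"
    define e where "e = E t x"
    have "2*\<beta>*t \<le> 2*\<beta>*T" using t T \<beta> by (intro mult_left_mono) auto
    moreover have "\<bar>b\<bar> = 2*\<beta>*t" using \<beta> t by (simp add: b_def abs_mult)
    ultimately have "\<bar>b\<bar> \<le> 1/2" using \<beta> by linarith
    then have b2: "b\<^sup>2 \<le> 1/4" using power_mono[of "\<bar>b\<bar>" "1/2" 2] by (simp add: power_divide)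
    have yy: "y t x = e * U t x" "yt t x = e * (Ut t x + \<tau>*b*U t x)"
      by (simp_all add: y_def yt_def u_def ut_def one e_def b_def)
    have "exp (2*(\<tau>*m)) \<le> exp (2*(\<tau> * (- (B*x - x\<^sup>2/2) - \<beta>*t\<^sup>2)))" using m[OF t xx] \<tau> by (simp add: mult_left_mono)
    also have "\<dots> = e\<^sup>2" by (simp add: e_def E_def exp_double)
    finally have "exp (2*\<tau>*m) \<le> e\<^sup>2" by (simp add: mult.assoc)
    then have "exp (2*\<tau>*m) * (a x * (2 * (U t x)\<^sup>2 + (Ut t x)\<^sup>2)) \<le> e\<^sup>2 * (a x * (2 * (U t x)\<^sup>2 + (Ut t x)\<^sup>2))"
      using a01 by (intro mult_right_mono) auto
    also have "\<dots> = a x * (2 * (y t x)\<^sup>2 + (e * Ut t x)\<^sup>2)" by (simp add: yy power2_eq_square algebra_simps)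
    also have "\<dots> \<le> a x * (2 * (y t x)\<^sup>2 + (2*(yt t x)\<^sup>2 + 2*(\<tau>*b*y t x)\<^sup>2))"
    proof -
      have gen: "(p - q)\<^sup>2 \<le> 2*p\<^sup>2 + 2*q\<^sup>2" for p q :: real
        using zero_le_power2[of "p + q"] by (simp add: power2_eq_square algebra_simps)
      have "e * Ut t x = yt t x - \<tau>*b*y t x" by (simp add: yy algebra_simps)
      then have "(e * Ut t x)\<^sup>2 \<le> 2*(yt t x)\<^sup>2 + 2*(\<tau>*b*y t x)\<^sup>2"
        using gen[of "yt t x" "\<tau>*b*y t x"] by simp
      then show ?thesis using a01 by (intro mult_left_mono) auto
    qed
    also have "\<dots> = 2 * (a x * (yt t x)\<^sup>2) + a x * (2 + 2*\<tau>\<^sup>2*b\<^sup>2) * (y t x)\<^sup>2"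
      by (simp add: power2_eq_square algebra_simps)
    also have "a x * (2 + 2*\<tau>\<^sup>2*b\<^sup>2) * (y t x)\<^sup>2 \<le> 2 * \<tau>\<^sup>2 * (y t x)\<^sup>2"
    proof (rule mult_right_mono)
      have t2: "1 \<le> \<tau>\<^sup>2" using \<tau> by (intro one_le_power) auto
      have "\<tau>\<^sup>2*b\<^sup>2 \<le> \<tau>\<^sup>2*(1/4)" using b2 by (intro mult_left_mono) auto
      then have "2 + 2*\<tau>\<^sup>2*b\<^sup>2 \<le> 4*\<tau>\<^sup>2" using t2 by linarith
      then have "a x * (2 + 2*\<tau>\<^sup>2*b\<^sup>2) \<le> (1/4) * (4*\<tau>\<^sup>2)" using a01 by (intro mult_mono) auto
      then show "a x * (2 + 2*\<tau>\<^sup>2*b\<^sup>2) \<le> 2*\<tau>\<^sup>2" using t2 by linarith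
    qed simp
    finally show "exp (2*\<tau>*m)/8 * (a x * (2 * (U t x)\<^sup>2 + (Ut t x)\<^sup>2)) \<le> a x/4*(yt t x)\<^sup>2 + \<tau>\<^sup>2/4*(y t x)\<^sup>2"
      by simp
  next
    fix t x assume "t \<in> {-T..T}" "x \<in> {0..x3}"
    then have "x \<in> {0..L}" using x by auto
    then show "0 \<le> a x/4*(yt t x)\<^sup>2 + \<tau>\<^sup>2/4*(y t x)\<^sup>2" using a by simp
  next
    fix t x assume "t \<in> {-T<..<T}" "x \<in> {0..x3}"
    then show "((\<lambda>t. U t x) has_real_derivative Ut t x) (at t)" using s x by auto
  qed (use T x a ac3 in auto)
  also have "\<dots> \<le> 27 * (1 + K) * exp (2*\<tau>*m') * dint T x3 H + 6*B^3*\<tau>\<^sup>2 * integral {-T..T} (\<lambda>t. (U t 0)\<^sup>2 + (Ux t 0)\<^sup>2)"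
    using carl Pb2 Bd unfolding Peq integral_mult_right by linarith
  finally show ?thesis by (simp add: algebra_simps)
qed

section \<open>From exponential weights to a power law\<close>

text \<open>
  Optimisation over \<open>\<tau>\<close>. The factor \<open>\<tau>\<^sup>2\<close> is absorbed by \<open>e\<^sup>2\<^sup>\<tau>\<close>, which puts the \<open>1\<close> into
  \<open>E = 1 - m\<close>; then \<open>e\<^sup>-\<^sup>2\<^sup>\<tau>\<^sup>D M\<^sup>2\<close> and \<open>e\<^sup>2\<^sup>\<tau>\<^sup>E \<delta>\<^sup>2\<close> are balanced at \<open>\<tau> = ln (M/\<delta>) / (D + E)\<close>. If this is below the admissible
  range then \<open>M\<close> is comparable to \<open>\<delta>\<close> and the trivial bound suffices.
\<close>
lemma holder_from_exponential_weights:
  fixes m m' C1 :: real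
  assumes mm: "m' < m" and m0: "m \<le> 0" and C1: "0 < C1"
  shows "\<exists>C \<theta>. 0 < C \<and> 0 < \<theta> \<and> \<theta> < 1 \<and> (\<forall>N M \<delta>. 0 \<le> M \<longrightarrow> 0 \<le> \<delta> \<longrightarrow> N \<le> M\<^sup>2 \<longrightarrow>
    (\<forall>\<tau>\<ge>16. exp (2*\<tau>*m) * N \<le> C1 * (exp (2*\<tau>*m') * (M\<^sup>2 + \<delta>\<^sup>2) + \<tau>\<^sup>2 * \<delta>\<^sup>2)) \<longrightarrow>
    N \<le> C * M powr (2*(1-\<theta>)) * \<delta> powr (2*\<theta>))"
proof -
  define D where "D = m - m'"
  define E where "E = 1 - m"
  define \<theta> where "\<theta> = D/(D+E)"
  define C where "C = 4*C1 + exp (32*D)"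
  have D: "0 < D" and E: "0 < E" using mm m0 by (auto simp: D_def E_def)
  have th: "0 < \<theta>" "\<theta> < 1" using D E by (auto simp: \<theta>_def)
  have thD: "\<theta> * (D+E) = D" "(1-\<theta>)*(D+E) = E" using D E by (auto simp: \<theta>_def field_simps)
  have C: "0 < C" using C1 by (simp add: C_def add_pos_pos)
  have main: "N \<le> C * M powr (2*(1-\<theta>)) * \<delta> powr (2*\<theta>)"
    if M: "0 \<le> M" and \<delta>: "0 \<le> \<delta>" and NM: "N \<le> M\<^sup>2"
      and h: "\<And>\<tau>. 16 \<le> \<tau> \<Longrightarrow> exp (2*\<tau>*m) * N \<le> C1 * (exp (2*\<tau>*m') * (M\<^sup>2 + \<delta>\<^sup>2) + \<tau>\<^sup>2 * \<delta>\<^sup>2)" for N M \<delta>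
  proof -
    have h2: "N \<le> 2*C1*(exp (-2*\<tau>*D) * M\<^sup>2 + exp (2*\<tau>*E) * \<delta>\<^sup>2)" if t: "16 \<le> \<tau>" for \<tau>
    proof -
      have "N = exp (-2*\<tau>*m) * (exp (2*\<tau>*m) * N)" by (simp add: exp_minus field_simps)
      also have "\<dots> \<le> exp (-2*\<tau>*m) * (C1 * (exp (2*\<tau>*m') * (M\<^sup>2 + \<delta>\<^sup>2) + \<tau>\<^sup>2 * \<delta>\<^sup>2))"
        by (rule mult_left_mono[OF h[OF t]]) simp
      also have "\<dots> = C1 * ((exp (-2*\<tau>*m) * exp (2*\<tau>*m')) * (M\<^sup>2 + \<delta>\<^sup>2) + (exp (-2*\<tau>*m) * \<tau>\<^sup>2) * \<delta>\<^sup>2)"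
        by (simp add: algebra_simps)
      also have "exp (-2*\<tau>*m) * exp (2*\<tau>*m') = exp (-2*\<tau>*D)" by (simp add: D_def exp_add[symmetric] algebra_simps)
      also have "C1 * (exp (-2*\<tau>*D) * (M\<^sup>2 + \<delta>\<^sup>2) + (exp (-2*\<tau>*m) * \<tau>\<^sup>2) * \<delta>\<^sup>2)
         \<le> C1 * (2 * (exp (-2*\<tau>*D) * M\<^sup>2 + exp (2*\<tau>*E) * \<delta>\<^sup>2))"
      proof (rule mult_left_mono)
        have "\<tau> \<le> exp \<tau>" using exp_ge_add_one_self[of \<tau>] by linarith
        then have "\<tau>\<^sup>2 \<le> (exp \<tau>)\<^sup>2" using t by (intro power_mono) auto
        then have "exp (-2*\<tau>*m) * \<tau>\<^sup>2 \<le> exp (-2*\<tau>*m) * exp (2*\<tau>)" by (simp add: exp_double)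
        also have "\<dots> = exp (2*\<tau>*E)" by (simp add: E_def exp_add[symmetric] algebra_simps)
        finally have "(exp (-2*\<tau>*m) * \<tau>\<^sup>2) * \<delta>\<^sup>2 \<le> exp (2*\<tau>*E) * \<delta>\<^sup>2" by (rule mult_right_mono) simp
        moreover have "exp (-2*\<tau>*D) * \<delta>\<^sup>2 \<le> exp (2*\<tau>*E) * \<delta>\<^sup>2"
        proof (rule mult_right_mono)
          have "0 \<le> \<tau>*D" "0 \<le> \<tau>*E" using t D E by auto
          moreover have "2*\<tau>*E - (-2*\<tau>*D) = 2*(\<tau>*D) + 2*(\<tau>*E)" by (simp add: algebra_simps)
          ultimately have "-2*\<tau>*D \<le> 2*\<tau>*E" by linarith
          then show "exp (-2*\<tau>*D) \<le> exp (2*\<tau>*E)" by (simp only: exp_le_cancel_iff)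
        qed simp
        moreover have "0 \<le> exp (-2*\<tau>*D) * M\<^sup>2" by simp
        ultimately show "exp (-2*\<tau>*D) * (M\<^sup>2 + \<delta>\<^sup>2) + (exp (-2*\<tau>*m) * \<tau>\<^sup>2) * \<delta>\<^sup>2
            \<le> 2 * (exp (-2*\<tau>*D) * M\<^sup>2 + exp (2*\<tau>*E) * \<delta>\<^sup>2)" unfolding distrib_left by linarith
      qed (use C1 in simp)
      finally show ?thesis by (simp add: algebra_simps)
    qed
    consider "M \<le> exp (16*(D+E)) * \<delta>" | "\<delta> = 0" | "0 < \<delta>" "exp (16*(D+E)) * \<delta> < M" using \<delta> by linarith
    then show ?thesis
    proof cases
      case 1
      have "M\<^sup>2 = M powr (2*(1-\<theta>)) * M powr (2*\<theta>)"
        using M by (cases "M = 0") (auto simp: powr_add[symmetric] algebra_simps)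
      also have "\<dots> \<le> M powr (2*(1-\<theta>)) * (exp (16*(D+E)) * \<delta>) powr (2*\<theta>)"
        using M 1 th by (intro mult_left_mono powr_mono2) auto
      also have "\<dots> = exp (32*(\<theta>*(D+E))) * M powr (2*(1-\<theta>)) * \<delta> powr (2*\<theta>)"
        using \<delta> by (simp add: powr_mult exp_powr_real algebra_simps)
      also have "\<dots> \<le> C * M powr (2*(1-\<theta>)) * \<delta> powr (2*\<theta>)"
        unfolding thD using C1 by (intro mult_right_mono) (auto simp: C_def)
      finally show ?thesis using NM by linarith
    next
      case 2
      have "N \<le> 0"
      proof (rule tendsto_lowerbound)
        show "((\<lambda>\<tau>. 2*C1*(exp (-2*\<tau>*D) * M\<^sup>2)) \<longlongrightarrow> 0) at_top"
        proof -
          have "LIM \<tau> at_top. (-2*D)*\<tau> :> at_bot"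
            using D by (intro filterlim_tendsto_neg_mult_at_bot[OF tendsto_const]) (auto intro: filterlim_ident)
          then have "((\<lambda>\<tau>. exp ((-2*D)*\<tau>)) \<longlongrightarrow> 0) at_top" by (rule filterlim_compose[OF exp_at_bot])
          then have "((\<lambda>\<tau>. 2*C1*(exp ((-2*D)*\<tau>) * M\<^sup>2)) \<longlongrightarrow> 2*C1*(0 * M\<^sup>2)) at_top" by (intro tendsto_intros)
          then show ?thesis by (simp add: mult_ac)
        qed
        show "\<forall>\<^sub>F \<tau> in at_top. N \<le> 2*C1*(exp (-2*\<tau>*D) * M\<^sup>2)"
          using eventually_ge_at_top[of 16] by eventually_elim (use h2 2 in auto)
      qed simp
      then show ?thesis using 2 th by simp
    next
      case 3
      then have M0: "0 < M" by (meson exp_gt_zero less_trans mult_pos_pos)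
      define \<tau> where "\<tau> = ln (M/\<delta>)/(D+E)"
      have "exp (16*(D+E)) < M/\<delta>" using 3 by (simp add: pos_less_divide_eq)
      then have "16*(D+E) < ln (M/\<delta>)" using M0 3 by (metis divide_pos_pos exp_less_cancel_iff exp_ln)
      then have t16: "16 \<le> \<tau>" using D E by (simp add: \<tau>_def pos_le_divide_eq)
      have tD: "\<tau>*D = \<theta> * ln (M/\<delta>)" "\<tau>*E = (1-\<theta>) * ln (M/\<delta>)"
        using D E by (auto simp: \<tau>_def \<theta>_def field_simps)
      have e1: "exp (-2*\<tau>*D) * M\<^sup>2 = M powr (2*(1-\<theta>)) * \<delta> powr (2*\<theta>)"
      proof -
        have "exp (-2*\<tau>*D) * M\<^sup>2 = exp (- 2 * (\<theta> * ln (M/\<delta>)) + 2 * ln M)"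
          unfolding exp_add using M0 by (simp add: exp_double tD(1)[symmetric] mult.assoc)
        also have "- 2 * (\<theta> * ln (M/\<delta>)) + 2 * ln M = 2*(1-\<theta>) * ln M + 2*\<theta> * ln \<delta>"
          using M0 3 by (simp add: ln_div algebra_simps)
        also have "exp \<dots> = M powr (2*(1-\<theta>)) * \<delta> powr (2*\<theta>)"
          using M0 3 by (simp add: powr_def exp_add)
        finally show ?thesis .
      qed
      have e2: "exp (2*\<tau>*E) * \<delta>\<^sup>2 = M powr (2*(1-\<theta>)) * \<delta> powr (2*\<theta>)"
      proof -
        have "exp (2*\<tau>*E) * \<delta>\<^sup>2 = exp (2 * ((1-\<theta>) * ln (M/\<delta>)) + 2 * ln \<delta>)"
          unfolding exp_add using 3 by (simp add: exp_double tD(2)[symmetric] mult.assoc)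
        also have "2 * ((1-\<theta>) * ln (M/\<delta>)) + 2 * ln \<delta> = 2*(1-\<theta>) * ln M + 2*\<theta> * ln \<delta>"
          using M0 3 by (simp add: ln_div algebra_simps)
        also have "exp \<dots> = M powr (2*(1-\<theta>)) * \<delta> powr (2*\<theta>)"
          using M0 3 by (simp add: powr_def exp_add)
        finally show ?thesis .
      qed
      have "N \<le> 4*C1*(M powr (2*(1-\<theta>)) * \<delta> powr (2*\<theta>))" using h2[OF t16] unfolding e1 e2 by (simp add: algebra_simps)
      also have "\<dots> \<le> C * (M powr (2*(1-\<theta>)) * \<delta> powr (2*\<theta>))" by (intro mult_right_mono) (auto simp: C_def)
      finally show ?thesis by (simp add: mult.assoc)
    qed
  qed
  show ?thesis using C th main by blast
qed

text \<open>
  Continuation from the side \<open>x = 0\<close>, where \<open>U\<close> and \<open>Ux\<close> are known, to \<open>x \<le> x1\<close>. The constants depend only on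
  \<open>a\<close> and the positions of the cutoffs. The quantity \<open>g\<close> is the drop of the weight from \<open>x1\<close> to \<open>x2\<close>, where the
  cutoff in \<open>x\<close> starts.
\<close>
lemma sideways_holder:
  fixes a a' :: "real \<Rightarrow> real"
  assumes x: "0 < x1" "x1 < x2" "x2 < x3" "x3 < L"
    and a_cont: "continuous_on {0..L} a" "continuous_on {0..L} a'"
    and a_deriv: "\<And>x. x \<in> {0<..<L} \<Longrightarrow> (a has_real_derivative a' x) (at x)"
    and a0: "a 0 = 0"
    and a: "\<And>x. x \<in> {0..L} \<Longrightarrow> 0 \<le> a x \<and> a x \<le> 1/4 \<and> (a' x)\<^sup>2 \<le> a x/4"
    and a3: "\<And>x. x \<in> {0..x3} \<Longrightarrow> - a x/4 \<le> a' x * (B - x)"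
    and B: "1 + L \<le> B" and \<alpha>: "0 < \<alpha>" "\<And>x. x \<in> {x2..L} \<Longrightarrow> \<alpha> \<le> a x"
  shows "\<exists>T C \<theta>. 1 < T \<and> 0 < C \<and> 0 < \<theta> \<and> \<theta> < 1 \<and>
    (\<forall>U Ut Ux Utt Uxx Uxt M \<delta>. elliptic_solution T L a U Ut Ux Utt Uxx Uxt \<longrightarrow> 0 \<le> M \<longrightarrow> 0 \<le> \<delta> \<longrightarrow>
      (\<forall>t\<in>{-T..T}. integral {0..L} (\<lambda>x. a x * (U t x)\<^sup>2) \<le> M\<^sup>2) \<longrightarrow>
      integral {-T..T} (\<lambda>t. (U t 0)\<^sup>2 + (Ux t 0)\<^sup>2) \<le> \<delta>\<^sup>2 \<longrightarrow>
      integral {0..x1} (\<lambda>x. a x * (U 0 x)\<^sup>2) \<le> C * M powr (2*(1-\<theta>)) * \<delta> powr (2*\<theta>))"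
proof -
  define \<rho> where "\<rho> = (\<lambda>x. - (B*x - x\<^sup>2/2))"
  have \<rho>_less: "\<rho> v < \<rho> u" if "0 \<le> u" "u < v" "v \<le> L" for u v
  proof -
    have "\<rho> u - \<rho> v = (v - u) * (B - (u+v)/2)" unfolding \<rho>_def by (simp add: field_simps power2_eq_square)
    moreover have "0 < (v - u) * (B - (u+v)/2)" using that B by (intro mult_pos_pos) auto
    ultimately show ?thesis by linarith
  qed
  have \<rho>_mono: "\<rho> v \<le> \<rho> u" if "0 \<le> u" "u \<le> v" "v \<le> L" for u v
    using \<rho>_less[of u v] that by (cases "u = v") auto
  define g where "g = \<rho> x1 - \<rho> x2"
  have g: "0 < g" using \<rho>_less[of x1 x2] x by (simp add: g_def)
  \<comment> \<open>With \<open>\<beta> = 1/(4T)\<close>, the term \<open>\<beta> t\<^sup>2\<close> is at most \<open>g/4\<close> for \<open>|t| \<le> 1\<close>, but at least \<open>T/16 \<ge> B x2\<close> for \<open>|t| \<ge> T - 2\<close>: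
    the weight is nearly constant in time around \<open>0\<close> and yet low near the ends.\<close>
  define T where "T = 5 + 16*B*x2 + 1/g"
  define \<beta> where "\<beta> = 1/(4*T)"
  have Bx: "0 < B*x2" using B x by simp
  have T: "5 < T" "16*(B*x2) < T" "1/g < T" using g Bx by (auto simp: T_def add_pos_pos)
  have \<beta>: "0 < \<beta>" "\<beta> \<le> 1/4" "2*\<beta>*T \<le> 1/2" using T by (auto simp: \<beta>_def field_simps)
  have \<beta>g: "\<beta> \<le> g/4" using T g by (simp add: \<beta>_def field_simps)
  define m where "m = \<rho> x1 - \<beta>"
  define m' where "m' = \<rho> x2"
  have mm: "m' < m" using \<beta>g g by (simp add: m_def m'_def g_def field_simps)
  have m0: "m \<le> 0" using \<rho>_mono[of 0 x1] x \<beta> by (simp add: m_def \<rho>_def)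
  have bT: "- (\<beta>*(T-2)\<^sup>2) \<le> m'"
  proof -
    have "(T/2)\<^sup>2 \<le> (T-2)\<^sup>2" using T by (intro power_mono) auto
    then have "\<beta>*(T/2)\<^sup>2 \<le> \<beta>*(T-2)\<^sup>2" using \<beta> by (intro mult_left_mono) auto
    moreover have "\<beta>*(T/2)\<^sup>2 = T/16" using T by (simp add: \<beta>_def power2_eq_square)
    moreover have "- (B*x2) \<le> m'" by (simp add: m'_def \<rho>_def)
    ultimately show ?thesis using T by linarith
  qed
  obtain z z' z'' kz where z: "cutoff x2 x3 z z' z'' kz" using cutoff_exists[OF x(3)] by blast
  \<comment> \<open>\<open>y\<close> and \<open>d\<close> localise the energy estimate; they equal 1 wherever \<open>z\<close> and \<open>c\<close> are nonzero\<close>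
  obtain y y' y'' ky where y: "cutoff x3 L y y' y'' ky" using cutoff_exists[OF x(4)] by blast
  have ex: "\<exists>g g' g'' K. (\<forall>s. (g has_real_derivative g' s) (at s)) \<and> (\<forall>s. (g' has_real_derivative g'' s) (at s)) \<and>
     continuous_on UNIV g'' \<and> (\<forall>s. 0 \<le> g s \<and> g s \<le> 1 \<and> \<bar>g' s\<bar> \<le> K \<and> \<bar>g'' s\<bar> \<le> K) \<and>
     (\<forall>s. \<bar>s\<bar> \<le> u \<longrightarrow> g s = 1 \<and> g' s = 0 \<and> g'' s = 0) \<and> (\<forall>s. \<bar>s\<bar> \<ge> v \<longrightarrow> g s = 0 \<and> g' s = 0 \<and> g'' s = 0)"
    if uv: "0 \<le> u" "u < v" for u v :: real
  proof -
    obtain f f' f'' k where "cutoff u v f f' f'' k" using cutoff_exists[OF uv(2)] by blast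
    then show ?thesis by (rule cutoff_sym[OF _ uv])
  qed
  obtain c c' c'' kc where c: "\<And>s. (c has_real_derivative c' s) (at s)" "\<And>s. (c' has_real_derivative c'' s) (at s)"
     "continuous_on UNIV c''" "\<And>s. 0 \<le> c s \<and> c s \<le> 1 \<and> \<bar>c' s\<bar> \<le> kc \<and> \<bar>c'' s\<bar> \<le> kc"
     "\<And>s. \<bar>s\<bar> \<le> T-2 \<Longrightarrow> c s = 1 \<and> c' s = 0 \<and> c'' s = 0" "\<And>s. \<bar>s\<bar> \<ge> T-1 \<Longrightarrow> c s = 0 \<and> c' s = 0 \<and> c'' s = 0"
    using ex[of "T-2" "T-1"] T by auto
  obtain d d' d'' kd where d: "\<And>s. (d has_real_derivative d' s) (at s)" "\<And>s. (d' has_real_derivative d'' s) (at s)"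
     "continuous_on UNIV d''" "\<And>s. 0 \<le> d s \<and> d s \<le> 1 \<and> \<bar>d' s\<bar> \<le> kd \<and> \<bar>d'' s\<bar> \<le> kd"
     "\<And>s. \<bar>s\<bar> \<le> T-1 \<Longrightarrow> d s = 1 \<and> d' s = 0 \<and> d'' s = 0" "\<And>s. \<bar>s\<bar> \<ge> T \<Longrightarrow> d s = 0 \<and> d' s = 0 \<and> d'' s = 0"
    using ex[of "T-1" "T"] T by auto
  define K where "K = kc\<^sup>2 + kd\<^sup>2 + kz\<^sup>2/\<alpha> + ky\<^sup>2/\<alpha>"
  have K: "kc\<^sup>2 \<le> K" "kd\<^sup>2 \<le> K" "kz\<^sup>2/\<alpha> \<le> K" "ky\<^sup>2/\<alpha> \<le> K" "0 \<le> K"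
    using \<alpha>(1) by (auto simp: K_def)
  have sq: "u\<^sup>2 \<le> k\<^sup>2" if "\<bar>u\<bar> \<le> k" for u k :: real using that by (metis abs_ge_zero power2_abs power_mono)
  have Kz: "k\<^sup>2/\<alpha> \<le> K \<Longrightarrow> \<bar>u\<bar> \<le> k \<Longrightarrow> (\<xi> < x2 \<Longrightarrow> u = 0) \<Longrightarrow> \<xi> \<in> {0..L} \<Longrightarrow> u\<^sup>2 \<le> K * a \<xi>" for k u \<xi>
  proof (cases "\<xi> < x2")
    case False
    assume h: "k\<^sup>2/\<alpha> \<le> K" "\<bar>u\<bar> \<le> k" "\<xi> \<in> {0..L}"
    have "u\<^sup>2 \<le> K * \<alpha>" using sq[OF h(2)] h(1) \<alpha>(1) by (simp add: field_simps)
    also have "\<dots> \<le> K * a \<xi>" using \<alpha>(2)[of \<xi>] False h(3) K(5) by (intro mult_left_mono) auto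
    finally show ?thesis .
  qed (use K(5) a in auto)
  note zz = z[unfolded cutoff_def] and yy = y[unfolded cutoff_def]
  define C1 where "C1 = (216 * (1 + K) + 48 * B^3) * ((12*K+3)*(2*T) + 1)"
  have C1: "0 < C1" using K(5) B x T by (auto simp: C1_def intro!: mult_pos_pos add_pos_pos add_nonneg_pos)
  obtain C \<theta> where C: "0 < C" "0 < \<theta>" "\<theta> < 1" and Cb: "\<And>N M \<delta>. 0 \<le> M \<Longrightarrow> 0 \<le> \<delta> \<Longrightarrow> N \<le> M\<^sup>2 \<Longrightarrow>
    (\<And>\<tau>. 16 \<le> \<tau> \<Longrightarrow> exp (2*\<tau>*m) * N \<le> C1 * (exp (2*\<tau>*m') * (M\<^sup>2 + \<delta>\<^sup>2) + \<tau>\<^sup>2 * \<delta>\<^sup>2)) \<Longrightarrow>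
    N \<le> C * M powr (2*(1-\<theta>)) * \<delta> powr (2*\<theta>)"
    using holder_from_exponential_weights[OF mm m0 C1] by blast
  show ?thesis
  proof (rule exI[of _ T], rule exI[of _ C], rule exI[of _ \<theta>], intro conjI C allI impI)
    show "1 < T" using T by simp
    fix U Ut Ux Utt Uxx Uxt M \<delta>
    assume sol: "elliptic_solution T L a U Ut Ux Utt Uxx Uxt" and M: "0 \<le> M" and \<delta>: "0 \<le> \<delta>"
      and hM: "\<forall>t\<in>{-T..T}. integral {0..L} (\<lambda>x. a x * (U t x)\<^sup>2) \<le> M\<^sup>2"
      and h\<delta>: "integral {-T..T} (\<lambda>t. (U t 0)\<^sup>2 + (Ux t 0)\<^sup>2) \<le> \<delta>\<^sup>2"
    have L0: "0 < L" and T0: "0 < T" using x T by auto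
    have cx: "cont2 T L U" "cont2 T L Ut" "cont2 T L Ux" using sol by (auto simp: elliptic_solution_def)
    note ca = cont2_x[OF a_cont(1), of T]
    have cc: "continuous_on UNIV d" "continuous_on UNIV y" "continuous_on UNIV d'" "continuous_on UNIV y'"
      using d yy by (auto intro!: continuous_at_imp_continuous_on DERIV_isCont)
    define W where "W = (\<lambda>t x. a x * (U t x)\<^sup>2)"
    define G where "G = (\<lambda>t x. (d t * y x)\<^sup>2 * ((Ux t x)\<^sup>2 + a x * (Ut t x)\<^sup>2))"
    define H where "H = (\<lambda>t x. W t x + G t x)"
    have cW: "cont2 T L W" "cont2 T L G" "cont2 T L H"
      unfolding cont2_def W_def G_def H_def
      by (intro continuous_intros ca cx[unfolded cont2_def] cont2_t[OF continuous_on_subset[OF cc(1) subset_UNIV]]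
         cont2_x[OF continuous_on_subset[OF cc(2) subset_UNIV]])+
    have Hn: "0 \<le> H t x" if "x \<in> {0..L}" for t x using a[OF that] by (simp add: H_def W_def G_def)
    have dW: "dint T L W \<le> (2*T) * M\<^sup>2"
    proof -
      have "dint T L W = integral {-T..T} (\<lambda>t. integral {0..L} (W t))" by (rule dint_iterated(1)[OF cW(1)])
      also have "\<dots> \<le> integral {-T..T} (\<lambda>t. M\<^sup>2)"
      proof (rule integral_le)
        have "continuous_on (cbox (-T) T) (\<lambda>t. integral (cbox 0 L) (W t))"
          using cW(1) by (intro integral_continuous_on_param) (simp add: cont2_def case_prod_unfold cbox_Pair_eq)
        then show "(\<lambda>t. integral {0..L} (W t)) integrable_on {-T..T}"
          by (intro integrable_continuous_interval) simp
      qed (use hM in \<open>auto simp: W_def\<close>)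
      also have "\<dots> = (2*T) * M\<^sup>2" using T0 by simp
      finally show ?thesis .
    qed
    have dG: "dint T L G \<le> (12*K+2) * dint T L W + integral {-T..T} (\<lambda>t. (U t 0)\<^sup>2 + (Ux t 0)\<^sup>2)"
      unfolding G_def W_def
    proof (rule caccioppoli[OF sol T0 L0 a_cont(1) _ d(1) cc(3) _ _ _ _ _ cc(4)])
      show "(d' s)\<^sup>2 \<le> K" for s using sq[of "d' s" kd] d(4)[of s] K by auto
      show "(y' x)\<^sup>2 \<le> K * a x" if "x \<in> {0..L}" for x
        using yy x that K(4) by (intro Kz[of ky]) auto
      show "(y has_real_derivative y' s) (at s)" "\<bar>y s\<bar> \<le> 1" for s using yy by auto
      show "\<bar>d s\<bar> \<le> 1" for s using d(4)[of s] by auto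
      show "d T = 0" "d (-T) = 0" using d(6) T0 by auto
      show "y L = 0" using yy by auto
    qed (use a in auto)
    have "dint T L H = dint T L W + dint T L G" unfolding H_def by (rule dint_add[OF cW(1,2)])
    also have "\<dots> \<le> (12*K+3) * dint T L W + \<delta>\<^sup>2" using dG h\<delta> by (simp add: algebra_simps)
    also have "\<dots> \<le> (12*K+3) * ((2*T) * M\<^sup>2) + \<delta>\<^sup>2" using dW K(5) by (intro add_right_mono mult_left_mono) auto
    also have "\<dots> \<le> ((12*K+3)*(2*T) + 1) * (M\<^sup>2 + \<delta>\<^sup>2)"
    proof -
      have "0 \<le> (12*K+3)*(2*T)*\<delta>\<^sup>2" "0 \<le> M\<^sup>2" using K(5) T0 by auto
      then show ?thesis by (simp add: algebra_simps)
    qed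
    finally have dH: "dint T L H \<le> ((12*K+3)*(2*T) + 1) * (M\<^sup>2 + \<delta>\<^sup>2)" .
    have dH3: "dint T x3 H \<le> dint T L H"
      by (rule dint_mono_domain[OF cW(3)]) (use x Hn in auto)
    have cH3: "cont2 T x3 H"
      using cW(3) x unfolding cont2_def by (rule_tac continuous_on_subset) (auto simp: cbox_Pair_eq)
    define I where "I = integral {0..x1} (\<lambda>x. a x * (U 0 x)\<^sup>2)"
    have cU0: "continuous_on {0..L} (\<lambda>x. a x * (U 0 x)\<^sup>2)"
      using T0 by (intro continuous_intros a_cont continuous_on_compose2[OF cx(1)[unfolded cont2_def], of _ "\<lambda>x. (0,x)", simplified])
        (auto intro!: continuous_intros simp: cbox_Pair_eq)
    have "I \<le> integral {0..L} (\<lambda>x. a x * (U 0 x)\<^sup>2)"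
      unfolding I_def using x a by (intro integral_subset_le integrable_continuous_interval continuous_on_subset[OF cU0]) auto
    also have "\<dots> \<le> M\<^sup>2" using hM T0 by auto
    finally have IM: "I \<le> M\<^sup>2" .
    have "I \<le> C * M powr (2*(1-\<theta>)) * \<delta> powr (2*\<theta>)"
    proof (rule Cb[OF M \<delta> IM])
      fix \<tau> :: real assume \<tau>: "16 \<le> \<tau>"
      have "exp (2*\<tau>*m) * I \<le> 216 * (1 + K) * exp (2*\<tau>*m') * dint T x3 H
         + 48 * B^3 * \<tau>\<^sup>2 * integral {-T..T} (\<lambda>t. (U t 0)\<^sup>2 + (Ux t 0)\<^sup>2)"
        unfolding I_def
      proof (rule sideways_carleman[where H=H, OF sol x _ a_cont a_deriv a0 a a3 B \<beta> \<tau> z _ c(1,2,3) _ c(5,6)])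
        fix \<xi> assume xi: "\<xi> \<in> {0..L}"
        show "(z' \<xi>)\<^sup>2 \<le> K * a \<xi> \<and> (z'' \<xi>)\<^sup>2 \<le> K * a \<xi>"
          using zz xi K(3) by (intro conjI Kz[of kz]) auto
      next
        fix s show "0 \<le> c s \<and> c s \<le> 1 \<and> (c' s)\<^sup>2 \<le> K \<and> (c'' s)\<^sup>2 \<le> K"
          using c(4)[of s] sq[of "c' s" kc] sq[of "c'' s" kc] K(1) by auto
      next
        fix t \<xi> assume h: "t \<in> {0..1::real}" "\<xi> \<in> {0..x1}"
        have "\<beta>*t\<^sup>2 \<le> \<beta>*1" using h \<beta> by (intro mult_left_mono) (auto simp: power_le_one)
        then show "m \<le> - (B*\<xi> - \<xi>\<^sup>2/2) - \<beta>*t\<^sup>2"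
          using \<rho>_mono[of \<xi> x1] h x unfolding m_def \<rho>_def by auto
      next
        fix t \<xi> assume h: "t \<in> {-T..T}" "\<xi> \<in> {0..x3}" "x2 \<le> \<xi> \<or> T - 2 \<le> \<bar>t\<bar>"
        have b0: "0 \<le> \<beta>*t\<^sup>2" using \<beta> by simp
        show "- (B*\<xi> - \<xi>\<^sup>2/2) - \<beta>*t\<^sup>2 \<le> m'"
        proof (cases "x2 \<le> \<xi>")
          case True
          then have "\<rho> \<xi> \<le> \<rho> x2" using h x by (intro \<rho>_mono) auto
          then show ?thesis using b0 unfolding m'_def \<rho>_def by linarith
        next
          case False
          then have "(T-2)\<^sup>2 \<le> t\<^sup>2" using h(3) T sq[of "T-2" "\<bar>t\<bar>"] by auto
          then have "\<beta>*(T-2)\<^sup>2 \<le> \<beta>*t\<^sup>2" using \<beta> by (intro mult_left_mono) auto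
          moreover have "\<rho> \<xi> \<le> \<rho> 0" using h x by (intro \<rho>_mono) auto
          ultimately show ?thesis using bT unfolding \<rho>_def by simp
        qed
      next
        fix t \<xi> assume h: "t \<in> {-T..T}" "\<xi> \<in> {0..x3}"
        then show "0 \<le> H t \<xi>" using x by (intro Hn) auto
        assume t: "\<bar>t\<bar> \<le> T - 1"
        have "d t = 1" "y \<xi> = 1" using d(5)[OF t] yy h by auto
        then show "a \<xi> * (U t \<xi>)\<^sup>2 + (Ux t \<xi>)\<^sup>2 + a \<xi> * (Ut t \<xi>)\<^sup>2 \<le> H t \<xi>" by (simp add: H_def W_def G_def)
      qed (use T cH3 in auto)
      also have "\<dots> \<le> (216 * (1 + K) + 48 * B^3) * (exp (2*\<tau>*m') * dint T x3 H + \<tau>\<^sup>2 * \<delta>\<^sup>2)"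
      proof -
        have B0: "0 \<le> B^3" using B x by simp
        have H0: "0 \<le> exp (2*\<tau>*m') * dint T x3 H" using dint_nonneg[OF cH3] Hn x by simp
        have "48 * B^3 * \<tau>\<^sup>2 * integral {-T..T} (\<lambda>t. (U t 0)\<^sup>2 + (Ux t 0)\<^sup>2) \<le> 48 * B^3 * \<tau>\<^sup>2 * \<delta>\<^sup>2"
          using h\<delta> B0 by (intro mult_left_mono) auto
        moreover have "0 \<le> 216 * (1 + K) * (\<tau>\<^sup>2 * \<delta>\<^sup>2)" "0 \<le> 48 * B^3 * (exp (2*\<tau>*m') * dint T x3 H)" using K(5) H0 B0 by auto
        ultimately show ?thesis by (simp add: algebra_simps)
      qed
      also have "\<dots> \<le> (216 * (1 + K) + 48 * B^3) * (((12*K+3)*(2*T) + 1) * (exp (2*\<tau>*m') * (M\<^sup>2 + \<delta>\<^sup>2) + \<tau>\<^sup>2 * \<delta>\<^sup>2))"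
      proof (rule mult_left_mono)
        have "exp (2*\<tau>*m') * dint T x3 H \<le> exp (2*\<tau>*m') * (((12*K+3)*(2*T) + 1) * (M\<^sup>2 + \<delta>\<^sup>2))"
          using dH dH3 by (intro mult_left_mono) auto
        moreover have "1 * (\<tau>\<^sup>2 * \<delta>\<^sup>2) \<le> ((12*K+3)*(2*T) + 1) * (\<tau>\<^sup>2 * \<delta>\<^sup>2)"
          using K(5) T0 by (intro mult_right_mono) auto
        ultimately show "exp (2*\<tau>*m') * dint T x3 H + \<tau>\<^sup>2 * \<delta>\<^sup>2 \<le> ((12*K+3)*(2*T) + 1) * (exp (2*\<tau>*m') * (M\<^sup>2 + \<delta>\<^sup>2) + \<tau>\<^sup>2 * \<delta>\<^sup>2)"
          by (simp add: algebra_simps)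
      qed (use K(5) B x in auto)
      finally show "exp (2*\<tau>*m) * I \<le> C1 * (exp (2*\<tau>*m') * (M\<^sup>2 + \<delta>\<^sup>2) + \<tau>\<^sup>2 * \<delta>\<^sup>2)"
        unfolding C1_def by (simp add: mult.assoc)
    qed
    then show "integral {0..x1} (\<lambda>x. a x * (U 0 x)\<^sup>2) \<le> C * M powr (2*(1-\<theta>)) * \<delta> powr (2*\<theta>)"
      unfolding I_def .
  qed
qed

section \<open>Mollifiers\<close>

text \<open>Iterating the choice of a derivative inside \<open>S\<close> gives the sequence of all derivatives.\<close>
lemma smooth_if_closed_under_deriv:
  fixes f :: "real \<Rightarrow> 'b::real_normed_vector"
  assumes f: "f \<in> S" and S: "\<And>g. g \<in> S \<Longrightarrow> \<exists>g'\<in>S. \<forall>t. (g has_vector_derivative g' t) (at t)"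
  shows "smooth f"
proof -
  obtain \<delta> where \<delta>: "\<And>g. g \<in> S \<Longrightarrow> \<delta> g \<in> S \<and> (\<forall>t. (g has_vector_derivative \<delta> g t) (at t))"
    using S by metis
  define D where "D n = (\<delta> ^^ n) f" for n
  have "D n \<in> S" for n by (induction n) (auto simp: D_def f \<delta>)
  then show ?thesis unfolding smooth_def using \<delta> by (intro exI[of _ D]) (auto simp: D_def)
qed

text \<open>
  Products of the standard bump with a rational function whose poles are \<open>\<plusminus>1\<close>: a class that is
  closed under differentiation.
\<close>
definition bump_fun :: "real poly \<Rightarrow> nat \<Rightarrow> real \<Rightarrow> real" where
  "bump_fun p k t = (if \<bar>t\<bar> < 1 then poly p t / (1 - t\<^sup>2)^k * exp (- 1/(1 - t\<^sup>2)) else 0)"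

text \<open>One term of the exponential series of \<open>1/s\<close>. It makes the bump beat every pole at the ends of its support.\<close>
lemma exp_neg_inverse_le:
  fixes s :: real
  assumes "0 < s"
  shows "exp (- 1/s) \<le> fact n * s^n"
proof -
  have "(1/s)^n / fact n \<le> (\<Sum>i\<le>n. (1/s)^i / fact i)"
    using assms by (intro member_le_sum) auto
  also have "\<dots> \<le> exp (1/s)"
  proof -
    have s: "(\<lambda>i. (1/s)^i /\<^sub>R fact i) sums exp (1/s)" by (rule exp_converges)
    have "sum (\<lambda>i. (1/s)^i /\<^sub>R fact i) {..n} \<le> (\<Sum>i. (1/s)^i /\<^sub>R fact i)"
      using assms by (intro sum_le_suminf sums_summable[OF s]) auto
    then have "sum (\<lambda>i. (1/s)^i /\<^sub>R fact i) {..n} \<le> exp (1/s)" using sums_unique[OF s] by simp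
    then show ?thesis by (simp add: divide_inverse mult.commute)
  qed
  finally have "(1/s)^n \<le> exp (1/s) * fact n" using pos_divide_le_eq[of "fact n" "(1/s)^n" "exp (1/s)"] by simp
  then have "(1/s)^n \<le> fact n * exp (1/s)" using mult.commute[of "exp (1/s)" "fact n"] by simp
  then show ?thesis using assms by (simp add: exp_minus field_simps power_divide)
qed

lemma bump_fun_deriv:
  "\<exists>q m. \<forall>t. (bump_fun p k has_real_derivative bump_fun q m t) (at t)"
proof (intro exI allI)
  let ?s = "[:1, 0, -1:] :: real poly"
  let ?q = "pderiv p * ?s * ?s + smult (2 * real k) (pCons 0 (p * ?s)) - smult 2 (pCons 0 p)"
  fix t :: real
  have s: "poly ?s t = 1 - t\<^sup>2" for t by (simp add: power2_eq_square)
  have q: "poly ?q t = poly (pderiv p) t * (1-t\<^sup>2)\<^sup>2 + 2 * real k * t * poly p t * (1-t\<^sup>2) - 2 * t * poly p t" for t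
    unfolding poly_diff poly_add poly_mult poly_smult poly_pCons s by (simp add: power2_eq_square algebra_simps)
  show "(bump_fun p k has_real_derivative bump_fun ?q (k+2) t) (at t)"
  proof (cases "\<bar>t\<bar> < 1")
    case True
    define f where "f = (\<lambda>t. poly p t * inverse (1 - t\<^sup>2)^k * exp (- inverse (1 - t\<^sup>2)))"
    have t2: "1 - t\<^sup>2 \<noteq> 0" using True by (metis abs_square_eq_1 diff_eq_diff_eq diff_zero less_irrefl right_minus_eq)
    define r where "r = inverse (1 - t\<^sup>2)"
    have rs: "r * (1 - t\<^sup>2) = 1" using t2 by (simp add: r_def)
    have d1: "((\<lambda>t. inverse (1 - t\<^sup>2)) has_real_derivative 2 * t * r\<^sup>2) (at t)"
      using t2 by (auto intro!: derivative_eq_intros simp: r_def power2_eq_square)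
    have d2: "((\<lambda>t. inverse (1 - t\<^sup>2)^k) has_real_derivative real k * r^(k-1) * (2 * t * r\<^sup>2)) (at t)"
      using DERIV_power[OF d1, of k] by (simp add: r_def mult_ac)
    have kr: "real k * r^(k-1) * (2 * t * r\<^sup>2) = 2 * real k * t * r^(k+1)"
      by (cases k) (auto simp: power2_eq_square)
    have d3: "((\<lambda>t. exp (- inverse (1 - t\<^sup>2))) has_real_derivative exp (- r) * (- (2 * t * r\<^sup>2))) (at t)"
      using DERIV_fun_exp[OF DERIV_minus[OF d1]] by (simp add: r_def)
    have "(f has_real_derivative (poly (pderiv p) t * r^k + 2 * real k * t * r^(k+1) * poly p t) * exp (- r)
        + exp (- r) * (- (2 * t * r\<^sup>2)) * (poly p t * r^k)) (at t)"
      unfolding f_def using DERIV_mult[OF DERIV_mult[OF poly_DERIV d2] d3] unfolding kr by (simp add: r_def)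
    moreover have "(poly (pderiv p) t * r^k + 2 * real k * t * r^(k+1) * poly p t) * exp (- r)
        + exp (- r) * (- (2 * t * r\<^sup>2)) * (poly p t * r^k) = bump_fun ?q (k+2) t"
    proof -
      have "bump_fun ?q (k+2) t = poly ?q t * r^(k+2) * exp (- r)"
        using True t2 by (simp only: bump_fun_def r_def if_True divide_inverse power_inverse mult_minus_left mult_1_left)
      also have "poly ?q t * r^(k+2) = poly (pderiv p) t * r^k * (r * (1-t\<^sup>2))\<^sup>2 + 2 * real k * t * poly p t * r^(k+1) * (r * (1-t\<^sup>2)) - 2 * t * poly p t * r^(k+2)"
        unfolding q by (simp add: power2_eq_square algebra_simps)
      finally show ?thesis unfolding rs by (simp add: power2_eq_square algebra_simps)
    qed
    ultimately have "(f has_real_derivative bump_fun ?q (k+2) t) (at t)" by simp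
    then show ?thesis
      by (rule has_field_derivative_transform_within_open[of _ _ _ "{-1<..<1}"])
         (use True in \<open>auto simp: f_def bump_fun_def divide_simps power_inverse\<close>)
  next
    case False
    then have z: "bump_fun ?q (k+2) t = 0" "bump_fun p k t = 0" by (auto simp: bump_fun_def)
    obtain C where C: "0 < C" "\<And>u. u \<in> {-1..1} \<Longrightarrow> \<bar>poly p u\<bar> \<le> C"
    proof -
      have "bounded (poly p ` {-1..1})" by (intro compact_imp_bounded compact_continuous_image continuous_intros) auto
      then show ?thesis using that unfolding bounded_pos by auto
    qed
    define K where "K = C * fact (k+2) * 4"
    have K: "0 \<le> K" using C by (simp add: K_def)
    have bound: "\<bar>bump_fun p k u\<bar> \<le> K * \<bar>u - t\<bar>^2" for u
    proof (cases "\<bar>u\<bar> < 1")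
      case u: True
      define s where "s = 1 - u\<^sup>2"
      have "u \<in> {-1..1}" using u by auto
      then have Cu: "\<bar>poly p u\<bar> \<le> C" by (rule C(2))
      have s0: "0 < s" using u by (simp add: s_def abs_square_less_1)
      have "s = (1 - \<bar>u\<bar>) * (1 + \<bar>u\<bar>)" by (simp add: s_def algebra_simps power2_eq_square abs_mult_self_eq)
      also have "\<dots> \<le> \<bar>u - t\<bar> * 2" using u False by (intro mult_mono) auto
      finally have s2: "s \<le> 2 * \<bar>u - t\<bar>" by simp
      have "\<bar>bump_fun p k u\<bar> = \<bar>poly p u\<bar> / s^k * exp (- 1/s)"
        using u s0 by (simp add: bump_fun_def s_def abs_mult)
      also have "\<dots> \<le> C / s^k * (fact (k+2) * s^(k+2))"
        using Cu s0 C(1) by (intro mult_mono divide_right_mono exp_neg_inverse_le) simp_all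
      also have "\<dots> = C * fact (k+2) * s\<^sup>2" using s0 by (simp add: power_add power2_eq_square)
      also have "\<dots> \<le> C * fact (k+2) * (2 * \<bar>u - t\<bar>)\<^sup>2" using s2 s0 C by (intro mult_left_mono power_mono) auto
      finally show ?thesis by (simp add: K_def power_mult_distrib)
    qed (use K in \<open>simp add: bump_fun_def\<close>)
    have "(bump_fun p k has_derivative (\<lambda>h. 0)) (at t)"
      unfolding has_derivative_at_alt
    proof (intro conjI allI impI)
      fix e :: real assume e: "0 < e"
      show "\<exists>d>0. \<forall>y. norm (y - t) < d \<longrightarrow> norm (bump_fun p k y - bump_fun p k t - 0) \<le> e * norm (y - t)"
      proof (intro exI[of _ "e/(K+1)"] conjI allI impI)
        show "0 < e/(K+1)" using e K by simp
        fix y assume y: "norm (y - t) < e/(K+1)"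
        have "K * \<bar>y - t\<bar> \<le> (K+1) * \<bar>y-t\<bar>" by (simp add: algebra_simps)
        also have "\<dots> \<le> e" using y K by (simp add: field_simps)
        finally have "K * \<bar>y - t\<bar> * \<bar>y - t\<bar> \<le> e * \<bar>y - t\<bar>" by (rule mult_right_mono) simp
        then show "norm (bump_fun p k y - bump_fun p k t - 0) \<le> e * norm (y - t)"
          using bound[of y] z by (simp add: power2_eq_square mult.assoc)
      qed
    qed simp
    moreover have "(*) 0 = (\<lambda>h::real. 0)" by auto
    ultimately show ?thesis unfolding z(1) has_field_derivative_def by simp
  qed
qed

text \<open>The whole sequence of derivatives is carried along: \<open>D n\<close> is the \<open>n\<close>-th derivative of the kernel \<open>D 0\<close>.\<close>
definition mollifier :: "real \<Rightarrow> (nat \<Rightarrow> real \<Rightarrow> real) \<Rightarrow> bool" where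
  "mollifier \<epsilon> D \<longleftrightarrow> 0 < \<epsilon> \<and> (\<forall>n t. (D n has_real_derivative D (Suc n) t) (at t)) \<and>
     (\<forall>n t. \<epsilon> \<le> \<bar>t\<bar> \<longrightarrow> D n t = 0) \<and> (\<forall>t. 0 \<le> D 0 t) \<and> (D 0 has_integral 1) {-\<epsilon>..\<epsilon>}"

lemma mollifier_exists:
  assumes "0 < \<epsilon>"
  shows "\<exists>D. mollifier \<epsilon> D"
proof -
  define S where "S = {bump_fun p k |p k. True}"
  have "smooth (bump_fun 1 0)"
  proof (rule smooth_if_closed_under_deriv)
    show "bump_fun 1 0 \<in> S" by (auto simp: S_def)
    fix g assume "g \<in> S"
    then show "\<exists>g'\<in>S. \<forall>t. (g has_vector_derivative g' t) (at t)"
      using bump_fun_deriv unfolding S_def has_real_derivative_iff_has_vector_derivative by fastforce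
  qed
  then obtain B where B: "B 0 = bump_fun 1 0" "\<And>n t. (B n has_real_derivative B (Suc n) t) (at t)"
    unfolding smooth_def has_real_derivative_iff_has_vector_derivative by auto
  have B0: "B 0 t = 0" if "1 \<le> \<bar>t\<bar>" for t using that B(1) by (simp add: bump_fun_def)
  have Bpos: "0 < B 0 t" if "\<bar>t\<bar> < 1" for t using that B(1) by (simp add: bump_fun_def)
  have Bc: "continuous_on UNIV (B n)" for n
    using B(2) by (auto intro!: continuous_at_imp_continuous_on DERIV_isCont)
  have Bz: "B n t = 0" if "1 \<le> \<bar>t\<bar>" for n t
    using that
  proof (induction n arbitrary: t)
    case (Suc n)
    have open_case: "B (Suc n) u = 0" if u: "1 < \<bar>u\<bar>" for u
    proof -
      have "((\<lambda>_. 0) has_real_derivative B (Suc n) u) (at u)"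
      proof (rule has_field_derivative_transform_within_open[OF B(2)])
        show "open {v::real. 1 < \<bar>v\<bar>}" by (intro open_Collect_less continuous_intros)
      qed (use u Suc.IH in auto)
      then show ?thesis by (rule DERIV_unique[OF _ DERIV_const])
    qed
    have "B (Suc n) t = 0"
    proof (rule continuous_constant_on_closure[where S="{v. 1 < \<bar>v\<bar>}" and f="B (Suc n)" and a=0 and x=t])
      show "continuous_on (closure {v. 1 < \<bar>v\<bar>}) (B (Suc n))" by (rule continuous_on_subset[OF Bc]) simp
      show "t \<in> closure {v. 1 < \<bar>v\<bar>}"
      proof (cases "1 < \<bar>t\<bar>")
        case True then show ?thesis by (intro subsetD[OF closure_subset]) simp
      next
        case False
        have "(\<lambda>m. t * (1 + 1/Suc m)) \<longlonglongrightarrow> t * (1 + 0)"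
          by (intro tendsto_intros LIMSEQ_Suc[OF lim_1_over_n])
        then have l: "(\<lambda>m. t * (1 + 1/Suc m)) \<longlonglongrightarrow> t" by simp
        have "\<bar>t\<bar> = 1" using False Suc.prems by simp
        then have "1 < \<bar>t * (1 + 1/Suc m)\<bar>" for m by (simp add: abs_mult)
        then have "\<forall>m. t * (1 + 1/Suc m) \<in> {v. 1 < \<bar>v\<bar>}" by blast
        then have "\<exists>x. (\<forall>m. x m \<in> {v. 1 < \<bar>v\<bar>}) \<and> x \<longlonglongrightarrow> t"
          using l by (rule_tac exI, rule_tac conjI)
        then show ?thesis by (simp only: closure_sequential)
      qed
    qed (use open_case in simp)
    then show ?case .
  qed (rule B0)
  have int: "B 0 integrable_on {-1..1}" by (intro integrable_continuous_interval continuous_on_subset[OF Bc]) auto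
  define I where "I = integral {-1..1} (B 0)"
  have I: "0 < I"
  proof -
    have "0 \<le> B 0 t" for t using Bpos[of t] B0[of t] by (cases "\<bar>t\<bar> < 1") auto
    then have "0 \<le> I" unfolding I_def by (intro integral_nonneg int) auto
    moreover have "I \<noteq> 0"
    proof
      assume "I = 0"
      then have "(B 0 has_integral 0) {-1..1}" using int by (simp add: I_def has_integral_iff)
      then have "B 0 0 = 0"
        using has_integral_0_cbox_imp_0[of "-1" 1 "B 0" 0] \<open>\<And>t. 0 \<le> B 0 t\<close> continuous_on_subset[OF Bc] by auto
      then show False using Bpos[of 0] by simp
    qed
    ultimately show ?thesis by simp
  qed
  define D where "D n t = B n (t/\<epsilon>) / (I * \<epsilon> ^ Suc n)" for n t
  have "mollifier \<epsilon> D"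
    unfolding mollifier_def
  proof (intro conjI allI impI assms)
    fix n t
    have "((\<lambda>t. B n (t/\<epsilon>)) has_real_derivative B (Suc n) (t/\<epsilon>) * (1/\<epsilon>)) (at t)"
      by (rule DERIV_chain2[OF B(2) DERIV_cdivide[OF DERIV_ident]])
    then have "((\<lambda>t. B n (t/\<epsilon>) / (I * \<epsilon> ^ Suc n)) has_real_derivative (B (Suc n) (t/\<epsilon>) * (1/\<epsilon>)) / (I * \<epsilon> ^ Suc n)) (at t)"
      by (rule DERIV_cdivide)
    then show "(D n has_real_derivative D (Suc n) t) (at t)" using assms by (simp add: D_def[abs_def] field_simps)
    show "\<epsilon> \<le> \<bar>t\<bar> \<Longrightarrow> D n t = 0" using assms by (simp add: D_def Bz)
    have "0 \<le> B 0 u" for u using Bpos[of u] B0[of u] by (cases "\<bar>u\<bar> < 1") auto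
    then show "0 \<le> D 0 t" using I assms by (simp add: D_def)
  next
    have "(B 0 has_integral I) (cbox (-1) 1)" using int by (simp add: I_def has_integral_iff)
    from has_integral_affinity'[OF this, of "1/\<epsilon>" 0]
    have "((\<lambda>t. B 0 (t/\<epsilon>)) has_integral \<epsilon> * I) {-\<epsilon>..\<epsilon>}" using assms by simp
    from has_integral_divide[OF this, of "I*\<epsilon>"]
    show "(D 0 has_integral 1) {-\<epsilon>..\<epsilon>}" using I assms by (simp add: D_def[abs_def])
  qed
  then show ?thesis by blast
qed

lemma mollifierD:
  assumes "mollifier \<epsilon> D"
  shows "0 < \<epsilon>" "(D n has_real_derivative D (Suc n) t) (at t)" "\<epsilon> \<le> \<bar>t\<bar> \<Longrightarrow> D n t = 0" "0 \<le> D 0 t"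
    "(D 0 has_integral 1) {-\<epsilon>..\<epsilon>}" "continuous_on S (D n)"
proof -
  show "continuous_on S (D n)"
    using assms by (auto simp: mollifier_def intro!: continuous_at_imp_continuous_on DERIV_isCont)
qed (use assms in \<open>auto simp: mollifier_def\<close>)

lemma mollifier_bounded:
  assumes "mollifier \<epsilon> D"
  shows "\<exists>C>0. \<forall>t. \<bar>D n t\<bar> \<le> C"
proof -
  have "bounded (D n ` {-\<epsilon>..\<epsilon>})"
    by (intro compact_imp_bounded compact_continuous_image mollifierD(6)[OF assms]) auto
  then obtain C where C: "0 < C" "\<And>t. t \<in> {-\<epsilon>..\<epsilon>} \<Longrightarrow> \<bar>D n t\<bar> \<le> C" unfolding bounded_pos by auto
  have "\<bar>D n t\<bar> \<le> C" for t
    using C(1) C(2)[of t] mollifierD(3)[OF assms, of t n] by (cases "\<bar>t\<bar> \<le> \<epsilon>") (auto simp: abs_le_iff)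
  then show ?thesis using C by blast
qed

lemma mollifier_test_function:
  assumes D: "mollifier \<epsilon> D" and t: "{t-\<epsilon>..t+\<epsilon>} \<subseteq> J"
  shows "test_function J (\<lambda>s. D n (t - s))" "deriv (\<lambda>s. D n (t - s)) = (\<lambda>s. - D (Suc n) (t - s))"
proof -
  have d: "((\<lambda>s. D m (t - s)) has_real_derivative - D (Suc m) (t - s)) (at s)" for m s
    using DERIV_chain'[OF DERIV_diff[OF DERIV_const[of t] DERIV_ident] mollifierD(2)[OF D, of m "t - s"]] by simp
  show "deriv (\<lambda>s. D n (t - s)) = (\<lambda>s. - D (Suc n) (t - s))" by (rule ext) (rule DERIV_imp_deriv[OF d])
  show "test_function J (\<lambda>s. D n (t - s))"
    unfolding test_function_def
  proof
    show "smooth (\<lambda>s. D n (t - s))"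
      unfolding smooth_def
    proof (intro exI[of _ "\<lambda>m s. (-1)^m * D (n+m) (t - s)"] conjI allI)
      fix m s
      have "((\<lambda>s. (-1)^m * D (n+m) (t - s)) has_real_derivative (-1)^m * (- D (Suc (n+m)) (t - s))) (at s)"
        by (rule DERIV_cmult[OF d])
      then show "((\<lambda>s. (-1)^m * D (n+m) (t - s)) has_vector_derivative (-1)^Suc m * D (n + Suc m) (t - s)) (at s)"
        by (simp add: has_real_derivative_iff_has_vector_derivative)
    qed simp
    show "\<exists>K. compact K \<and> K \<subseteq> J \<and> (\<forall>s. s \<notin> K \<longrightarrow> D n (t - s) = 0)"
      using t by (intro exI[of _ "{t-\<epsilon>..t+\<epsilon>}"]) (auto intro!: mollifierD(3)[OF D])
  qed
qed

section \<open>Mollification and weak derivatives of scalar functions\<close>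

text \<open>
  Convolution with the \<open>n\<close>-th derivative of the kernel, that is, the \<open>n\<close>-th derivative of the
  mollified function. The integral is confined to \<open>J\<close>, where \<open>k\<close> is given; this is harmless for \<open>t\<close> at distance
  at least \<open>\<epsilon>\<close> from the boundary of \<open>J\<close>.
\<close>
definition mollify :: "real set \<Rightarrow> (nat \<Rightarrow> real \<Rightarrow> real) \<Rightarrow> nat \<Rightarrow> (real \<Rightarrow> 'b::{banach,second_countable_topology}) \<Rightarrow> real \<Rightarrow> 'b" where
  "mollify J D n k t = (\<integral>s. D n (t - s) *\<^sub>R k s \<partial>lebesgue_on J)"

lemma continuous_measurable_lebesgue_on:
  fixes f :: "real \<Rightarrow> 'b::euclidean_space"
  assumes "continuous_on UNIV f"
  shows "f \<in> borel_measurable (lebesgue_on J)"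
proof -
  have "f \<in> borel_measurable borel" using assms by (rule borel_measurable_continuous_onI)
  then have "f \<in> borel_measurable lebesgue" by (intro measurable_completion) simp
  then show ?thesis by (rule measurable_restrict_space1)
qed

lemma mollifier_measurable:
  assumes "mollifier \<epsilon> D"
  shows "(\<lambda>s. D n (t - s)) \<in> borel_measurable (lebesgue_on J)"
proof (rule continuous_measurable_lebesgue_on)
  show "continuous_on UNIV (\<lambda>s. D n (t - s))"
    by (rule continuous_on_compose2[OF mollifierD(6)[OF assms, of UNIV n]]) (auto intro!: continuous_intros)
qed

lemma integrable_bounded_scaleR:
  fixes k :: "'a \<Rightarrow> 'b::{banach,second_countable_topology}"
  assumes k: "integrable M k" and c: "c \<in> borel_measurable M" and b: "\<And>s. \<bar>c s\<bar> \<le> C"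
  shows "integrable M (\<lambda>s. c s *\<^sub>R k s)"
proof (rule Bochner_Integration.integrable_bound[OF integrable_mult_right[OF integrable_norm[OF k], of C]])
  show "(\<lambda>s. c s *\<^sub>R k s) \<in> borel_measurable M" using k c by (intro borel_measurable_scaleR) auto
  have "0 \<le> C" using b[of undefined] by (meson abs_ge_zero order_trans)
  then show "AE s in M. norm (c s *\<^sub>R k s) \<le> norm (C * norm (k s))"
    using b by (auto intro!: AE_I2 mult_right_mono)
qed

lemma mollify_integrable:
  fixes k :: "real \<Rightarrow> 'b::{banach,second_countable_topology}"
  assumes "mollifier \<epsilon> D" "integrable (lebesgue_on J) k"
  shows "integrable (lebesgue_on J) (\<lambda>s. D n (t - s) *\<^sub>R k s)"
proof -
  obtain C where "\<And>t. \<bar>D n t\<bar> \<le> C" using mollifier_bounded[OF assms(1)] by blast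
  then show ?thesis by (intro integrable_bounded_scaleR[OF assms(2) mollifier_measurable[OF assms(1)]])
qed

lemma mollifier_taylor:
  assumes D: "mollifier \<epsilon> D"
  shows "\<exists>C>0. \<forall>u h. \<bar>D n (u + h) - D n u - h * D (Suc n) u\<bar> \<le> C * h\<^sup>2"
proof -
  obtain C where C: "0 < C" "\<And>t. \<bar>D (Suc (Suc n)) t\<bar> \<le> C" using mollifier_bounded[OF D] by blast
  have lip: "\<bar>D (Suc n) v - D (Suc n) u\<bar> \<le> C * \<bar>v - u\<bar>" for u v
    using field_differentiable_bound[of UNIV "D (Suc n)" "D (Suc (Suc n))" C v u] C mollifierD(2)[OF D] by auto
  have "\<bar>D n (u + h) - D n u - h * D (Suc n) u\<bar> \<le> C * h\<^sup>2" for u h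
  proof -
    define g where "g = (\<lambda>x. D n x - x * D (Suc n) u)"
    have "\<bar>g (u + h) - g u\<bar> \<le> (C * \<bar>h\<bar>) * \<bar>(u + h) - u\<bar>"
    proof -
      have "norm (g (u + h) - g u) \<le> (C * \<bar>h\<bar>) * norm ((u + h) - u)"
      proof (rule field_differentiable_bound[of "closed_segment u (u+h)" g "\<lambda>x. D (Suc n) x - D (Suc n) u"])
        fix x assume x: "x \<in> closed_segment u (u + h)"
        show "(g has_field_derivative D (Suc n) x - D (Suc n) u) (at x within closed_segment u (u + h))"
          unfolding g_def by (rule derivative_eq_intros has_field_derivative_at_within[OF mollifierD(2)[OF D]] refl | simp)+
        have "\<bar>x - u\<bar> \<le> \<bar>h\<bar>" using x by (auto simp: closed_segment_eq_real_ivl split: if_splits)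
        then show "norm (D (Suc n) x - D (Suc n) u) \<le> C * \<bar>h\<bar>"
          using lip[of x u] C(1) by (auto intro: order_trans mult_left_mono)
      qed auto
      then show ?thesis by simp
    qed
    then show ?thesis by (simp add: g_def algebra_simps power2_eq_square abs_mult_self_eq)
  qed
  then show ?thesis using C by blast
qed

text \<open>The quadratic Taylor remainder of the kernel is uniform, so difference quotients converge under the integral for any integrable \<open>k\<close>.\<close>
lemma mollify_has_derivative:
  fixes k :: "real \<Rightarrow> 'b::{banach,second_countable_topology}"
  assumes D: "mollifier \<epsilon> D" and k: "integrable (lebesgue_on J) k"
  shows "(mollify J D n k has_vector_derivative mollify J D (Suc n) k t) (at t)"
proof -
  obtain C where C: "0 < C" "\<And>u h. \<bar>D n (u + h) - D n u - h * D (Suc n) u\<bar> \<le> C * h\<^sup>2"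
    using mollifier_taylor[OF D] by blast
  define K where "K = C * (\<integral>s. norm (k s) \<partial>lebesgue_on J)"
  have K: "0 \<le> K" using C by (simp add: K_def)
  have b: "norm (mollify J D n k y - mollify J D n k t - (y - t) *\<^sub>R mollify J D (Suc n) k t) \<le> K * (y-t)\<^sup>2" for y
  proof -
    define h where "h = y - t"
    have i: "integrable (lebesgue_on J) (\<lambda>s. D m (u - s) *\<^sub>R k s)" for m u by (rule mollify_integrable[OF D k])
    have "mollify J D n k y - mollify J D n k t - (y - t) *\<^sub>R mollify J D (Suc n) k t
        = (\<integral>s. D n (y - s) *\<^sub>R k s - D n (t - s) *\<^sub>R k s - h *\<^sub>R (D (Suc n) (t - s) *\<^sub>R k s) \<partial>lebesgue_on J)"
      unfolding mollify_def h_def by (simp add: i del: scaleR_scaleR)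
    also have "norm \<dots> \<le> (\<integral>s. (C * h\<^sup>2) * norm (k s) \<partial>lebesgue_on J)"
    proof (rule Bochner_Integration.integral_norm_bound_integral)
      fix s
      have "D n (y - s) *\<^sub>R k s - D n (t - s) *\<^sub>R k s - h *\<^sub>R (D (Suc n) (t - s) *\<^sub>R k s)
         = (D n ((t - s) + h) - D n (t - s) - h * D (Suc n) (t - s)) *\<^sub>R k s"
        by (simp add: h_def algebra_simps)
      then show "norm (D n (y - s) *\<^sub>R k s - D n (t - s) *\<^sub>R k s - h *\<^sub>R (D (Suc n) (t - s) *\<^sub>R k s)) \<le> (C * h\<^sup>2) * norm (k s)"
        using mult_right_mono[OF C(2)[of "t - s" h], of "norm (k s)"] by simp
    next
      show "integrable (lebesgue_on J) (\<lambda>s. D n (y - s) *\<^sub>R k s - D n (t - s) *\<^sub>R k s - h *\<^sub>R (D (Suc n) (t - s) *\<^sub>R k s))"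
        by (intro Bochner_Integration.integrable_diff integrable_scaleR_right i)
    qed (use k in auto)
    also have "\<dots> = K * h\<^sup>2" by (simp add: K_def)
    finally show ?thesis by (simp add: h_def)
  qed
  show ?thesis
    unfolding has_vector_derivative_def has_derivative_at_alt
  proof (intro conjI allI impI)
    show "bounded_linear (\<lambda>x. x *\<^sub>R mollify J D (Suc n) k t)" by (rule bounded_linear_scaleR_left)
    fix e :: real assume e: "0 < e"
    show "\<exists>d>0. \<forall>y. norm (y - t) < d \<longrightarrow>
       norm (mollify J D n k y - mollify J D n k t - (y - t) *\<^sub>R mollify J D (Suc n) k t) \<le> e * norm (y - t)"
    proof (intro exI[of _ "e/(K+1)"] conjI allI impI)
      show "0 < e/(K+1)" using e K by simp
      fix y assume y: "norm (y - t) < e/(K+1)"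
      have "K * \<bar>y - t\<bar> \<le> (K+1) * \<bar>y-t\<bar>" by (simp add: algebra_simps)
      also have "\<dots> \<le> e" using y K by (simp add: field_simps)
      finally have "K * \<bar>y - t\<bar> * \<bar>y - t\<bar> \<le> e * \<bar>y - t\<bar>" by (rule mult_right_mono) simp
      then have "K * (y-t)\<^sup>2 \<le> e * norm (y - t)" by (simp add: power2_eq_square mult.assoc abs_mult_self_eq)
      then show "norm (mollify J D n k y - mollify J D n k t - (y - t) *\<^sub>R mollify J D (Suc n) k t) \<le> e * norm (y - t)"
        using b[of y] by linarith
    qed
  qed
qed

lemma mollifier_integral_one:
  assumes D: "mollifier \<epsilon> D" and sub: "{t-\<epsilon>..t+\<epsilon>} \<subseteq> J" and J: "J \<in> sets lebesgue"
  shows "integrable (lebesgue_on J) (\<lambda>s. D 0 (t - s))" "(\<integral>s. D 0 (t - s) \<partial>lebesgue_on J) = 1"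
proof -
  have "((\<lambda>u. D 0 (- u)) has_integral 1) (cbox (-\<epsilon>) \<epsilon>)"
    using has_integral_reflect_lemma[of "D 0" 1 "-\<epsilon>" \<epsilon>] mollifierD(5)[OF D] by simp
  from has_integral_affinity'[OF this, of 1 "-t"]
  have "((\<lambda>s. D 0 (t - s)) has_integral 1) {t-\<epsilon>..t+\<epsilon>}" by (simp add: add.commute)
  then have h: "((\<lambda>s. D 0 (t - s)) has_integral 1) J"
    by (rule has_integral_on_superset[OF _ _ sub]) (auto intro!: mollifierD(3)[OF D])
  then have "(\<lambda>s. D 0 (t - s)) absolutely_integrable_on J"
    using mollifierD(4)[OF D] by (intro nonnegative_absolutely_integrable_1) auto
  then show i: "integrable (lebesgue_on J) (\<lambda>s. D 0 (t - s))"
    using J by (simp add: absolutely_integrable_on_def set_integrable_def integrable_restrict_space)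
  show "(\<integral>s. D 0 (t - s) \<partial>lebesgue_on J) = 1"
    using lebesgue_integral_eq_integral[OF i J] h by (simp add: integral_unique)
qed

lemma mollify_near:
  fixes k :: "real \<Rightarrow> 'b::{banach,second_countable_topology}"
  assumes D: "mollifier \<epsilon> D" and sub: "{t-\<epsilon>..t+\<epsilon>} \<subseteq> J" and J: "J \<in> sets lebesgue" and k: "integrable (lebesgue_on J) k"
    and e: "\<And>s. s \<in> J \<Longrightarrow> \<bar>s - t\<bar> \<le> \<epsilon> \<Longrightarrow> norm (k s - l) \<le> e"
  shows "norm (mollify J D 0 k t - l) \<le> e"
proof -
  note one = mollifier_integral_one[OF D sub J]
  have i: "integrable (lebesgue_on J) (\<lambda>s. D 0 (t - s) *\<^sub>R k s)" by (rule mollify_integrable[OF D k])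
  have i2: "integrable (lebesgue_on J) (\<lambda>s. D 0 (t - s) *\<^sub>R l)" using one by simp
  have "mollify J D 0 k t - l = (\<integral>s. D 0 (t - s) *\<^sub>R k s \<partial>lebesgue_on J) - (\<integral>s. D 0 (t - s) *\<^sub>R l \<partial>lebesgue_on J)"
    using one by (simp add: mollify_def)
  also have "\<dots> = (\<integral>s. D 0 (t - s) *\<^sub>R (k s - l) \<partial>lebesgue_on J)"
    using i i2 by (simp add: scaleR_diff_right)
  also have "norm \<dots> \<le> (\<integral>s. D 0 (t - s) * e \<partial>lebesgue_on J)"
  proof (rule Bochner_Integration.integral_norm_bound_integral)
    show "integrable (lebesgue_on J) (\<lambda>s. D 0 (t - s) *\<^sub>R (k s - l))" using i i2 by (simp add: scaleR_diff_right)
    show "integrable (lebesgue_on J) (\<lambda>s. D 0 (t - s) * e)" using one by simp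
    fix s assume "s \<in> space (lebesgue_on J)"
    then show "norm (D 0 (t - s) *\<^sub>R (k s - l)) \<le> D 0 (t - s) * e"
      using e[of s] mollifierD(3)[OF D, of "t - s" 0] mollifierD(4)[OF D, of "t - s"]
      by (cases "\<epsilon> \<le> \<bar>t - s\<bar>") (auto simp: abs_minus_commute intro!: mult_left_mono)
  qed
  also have "\<dots> = e" using one by simp
  finally show ?thesis .
qed

lemma lebesgue_on_interval_finite: "finite_measure (lebesgue_on {a<..<b::real})"
  by (rule finite_measure_lebesgue_on) simp

text \<open>The positive and the negative part of \<open>h\<close>, as densities, give measures that agree on all half-lines.\<close>
lemma AE_zero_if_interval_integrals_zero:
  fixes h :: "real \<Rightarrow> real"
  assumes h: "integrable lebesgue h" and z: "\<And>x. (\<integral>u. indicator {x<..} u * h u \<partial>lebesgue) = 0"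
  shows "AE x in lebesgue. h x = 0"
proof -
  obtain g where g: "g \<in> borel_measurable lborel" and gh: "AE x in lborel. h x = g x"
    using completion_ex_borel_measurable_real[of h lborel] h by auto
  have gl: "g \<in> borel_measurable lebesgue" using g by (rule measurable_completion)
  have gh': "AE x in lebesgue. h x = g x" by (rule AE_completion[OF gh])
  have gi: "integrable lborel g"
    using integrable_cong_AE[OF _ gl gh'] h integrable_completion[OF g] by auto
  have gb [measurable]: "g \<in> borel_measurable borel"
    using g by (simp only: measurable_lborel2)
  have gz: "(\<integral>u. indicator {x<..} u * g u \<partial>lborel) = 0" for x
  proof -
    have "(\<integral>u. indicator {x<..} u * g u \<partial>lborel) = (\<integral>u. indicator {x<..} u * g u \<partial>lebesgue)"
      by (intro integral_completion[symmetric]) measurable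
    also have "\<dots> = (\<integral>u. indicator {x<..} u * h u \<partial>lebesgue)"
      using gh' h gl by (intro integral_cong_AE borel_measurable_times borel_measurable_indicator) auto
    finally show ?thesis using z by simp
  qed
  define M where "M = density lborel (\<lambda>x. ennreal (g x))"
  define N where "N = density lborel (\<lambda>x. ennreal (- g x))"
  have eM: "emeasure M {x<..} = (\<integral>\<^sup>+u. ennreal (indicator {x<..} u * g u) \<partial>lborel)" for x
    unfolding M_def by (subst emeasure_density) (auto intro!: nn_integral_cong simp: indicator_def)
  have eN: "emeasure N {x<..} = (\<integral>\<^sup>+u. ennreal (- (indicator {x<..} u * g u)) \<partial>lborel)" for x
    unfolding N_def by (subst emeasure_density) (auto intro!: nn_integral_cong simp: indicator_def)
  have ix: "integrable lborel (\<lambda>u. indicator {x<..} u * g u)" for x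
    using integrable_real_mult_indicator[OF _ gi, of "{x<..}"] by (simp add: mult.commute)
  have fin: "emeasure M {x<..} < \<infinity>" "emeasure N {x<..} < \<infinity>" for x
    using ix[of x] unfolding eM eN real_integrable_def by (auto simp: less_top)
  have "M = N"
  proof (rule measure_eqI_lessThan)
    fix x
    have "0 = enn2real (emeasure M {x<..}) - enn2real (emeasure N {x<..})"
      using real_lebesgue_integral_def[OF ix[of x]] gz[of x] unfolding eM eN by simp
    then have "enn2real (emeasure M {x<..}) = enn2real (emeasure N {x<..})" by simp
    then show "emeasure M {x<..} = emeasure N {x<..}"
      using fin[of x] by (metis ennreal_enn2real infinity_ennreal_def)
    show "emeasure M {x<..} < \<infinity>" by (rule fin)
  qed (auto simp: M_def N_def)
  then have "AE x in lborel. ennreal (g x) = ennreal (- g x)"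
    unfolding M_def N_def by (intro sigma_finite_measure.density_unique[OF sigma_finite_lborel]) auto
  then have "AE x in lborel. g x = 0"
  proof eventually_elim
    case (elim x)
    then show ?case
      using ennreal_neg[of "g x"] ennreal_neg[of "- g x"] ennreal_eq_0_iff[of "g x"] ennreal_eq_0_iff[of "- g x"]
      by (cases "0 \<le> g x") auto
  qed
  then have "AE x in lborel. h x = 0" using gh by eventually_elim simp
  then show ?thesis by (rule AE_completion)
qed

lemma AE_zero_if_primitive_zero:
  fixes h :: "real \<Rightarrow> complex"
  assumes h: "integrable (lebesgue_on {a<..<b}) h" and z: "\<And>t. t \<in> {a..b} \<Longrightarrow> integral {a..t} h = 0"
  shows "AE t in lebesgue_on {a<..<b}. h t = 0"
proof -
  have io: "h integrable_on {a..b}"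
    using integrable_on_lebesgue_on[OF h] by (simp add: integrable_on_open_interval_real)
  have main: "AE t in lebesgue. indicator {a<..<b} t * p (h t) = 0"
    if p: "bounded_linear p" for p :: "complex \<Rightarrow> real"
  proof (rule AE_zero_if_interval_integrals_zero)
    have ph: "integrable (lebesgue_on {a<..<b}) (\<lambda>t. p (h t))" by (rule integrable_bounded_linear[OF p h])
    then show i: "integrable lebesgue (\<lambda>t. indicator {a<..<b} t * p (h t))"
      by (simp add: integrable_restrict_space)
    fix x
    have iab: "(\<lambda>t. p (h t)) integrable_on {a..b}" using integrable_linear[OF io p] by (simp add: o_def)
    have zp: "integral {a..t} (\<lambda>t. p (h t)) = 0" if "t \<in> {a..b}" for t
    proof -
      have "h integrable_on {a..t}" using io that by (auto intro: integrable_on_subinterval)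
      then have "integral {a..t} (\<lambda>t. p (h t)) = p (integral {a..t} h)" using integral_linear[OF _ p, of h "{a..t}"] by (simp add: o_def)
      then show ?thesis using z[OF that] by (simp add: linear_simps[OF p])
    qed
    show "(\<integral>u. indicator {x<..} u * (indicator {a<..<b} u * p (h u)) \<partial>lebesgue) = 0"
    proof (cases "x < b \<and> a < b")
      case False
      then have "(\<lambda>u. indicator {x<..} u * (indicator {a<..<b} u * p (h u))) = (\<lambda>u. 0)"
        by (auto simp: indicator_def)
      then show ?thesis by (simp only: Bochner_Integration.integral_zero)
    next
      case True
      define y where "y = max x a"
      have y: "a \<le> y" "y < b" using True by (auto simp: y_def)
      have eq: "(\<lambda>u. indicator {x<..} u * (indicator {a<..<b} u * p (h u))) = (\<lambda>u. indicator {y<..<b} u *\<^sub>R p (h u))"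
        by (auto simp: indicator_def y_def)
      have sub: "{y<..<b} \<subseteq> {a<..<b}" using y by auto
      have i2: "integrable (lebesgue_on {y<..<b}) (\<lambda>t. p (h t))"
      proof -
        have "integrable lebesgue (\<lambda>u. indicator {y<..<b} u *\<^sub>R (indicator {a<..<b} u * p (h u)))"
          by (rule integrable_mult_indicator[OF _ i]) simp
        also have "(\<lambda>u. indicator {y<..<b} u *\<^sub>R (indicator {a<..<b} u * p (h u))) = (\<lambda>u. indicator {y<..<b} u *\<^sub>R p (h u))"
          using sub by (auto simp: indicator_def fun_eq_iff)
        finally show ?thesis by (simp add: integrable_restrict_space)
      qed
      have "(\<integral>u. indicator {y<..<b} u *\<^sub>R p (h u) \<partial>lebesgue) = (\<integral>u. p (h u) \<partial>lebesgue_on {y<..<b})"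
        by (simp add: integral_restrict_space)
      also have "\<dots> = integral {y<..<b} (\<lambda>u. p (h u))" by (rule lebesgue_integral_eq_integral[OF i2]) simp
      also have "\<dots> = integral {y..b} (\<lambda>u. p (h u))" by (simp add: integral_open_interval_real)
      also have "\<dots> = integral {a..b} (\<lambda>u. p (h u)) - integral {a..y} (\<lambda>u. p (h u))"
        using Henstock_Kurzweil_Integration.integral_combine[OF y(1) less_imp_le[OF y(2)] iab] by simp
      also have "\<dots> = 0" using zp y by simp
      finally show ?thesis unfolding eq .
    qed
  qed
  have "AE t in lebesgue. t \<in> {a<..<b} \<longrightarrow> h t = 0"
    using main[OF bounded_linear_Re] main[OF bounded_linear_Im]
    by eventually_elim (auto simp: complex_eq_iff indicator_def)
  then show ?thesis by (simp add: AE_restrict_space_iff)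
qed

lemma primitive_test_function:
  fixes k :: "real \<Rightarrow> complex" and \<eta> :: "real \<Rightarrow> real"
  assumes k: "integrable (lebesgue_on {a<..<b}) k" and ab: "a < b"
    and \<eta>: "\<And>t. (\<eta> has_real_derivative \<eta>' t) (at t)" "continuous_on UNIV \<eta>'" "\<eta> b = 0"
  shows "(\<integral>t. \<eta>' t *\<^sub>R integral {a..t} k \<partial>lebesgue_on {a<..<b}) = - (\<integral>t. \<eta> t *\<^sub>R k t \<partial>lebesgue_on {a<..<b})"
proof -
  let ?M = "lebesgue_on {a<..<b}"
  interpret F: finite_measure ?M by (rule lebesgue_on_interval_finite)
  interpret P: pair_sigma_finite ?M ?M ..
  have io: "k integrable_on {a..b}"
    using integrable_on_lebesgue_on[OF k] by (simp add: integrable_on_open_interval_real)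
  obtain C where C: "\<And>t. t \<in> {a..b} \<Longrightarrow> \<bar>\<eta>' t\<bar> \<le> C"
  proof -
    have "bounded (\<eta>' ` {a..b})" using \<eta>(2) by (intro compact_imp_bounded compact_continuous_image continuous_on_subset[OF \<eta>(2)]) auto
    then obtain C where "\<forall>x\<in>\<eta>' ` {a..b}. norm x \<le> C" unfolding bounded_iff by blast
    then show ?thesis using that[of C] by simp
  qed
  have m\<eta> [measurable]: "\<eta>' \<in> borel_measurable ?M" by (rule continuous_measurable_lebesgue_on[OF \<eta>(2)])
  have mk [measurable]: "k \<in> borel_measurable ?M" using k by simp
  have mid [measurable]: "(\<lambda>x::real. x) \<in> borel_measurable ?M" by (rule continuous_measurable_lebesgue_on) (rule continuous_on_id)
  define f where "f = (\<lambda>t s. indicator {x. fst x < snd x} (s, t) *\<^sub>R (\<eta>' t *\<^sub>R k s))"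
  have mf: "case_prod f \<in> borel_measurable (?M \<Otimes>\<^sub>M ?M)"
  proof -
    have "(\<lambda>p. (snd p, fst p)) \<in> (?M \<Otimes>\<^sub>M ?M) \<rightarrow>\<^sub>M (borel :: (real \<times> real) measure)"
      by measurable
    then have "(\<lambda>p. indicator {x::real\<times>real. fst x < snd x} (snd p, fst p) :: real) \<in> borel_measurable (?M \<Otimes>\<^sub>M ?M)"
      by (rule measurable_compose) (auto intro!: borel_measurable_indicator borel_open open_Collect_less continuous_intros)
    then show ?thesis unfolding f_def case_prod_unfold by measurable
  qed
  have C0: "0 \<le> C" using C[of a] ab by auto
  have int: "integrable (?M \<Otimes>\<^sub>M ?M) (case_prod f)"
  proof (rule P.Fubini_integrable[OF mf])
    show "integrable ?M (\<lambda>t. \<integral>s. norm (case_prod f (t, s)) \<partial>?M)"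
    proof (rule Bochner_Integration.integrable_bound)
      show "integrable ?M (\<lambda>t. C * (\<integral>s. norm (k s) \<partial>?M))" by simp
      show "(\<lambda>t. \<integral>s. norm (case_prod f (t, s)) \<partial>?M) \<in> borel_measurable ?M" using mf by measurable
      show "AE t in ?M. norm (\<integral>s. norm (case_prod f (t, s)) \<partial>?M) \<le> norm (C * (\<integral>s. norm (k s) \<partial>?M))"
      proof (rule AE_I2)
        fix t assume t: "t \<in> space ?M"
        have "(\<integral>s. norm (case_prod f (t, s)) \<partial>?M) \<le> (\<integral>s. C * norm (k s) \<partial>?M)"
        proof (rule integral_mono')
          fix s show "norm (case_prod f (t, s)) \<le> C * norm (k s)"
            using C[of t] C0 t by (auto simp: f_def indicator_def intro!: mult_right_mono)
        qed (use k C0 in auto)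
        then show "norm (\<integral>s. norm (case_prod f (t, s)) \<partial>?M) \<le> norm (C * (\<integral>s. norm (k s) \<partial>?M))"
          using C0 by simp
      qed
    qed
    show "AE t in ?M. integrable ?M (\<lambda>s. case_prod f (t, s))"
    proof (rule AE_I2)
      fix t assume t: "t \<in> space ?M"
      have "integrable ?M (\<lambda>s. (indicator {..<t} s * \<eta>' t) *\<^sub>R k s)"
        by (rule integrable_bounded_scaleR[OF k, of _ "\<bar>\<eta>' t\<bar>"]) (auto simp: indicator_def)
      then show "integrable ?M (\<lambda>s. case_prod f (t, s))"
        by (rule back_subst[of "integrable ?M"]) (auto simp: f_def indicator_def)
    qed
  qed
  have sub: "integral {a..t} k = (\<integral>s. indicator {..<t} s *\<^sub>R k s \<partial>?M)" if t: "t \<in> {a<..<b}" for t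
  proof -
    have "integrable ?M (\<lambda>s. indicator {..<t} s *\<^sub>R k s)"
      by (rule integrable_bounded_scaleR[OF k, of _ 1]) (auto simp: indicator_def)
    then have "(\<integral>s. indicator {..<t} s *\<^sub>R k s \<partial>?M) = integral {a<..<b} (\<lambda>s. indicator {..<t} s *\<^sub>R k s)"
      by (rule lebesgue_integral_eq_integral) simp
    also have "\<dots> = integral {a<..<b} (\<lambda>s. if s \<in> {a<..<t} then k s else 0)"
      by (rule Henstock_Kurzweil_Integration.integral_cong) (auto simp: indicator_def)
    also have "\<dots> = integral {a<..<t} k" unfolding integral_restrict_Int using t by (intro arg_cong[where f="\<lambda>S. integral S k"]) auto
    finally show ?thesis by (simp add: integral_open_interval_real)
  qed
  have tail: "(\<integral>t. indicator {s<..} t * \<eta>' t \<partial>?M) = - \<eta> s" if s: "s \<in> {a<..<b}" for s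
  proof -
    have "integrable ?M (\<lambda>t. indicator {s<..} t *\<^sub>R \<eta>' t)"
    proof (rule F.integrable_const_bound[of _ C])
      show "AE t in ?M. norm (indicator {s<..} t *\<^sub>R \<eta>' t) \<le> C"
        using C C0 by (intro AE_I2) (auto simp: indicator_def)
    qed measurable
    then have "(\<integral>t. indicator {s<..} t *\<^sub>R \<eta>' t \<partial>?M) = integral {a<..<b} (\<lambda>t. indicator {s<..} t *\<^sub>R \<eta>' t)"
      by (rule lebesgue_integral_eq_integral) simp
    also have "\<dots> = integral {a<..<b} (\<lambda>t. if t \<in> {s<..<b} then \<eta>' t else 0)"
      by (rule Henstock_Kurzweil_Integration.integral_cong) (auto simp: indicator_def)
    also have "\<dots> = integral {s<..<b} \<eta>'" unfolding integral_restrict_Int using s by (intro arg_cong[where f="\<lambda>S. integral S \<eta>'"]) auto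
    also have "\<dots> = integral {s..b} \<eta>'" by (simp add: integral_open_interval_real)
    also have "\<dots> = \<eta> b - \<eta> s"
      using s by (intro integral_unique fundamental_theorem_of_calculus)
        (auto simp: has_real_derivative_iff_has_vector_derivative[symmetric] intro: has_field_derivative_at_within \<eta>(1))
    finally show ?thesis using \<eta>(3) by simp
  qed
  have "(\<integral>t. \<eta>' t *\<^sub>R integral {a..t} k \<partial>?M) = (\<integral>t. (\<integral>s. f t s \<partial>?M) \<partial>?M)"
  proof (rule Bochner_Integration.integral_cong[OF refl])
    fix t assume t: "t \<in> space ?M"
    then have "\<eta>' t *\<^sub>R integral {a..t} k = (\<integral>s. \<eta>' t *\<^sub>R (indicator {..<t} s *\<^sub>R k s) \<partial>?M)"
      using sub by (simp del: scaleR_scaleR)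
    also have "\<dots> = (\<integral>s. f t s \<partial>?M)" by (rule Bochner_Integration.integral_cong) (auto simp: f_def indicator_def)
    finally show "\<eta>' t *\<^sub>R integral {a..t} k = (\<integral>s. f t s \<partial>?M)" .
  qed
  also have "\<dots> = (\<integral>s. (\<integral>t. f t s \<partial>?M) \<partial>?M)" by (rule P.Fubini_integral[OF int, symmetric])
  also have "\<dots> = (\<integral>s. - (\<eta> s *\<^sub>R k s) \<partial>?M)"
  proof (rule Bochner_Integration.integral_cong[OF refl])
    fix s assume s: "s \<in> space ?M"
    have "(\<integral>t. f t s \<partial>?M) = (\<integral>t. (indicator {s<..} t * \<eta>' t) *\<^sub>R k s \<partial>?M)"
      by (rule Bochner_Integration.integral_cong) (auto simp: f_def indicator_def)
    also have "\<dots> = (\<integral>t. indicator {s<..} t * \<eta>' t \<partial>?M) *\<^sub>R k s"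
    proof (rule integral_scaleR_left)
      show "integrable ?M (\<lambda>t. indicator {s<..} t * \<eta>' t)"
      proof (rule F.integrable_const_bound[of _ C])
        show "AE t in ?M. norm (indicator {s<..} t * \<eta>' t) \<le> C"
          using C C0 by (intro AE_I2) (auto simp: indicator_def)
      qed measurable
    qed
    also have "\<dots> = - (\<eta> s *\<^sub>R k s)" using tail[of s] s by simp
    finally show "(\<integral>t. f t s \<partial>?M) = - (\<eta> s *\<^sub>R k s)" .
  qed
  finally show ?thesis by simp
qed

text \<open>
  Du Bois-Reymond lemma. The primitive \<open>H\<close> of \<open>h\<close> is continuous, so its mollifications converge to it at
  every point; they are affine because the mollified \<open>h\<close> has zero derivative. Hence \<open>H\<close> is affine, and \<open>h\<close> is
  almost everywhere its slope.
\<close>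
lemma weak_derivative_zero_imp_constant:
  fixes h :: "real \<Rightarrow> complex"
  assumes ab: "a < b" and h: "integrable (lebesgue_on {a<..<b}) h"
    and z: "\<And>\<eta>::real\<Rightarrow>real. test_function {a<..<b} \<eta> \<Longrightarrow> (\<integral>t. deriv \<eta> t *\<^sub>R h t \<partial>lebesgue_on {a<..<b}) = 0"
  shows "\<exists>c. AE t in lebesgue_on {a<..<b}. h t = c"
proof -
  let ?J = "{a<..<b}"
  let ?M = "lebesgue_on ?J"
  interpret F: finite_measure ?M by (rule lebesgue_on_interval_finite)
  have io: "h integrable_on {a..b}"
    using integrable_on_lebesgue_on[OF h] by (simp add: integrable_on_open_interval_real)
  define H where "H t = integral {a..t} h" for t
  have Hc: "continuous_on {a..b} H"
    unfolding H_def using indefinite_integral_continuous_1[OF io] .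
  have Hi: "integrable ?M H"
  proof -
    obtain C where "\<forall>x\<in>H ` {a..b}. norm x \<le> C"
      using compact_imp_bounded[OF compact_continuous_image[OF Hc]] unfolding bounded_iff by blast
    then have C: "\<And>t. t \<in> {a..b} \<Longrightarrow> norm (H t) \<le> C" by simp
    have "continuous_on ?J H" by (rule continuous_on_subset[OF Hc]) auto
    then have "H \<in> borel_measurable ?M" by (rule continuous_imp_measurable_on_sets_lebesgue) simp
    then show ?thesis using C by (intro F.integrable_const_bound[of _ C]) (auto intro!: AE_I2)
  qed
  have aff: "\<exists>c. \<forall>t\<in>{a+\<epsilon><..<b-\<epsilon>}. mollify ?J D 0 H t = mollify ?J D 0 H p + (t - p) *\<^sub>R c"
    if D: "mollifier \<epsilon> D" and p: "p \<in> {a+\<epsilon><..<b-\<epsilon>}" for \<epsilon> D p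
  proof -
    have e0: "0 < \<epsilon>" by (rule mollifierD(1)[OF D])
    have d2: "mollify ?J D (Suc n) h t = 0" if "t \<in> {a+\<epsilon><..<b-\<epsilon>}" for t n
    proof -
      have sub: "{t-\<epsilon>..t+\<epsilon>} \<subseteq> ?J" using that by auto
      have "(\<integral>s. (- D (Suc n) (t - s)) *\<^sub>R h s \<partial>?M) = 0"
        using z[OF mollifier_test_function(1)[OF D sub, of n]] unfolding mollifier_test_function(2)[OF D sub, of n] .
      then show ?thesis by (simp add: mollify_def)
    qed
    have d1: "mollify ?J D (Suc 0) H t = mollify ?J D 0 h t" if "t \<in> {a+\<epsilon><..<b-\<epsilon>}" for t
    proof -
      have "(\<integral>s. (- D (Suc 0) (t - s)) *\<^sub>R integral {a..s} h \<partial>?M) = - (\<integral>s. D 0 (t - s) *\<^sub>R h s \<partial>?M)"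
      proof (rule primitive_test_function[OF h ab])
        show "((\<lambda>s. D 0 (t - s)) has_real_derivative - D (Suc 0) (t - s)) (at s)" for s
          using DERIV_chain'[OF DERIV_diff[OF DERIV_const[of t] DERIV_ident] mollifierD(2)[OF D, of 0 "t - s"]] by simp
        show "continuous_on UNIV (\<lambda>s. - D (Suc 0) (t - s))"
          by (intro continuous_intros continuous_on_compose2[OF mollifierD(6)[OF D, of UNIV]]) auto
        show "D 0 (t - b) = 0" by (rule mollifierD(3)[OF D]) (use that e0 in auto)
      qed
      then show ?thesis by (simp add: mollify_def H_def)
    qed
    obtain c where c: "\<And>t. t \<in> {a+\<epsilon><..<b-\<epsilon>} \<Longrightarrow> mollify ?J D 0 h t = c"
    proof (rule has_vector_derivative_zero_constant[of "{a+\<epsilon><..<b-\<epsilon>}" "mollify ?J D 0 h"])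
      fix t assume t: "t \<in> {a+\<epsilon><..<b-\<epsilon>}"
      show "(mollify ?J D 0 h has_vector_derivative 0) (at t within {a+\<epsilon><..<b-\<epsilon>})"
        using mollify_has_derivative[OF D h, of 0 t] unfolding d2[OF t] by (rule has_vector_derivative_at_within)
    qed auto
    obtain c' where c': "\<And>t. t \<in> {a+\<epsilon><..<b-\<epsilon>} \<Longrightarrow> mollify ?J D 0 H t - t *\<^sub>R c = c'"
    proof (rule has_vector_derivative_zero_constant[of "{a+\<epsilon><..<b-\<epsilon>}" "\<lambda>t. mollify ?J D 0 H t - t *\<^sub>R c"])
      fix t assume t: "t \<in> {a+\<epsilon><..<b-\<epsilon>}"
      have "(mollify ?J D 0 H has_vector_derivative c) (at t)"
        using mollify_has_derivative[OF D Hi, of 0 t] unfolding d1[OF t] c[OF t] .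
      then have "((\<lambda>t. mollify ?J D 0 H t - t *\<^sub>R c) has_vector_derivative c - (t *\<^sub>R 0 + 1 *\<^sub>R c)) (at t)"
        by (intro has_vector_derivative_diff has_vector_derivative_scaleR DERIV_ident has_vector_derivative_const)
      then show "((\<lambda>t. mollify ?J D 0 H t - t *\<^sub>R c) has_vector_derivative 0) (at t within {a+\<epsilon><..<b-\<epsilon>})"
        by (simp add: has_vector_derivative_at_within)
    qed auto
    have "mollify ?J D 0 H t = mollify ?J D 0 H p + (t - p) *\<^sub>R c" if "t \<in> {a+\<epsilon><..<b-\<epsilon>}" for t
      using c'[OF that] c'[OF p] by (simp add: algebra_simps)
    then show ?thesis by blast
  qed
  \<comment> \<open>Affinity passes to the limit once it is expressed through the values at three points.\<close>
  define p q where "p = (2*a+b)/3" and "q = (a+2*b)/3"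
  have pq: "p \<in> ?J" "q \<in> ?J" "p < q" using ab by (auto simp: p_def q_def)
  define c where "c = (H q - H p) /\<^sub>R (q - p)"
  have lin: "(q - p) *\<^sub>R (H t - H p) = (t - p) *\<^sub>R (H q - H p)" if t: "t \<in> ?J" for t
  proof -
    define E where "E = (q - p) *\<^sub>R (H t - H p) - (t - p) *\<^sub>R (H q - H p)"
    have "norm E \<le> e" if e: "0 < e" for e
    proof -
      define e' where "e' = e / (4*(b-a))"
      have e': "0 < e'" using e ab by (simp add: e'_def)
      have cont: "\<exists>d>0. \<forall>s\<in>?J. \<bar>s - u\<bar> \<le> d \<longrightarrow> norm (H s - H u) \<le> e'" if u: "u \<in> ?J" for u
      proof -
        have "u \<in> {a..b}" using u by auto
        then obtain d where d: "0 < d" "\<And>s. s \<in> {a..b} \<Longrightarrow> dist s u < d \<Longrightarrow> dist (H s) (H u) < e'"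
          using Hc e' unfolding continuous_on_iff by blast
        then show ?thesis by (intro exI[of _ "d/2"]) (auto simp: dist_norm intro!: less_imp_le)
      qed
      obtain d1 where d1: "0 < d1" "\<forall>s\<in>?J. \<bar>s - t\<bar> \<le> d1 \<longrightarrow> norm (H s - H t) \<le> e'" using cont[OF t] by blast
      obtain d2 where d2: "0 < d2" "\<forall>s\<in>?J. \<bar>s - p\<bar> \<le> d2 \<longrightarrow> norm (H s - H p) \<le> e'" using cont[OF pq(1)] by blast
      obtain d3 where d3: "0 < d3" "\<forall>s\<in>?J. \<bar>s - q\<bar> \<le> d3 \<longrightarrow> norm (H s - H q) \<le> e'" using cont[OF pq(2)] by blast
      define l where "l = Min {t - a, b - t, p - a, b - q}"
      define \<epsilon> where "\<epsilon> = Min {d1, d2, d3, l/2}"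
      have l: "0 < l" "l \<le> t - a" "l \<le> b - t" "l \<le> p - a" "l \<le> b - q" using t pq by (auto simp: l_def)
      have \<epsilon>: "0 < \<epsilon>" "\<epsilon> \<le> d1" "\<epsilon> \<le> d2" "\<epsilon> \<le> d3" "\<epsilon> < l"
      proof -
        show "0 < \<epsilon>" "\<epsilon> \<le> d1" "\<epsilon> \<le> d2" "\<epsilon> \<le> d3" using d1(1) d2(1) d3(1) l by (auto simp: \<epsilon>_def)
        have "\<epsilon> \<le> l/2" by (simp add: \<epsilon>_def)
        then show "\<epsilon> < l" using l(1) by linarith
      qed
      obtain D where D: "mollifier \<epsilon> D" using mollifier_exists[OF \<epsilon>(1)] by blast
      have ins: "t \<in> {a+\<epsilon><..<b-\<epsilon>}" "p \<in> {a+\<epsilon><..<b-\<epsilon>}" "q \<in> {a+\<epsilon><..<b-\<epsilon>}" using l \<epsilon> pq by auto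
      have sub: "{u-\<epsilon>..u+\<epsilon>} \<subseteq> ?J" if "u \<in> {a+\<epsilon><..<b-\<epsilon>}" for u using that by auto
      define m where "m = mollify ?J D 0 H"
      have n: "norm (m t - H t) \<le> e'" "norm (m p - H p) \<le> e'" "norm (m q - H q) \<le> e'"
      proof -
        show "norm (m t - H t) \<le> e'" unfolding m_def
          by (rule mollify_near[OF D sub[OF ins(1)] _ Hi]) (use d1(2) \<epsilon>(2) in auto)
        show "norm (m p - H p) \<le> e'" unfolding m_def
          by (rule mollify_near[OF D sub[OF ins(2)] _ Hi]) (use d2(2) \<epsilon>(3) in auto)
        show "norm (m q - H q) \<le> e'" unfolding m_def
          by (rule mollify_near[OF D sub[OF ins(3)] _ Hi]) (use d3(2) \<epsilon>(4) in auto)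
      qed
      obtain c where c: "\<And>t. t \<in> {a+\<epsilon><..<b-\<epsilon>} \<Longrightarrow> m t = m p + (t - p) *\<^sub>R c"
        using aff[OF D ins(2)] unfolding m_def by blast
      have "(q - p) *\<^sub>R (m t - m p) = (t - p) *\<^sub>R (m q - m p)" using c[OF ins(1)] c[OF ins(3)] by simp
      then have "E = (t - p) *\<^sub>R ((m q - H q) - (m p - H p)) - (q - p) *\<^sub>R ((m t - H t) - (m p - H p))"
        unfolding E_def by (simp add: algebra_simps)
      also have "norm \<dots> \<le> norm ((t - p) *\<^sub>R ((m q - H q) - (m p - H p))) + norm ((q - p) *\<^sub>R ((m t - H t) - (m p - H p)))"
        by (rule norm_triangle_ineq4)
      also have "\<dots> \<le> (b-a) * (2*e') + (b-a) * (2*e')"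
      proof (rule add_mono)
        have "norm ((m q - H q) - (m p - H p)) \<le> 2*e'" "norm ((m t - H t) - (m p - H p)) \<le> 2*e'"
          using n norm_triangle_ineq4[of "m q - H q" "m p - H p"] norm_triangle_ineq4[of "m t - H t" "m p - H p"] by linarith+
        then show "norm ((t - p) *\<^sub>R ((m q - H q) - (m p - H p))) \<le> (b-a) * (2*e')"
          "norm ((q - p) *\<^sub>R ((m t - H t) - (m p - H p))) \<le> (b-a) * (2*e')"
          unfolding norm_scaleR using t pq by (auto intro!: mult_mono)
      qed
      also have "\<dots> = e"
      proof -
        have gen: "w * (e/(4*w)) = e/4" if "w \<noteq> 0" for w :: real using that by simp
        have "(b-a) * e' = e/4" unfolding e'_def by (rule gen) (use ab in simp)
        then show ?thesis by (simp add: algebra_simps)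
      qed
      finally show ?thesis .
    qed
    then have "norm E \<le> 0 + e" if "0 < e" for e using that by simp
    then have "norm E \<le> 0" by (rule field_le_epsilon)
    then show ?thesis by (simp add: E_def)
  qed
  have Hlin: "H t - (t - a) *\<^sub>R c = H p - (p - a) *\<^sub>R c" if t: "t \<in> ?J" for t
  proof -
    have "(q - p) *\<^sub>R (H t - H p) = (q - p) *\<^sub>R ((t - p) *\<^sub>R c)"
      unfolding lin[OF t] c_def using pq by simp
    then have "H t - H p = (t - p) *\<^sub>R c" using pq by (simp only: scaleR_cancel_left) auto
    then show ?thesis by (simp add: algebra_simps)
  qed
  have clos: "closure ?J = {a..b}" using ab by simp
  have K: "H t - (t - a) *\<^sub>R c = H p - (p - a) *\<^sub>R c" if "t \<in> {a..b}" for t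
    by (rule continuous_constant_on_closure[where S="?J" and f="\<lambda>t. H t - (t - a) *\<^sub>R c" and x=t, OF _ Hlin])
       (use that in \<open>auto simp: clos intro!: continuous_intros Hc\<close>)
  have Ha: "H a = 0" by (simp add: H_def)
  have H0: "H t = (t - a) *\<^sub>R c" if "t \<in> {a..b}" for t
    using K[OF that] K[of a] ab Ha by simp
  have "AE t in ?M. h t - c = 0"
  proof (rule AE_zero_if_primitive_zero)
    show "integrable ?M (\<lambda>t. h t - c)" using h by simp
    fix t assume t: "t \<in> {a..b}"
    have "h integrable_on {a..t}" using io t by (auto intro: integrable_on_subinterval)
    then have "(h has_integral H t) {a..t}" by (simp add: H_def has_integral_integral[symmetric])
    moreover have "((\<lambda>t. c) has_integral (t - a) *\<^sub>R c) {a..t}" using has_integral_const_real[of c a t] t by simp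
    ultimately have "((\<lambda>t. h t - c) has_integral H t - (t - a) *\<^sub>R c) {a..t}" by (rule has_integral_diff)
    then have "integral {a..t} (\<lambda>t. h t - c) = H t - (t - a) *\<^sub>R c" by (rule integral_unique)
    then show "integral {a..t} (\<lambda>t. h t - c) = 0" using H0[OF t] by simp
  qed
  then show ?thesis by (intro exI[of _ c]) auto
qed

lemma weak_derivative_imp_primitive:
  fixes f g :: "real \<Rightarrow> complex"
  assumes ab: "a < b" and f: "integrable (lebesgue_on {a<..<b}) f" and g: "integrable (lebesgue_on {a<..<b}) g"
    and w: "\<And>\<eta>::real\<Rightarrow>real. test_function {a<..<b} \<eta> \<Longrightarrow>
      (\<integral>t. deriv \<eta> t *\<^sub>R f t \<partial>lebesgue_on {a<..<b}) = - (\<integral>t. \<eta> t *\<^sub>R g t \<partial>lebesgue_on {a<..<b})"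
  shows "\<exists>c. AE t in lebesgue_on {a<..<b}. f t = c + integral {a..t} g"
proof -
  let ?J = "{a<..<b}"
  let ?M = "lebesgue_on ?J"
  interpret F: finite_measure ?M by (rule lebesgue_on_interval_finite)
  have io: "g integrable_on {a..b}"
    using integrable_on_lebesgue_on[OF g] by (simp add: integrable_on_open_interval_real)
  define G where "G t = integral {a..t} g" for t
  have Gc: "continuous_on {a..b} G"
    unfolding G_def using indefinite_integral_continuous_1[OF io] .
  have Gi: "integrable ?M G"
  proof -
    obtain C where "\<forall>x\<in>G ` {a..b}. norm x \<le> C"
      using compact_imp_bounded[OF compact_continuous_image[OF Gc]] unfolding bounded_iff by blast
    then have C: "\<And>t. t \<in> {a..b} \<Longrightarrow> norm (G t) \<le> C" by simp
    have "continuous_on ?J G" by (rule continuous_on_subset[OF Gc]) auto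
    then have "G \<in> borel_measurable ?M" by (rule continuous_imp_measurable_on_sets_lebesgue) simp
    then show ?thesis using C by (intro F.integrable_const_bound[of _ C]) (auto intro!: AE_I2)
  qed
  have "\<exists>c. AE t in ?M. f t - G t = c"
  proof (rule weak_derivative_zero_imp_constant[OF ab])
    show "integrable ?M (\<lambda>t. f t - G t)" using f Gi by simp
    fix \<eta> :: "real \<Rightarrow> real" assume t: "test_function ?J \<eta>"
    obtain E where E: "E 0 = \<eta>" "\<And>n t. (E n has_real_derivative E (Suc n) t) (at t)"
      using t unfolding test_function_def smooth_def has_real_derivative_iff_has_vector_derivative by blast
    obtain K where K: "compact K" "K \<subseteq> ?J" "\<And>t. t \<notin> K \<Longrightarrow> \<eta> t = 0" using t unfolding test_function_def by blast
    have de: "deriv \<eta> = E 1" using E(2)[of 0] E(1) by (auto intro!: ext DERIV_imp_deriv)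
    have Ec: "continuous_on UNIV (E n)" for n
      using E(2) by (auto intro!: continuous_at_imp_continuous_on DERIV_isCont)
    have mE: "E 1 \<in> borel_measurable ?M" by (rule continuous_measurable_lebesgue_on[OF Ec])
    have iE: "integrable ?M (\<lambda>t. E 1 t *\<^sub>R k t)" if k: "integrable ?M k" for k :: "real \<Rightarrow> complex"
    proof -
      obtain C where "\<forall>x\<in>E 1 ` {a..b}. norm x \<le> C"
        using compact_imp_bounded[OF compact_continuous_image[OF continuous_on_subset[OF Ec]]] unfolding bounded_iff by blast
      then have C: "\<And>t. t \<in> {a..b} \<Longrightarrow> \<bar>E 1 t\<bar> \<le> C" by simp
      have "integrable ?M (\<lambda>t. (indicator {a..b} t * E 1 t) *\<^sub>R k t)"
      proof (rule integrable_bounded_scaleR[OF k, of _ "\<bar>C\<bar>"])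
        show "\<bar>indicator {a..b} t * E 1 t\<bar> \<le> \<bar>C\<bar>" for t using C[of t] by (auto simp: indicator_def)
        show "(\<lambda>t. indicator {a..b} t * E 1 t) \<in> borel_measurable ?M"
          by (subst measurable_cong[where g="E 1"]) (auto simp: indicator_def intro: mE[simplified])
      qed
      then show ?thesis
        by (rule Bochner_Integration.integrable_cong[THEN iffD1, rotated 2]) (auto simp: indicator_def)
    qed
    have "(\<integral>t. E 1 t *\<^sub>R G t \<partial>?M) = - (\<integral>t. \<eta> t *\<^sub>R g t \<partial>?M)"
      unfolding G_def
    proof (rule primitive_test_function[OF g ab])
      show "(\<eta> has_real_derivative E 1 t) (at t)" for t using E(2)[of 0 t] E(1) by simp
      have "b \<notin> K" using K(2) by auto
      then show "\<eta> b = 0" by (rule K(3))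
    qed (rule Ec)
    then show "(\<integral>t. deriv \<eta> t *\<^sub>R (f t - G t) \<partial>?M) = 0"
      using w[OF t] iE[OF f] iE[OF Gi] unfolding de scaleR_diff_right by simp
  qed
  then obtain c where c: "AE t in ?M. f t - G t = c" by blast
  have "AE t in ?M. f t = c + integral {a..t} g"
    using c by eventually_elim (auto simp: G_def algebra_simps)
  then show ?thesis by blast
qed

section \<open>Functionals of Bochner integrals; completeness of the weighted space\<close>

lemma borel_measurable_AE_lebesgue_on:
  fixes f g :: "real \<Rightarrow> 'b::euclidean_space"
  assumes f: "f \<in> borel_measurable (lebesgue_on J)" and ae: "AE x in lebesgue_on J. f x = g x" and J: "J \<in> sets lebesgue"
  shows "g \<in> borel_measurable (lebesgue_on J)"
proof -
  have "AE x in lebesgue. (if x \<in> J then f x else 0) = (if x \<in> J then g x else 0)"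
    using ae J by (simp add: AE_restrict_space_iff)
  then have "(\<lambda>x. if x \<in> J then g x else 0) \<in> borel_measurable lebesgue"
    by (rule borel_measurable_AE[OF borel_measurable_if_I[OF f J]])
  then show ?thesis by (rule borel_measurable_if_D)
qed

lemma strongly_measurable_continuous:
  fixes T :: "'b::real_normed_vector \<Rightarrow> 'c::euclidean_space" and f :: "real \<Rightarrow> 'b"
  assumes f: "strongly_measurable (lebesgue_on J) f" and T: "continuous_on UNIV T" and J: "J \<in> sets lebesgue"
  shows "(\<lambda>x. T (f x)) \<in> borel_measurable (lebesgue_on J)"
proof -
  obtain s where s: "\<And>n. simple_function (lebesgue_on J) (s n)" "AE x in lebesgue_on J. (\<lambda>n. s n x) \<longlonglongrightarrow> f x"
    using f unfolding strongly_measurable_def by blast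
  have m: "(\<lambda>x. T (s n x)) \<in> borel_measurable (lebesgue_on J)" for n
    using simple_function_compose1[OF s(1)] by (rule borel_measurable_simple_function)
  have "(\<lambda>x. lim (\<lambda>n. T (s n x))) \<in> borel_measurable (lebesgue_on J)"
    by (rule borel_measurable_lim_metric[OF m])
  then show ?thesis
  proof (rule borel_measurable_AE_lebesgue_on[OF _ _ J])
    show "AE x in lebesgue_on J. lim (\<lambda>n. T (s n x)) = T (f x)"
      using s(2) by eventually_elim (auto intro!: limI continuous_on_tendsto_compose[OF T])
  qed
qed

text \<open>
  A bounded functional turns strong measurability, Bochner integrals and weak derivatives into their
  scalar counterparts, for which the Lebesgue theory is available.
\<close>
lemma strongly_measurable_functional:
  fixes T :: "'b::real_normed_vector \<Rightarrow> 'c::euclidean_space" and f :: "real \<Rightarrow> 'b"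
  assumes f: "strongly_measurable (lebesgue_on J) f" and T: "bounded_linear T" and J: "J \<in> sets lebesgue"
  shows "(\<lambda>x. T (f x)) \<in> borel_measurable (lebesgue_on J)"
  by (rule strongly_measurable_continuous[OF f linear_continuous_on[OF T] J])

lemma strongly_measurable_dist_simple:
  fixes f :: "real \<Rightarrow> 'b::real_normed_vector"
  assumes f: "strongly_measurable (lebesgue_on J) f" and g: "simple_function (lebesgue_on J) g" and J: "J \<in> sets lebesgue"
  shows "(\<lambda>x. norm (f x - g x)) \<in> borel_measurable (lebesgue_on J)"
proof -
  obtain s where s: "\<And>n. simple_function (lebesgue_on J) (s n)" "AE x in lebesgue_on J. (\<lambda>n. s n x) \<longlonglongrightarrow> f x"
    using f unfolding strongly_measurable_def by blast
  have "strongly_measurable (lebesgue_on J) (\<lambda>x. (f x, g x))"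
    unfolding strongly_measurable_def
  proof (intro exI conjI allI)
    show "simple_function (lebesgue_on J) (\<lambda>x. (s n x, g x))" for n by (rule simple_function_Pair[OF s(1) g])
    show "AE x in lebesgue_on J. (\<lambda>n. (s n x, g x)) \<longlonglongrightarrow> (f x, g x)"
      using s(2) by eventually_elim (intro tendsto_intros)
  qed
  from strongly_measurable_continuous[OF this _ J, of "\<lambda>p. norm (fst p - snd p)"]
  show ?thesis by (simp add: continuous_intros)
qed

lemma bochner_integral_functional:
  fixes T :: "'b::real_normed_vector \<Rightarrow> 'c::euclidean_space" and f :: "real \<Rightarrow> 'b"
  assumes f: "bochner_integral_is (lebesgue_on J) f I" and T: "bounded_linear T" and J: "J \<in> sets lebesgue"
  shows "has_bochner_integral (lebesgue_on J) (\<lambda>x. T (f x)) (T I)"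
proof -
  let ?M = "lebesgue_on J"
  interpret T: bounded_linear T by fact
  obtain s where s: "\<And>n::nat. Bochner_Integration.simple_bochner_integrable ?M (s n)"
     "(\<lambda>n. \<integral>\<^sup>+x. ennreal (norm (f x - s n x)) \<partial>?M) \<longlonglongrightarrow> 0"
     "(\<lambda>n. Bochner_Integration.simple_bochner_integral ?M (s n)) \<longlonglongrightarrow> I" and sm: "strongly_measurable ?M f"
    using f unfolding bochner_integral_is_def by blast
  obtain K where K: "K > 0" "\<And>x i. norm (T (f x) - T (s i x)) \<le> norm (f x - s i x) * K"
    using T.pos_bounded by (auto simp: T.diff[symmetric])
  show ?thesis
  proof (rule has_bochner_integral.intros[of _ _ "\<lambda>n x. T (s n x)"])
    show "(\<lambda>x. T (f x)) \<in> borel_measurable ?M" by (rule strongly_measurable_functional[OF sm T J])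
    show "Bochner_Integration.simple_bochner_integrable ?M (\<lambda>x. T (s n x))" for n
      using s(1)[of n] by (rule simple_bochner_integrable_compose2[where p="\<lambda>x y. T x", rotated]) (use s(1) T.zero in auto)
    have "(\<lambda>n. Bochner_Integration.simple_bochner_integral ?M (\<lambda>x. T (s n x))) = (\<lambda>n. T (Bochner_Integration.simple_bochner_integral ?M (s n)))"
      using simple_bochner_integral_linear[OF T.linear s(1)] by auto
    then show "(\<lambda>n. Bochner_Integration.simple_bochner_integral ?M (\<lambda>x. T (s n x))) \<longlonglongrightarrow> T I"
      using T.tendsto[OF s(3)] by simp
    show "(\<lambda>n. \<integral>\<^sup>+x. ennreal (norm (T (f x) - T (s n x))) \<partial>?M) \<longlonglongrightarrow> 0"
    proof (rule tendsto_sandwich)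
      show "\<forall>\<^sub>F n in sequentially. 0 \<le> (\<integral>\<^sup>+x. ennreal (norm (T (f x) - T (s n x))) \<partial>?M)" by simp
      show "(\<lambda>n. 0::ennreal) \<longlonglongrightarrow> 0" by simp
      show "\<forall>\<^sub>F n in sequentially. (\<integral>\<^sup>+x. ennreal (norm (T (f x) - T (s n x))) \<partial>?M) \<le> ennreal K * (\<integral>\<^sup>+x. ennreal (norm (f x - s n x)) \<partial>?M)"
      proof (intro always_eventually allI)
        fix n
        have "(\<integral>\<^sup>+x. ennreal (norm (T (f x) - T (s n x))) \<partial>?M) \<le> (\<integral>\<^sup>+x. ennreal K * ennreal (norm (f x - s n x)) \<partial>?M)"
          using K by (intro nn_integral_mono) (auto simp: ac_simps ennreal_mult[symmetric])
        also have "\<dots> = ennreal K * (\<integral>\<^sup>+x. ennreal (norm (f x - s n x)) \<partial>?M)"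
        proof (rule nn_integral_cmult)
          have "simple_function ?M (s n)" using s(1)[of n] by (auto elim: simple_bochner_integrable.cases)
          from strongly_measurable_dist_simple[OF sm this J]
          show "(\<lambda>x. ennreal (norm (f x - s n x))) \<in> borel_measurable ?M" by measurable
        qed
        finally show "(\<integral>\<^sup>+x. ennreal (norm (T (f x) - T (s n x))) \<partial>?M) \<le> ennreal K * (\<integral>\<^sup>+x. ennreal (norm (f x - s n x)) \<partial>?M)" .
      qed
      show "(\<lambda>n. ennreal K * (\<integral>\<^sup>+x. ennreal (norm (f x - s n x)) \<partial>?M)) \<longlonglongrightarrow> 0"
        using ennreal_tendsto_cmult[OF _ s(2), of K] by simp
    qed
  qed
qed

lemma bochner_L2_functional:
  fixes T :: "'b::real_normed_vector \<Rightarrow> 'c::euclidean_space" and f :: "real \<Rightarrow> 'b"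
  assumes f: "bochner_L2 {a<..<b} f" and T: "bounded_linear T"
  shows "(\<lambda>x. T (f x)) \<in> borel_measurable (lebesgue_on {a<..<b})"
    "integrable (lebesgue_on {a<..<b}) (\<lambda>x. (norm (T (f x)))\<^sup>2)"
    "integrable (lebesgue_on {a<..<b}) (\<lambda>x. T (f x))"
    "integrable (lebesgue_on {a<..<b}) (\<lambda>x. norm (f x))"
proof -
  let ?M = "lebesgue_on {a<..<b}"
  interpret F: finite_measure ?M by (rule lebesgue_on_interval_finite)
  have f2: "integrable ?M (\<lambda>t. (norm (f t))\<^sup>2)" "strongly_measurable ?M f" using f by (auto simp: bochner_L2_def)
  show m [measurable]: "(\<lambda>x. T (f x)) \<in> borel_measurable ?M"
    by (rule strongly_measurable_functional[OF f2(2) T]) simp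
  have "(\<lambda>x. sqrt ((norm (f x))\<^sup>2)) \<in> borel_measurable ?M" using f2(1) by measurable
  then have mn [measurable]: "(\<lambda>x. norm (f x)) \<in> borel_measurable ?M" by simp
  show n: "integrable ?M (\<lambda>x. norm (f x))"
  proof (rule Bochner_Integration.integrable_bound)
    show "integrable ?M (\<lambda>x. 1 + (norm (f x))\<^sup>2)" using f2 by simp
    have "y \<le> 1 + y\<^sup>2" for y :: real using zero_le_power2[of "y - 1/2"] by (simp add: power2_eq_square algebra_simps)
    then show "AE x in ?M. norm (norm (f x)) \<le> norm (1 + (norm (f x))\<^sup>2)" by (auto intro!: AE_I2)
  qed measurable
  obtain K where K: "0 < K" "\<And>x. norm (T x) \<le> norm x * K" using bounded_linear.pos_bounded[OF T] by blast
  show "integrable ?M (\<lambda>x. T (f x))"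
  proof (rule Bochner_Integration.integrable_bound)
    show "integrable ?M (\<lambda>x. norm (f x) * K)" using n by simp
    show "AE x in ?M. norm (T (f x)) \<le> norm (norm (f x) * K)" using K by (auto intro!: AE_I2)
  qed measurable
  show "integrable ?M (\<lambda>x. (norm (T (f x)))\<^sup>2)"
  proof (rule Bochner_Integration.integrable_bound)
    show "integrable ?M (\<lambda>x. (norm (f x))\<^sup>2 * K\<^sup>2)" using f2 by simp
    show "AE x in ?M. norm ((norm (T (f x)))\<^sup>2) \<le> norm ((norm (f x))\<^sup>2 * K\<^sup>2)"
      using power_mono[OF K(2), of _ 2] by (auto intro!: AE_I2 simp: power_mult_distrib)
  qed measurable
qed

lemma bochner_weak_deriv_functional:
  fixes T :: "'b::real_normed_vector \<Rightarrow> 'c::euclidean_space" and f :: "real \<Rightarrow> 'b"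
  assumes w: "bochner_weak_deriv {a<..<b} u v" and T: "bounded_linear T" and \<eta>: "test_function {a<..<b} \<eta>"
  shows "integrable (lebesgue_on {a<..<b}) (\<lambda>t. deriv \<eta> t *\<^sub>R T (u t))" "integrable (lebesgue_on {a<..<b}) (\<lambda>t. \<eta> t *\<^sub>R T (v t))"
    "(\<integral>t. deriv \<eta> t *\<^sub>R T (u t) \<partial>lebesgue_on {a<..<b}) = - (\<integral>t. \<eta> t *\<^sub>R T (v t) \<partial>lebesgue_on {a<..<b})"
proof -
  interpret T: bounded_linear T by fact
  obtain I where I: "bochner_integral_is (lebesgue_on {a<..<b}) (\<lambda>t. deriv \<eta> t *\<^sub>R u t) (- I)"
     "bochner_integral_is (lebesgue_on {a<..<b}) (\<lambda>t. \<eta> t *\<^sub>R v t) I"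
    using w \<eta> unfolding bochner_weak_deriv_def by blast
  have 1: "has_bochner_integral (lebesgue_on {a<..<b}) (\<lambda>t. deriv \<eta> t *\<^sub>R T (u t)) (- T I)"
    using bochner_integral_functional[OF I(1) T] by (simp add: T.scaleR T.neg)
  have 2: "has_bochner_integral (lebesgue_on {a<..<b}) (\<lambda>t. \<eta> t *\<^sub>R T (v t)) (T I)"
    using bochner_integral_functional[OF I(2) T] by (simp add: T.scaleR)
  show "integrable (lebesgue_on {a<..<b}) (\<lambda>t. deriv \<eta> t *\<^sub>R T (u t))" "integrable (lebesgue_on {a<..<b}) (\<lambda>t. \<eta> t *\<^sub>R T (v t))"
    "(\<integral>t. deriv \<eta> t *\<^sub>R T (u t) \<partial>lebesgue_on {a<..<b}) = - (\<integral>t. \<eta> t *\<^sub>R T (v t) \<partial>lebesgue_on {a<..<b})"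
    using 1 2 by (auto simp: has_bochner_integral_iff)
qed

subsection \<open>Completeness\<close>

lemma omega_le_1: "omega \<phi> \<le> 1"
  by (simp add: omega_def)

lemma omega_nonneg: "\<phi> \<in> {0..pi} \<Longrightarrow> 0 \<le> omega \<phi>"
  by (simp add: omega_def sin_ge_zero)

lemma finite_omega_measure: "finite_measure omega_measure"
proof
  have "emeasure omega_measure (space omega_measure) = (\<integral>\<^sup>+\<phi>. ennreal (omega \<phi>) \<partial>lebesgue_on {0<..<pi})"
    unfolding omega_measure_def
    by (subst emeasure_density[OF omega_measurable]) (auto intro!: nn_integral_cong simp: indicator_def)
  also have "\<dots> \<le> (\<integral>\<^sup>+\<phi>. 1 \<partial>lebesgue_on {0<..<pi})"
    by (intro nn_integral_mono) (auto simp: omega_le_1 ennreal_le_1)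
  also have "\<dots> < \<infinity>" by (simp add: emeasure_restrict_space)
  finally show "emeasure omega_measure (space omega_measure) \<noteq> \<infinity>" by simp
qed

lemma L2_omega_relI: "F \<in> L2_omega \<Longrightarrow> L2_omega_rel F F"
  by (simp add: L2_omega_rel_def)

lemma hspace_exhaust:
  obtains F where "F \<in> L2_omega" "f = abs_hspace F"
proof -
  have "\<exists>F. F \<in> L2_omega \<and> f = abs_hspace F"
    by (induction f rule: hspace.abs_induct) (auto simp: L2_omega_rel_def)
  then show ?thesis using that by blast
qed

lemma hinner_abs: "F \<in> L2_omega \<Longrightarrow> G \<in> L2_omega \<Longrightarrow> hinner (abs_hspace F) (abs_hspace G) = (\<integral>\<phi>. F \<phi> * cnj (G \<phi>) \<partial>omega_measure)"
  by (simp add: hinner.abs_eq L2_omega_relI)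

lemma norm_abs_hspace: "F \<in> L2_omega \<Longrightarrow> (norm (abs_hspace F))\<^sup>2 = (\<integral>\<phi>. (cmod (F \<phi>))\<^sup>2 \<partial>omega_measure)"
proof -
  assume F: "F \<in> L2_omega"
  have "(\<integral>\<phi>. F \<phi> * cnj (F \<phi>) \<partial>omega_measure) = (\<integral>\<phi>. complex_of_real ((cmod (F \<phi>))\<^sup>2) \<partial>omega_measure)"
    by (simp only: complex_norm_square)
  then show ?thesis
    unfolding power2_norm_eq_inner inner_hspace_def hinner_abs[OF F F] by (simp only: integral_complex_of_real Re_complex_of_real)
qed

lemma abs_hspace_diff: "F \<in> L2_omega \<Longrightarrow> G \<in> L2_omega \<Longrightarrow> abs_hspace F - abs_hspace G = abs_hspace (\<lambda>\<phi>. F \<phi> - G \<phi>)"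
  using L2_omega_scale[of G "-1"]
  by (simp add: minus_hspace_def hscale.abs_eq plus_hspace.abs_eq L2_omega_relI)

lemma L2_omega_diff: "F \<in> L2_omega \<Longrightarrow> G \<in> L2_omega \<Longrightarrow> (\<lambda>\<phi>. F \<phi> - G \<phi>) \<in> L2_omega"
  using L2_omega_add[OF _ L2_omega_scale[of G "-1"], of F] by simp

lemma abs_hspace_eqI: "F \<in> L2_omega \<Longrightarrow> G \<in> L2_omega \<Longrightarrow> (AE \<phi> in omega_measure. F \<phi> = G \<phi>) \<Longrightarrow> abs_hspace F = abs_hspace G"
  by (rule Quotient3_rel_abs[OF Quotient3_hspace]) (simp add: L2_omega_rel_def)

lemma nn_norm_abs_hspace: "F \<in> L2_omega \<Longrightarrow> (\<integral>\<^sup>+\<phi>. ennreal ((cmod (F \<phi>))\<^sup>2) \<partial>omega_measure) = ennreal ((norm (abs_hspace F))\<^sup>2)"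
  by (subst nn_integral_eq_integral) (auto simp: L2_omega_def norm_abs_hspace)

text \<open>The measure is finite, so smallness in \<open>L\<^sup>2\<close> is smallness in \<open>L\<^sup>1\<close>; here by \<open>|F| \<le> e + |F|\<^sup>2/e\<close>.\<close>
lemma nn_L1_bound: 
  assumes "F \<in> L2_omega" "norm (abs_hspace F) \<le> e" "0 < e"
  shows "(\<integral>\<^sup>+\<phi>. ennreal (cmod (F \<phi>)) \<partial>omega_measure) \<le> ennreal e * (emeasure omega_measure (space omega_measure) + 1)"
proof -
  have [measurable]: "F \<in> borel_measurable omega_measure" using assms by (simp add: L2_omega_def)
  have "(\<integral>\<^sup>+\<phi>. ennreal (cmod (F \<phi>)) \<partial>omega_measure) \<le> (\<integral>\<^sup>+\<phi>. ennreal e + ennreal (1/e) * ennreal ((cmod (F \<phi>))\<^sup>2) \<partial>omega_measure)"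
  proof (rule nn_integral_mono)
    fix \<phi>
    have "y \<le> e + (1/e) * y\<^sup>2" for y :: real
    proof -
      have "0 \<le> (y - e/2)\<^sup>2" by simp
      then have "y * e \<le> y\<^sup>2 + e\<^sup>2" by (simp add: power2_eq_square algebra_simps) (use zero_le_square[of e] in linarith)
      then show ?thesis using assms(3) by (simp add: field_simps power2_eq_square)
    qed
    then show "ennreal (cmod (F \<phi>)) \<le> ennreal e + ennreal (1/e) * ennreal ((cmod (F \<phi>))\<^sup>2)"
      using assms(3) by (simp add: ennreal_mult[symmetric] ennreal_plus[symmetric] del: ennreal_plus)
  qed
  also have "\<dots> = ennreal e * emeasure omega_measure (space omega_measure) + ennreal (1/e) * ennreal ((norm (abs_hspace F))\<^sup>2)"
    by (subst nn_integral_add) (auto simp: nn_integral_cmult nn_norm_abs_hspace[OF assms(1)])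
  also have "ennreal (1/e) * ennreal ((norm (abs_hspace F))\<^sup>2) \<le> ennreal e"
  proof -
    have "(norm (abs_hspace F))\<^sup>2 \<le> e\<^sup>2" using assms by (intro power_mono) auto
    then have "(1/e) * (norm (abs_hspace F))\<^sup>2 \<le> e" using assms(3) by (simp add: field_simps power2_eq_square)
    then show ?thesis using assms(3) by (simp add: ennreal_mult[symmetric])
  qed
  finally show ?thesis by (simp add: distrib_left)
qed

text \<open>
  The Riesz-Fischer argument: a subsequence with geometrically small increments converges almost
  everywhere, and Fatou's lemma gives convergence in norm. Completeness is needed to extend the uniformly
  continuous map below to the closed time interval.
\<close>
instance hspace :: complete_space
proof
  fix X :: "nat \<Rightarrow> hspace" assume X: "Cauchy X"
  let ?\<mu> = "omega_measure"
  interpret F: finite_measure ?\<mu> by (rule finite_omega_measure)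
  have "\<exists>N. \<forall>m\<ge>N. \<forall>n\<ge>N. norm (X m - X n) < (1/2)^k" for k :: nat
    using CauchyD[OF X, of "(1/2)^k"] by auto
  then obtain N where N: "\<And>k m n. N k \<le> m \<Longrightarrow> N k \<le> n \<Longrightarrow> norm (X m - X n) < (1/2)^k" by metis
  define r where "r k = (\<Sum>i\<le>k. N i) + k" for k
  have rN: "N k \<le> r k" for k unfolding r_def by (intro trans_le_add1 member_le_sum) auto
  have rm: "r k \<le> r j" if "k \<le> j" for k j unfolding r_def using that by (intro add_mono sum_mono2) auto
  have rX: "norm (X (r j) - X (r k)) < (1/2)^k" if "k \<le> j" for k j
    using N[of k "r j" "r k"] rN[of k] rm[OF that] by linarith
  have "\<exists>F. \<forall>k. F k \<in> L2_omega \<and> X (r k) = abs_hspace (F k)"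
    by (intro choice allI) (metis hspace_exhaust)
  then obtain F where F: "\<And>k. F k \<in> L2_omega" "\<And>k. X (r k) = abs_hspace (F k)" by blast
  have mF [measurable]: "F k \<in> borel_measurable ?\<mu>" for k using F(1) by (rule L2_omega_measurable)
  have ndiff: "norm (abs_hspace (\<lambda>\<phi>. F j \<phi> - F k \<phi>)) < (1/2)^k" if "k \<le> j" for k j
    using rX[OF that] F by (simp add: abs_hspace_diff)
  have "(\<integral>\<^sup>+\<phi>. (\<Sum>k. ennreal (cmod (F (Suc k) \<phi> - F k \<phi>))) \<partial>?\<mu>) = (\<Sum>k. \<integral>\<^sup>+\<phi>. ennreal (cmod (F (Suc k) \<phi> - F k \<phi>)) \<partial>?\<mu>)"
    by (rule nn_integral_suminf) measurable
  also have "\<dots> \<le> (\<Sum>k. ennreal ((1/2)^k) * (emeasure ?\<mu> (space ?\<mu>) + 1))"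
    using ndiff[of _ "Suc _"] by (intro suminf_le nn_L1_bound L2_omega_diff F) (auto intro: less_imp_le)
  also have "\<dots> = (\<Sum>k. ennreal ((1/2)^k)) * (emeasure ?\<mu> (space ?\<mu>) + 1)" by simp
  also have "(\<Sum>k. ennreal ((1/2)^k)) = ennreal 2"
    by (rule suminf_ennreal_eq) (use geometric_sums[of "1/2::real"] in auto)
  also have "ennreal 2 * (emeasure ?\<mu> (space ?\<mu>) + 1) < \<infinity>"
    using F.emeasure_finite[of "space ?\<mu>"] by (simp add: ennreal_mult_less_top less_top[symmetric] ennreal_mult_eq_top_iff)
  finally have fin: "(\<integral>\<^sup>+\<phi>. (\<Sum>k. ennreal (cmod (F (Suc k) \<phi> - F k \<phi>))) \<partial>?\<mu>) \<noteq> \<infinity>" by simp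
  define G where "G \<phi> = lim (\<lambda>k. F k \<phi>)" for \<phi>
  have mG [measurable]: "G \<in> borel_measurable ?\<mu>" unfolding G_def by (rule borel_measurable_lim_metric) measurable
  have "AE \<phi> in ?\<mu>. (\<Sum>k. ennreal (cmod (F (Suc k) \<phi> - F k \<phi>))) \<noteq> \<infinity>"
    by (rule nn_integral_PInf_AE[OF _ fin]) measurable
  then have lim: "AE \<phi> in ?\<mu>. (\<lambda>k. F k \<phi>) \<longlonglongrightarrow> G \<phi>"
  proof eventually_elim
    case (elim \<phi>)
    then have "summable (\<lambda>k. cmod (F (Suc k) \<phi> - F k \<phi>))"
      by (intro summable_suminf_not_top) auto
    then have "summable (\<lambda>k. F (Suc k) \<phi> - F k \<phi>)" by (rule summable_norm_cancel)
    then have "convergent (\<lambda>n. \<Sum>k<n. F (Suc k) \<phi> - F k \<phi>)" by (simp add: summable_iff_convergent)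
    then have "convergent (\<lambda>n. F n \<phi> - F 0 \<phi>)" using sum_lessThan_telescope[of "\<lambda>n. F n \<phi>"] by simp
    then have "convergent (\<lambda>n. (F n \<phi> - F 0 \<phi>) + F 0 \<phi>)" by (intro convergent_add convergent_const)
    then show ?case unfolding G_def by (simp add: convergent_LIMSEQ_iff)
  qed
  have key: "(\<integral>\<^sup>+\<phi>. ennreal ((cmod (G \<phi> - F k \<phi>))\<^sup>2) \<partial>?\<mu>) \<le> ennreal (((1/2)^k)\<^sup>2)" for k
  proof -
    have "(\<integral>\<^sup>+\<phi>. ennreal ((cmod (G \<phi> - F k \<phi>))\<^sup>2) \<partial>?\<mu>) = (\<integral>\<^sup>+\<phi>. liminf (\<lambda>j. ennreal ((cmod (F j \<phi> - F k \<phi>))\<^sup>2)) \<partial>?\<mu>)"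
    proof (rule nn_integral_cong_AE)
      show "AE \<phi> in ?\<mu>. ennreal ((cmod (G \<phi> - F k \<phi>))\<^sup>2) = liminf (\<lambda>j. ennreal ((cmod (F j \<phi> - F k \<phi>))\<^sup>2))"
        using lim
      proof eventually_elim
        case (elim \<phi>)
        have "(\<lambda>j. ennreal ((cmod (F j \<phi> - F k \<phi>))\<^sup>2)) \<longlonglongrightarrow> ennreal ((cmod (G \<phi> - F k \<phi>))\<^sup>2)"
          by (intro tendsto_intros elim)
        then show ?case by (rule lim_imp_Liminf[OF sequentially_bot, symmetric])
      qed
    qed
    also have "\<dots> \<le> liminf (\<lambda>j. \<integral>\<^sup>+\<phi>. ennreal ((cmod (F j \<phi> - F k \<phi>))\<^sup>2) \<partial>?\<mu>)"
      by (rule nn_integral_liminf) measurable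
    also have "\<dots> \<le> ennreal (((1/2)^k)\<^sup>2)"
    proof (rule Liminf_le)
      show "\<forall>\<^sub>F j in sequentially. (\<integral>\<^sup>+\<phi>. ennreal ((cmod (F j \<phi> - F k \<phi>))\<^sup>2) \<partial>?\<mu>) \<le> ennreal (((1/2)^k)\<^sup>2)"
        using eventually_ge_at_top[of k]
      proof eventually_elim
        case (elim j)
        have "(norm (abs_hspace (\<lambda>\<phi>. F j \<phi> - F k \<phi>)))\<^sup>2 \<le> ((1/2)^k)\<^sup>2"
          using ndiff[OF elim] by (intro power_mono) auto
        then show ?case by (subst nn_norm_abs_hspace[OF L2_omega_diff[OF F(1) F(1)]]) (rule ennreal_leI)
      qed
    qed simp
    finally show ?thesis .
  qed
  have GF: "(\<lambda>\<phi>. G \<phi> - F k \<phi>) \<in> L2_omega" for k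
    using key[of k] unfolding L2_omega_def
    by (auto intro!: integrableI_bounded simp: less_top[symmetric] top_unique dest: order_le_less_trans[OF _ ennreal_less_top])
  have G: "G \<in> L2_omega" using L2_omega_add[OF GF[of 0] F(1)[of 0]] by simp
  have nk: "norm (abs_hspace G - X (r k)) \<le> (1/2)^k" for k
  proof -
    have "ennreal ((norm (abs_hspace (\<lambda>\<phi>. G \<phi> - F k \<phi>)))\<^sup>2) \<le> ennreal (((1/2)^k)\<^sup>2)"
      using key[of k] by (simp only: nn_norm_abs_hspace[OF GF])
    then have "(norm (abs_hspace (\<lambda>\<phi>. G \<phi> - F k \<phi>)))\<^sup>2 \<le> ((1/2)^k)\<^sup>2" by (subst (asm) ennreal_le_iff) auto
    then have "norm (abs_hspace (\<lambda>\<phi>. G \<phi> - F k \<phi>)) \<le> (1/2)^k" by (rule power2_le_imp_le) simp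
    then show ?thesis by (simp add: F(2) abs_hspace_diff G F(1))
  qed
  have "X \<longlonglongrightarrow> abs_hspace G"
  proof (rule LIMSEQ_I)
    fix e :: real assume e: "0 < e"
    obtain k where k: "(1/2::real)^k < e/2" using real_arch_pow_inv[of "e/2" "1/2"] e by auto
    show "\<exists>no. \<forall>n\<ge>no. norm (X n - abs_hspace G) < e"
    proof (intro exI[of _ "r k"] allI impI)
      fix n assume n: "r k \<le> n"
      have "norm (X n - X (r k)) < (1/2)^k" using N[of k n "r k"] rN[of k] n by linarith
      moreover have "norm (X n - abs_hspace G) \<le> norm (X n - X (r k)) + norm (abs_hspace G - X (r k))"
        by (metis norm_minus_commute norm_triangle_sub diff_add_cancel norm_triangle_ineq add_diff_eq diff_diff_eq2)
      ultimately show "norm (X n - abs_hspace G) < e" using nk[of k] k by linarith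
    qed
  qed
  then show "convergent X" by (rule convergentI)
qed

section \<open>The continuous representative in time\<close>

lemma finite_simple_image: "simple_function M s \<Longrightarrow> finite (s ` space M)"
  by (simp add: simple_function_def)

lemma closure_interval_minus_null:
  assumes "p < q" and N: "N \<in> null_sets lebesgue"
  shows "closure ({p<..<q} - N) = {p..q::real}"
proof
  show "closure ({p<..<q} - N) \<subseteq> {p..q}" by (rule closure_minimal) auto
  show "{p..q} \<subseteq> closure ({p<..<q} - N)"
  proof
    fix x assume x: "x \<in> {p..q}"
    show "x \<in> closure ({p<..<q} - N)"
      unfolding closure_approachable
    proof (intro allI impI)
      fix e :: real assume e: "0 < e"
      define U where "U = {max p (x-e)<..<min q (x+e)}"
      have "open U" "U \<noteq> {}" using x e assms(1) by (auto simp: U_def)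
      then have "\<not> negligible U" using open_not_negligible by blast
      then have "\<not> U \<subseteq> N" using N negligible_subset negligible_iff_null_sets by blast
      then obtain y where "y \<in> U" "y \<notin> N" by blast
      then show "\<exists>y\<in>{p<..<q} - N. dist y x < e" by (intro bexI[of _ y]) (auto simp: U_def dist_real_def)
    qed
  qed
qed

text \<open>
  Tested with a single vector, \<open>u\<close> is a primitive of \<open>v\<close> outside a null set. Strong measurability supplies a countable set
  \<open>D\<close> of vectors that approximates all values of \<open>u\<close>, so that one null set serves for all
  of them, and \<open>|u(t) - u(t')| \<le> |\<integral> |v| |\<close> follows off this set. Hence \<open>u\<close> is uniformly continuous there and
  extends.
\<close>
lemma weak_derivative_imp_continuous_representative:
  fixes u v :: "real \<Rightarrow> hspace"
  assumes pq: "p < q" and u: "bochner_L2 {p<..<q} u" and v: "bochner_L2 {p<..<q} v" and w: "bochner_weak_deriv {p<..<q} u v"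
  shows "\<exists>c. continuous_on {p..q} c \<and> (AE t in lebesgue_on {p<..<q}. c t = u t)"
proof -
  let ?J = "{p<..<q}"
  let ?M = "lebesgue_on ?J"
  obtain s where s: "\<And>n::nat. simple_function ?M (s n)" "AE x in ?M. (\<lambda>n. s n x) \<longlonglongrightarrow> u x"
    using u unfolding bochner_L2_def strongly_measurable_def by blast
  define D where "D = (\<Union>n. s n ` space ?M)"
  have cD: "countable D" unfolding D_def using finite_simple_image[OF s(1)] by (intro countable_UN) (auto intro: countable_finite)
  define T where "T h x = complex_of_real (inner x h)" for h x :: hspace
  have T: "bounded_linear (T h)" for h
    unfolding T_def by (rule bounded_linear_compose[OF bounded_linear_of_real bounded_linear_inner_left])
  have vn: "integrable ?M (\<lambda>t. norm (v t))" by (rule bochner_L2_functional(4)[OF v T])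
  then have vio: "(\<lambda>t. norm (v t)) integrable_on {p..q}"
    using integrable_on_lebesgue_on[OF vn] by (simp add: integrable_on_open_interval_real)
  define V where "V t = integral {p..t} (\<lambda>t. norm (v t))" for t
  have Vc: "continuous_on {p..q} V" unfolding V_def by (rule indefinite_integral_continuous_1[OF vio])
  have "\<exists>c. AE t in ?M. T h (u t) = c + integral {p..t} (\<lambda>t. T h (v t))" for h
  proof (rule weak_derivative_imp_primitive[OF pq])
    show "integrable ?M (\<lambda>t. T h (u t))" "integrable ?M (\<lambda>t. T h (v t))"
      by (rule bochner_L2_functional(3)[OF u T], rule bochner_L2_functional(3)[OF v T])
  qed (rule bochner_weak_deriv_functional(3)[OF w T])
  then obtain c where c: "\<And>h. AE t in ?M. T h (u t) = c h + integral {p..t} (\<lambda>t. T h (v t))" by metis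
  have "AE t in ?M. \<forall>h\<in>D. T h (u t) = c h + integral {p..t} (\<lambda>t. T h (v t))"
    using c cD by (simp add: AE_ball_countable)
  then have "AE t in ?M. (\<forall>h\<in>D. T h (u t) = c h + integral {p..t} (\<lambda>t. T h (v t))) \<and> (\<lambda>n. s n t) \<longlonglongrightarrow> u t"
    using s(2) by eventually_elim auto
  from AE_E3[OF this] obtain N where N0: "N \<in> null_sets ?M"
    "\<And>t. t \<in> space ?M - N \<Longrightarrow> (\<forall>h\<in>D. T h (u t) = c h + integral {p..t} (\<lambda>t. T h (v t))) \<and> (\<lambda>n. s n t) \<longlonglongrightarrow> u t"
    by metis
  have N: "N \<in> null_sets ?M"
    "\<And>t. t \<in> ?J \<Longrightarrow> t \<notin> N \<Longrightarrow> (\<forall>h\<in>D. T h (u t) = c h + integral {p..t} (\<lambda>t. T h (v t))) \<and> (\<lambda>n. s n t) \<longlonglongrightarrow> u t"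
    using N0 by auto
  have sD: "s n t \<in> D" if "t \<in> ?J" for n t
    unfolding D_def using that by (intro UN_I[of n] imageI) simp_all
  have Nl: "N \<in> null_sets lebesgue" using N(1) by (simp add: null_sets_restrict_space)
  have inc: "\<bar>inner (u t - u t') h\<bar> \<le> norm h * \<bar>V t - V t'\<bar>"
    if h: "h = d1 - d2" "d1 \<in> D" "d2 \<in> D" and t: "t \<in> ?J - N" "t' \<in> ?J - N" for h d1 d2 t t'
  proof -
    have "\<bar>inner (u t - u t') h\<bar> \<le> norm h * (V t - V t')" if "t' \<le> t" "t \<in> ?J - N" "t' \<in> ?J - N" for t t'
    proof -
      have Ti: "(\<lambda>t. T h (v t)) integrable_on {p..q}" for h
        using integrable_on_lebesgue_on[OF bochner_L2_functional(3)[OF v T]] by (simp add: integrable_on_open_interval_real)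
      have comb: "integral {p..t} g - integral {p..t'} g = integral {t'..t} g" if "g integrable_on {p..q}" for g :: "real \<Rightarrow> 'z::banach"
        using Henstock_Kurzweil_Integration.integral_combine[of p t' t g] \<open>t' \<le> t\<close> \<open>t \<in> ?J - N\<close> \<open>t' \<in> ?J - N\<close> integrable_on_subinterval[OF that, of p t]
        by (auto simp: algebra_simps)
      have e: "T d (u t) - T d (u t') = integral {t'..t} (\<lambda>t. T d (v t))" if "d \<in> D" for d
        using N(2)[of t] N(2)[of t'] that \<open>t \<in> ?J - N\<close> \<open>t' \<in> ?J - N\<close> comb[OF Ti[of d]] by auto
      have Tis: "(\<lambda>t. T d (v t)) integrable_on {t'..t}" for d
        using integrable_on_subinterval[OF Ti, of t' t d] \<open>t \<in> ?J - N\<close> \<open>t' \<in> ?J - N\<close> by auto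
      have Th: "T h x = T d1 x - T d2 x" for x by (simp add: T_def h(1) inner_diff_right)
      have "T h (u t - u t') = integral {t'..t} (\<lambda>t. T h (v t))"
      proof -
        have "T h (u t - u t') = (T d1 (u t) - T d1 (u t')) - (T d2 (u t) - T d2 (u t'))"
          unfolding Th by (simp add: T_def inner_diff_left)
        also have "\<dots> = integral {t'..t} (\<lambda>t. T d1 (v t) - T d2 (v t))"
          unfolding e[OF h(2)] e[OF h(3)] by (rule Henstock_Kurzweil_Integration.integral_diff[symmetric]) (rule Tis)+
        finally show ?thesis unfolding Th .
      qed
      also have "norm \<dots> \<le> integral {t'..t} (\<lambda>t. norm h * norm (v t))"
      proof (rule Henstock_Kurzweil_Integration.integral_norm_bound_integral[OF Tis])
        have "(\<lambda>t. norm (v t)) integrable_on {t'..t}"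
          using integrable_on_subinterval[OF vio, of t' t] \<open>t \<in> ?J - N\<close> \<open>t' \<in> ?J - N\<close> by auto
        then show "(\<lambda>t. norm h * norm (v t)) integrable_on {t'..t}" by (rule integrable_on_mult_right)
        show "norm (T h (v t)) \<le> norm h * norm (v t)" for t
          using Cauchy_Schwarz_ineq2[of "v t" h] by (simp add: T_def mult.commute)
      qed
      also have "\<dots> = norm h * (V t - V t')" using comb[OF vio] by (simp add: V_def)
      finally show ?thesis by (simp add: T_def)
    qed
    note le = this
    show ?thesis
    proof (cases "t' \<le> t")
      case True
      then show ?thesis using le[OF True t] by (smt (verit) mult_left_mono norm_ge_zero)
    next
      case False
      have "\<bar>inner (u t - u t') h\<bar> = \<bar>inner (u t' - u t) h\<bar>" by (simp add: inner_diff_left abs_minus_commute)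
      also have "\<dots> \<le> norm h * (V t' - V t)" using False t by (intro le) auto
      also have "\<dots> \<le> norm h * \<bar>V t - V t'\<bar>" by (intro mult_left_mono) auto
      finally show ?thesis .
    qed
  qed
  have lip: "norm (u t - u t') \<le> \<bar>V t - V t'\<bar>" if t: "t \<in> ?J - N" "t' \<in> ?J - N" for t t'
  proof -
    have l: "(\<lambda>n. s n t - s n t') \<longlonglongrightarrow> u t - u t'" using N(2) t by (intro tendsto_diff) auto
    have "\<bar>inner (u t - u t') (u t - u t')\<bar> \<le> norm (u t - u t') * \<bar>V t - V t'\<bar>"
    proof (rule tendsto_le[OF sequentially_bot])
      show "(\<lambda>n. norm (s n t - s n t') * \<bar>V t - V t'\<bar>) \<longlonglongrightarrow> norm (u t - u t') * \<bar>V t - V t'\<bar>"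
        by (intro tendsto_intros l)
      show "(\<lambda>n. \<bar>inner (u t - u t') (s n t - s n t')\<bar>) \<longlonglongrightarrow> \<bar>inner (u t - u t') (u t - u t')\<bar>"
        by (intro tendsto_intros l)
      show "\<forall>\<^sub>F n in sequentially. \<bar>inner (u t - u t') (s n t - s n t')\<bar> \<le> norm (s n t - s n t') * \<bar>V t - V t'\<bar>"
        by (intro always_eventually allI inc[OF refl _ _ t] sD) (use t in auto)
    qed
    then have "norm (u t - u t') * norm (u t - u t') \<le> norm (u t - u t') * \<bar>V t - V t'\<bar>"
      by (simp add: dot_square_norm power2_eq_square)
    then show ?thesis by (cases "norm (u t - u t') = 0") auto
  qed
  have clos: "closure (?J - N) = {p..q}" by (rule closure_interval_minus_null[OF pq Nl])
  have Vu: "uniformly_continuous_on {p..q} V" by (rule compact_uniformly_continuous[OF Vc]) simp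
  have uc: "uniformly_continuous_on (?J - N) u"
    unfolding uniformly_continuous_on_def
  proof (intro allI impI)
    fix e :: real assume "0 < e"
    then obtain d where d: "0 < d" "\<And>x x'. x \<in> {p..q} \<Longrightarrow> x' \<in> {p..q} \<Longrightarrow> dist x' x < d \<Longrightarrow> dist (V x') (V x) < e"
      using Vu unfolding uniformly_continuous_on_def by metis
    show "\<exists>d>0. \<forall>x\<in>?J - N. \<forall>x'\<in>?J - N. dist x' x < d \<longrightarrow> dist (u x') (u x) < e"
    proof (intro exI[of _ d] conjI ballI impI d)
      fix x x' assume x: "x \<in> ?J - N" "x' \<in> ?J - N" "dist x' x < d"
      have "dist (V x') (V x) < e" using x by (intro d) auto
      then show "dist (u x') (u x) < e" using lip[OF x(2,1)] by (simp add: dist_norm)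
    qed
  qed
  obtain g where g: "uniformly_continuous_on (closure (?J - N)) g" "\<And>x. x \<in> ?J - N \<Longrightarrow> u x = g x"
    by (rule uniformly_continuous_on_extension_on_closure[OF uc]) blast
  show ?thesis
  proof (intro exI[of _ g] conjI)
    show "continuous_on {p..q} g" using uniformly_continuous_imp_continuous[OF g(1)] by (simp add: clos)
    show "AE t in ?M. g t = u t"
      by (rule AE_I'[OF N(1)]) (use g(2) in fastforce)
  qed
qed

lemma cont_rep_props:
  assumes pq: "p < q" and u: "bochner_L2 {p<..<q} (\<lambda>t. emb (w t))" and v: "bochner_L2 {p<..<q} v" and w: "bochner_weak_deriv {p<..<q} (\<lambda>t. emb (w t)) v"
  shows "continuous_on {p..q} (cont_rep {p<..<q} w)" "AE t in lebesgue_on {p<..<q}. cont_rep {p<..<q} w t = emb (w t)"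
proof -
  have cl: "closure {p<..<q} = {p..q}" using pq by simp
  have "\<exists>u. continuous_on (closure {p<..<q}) u \<and> (AE t in lebesgue_on {p<..<q}. u t = emb (w t))"
    unfolding cl by (rule weak_derivative_imp_continuous_representative[OF pq u v w])
  from someI_ex[OF this]
  show "continuous_on {p..q} (cont_rep {p<..<q} w)" "AE t in lebesgue_on {p<..<q}. cont_rep {p<..<q} w t = emb (w t)"
    unfolding cont_rep_def cl by auto
qed

subsection \<open>The coordinate\<close>

text \<open>In this coordinate \<open>\<omega> d/d\<phi>\<close> becomes \<open>d/dx\<close>, so that \<open>A\<^sub>0 = - 4 \<omega>\<^sup>-\<^sup>2 d\<^sup>2/dx\<^sup>2\<close>.\<close>
definition arclen :: "real \<Rightarrow> real" where "arclen \<phi> = integral {0..\<phi>} (\<lambda>s. 1 / omega s)"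

lemma omega_continuous: "continuous_on S omega"
  unfolding omega_def by (intro continuous_intros)

lemma omega_reflect: "omega (pi - \<phi>) = omega \<phi>"
  by (simp add: omega_def)

text \<open>Near either endpoint \<open>sin s\<close> is at least a multiple of the distance to it, so \<open>1 / omega s\<close> has only an inverse square root singularity.\<close>
lemma inverse_omega_integrable: "(\<lambda>s. 1 / omega s) absolutely_integrable_on {0..pi}"
proof -
  have pw: "((\<lambda>s. 1 / sqrt s) has_integral 2 * sqrt pi - 2 * sqrt 0) {0..pi}"
  proof (rule fundamental_theorem_of_calculus_interior)
    show "continuous_on {0..pi} (\<lambda>s. 2 * sqrt s)" by (intro continuous_intros)
    fix s :: real assume "s \<in> {0<..<pi}"
    then show "((\<lambda>s. 2 * sqrt s) has_vector_derivative 1 / sqrt s) (at s)"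
      unfolding has_real_derivative_iff_has_vector_derivative[symmetric]
      by (auto intro!: derivative_eq_intros simp: field_simps)
  qed simp
  have pw2: "((\<lambda>s. 1 / sqrt (pi - s)) has_integral - (2 * sqrt (pi - pi)) - (- (2 * sqrt (pi - 0)))) {0..pi}"
  proof (rule fundamental_theorem_of_calculus_interior)
    show "continuous_on {0..pi} (\<lambda>s. - (2 * sqrt (pi - s)))" by (intro continuous_intros)
    fix s :: real assume "s \<in> {0<..<pi}"
    then show "((\<lambda>s. - (2 * sqrt (pi - s))) has_vector_derivative 1 / sqrt (pi - s)) (at s)"
      unfolding has_real_derivative_iff_has_vector_derivative[symmetric]
      by (auto intro!: derivative_eq_intros simp: field_simps)
  qed simp
  have i: "(\<lambda>s. 1 / sqrt s + 1 / sqrt (pi - s)) integrable_on {0..pi}"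
    using has_integral_add[OF pw pw2] by blast
  have ub: "norm (1 / omega s) \<le> 2 * (1 / sqrt s + 1 / sqrt (pi - s))" if s01: "s \<in> {0..pi}" for s
  proof -
    have half: "1 / omega s \<le> 2 * (1 / sqrt s)" if "s \<in> {0<..pi/2}" for s
    proof -
      have "s / 4 \<le> sin s"
      proof (cases "s \<le> 1")
        case True
        have "\<bar>sin s - (\<Sum>m<3. sin_coeff m * s ^ m)\<bar> \<le> inverse (fact 3) * \<bar>s\<bar> ^ 3" by (rule Maclaurin_sin_bound)
        then have "s - s^3/6 \<le> sin s" using that by (simp add: eval_nat_numeral sin_coeff_def abs_if split: if_splits)
        moreover have "s^3 \<le> s * 1" using that True by (simp add: power3_eq_cube mult_le_one)
        ultimately show ?thesis using that by simp
      next
        case False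
        have "sin 1 \<le> sin s" using False that by (intro sin_monotone_2pi_le) (auto intro: order_trans[OF _ pi_ge_two[THEN divide_right_mono]] simp: pi_half_ge_zero)
        moreover have "s / 4 \<le> 1/2" using that pi_less_4 by simp
        moreover have "1/2 \<le> sin (1::real)"
          using Maclaurin_sin_bound[of 1 3] by (simp add: eval_nat_numeral sin_coeff_def abs_if split: if_splits)
        ultimately show ?thesis by linarith
      qed
      then have "sqrt (s/4) \<le> omega s" unfolding omega_def by simp
      then have "sqrt s / 2 \<le> omega s" by (simp add: real_sqrt_divide)
      then have "1 / omega s \<le> 1 / (sqrt s / 2)" using that by (intro divide_left_mono) (auto intro!: mult_pos_pos omega_pos)
      then show ?thesis by simp
    qed
    consider "s = 0 \<or> s = pi" | "s \<in> {0<..pi/2}" | "pi - s \<in> {0<..pi/2}" "s < pi"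
      using s01 by (cases "s = 0 \<or> s = pi"; cases "s \<le> pi/2") auto
    then show ?thesis
    proof cases
      case 1
      then show ?thesis by (auto simp: omega_def)
    next
      case 2
      then have n: "0 \<le> 1 / sqrt (pi - s)" "norm (1 / omega s) = 1 / omega s" using omega_nonneg[of s] s01 by auto
      show ?thesis using half[OF 2] n(1) unfolding n(2) distrib_left by linarith
    next
      case 3
      then have n: "0 \<le> 1 / sqrt s" "norm (1 / omega s) = 1 / omega s" using omega_nonneg[of s] s01 by auto
      show ?thesis using half[OF 3(1)] n(1) unfolding omega_reflect n(2) distrib_left by linarith
    qed
  qed
  show ?thesis
  proof (rule measurable_bounded_by_integrable_imp_absolutely_integrable)
    have "(\<lambda>s. 1 / omega s) \<in> borel_measurable borel" by measurable
    then have "(\<lambda>s. 1 / omega s) \<in> borel_measurable lebesgue" by (intro measurable_completion) simp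
    then show "(\<lambda>s. 1 / omega s) \<in> borel_measurable (lebesgue_on {0..pi})" by (rule measurable_restrict_space1)
    show "(\<lambda>s. 2 * (1 / sqrt s + 1 / sqrt (pi - s))) integrable_on {0..pi}" by (rule integrable_on_mult_right[OF i])
  qed (use ub in auto)
qed

section \<open>Continuous representatives in the angle\<close>

abbreviation leb0 :: "real measure" where "leb0 \<equiv> lebesgue_on {0<..<pi}"

lemma omega_meas_leb: "omega \<in> borel_measurable leb0"
proof -
  have "omega \<in> borel_measurable lebesgue" by (rule measurable_completion) simp
  then show ?thesis by (rule measurable_restrict_space1)
qed

lemma meas_omega_iff: "f \<in> borel_measurable omega_measure \<longleftrightarrow> f \<in> borel_measurable leb0"
  by (simp add: omega_measure_def)

lemma integrable_omega_iff:
  fixes g :: "real \<Rightarrow> 'b::{banach,second_countable_topology}"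
  assumes "g \<in> borel_measurable leb0"
  shows "integrable omega_measure g \<longleftrightarrow> integrable leb0 (\<lambda>\<phi>. omega \<phi> *\<^sub>R g \<phi>)"
    "integral\<^sup>L omega_measure g = (\<integral>\<phi>. omega \<phi> *\<^sub>R g \<phi> \<partial>leb0)"
proof -
  have p: "AE \<phi> in leb0. 0 \<le> omega \<phi>" by (rule AE_I2) (auto intro!: omega_nonneg)
  show "integrable omega_measure g \<longleftrightarrow> integrable leb0 (\<lambda>\<phi>. omega \<phi> *\<^sub>R g \<phi>)"
    unfolding omega_measure_def by (rule integrable_density[OF assms omega_meas_leb p])
  show "integral\<^sup>L omega_measure g = (\<integral>\<phi>. omega \<phi> *\<^sub>R g \<phi> \<partial>leb0)"
    unfolding omega_measure_def by (rule integral_density[OF assms omega_meas_leb p])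
qed

lemma inverse_omega_leb: "(\<lambda>s. 1 / omega s) \<in> borel_measurable leb0" "integrable leb0 (\<lambda>s. 1 / omega s)"
proof -
  show m: "(\<lambda>s. 1 / omega s) \<in> borel_measurable leb0" using omega_meas_leb by measurable
  have "set_integrable lebesgue {0<..<pi} (\<lambda>s. 1 / omega s)"
    by (rule set_integrable_subset[OF inverse_omega_integrable]) auto
  then show "integrable leb0 (\<lambda>s. 1 / omega s)" by (simp add: set_integrable_def integrable_restrict_space)
qed

lemma inverse_omega_integrable_on: "(\<lambda>s. 1 / omega s) integrable_on {0..pi}"
  using inverse_omega_integrable by (rule set_lebesgue_integral_eq_integral(1))

lemma arclen_continuous: "continuous_on {0..pi} arclen"
  unfolding arclen_def[abs_def] by (rule indefinite_integral_continuous_1[OF inverse_omega_integrable_on])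

lemma arclen_0 [simp]: "arclen 0 = 0" by (simp add: arclen_def)

lemma arclen_has_derivative:
  assumes "\<phi> \<in> {0<..<pi}"
  shows "(arclen has_real_derivative 1 / omega \<phi>) (at \<phi>)"
proof -
  have c: "continuous (at \<phi>) (\<lambda>s. 1 / omega s)"
  proof -
    have "continuous_on {0<..<pi} (\<lambda>s. 1 / omega s)"
      using omega_pos by (intro continuous_intros omega_continuous) (auto dest!: omega_pos)
    then show ?thesis using assms by (simp add: continuous_on_eq_continuous_at)
  qed
  have "((\<lambda>u. integral {0..u} (\<lambda>s. 1 / omega s)) has_vector_derivative 1 / omega \<phi>) (at \<phi> within {0..pi} - {})"
    using assms c by (intro integral_has_vector_derivative_continuous_at[OF inverse_omega_integrable_on]) (auto intro: continuous_at_imp_continuous_at_within)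
  moreover have "at \<phi> within {0..pi} = at \<phi>" using assms by (intro at_within_interior) auto
  ultimately show ?thesis unfolding arclen_def[abs_def] by (simp add: has_real_derivative_iff_has_vector_derivative)
qed

lemma arclen_strict_mono: "0 \<le> u \<Longrightarrow> u < v \<Longrightarrow> v \<le> pi \<Longrightarrow> arclen u < arclen v"
proof -
  assume h: "0 \<le> u" "u < v" "v \<le> pi"
  show ?thesis
  proof (rule DERIV_pos_imp_increasing_open[OF h(2)])
    show "continuous_on {u..v} arclen" by (rule continuous_on_subset[OF arclen_continuous]) (use h in auto)
    fix x assume "u < x" "x < v"
    then have "x \<in> {0<..<pi}" using h by auto
    then show "\<exists>y. DERIV arclen x :> y \<and> 0 < y" using arclen_has_derivative omega_pos by (intro exI[of _ "1 / omega x"]) auto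
  qed
qed

lemma arclen_reflect:
  assumes "\<phi> \<in> {0..pi}"
  shows "arclen (pi - \<phi>) = arclen pi - arclen \<phi>"
proof -
  define g where "g = (\<lambda>x. arclen (pi - x) + arclen x)"
  have "g \<phi> = g 0"
  proof (cases "\<phi> = 0")
    case False
    show ?thesis
    proof (rule DERIV_isconst2[of 0 pi g])
      show "continuous_on {0..pi} g" unfolding g_def
        by (intro continuous_intros arclen_continuous continuous_on_compose2[OF arclen_continuous]) auto
      fix x :: real assume x: "0 < x" "x < pi"
      have "((\<lambda>x. arclen (pi - x)) has_real_derivative 1 / omega (pi - x) * (0 - 1)) (at x)"
        by (rule DERIV_chain2[OF arclen_has_derivative DERIV_diff[OF DERIV_const DERIV_ident]]) (use x in auto)
      then have "(g has_real_derivative 1 / omega (pi - x) * (0 - 1) + 1 / omega x) (at x)"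
        unfolding g_def by (rule DERIV_add) (use arclen_has_derivative x in auto)
      then show "DERIV g x :> 0" by (simp add: omega_reflect)
    qed (use assms in auto)
  qed simp
  then show ?thesis by (simp add: g_def)
qed

subsection \<open>Pointwise evaluation on the form domain\<close>

lemma L2_omega_bounded:
  assumes m: "F \<in> borel_measurable leb0" and b: "\<And>\<phi>. \<phi> \<in> {0<..<pi} \<Longrightarrow> cmod (F \<phi>) \<le> C"
  shows "F \<in> L2_omega"
proof -
  interpret F: finite_measure omega_measure by (rule finite_omega_measure)
  have mo: "F \<in> borel_measurable omega_measure" using m by (simp add: meas_omega_iff)
  have sp: "space omega_measure = {0<..<pi}" by (simp add: omega_measure_def)
  have "integrable omega_measure (\<lambda>\<phi>. (cmod (F \<phi>))\<^sup>2)"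
  proof (rule F.integrable_const_bound[of _ "C\<^sup>2"])
    show "AE \<phi> in omega_measure. norm ((cmod (F \<phi>))\<^sup>2) \<le> C\<^sup>2"
      using b by (intro AE_I2) (auto simp: sp intro!: power_mono)
    show "(\<lambda>\<phi>. (cmod (F \<phi>))\<^sup>2) \<in> borel_measurable omega_measure" using mo by measurable
  qed
  then show ?thesis using mo by (simp add: L2_omega_def)
qed

lemma L2_omega_inverse_omega: "(\<lambda>\<phi>. complex_of_real (1 / omega \<phi>)) \<in> L2_omega"
proof -
  have m: "(\<lambda>\<phi>. complex_of_real (1 / omega \<phi>)) \<in> borel_measurable leb0" using inverse_omega_leb(1) by measurable
  have m2: "(\<lambda>\<phi>. (cmod (complex_of_real (1 / omega \<phi>)))\<^sup>2) \<in> borel_measurable leb0" using m by measurable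
  have "integrable leb0 (\<lambda>\<phi>. omega \<phi> *\<^sub>R (cmod (complex_of_real (1 / omega \<phi>)))\<^sup>2)"
  proof (rule Bochner_Integration.integrable_cong[THEN iffD1, OF refl _ inverse_omega_leb(2)])
    fix \<phi> assume "\<phi> \<in> space leb0"
    then have "0 < omega \<phi>" by (auto intro: omega_pos)
    then show "1 / omega \<phi> = omega \<phi> *\<^sub>R (cmod (complex_of_real (1 / omega \<phi>)))\<^sup>2"
      by (simp add: norm_divide power2_eq_square field_simps)
  qed
  then have "integrable omega_measure (\<lambda>\<phi>. (cmod (complex_of_real (1 / omega \<phi>)))\<^sup>2)"
    unfolding integrable_omega_iff(1)[OF m2] .
  then show ?thesis using m unfolding L2_omega_def by (simp only: mem_Collect_eq meas_omega_iff)
qed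

lemma L2_omega_abs: "F \<in> L2_omega \<Longrightarrow> (\<lambda>\<phi>. complex_of_real (cmod (F \<phi>))) \<in> L2_omega"
  "F \<in> L2_omega \<Longrightarrow> norm (abs_hspace (\<lambda>\<phi>. complex_of_real (cmod (F \<phi>)))) = norm (abs_hspace F)"
proof -
  assume F: "F \<in> L2_omega"
  then have [measurable]: "F \<in> borel_measurable omega_measure" by (simp add: L2_omega_def)
  show A: "(\<lambda>\<phi>. complex_of_real (cmod (F \<phi>))) \<in> L2_omega" using F by (simp add: L2_omega_def)
  have "(norm (abs_hspace (\<lambda>\<phi>. complex_of_real (cmod (F \<phi>)))))\<^sup>2 = (norm (abs_hspace F))\<^sup>2"
    unfolding norm_abs_hspace[OF A] norm_abs_hspace[OF F] by simp
  then show "norm (abs_hspace (\<lambda>\<phi>. complex_of_real (cmod (F \<phi>)))) = norm (abs_hspace F)" by simp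
qed

text \<open>The Cauchy-Schwarz constant in \<open>\<integral> |G| d\<phi> \<le> (\<integral> \<omega>\<^sup>-\<^sup>1 d\<phi>)\<^sup>1\<^sup>/\<^sup>2 (\<integral> \<omega> |G|\<^sup>2 d\<phi>)\<^sup>1\<^sup>/\<^sup>2\<close>.\<close>
definition inverse_omega_norm :: real where "inverse_omega_norm = norm (abs_hspace (\<lambda>\<phi>. complex_of_real (1 / omega \<phi>)))"

lemma L2_omega_integrable_leb:
  assumes G: "G \<in> L2_omega"
  shows "integrable leb0 G" "(\<integral>\<phi>. cmod (G \<phi>) \<partial>leb0) \<le> inverse_omega_norm * norm (abs_hspace G)"
proof -
  have m: "G \<in> borel_measurable leb0" using G by (simp add: L2_omega_def meas_omega_iff)
  note [measurable] = m inverse_omega_leb(1)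
  have i: "integrable omega_measure (\<lambda>\<phi>. complex_of_real (cmod (G \<phi>)) * cnj (complex_of_real (1 / omega \<phi>)))"
    by (rule L2_omega_mult_cnj[OF L2_omega_abs(1)[OF G] L2_omega_inverse_omega])
  have m1: "(\<lambda>\<phi>. complex_of_real (cmod (G \<phi>)) * cnj (complex_of_real (1 / omega \<phi>))) \<in> borel_measurable leb0"
    unfolding complex_cnj_complex_of_real by measurable
  have eq: "omega \<phi> *\<^sub>R (complex_of_real (cmod (G \<phi>)) * cnj (complex_of_real (1 / omega \<phi>))) = complex_of_real (cmod (G \<phi>))"
    if "\<phi> \<in> space leb0" for \<phi>
    using omega_pos[of \<phi>] that by (simp add: scaleR_conv_of_real)
  have i2: "integrable leb0 (\<lambda>\<phi>. omega \<phi> *\<^sub>R (complex_of_real (cmod (G \<phi>)) * cnj (complex_of_real (1 / omega \<phi>))))"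
    using i unfolding integrable_omega_iff(1)[OF m1] .
  have ic: "integrable leb0 (\<lambda>\<phi>. complex_of_real (cmod (G \<phi>)))"
    by (rule iffD1[OF Bochner_Integration.integrable_cong[OF refl] i2]) (rule eq)
  then have "integrable leb0 (\<lambda>\<phi>. norm (complex_of_real (cmod (G \<phi>))))" by (rule integrable_norm)
  then have in_: "integrable leb0 (\<lambda>\<phi>. cmod (G \<phi>))" by simp
  then show "integrable leb0 G" using m by (simp add: integrable_norm_iff)
  have "complex_of_real (\<integral>\<phi>. cmod (G \<phi>) \<partial>leb0) = (\<integral>\<phi>. omega \<phi> *\<^sub>R (complex_of_real (cmod (G \<phi>)) * cnj (complex_of_real (1 / omega \<phi>))) \<partial>leb0)"
    unfolding integral_complex_of_real[symmetric] by (rule Bochner_Integration.integral_cong[OF refl eq[symmetric]])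
  also have "\<dots> = hinner (abs_hspace (\<lambda>\<phi>. complex_of_real (cmod (G \<phi>)))) (abs_hspace (\<lambda>\<phi>. complex_of_real (1 / omega \<phi>)))"
    unfolding hinner_abs[OF L2_omega_abs(1)[OF G] L2_omega_inverse_omega] integrable_omega_iff(2)[OF m1] ..
  finally have "(\<integral>\<phi>. cmod (G \<phi>) \<partial>leb0) = inner (abs_hspace (\<lambda>\<phi>. complex_of_real (cmod (G \<phi>)))) (abs_hspace (\<lambda>\<phi>. complex_of_real (1 / omega \<phi>)))"
    unfolding inner_hspace_def by (metis Re_complex_of_real)
  also have "\<dots> \<le> norm (abs_hspace (\<lambda>\<phi>. complex_of_real (cmod (G \<phi>)))) * inverse_omega_norm"
    unfolding inverse_omega_norm_def by (rule norm_cauchy_schwarz)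
  finally show "(\<integral>\<phi>. cmod (G \<phi>) \<partial>leb0) \<le> inverse_omega_norm * norm (abs_hspace G)" by (simp add: L2_omega_abs(2)[OF G] mult.commute)
qed

lemma continuous_eq_if_AE_eq:
  fixes u v :: "real \<Rightarrow> complex"
  assumes u: "continuous_on {p..q} u" "continuous_on {p..q} v" and pq: "p < q"
    and ae: "AE x in lebesgue_on {p<..<q}. u x = v x" and x: "x \<in> {p..q}"
  shows "u x = v x"
proof -
  from AE_E3[OF ae] obtain N where N: "N \<in> null_sets (lebesgue_on {p<..<q})" "\<And>x. x \<in> space (lebesgue_on {p<..<q}) - N \<Longrightarrow> u x = v x"
    by metis
  have Nl: "N \<in> null_sets lebesgue" using N(1) by (simp add: null_sets_restrict_space)
  have "u x - v x = 0"
    by (rule continuous_constant_on_closure[where S="{p<..<q} - N" and f="\<lambda>x. u x - v x" and x=x])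
      (use N(2) x in \<open>auto simp: closure_interval_minus_null[OF pq Nl] intro!: continuous_intros u\<close>)
  then show ?thesis by simp
qed

text \<open>The continuous representative of an element of the form domain. Its values at \<open>0\<close> and \<open>pi\<close> form the trace.\<close>
definition crep :: "vspace \<Rightarrow> real \<Rightarrow> complex" where
  "crep f = (SOME u. continuous_on {0..pi} u \<and> represents (emb f) u)"

abbreviation ev :: "real \<Rightarrow> vspace \<Rightarrow> complex" where "ev \<phi> f \<equiv> crep f \<phi>"

lemma represents_abs: "F \<in> L2_omega \<Longrightarrow> represents (abs_hspace F) u \<longleftrightarrow> (AE \<phi> in leb0. u \<phi> = F \<phi>)"
  by (simp add: represents.abs_eq L2_omega_relI)

lemma vspace_reps:
  obtains F G where "F \<in> L2_omega" "G \<in> L2_omega" "emb f = abs_hspace F" "vderiv f = abs_hspace G" "weak_deriv_fun F G"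
proof -
  obtain F where F: "F \<in> L2_omega" "emb f = abs_hspace F" by (rule hspace_exhaust)
  obtain G where G: "G \<in> L2_omega" "vderiv f = abs_hspace G" by (rule hspace_exhaust)
  have "weak_deriv_fun F G" using weak_deriv_vderiv[of f] unfolding F G by (simp add: weak_deriv.abs_eq L2_omega_relI F G)
  then show ?thesis using that F G by blast
qed

lemma real_test_function_complex:
  assumes "test_function J \<eta>"
  shows "test_function J (\<lambda>t. complex_of_real (\<eta> t))" "vector_derivative (\<lambda>t. complex_of_real (\<eta> t)) (at t) = complex_of_real (deriv \<eta> t)"
proof -
  obtain E where E: "E 0 = \<eta>" "\<And>n t. (E n has_vector_derivative E (Suc n) t) (at t)"
    using assms unfolding test_function_def smooth_def by blast
  have d: "((\<lambda>t. complex_of_real (E n t)) has_vector_derivative complex_of_real (E (Suc n) t)) (at t)" for n t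
    using bounded_linear.has_vector_derivative[OF bounded_linear_of_real E(2)] .
  have "smooth (\<lambda>t. complex_of_real (\<eta> t))"
    unfolding smooth_def using d E(1) by (intro exI[of _ "\<lambda>n t. complex_of_real (E n t)"]) auto
  then show "test_function J (\<lambda>t. complex_of_real (\<eta> t))" using assms by (auto simp: test_function_def)
  have "deriv \<eta> t = E 1 t" using E(1) E(2)[of 0 t] by (auto simp: has_real_derivative_iff_has_vector_derivative[symmetric] intro!: DERIV_imp_deriv)
  then show "vector_derivative (\<lambda>t. complex_of_real (\<eta> t)) (at t) = complex_of_real (deriv \<eta> t)"
    using d[of 0 t] E(1) by (auto intro!: vector_derivative_at)
qed

lemma vspace_primitive:
  assumes FG: "F \<in> L2_omega" "G \<in> L2_omega" "weak_deriv_fun F G"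
  shows "\<exists>c. AE \<phi> in leb0. F \<phi> = c + integral {0..\<phi>} G"
proof (rule weak_derivative_imp_primitive)
  show "(0::real) < pi" by simp
  show "integrable leb0 F" "integrable leb0 G" using FG L2_omega_integrable_leb by auto
  fix \<eta> :: "real \<Rightarrow> real" assume t: "test_function {0<..<pi} \<eta>"
  obtain I where I: "has_bochner_integral leb0 (\<lambda>\<phi>. F \<phi> * complex_of_real (deriv \<eta> \<phi>)) (- I)"
     "has_bochner_integral leb0 (\<lambda>\<phi>. G \<phi> * complex_of_real (\<eta> \<phi>)) I"
    using FG(3)[unfolded weak_deriv_fun_def, rule_format, OF real_test_function_complex(1)[OF t]]
    unfolding real_test_function_complex(2)[OF t] by blast
  show "(\<integral>t. deriv \<eta> t *\<^sub>R F t \<partial>leb0) = - (\<integral>t. \<eta> t *\<^sub>R G t \<partial>leb0)"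
    using has_bochner_integral_integral_eq[OF I(1)] has_bochner_integral_integral_eq[OF I(2)]
    by (simp add: scaleR_conv_of_real mult.commute)
qed

lemma L2_omega_integrable_on:
  assumes "G \<in> L2_omega" shows "G integrable_on {0..pi}"
  using integrable_on_lebesgue_on[OF L2_omega_integrable_leb(1)[OF assms]] by (simp add: integrable_on_open_interval_real)

lemma crep_props:
  "continuous_on {0..pi} (crep f)" "represents (emb f) (crep f)"
proof -
  obtain F G where FG: "F \<in> L2_omega" "G \<in> L2_omega" "emb f = abs_hspace F" "vderiv f = abs_hspace G" "weak_deriv_fun F G"
    by (rule vspace_reps)
  obtain c where c: "AE \<phi> in leb0. F \<phi> = c + integral {0..\<phi>} G" using vspace_primitive[OF FG(1,2,5)] by blast
  have "\<exists>u. continuous_on {0..pi} u \<and> represents (emb f) u"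
  proof (intro exI conjI)
    show "continuous_on {0..pi} (\<lambda>\<phi>. c + integral {0..\<phi>} G)"
      by (intro continuous_intros indefinite_integral_continuous_1 L2_omega_integrable_on FG)
    show "represents (emb f) (\<lambda>\<phi>. c + integral {0..\<phi>} G)"
      unfolding FG(3) represents_abs[OF FG(1)] using c by eventually_elim simp
  qed
  from someI_ex[OF this] show "continuous_on {0..pi} (crep f)" "represents (emb f) (crep f)"
    unfolding crep_def by auto
qed

lemma crep_unique:
  assumes "continuous_on {0..pi} u" "represents (emb f) u" "\<phi> \<in> {0..pi}"
  shows "crep f \<phi> = u \<phi>"
proof -
  obtain F where F: "F \<in> L2_omega" "emb f = abs_hspace F" by (rule hspace_exhaust)
  have "AE \<phi> in leb0. crep f \<phi> = F \<phi>" "AE \<phi> in leb0. u \<phi> = F \<phi>"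
    using crep_props(2)[of f] assms(2) unfolding F(2) represents_abs[OF F(1)] by auto
  then have "AE \<phi> in leb0. crep f \<phi> = u \<phi>" by eventually_elim simp
  then show ?thesis by (rule continuous_eq_if_AE_eq[OF crep_props(1) assms(1) pi_gt_zero _ assms(3)])
qed

lemma crep_primitive:
  assumes G: "G \<in> L2_omega" "vderiv f = abs_hspace G" and \<phi>: "\<phi> \<in> {0..pi}"
  shows "crep f \<phi> = crep f 0 + integral {0..\<phi>} G"
proof -
  obtain F where F: "F \<in> L2_omega" "emb f = abs_hspace F" by (rule hspace_exhaust)
  have w: "weak_deriv_fun F G" using weak_deriv_vderiv[of f] unfolding F G by (simp add: weak_deriv.abs_eq L2_omega_relI F G)
  obtain c where c: "AE \<phi> in leb0. F \<phi> = c + integral {0..\<phi>} G" using vspace_primitive[OF F(1) G(1) w] by blast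
  have co: "continuous_on {0..pi} (\<lambda>\<phi>. c + integral {0..\<phi>} G)"
    by (intro continuous_intros indefinite_integral_continuous_1 L2_omega_integrable_on G)
  have re: "represents (emb f) (\<lambda>\<phi>. c + integral {0..\<phi>} G)"
    unfolding F(2) represents_abs[OF F(1)] using c by eventually_elim simp
  show ?thesis using crep_unique[OF co re \<phi>] crep_unique[OF co re, of 0] by simp
qed

lemma crep_AE: "F \<in> L2_omega \<Longrightarrow> emb f = abs_hspace F \<Longrightarrow> AE \<phi> in leb0. crep f \<phi> = F \<phi>"
  using crep_props(2)[of f] by (simp add: represents_abs)

lemma crep_L2: "crep f \<in> L2_omega" "emb f = abs_hspace (crep f)"
proof -
  obtain F where F: "F \<in> L2_omega" "emb f = abs_hspace F" by (rule hspace_exhaust)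
  obtain C where "\<forall>x\<in>crep f ` {0..pi}. norm x \<le> C"
    using compact_imp_bounded[OF compact_continuous_image[OF crep_props(1)]] unfolding bounded_iff by blast
  then show c: "crep f \<in> L2_omega"
    by (intro L2_omega_bounded[of _ C] continuous_imp_measurable_on_sets_lebesgue continuous_on_subset[OF crep_props(1)]) auto
  show "emb f = abs_hspace (crep f)"
    unfolding F(2) using crep_AE[OF F] by (intro abs_hspace_eqI F(1) c) (simp add: AE_omega_measure, auto elim: eventually_mono)
qed

lemma crep_add: "\<phi> \<in> {0..pi} \<Longrightarrow> crep (f + g) \<phi> = crep f \<phi> + crep g \<phi>"
proof (rule crep_unique)
  show "continuous_on {0..pi} (\<lambda>\<phi>. crep f \<phi> + crep g \<phi>)" by (intro continuous_intros crep_props)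
  show "represents (emb (f + g)) (\<lambda>\<phi>. crep f \<phi> + crep g \<phi>)"
    unfolding vspace_ops crep_L2(2)[of f] crep_L2(2)[of g]
    by (simp add: plus_hspace.abs_eq L2_omega_relI crep_L2 represents_abs L2_omega_add)
qed

lemma crep_scaleR: "\<phi> \<in> {0..pi} \<Longrightarrow> crep (r *\<^sub>R f) \<phi> = r *\<^sub>R crep f \<phi>"
proof (rule crep_unique)
  show "continuous_on {0..pi} (\<lambda>\<phi>. r *\<^sub>R crep f \<phi>)" by (intro continuous_intros crep_props)
  show "represents (emb (r *\<^sub>R f)) (\<lambda>\<phi>. r *\<^sub>R crep f \<phi>)"
    unfolding emb_scaleR crep_L2(2)[of f] scaleR_hspace_def
    by (simp add: hscale.abs_eq L2_omega_relI crep_L2 represents_abs L2_omega_scale scaleR_conv_of_real)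
qed

text \<open>
  For \<open>f\<close> in the form domain, \<open>|f(\<phi>)|\<close> differs from the mean of \<open>|f|\<close> by at most \<open>\<integral> |f'| d\<phi>\<close>, which the form
  controls since \<open>1/\<omega>\<close> is integrable. This is what makes point evaluations, and with them the trace, continuous.
\<close>
lemma crep_bounded: "\<exists>C>0. \<forall>f. \<forall>\<phi>\<in>{0..pi}. cmod (crep f \<phi>) \<le> C * norm f"
proof -
  define one where "one = abs_hspace (\<lambda>_. 1)"
  have one: "(\<lambda>_. 1) \<in> L2_omega" by (rule L2_omega_bounded[of _ 1]) auto
  have m0: "0 < norm one"
  proof -
    have "one \<noteq> 0"
    proof
      assume "one = 0"
      then have "(\<integral>\<phi>. (cmod 1)\<^sup>2 \<partial>omega_measure) = 0" using norm_abs_hspace[OF one] by (simp add: one_def)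
      moreover have "integrable omega_measure (\<lambda>_. (cmod 1)\<^sup>2)" using one by (simp add: L2_omega_def)
      ultimately have "AE \<phi> in omega_measure. (cmod 1)\<^sup>2 = (0::real)" by (subst (asm) integral_nonneg_eq_0_iff_AE) auto
      then have "AE \<phi> in leb0. False" by (simp add: AE_omega_measure)
      then obtain N where N: "{x \<in> space leb0. \<not> False} \<subseteq> N" "N \<in> sets leb0" "emeasure leb0 N = 0" by (rule AE_E)
      have "emeasure leb0 {0<..<pi} \<le> emeasure leb0 N" 
        by (rule emeasure_mono[OF _ N(2)], rule order_trans[OF _ N(1)], rule subsetI, simp)
      then have "emeasure leb0 {0<..<pi} = 0" unfolding N(3) by (simp only: le_zero_eq)
      then show False by (simp add: emeasure_restrict_space)
    qed
    then show ?thesis by simp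
  qed
  define C where "C = 1 / norm one + inverse_omega_norm + 1"
  have K0: "0 \<le> inverse_omega_norm" by (simp add: inverse_omega_norm_def)
  have main: "cmod (crep f \<phi>) \<le> C * norm f" if \<phi>: "\<phi> \<in> {0..pi}" for f \<phi>
  proof -
    obtain G where G: "G \<in> L2_omega" "vderiv f = abs_hspace G" by (rule hspace_exhaust)
    have Gi: "integrable leb0 G" by (rule L2_omega_integrable_leb(1)[OF G(1)])
    have diff: "cmod (crep f \<phi> - crep f \<psi>) \<le> inverse_omega_norm * norm (vderiv f)" if "\<phi> \<in> {0..pi}" "\<psi> \<in> {0..pi}" "\<psi> \<le> \<phi>" for \<phi> \<psi>
    proof -
      have Gn: "integrable leb0 (\<lambda>\<phi>. cmod (G \<phi>))" using Gi by (rule integrable_norm)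
      have no: "(\<lambda>\<phi>. cmod (G \<phi>)) integrable_on {0..pi}"
        using integrable_on_lebesgue_on[OF Gn] by (simp add: integrable_on_open_interval_real)
      have io: "G integrable_on {0..\<phi>}" using L2_omega_integrable_on[OF G(1)] that by (auto intro: integrable_on_subinterval)
      have "crep f \<phi> - crep f \<psi> = integral {\<psi>..\<phi>} G"
        using crep_primitive[OF G that(1)] crep_primitive[OF G that(2)]
          Henstock_Kurzweil_Integration.integral_combine[of 0 \<psi> \<phi> G] io that by (auto simp: algebra_simps)
      also have "cmod \<dots> \<le> integral {\<psi>..\<phi>} (\<lambda>\<phi>. cmod (G \<phi>))"
        using io no that by (intro Henstock_Kurzweil_Integration.integral_norm_bound_integral) (auto intro: integrable_on_subinterval)
      also have "\<dots> \<le> integral {0..pi} (\<lambda>\<phi>. cmod (G \<phi>))"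
        using no that by (intro integral_subset_le) (auto intro: integrable_on_subinterval)
      also have "\<dots> = (\<integral>\<phi>. cmod (G \<phi>) \<partial>leb0)"
        using lebesgue_integral_eq_integral[OF Gn] by (simp add: integral_open_interval_real)
      also have "\<dots> \<le> inverse_omega_norm * norm (vderiv f)" unfolding G(2) by (rule L2_omega_integrable_leb(2)[OF G(1)])
      finally show ?thesis .
    qed
    have d: "cmod (crep f \<phi> - crep f \<psi>) \<le> inverse_omega_norm * norm (vderiv f)" if "\<psi> \<in> {0..pi}" for \<psi>
      using diff[OF \<phi> that] diff[OF that \<phi>] by (cases "\<psi> \<le> \<phi>") (auto simp: norm_minus_commute)
    have lam: "(\<lambda>_. crep f \<phi>) \<in> L2_omega" by (rule L2_omega_bounded[of _ "cmod (crep f \<phi>)"]) auto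
    have "norm (abs_hspace (\<lambda>_. crep f \<phi>)) = cmod (crep f \<phi>) * norm one"
    proof -
      have "(norm (abs_hspace (\<lambda>_. crep f \<phi>)))\<^sup>2 = (cmod (crep f \<phi>) * norm one)\<^sup>2"
        unfolding norm_abs_hspace[OF lam] power_mult_distrib one_def norm_abs_hspace[OF one] by simp
      then show ?thesis by (rule power2_eq_imp_eq) simp_all
    qed
    moreover have "norm (abs_hspace (\<lambda>_. crep f \<phi>)) \<le> norm (emb f) + inverse_omega_norm * norm (vderiv f) * norm one"
    proof -
      have df: "(\<lambda>\<psi>. crep f \<phi> - crep f \<psi>) \<in> L2_omega" by (rule L2_omega_diff[OF lam crep_L2(1)])
      have "(norm (abs_hspace (\<lambda>\<psi>. crep f \<phi> - crep f \<psi>)))\<^sup>2 \<le> (inverse_omega_norm * norm (vderiv f) * norm one)\<^sup>2"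
      proof -
        have "(norm (abs_hspace (\<lambda>\<psi>. crep f \<phi> - crep f \<psi>)))\<^sup>2 = (\<integral>\<psi>. (cmod (crep f \<phi> - crep f \<psi>))\<^sup>2 \<partial>omega_measure)"
          by (rule norm_abs_hspace[OF df])
        also have "\<dots> \<le> (\<integral>\<psi>. (inverse_omega_norm * norm (vderiv f))\<^sup>2 * (cmod 1)\<^sup>2 \<partial>omega_measure)"
        proof (rule integral_mono)
          show "integrable omega_measure (\<lambda>\<psi>. (cmod (crep f \<phi> - crep f \<psi>))\<^sup>2)" using df by (simp add: L2_omega_def)
          show "integrable omega_measure (\<lambda>\<psi>. (inverse_omega_norm * norm (vderiv f))\<^sup>2 * (cmod 1)\<^sup>2)"
            by (rule finite_measure.integrable_const[OF finite_omega_measure])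
          fix \<psi> assume "\<psi> \<in> space omega_measure"
          then have "\<psi> \<in> {0..pi}" by (auto simp: omega_measure_def)
          from d[OF this] show "(cmod (crep f \<phi> - crep f \<psi>))\<^sup>2 \<le> (inverse_omega_norm * norm (vderiv f))\<^sup>2 * (cmod 1)\<^sup>2"
            by (auto intro!: power_mono)
        qed
        also have "\<dots> = (inverse_omega_norm * norm (vderiv f))\<^sup>2 * (norm one)\<^sup>2" unfolding one_def norm_abs_hspace[OF one] by simp
        finally show ?thesis by (simp add: power_mult_distrib)
      qed
      then have n1: "norm (abs_hspace (\<lambda>\<psi>. crep f \<phi> - crep f \<psi>)) \<le> inverse_omega_norm * norm (vderiv f) * norm one"
        by (rule power2_le_imp_le) (use K0 in simp)
      have n2: "abs_hspace (\<lambda>\<psi>. crep f \<phi> - crep f \<psi>) = abs_hspace (\<lambda>_. crep f \<phi>) - emb f"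
        unfolding crep_L2(2)[of f] by (rule abs_hspace_diff[OF lam crep_L2(1), symmetric])
      have n3: "norm (abs_hspace (\<lambda>_. crep f \<phi>)) \<le> norm (emb f) + norm (abs_hspace (\<lambda>_. crep f \<phi>) - emb f)"
        by (rule norm_triangle_sub)
      show ?thesis by (rule order_trans[OF n3 add_left_mono[OF n1[unfolded n2]]])
    qed
    ultimately have "cmod (crep f \<phi>) * norm one \<le> (norm (emb f) / norm one + inverse_omega_norm * norm (vderiv f)) * norm one"
      using m0 by (simp add: algebra_simps)
    then have "cmod (crep f \<phi>) \<le> norm (emb f) / norm one + inverse_omega_norm * norm (vderiv f)" using m0 by (rule mult_right_le_imp_le)
    also have "\<dots> \<le> norm f / norm one + inverse_omega_norm * norm f"
    proof -
      have "norm (vderiv f) \<le> norm f" 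
        by (rule power2_le_imp_le) (auto simp: power2_norm_eq_inner inner_vspace_alt add_increasing2)
      then show ?thesis using norm_emb_le[of f] K0 m0 by (intro add_mono divide_right_mono mult_left_mono) auto
    qed
    also have "\<dots> \<le> C * norm f" by (simp add: C_def algebra_simps)
    finally show ?thesis .
  qed
  have "0 < C" using m0 K0 by (simp add: C_def add_nonneg_pos)
  then show ?thesis using main by blast
qed

lemma bounded_linear_ev: "\<phi> \<in> {0..pi} \<Longrightarrow> bounded_linear (ev \<phi>)"
proof -
  assume p: "\<phi> \<in> {0..pi}"
  obtain C where "\<forall>f. \<forall>\<phi>\<in>{0..pi}. cmod (crep f \<phi>) \<le> C * norm f" using crep_bounded by blast
  then show ?thesis using p by (intro bounded_linear_intro[where K=C]) (auto simp: crep_add crep_scaleR mult.commute)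
qed

lemma endpoint_trace_ev: "endpoint_trace f = vector [ev 0 f, ev pi f]"
  unfolding endpoint_trace_def
proof (rule the_equality)
  show "\<exists>u. continuous_on {0..pi} u \<and> represents (emb f) u \<and> vector [ev 0 f, ev pi f] = vector [u 0, u pi]"
    using crep_props by (intro exI[of _ "crep f"]) auto
  fix z assume "\<exists>u. continuous_on {0..pi} u \<and> represents (emb f) u \<and> z = (vector [u 0, u pi] :: complex ^ 2)"
  then obtain u where u: "continuous_on {0..pi} u" "represents (emb f) u" "z = vector [u 0, u pi]" by blast
  then show "z = vector [ev 0 f, ev pi f]" using crep_unique[OF u(1,2), of 0] crep_unique[OF u(1,2), of pi] by simp
qed

section \<open>Test functions in the form domain\<close>

lemma hinner_emb:
  assumes H: "H \<in> L2_omega"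
  shows "hinner (emb f) (abs_hspace H) = (\<integral>\<phi>. omega \<phi> *\<^sub>R (crep f \<phi> * cnj (H \<phi>)) \<partial>leb0)"
    "integrable leb0 (\<lambda>\<phi>. omega \<phi> *\<^sub>R (crep f \<phi> * cnj (H \<phi>)))"
proof -
  have [measurable]: "H \<in> borel_measurable leb0" "crep f \<in> borel_measurable leb0"
    using H crep_L2(1)[of f] by (auto simp: L2_omega_def meas_omega_iff)
  have cj: "(\<lambda>\<phi>. cnj (H \<phi>)) \<in> borel_measurable leb0"
    by (rule measurable_compose[OF _ borel_measurable_continuous_onI[of cnj]]) (auto intro!: continuous_intros)
  then have m: "(\<lambda>\<phi>. crep f \<phi> * cnj (H \<phi>)) \<in> borel_measurable leb0" by measurable
  show "hinner (emb f) (abs_hspace H) = (\<integral>\<phi>. omega \<phi> *\<^sub>R (crep f \<phi> * cnj (H \<phi>)) \<partial>leb0)"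
    unfolding crep_L2(2)[of f] hinner_abs[OF crep_L2(1) H] by (rule integrable_omega_iff(2)[OF m])
  show "integrable leb0 (\<lambda>\<phi>. omega \<phi> *\<^sub>R (crep f \<phi> * cnj (H \<phi>)))"
    using L2_omega_mult_cnj[OF crep_L2(1) H, of f] unfolding integrable_omega_iff(1)[OF m] .
qed

text \<open>Integration by parts with finitely many exceptional points, which admits the kink of the ramps below.\<close>
lemma weak_deriv_fun_piecewise:
  fixes V V' :: "real \<Rightarrow> complex"
  assumes V: "continuous_on {0..pi} V" and S: "finite S"
    and d: "\<And>\<phi>. \<phi> \<in> {0<..<pi} - S \<Longrightarrow> (V has_vector_derivative V' \<phi>) (at \<phi>)"
    and V': "integrable leb0 V'"
  shows "weak_deriv_fun V V'"
  unfolding weak_deriv_fun_def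
proof (intro allI impI)
  interpret F: finite_measure leb0 by (rule lebesgue_on_interval_finite)
  fix \<eta> :: "real \<Rightarrow> complex" assume t: "test_function {0<..<pi} \<eta>"
  obtain E where E: "E 0 = \<eta>" "\<And>n t. (E n has_vector_derivative E (Suc n) t) (at t)"
    using t unfolding test_function_def smooth_def by blast
  obtain K where K: "K \<subseteq> {0<..<pi}" "\<And>t. t \<notin> K \<Longrightarrow> \<eta> t = 0" using t unfolding test_function_def by blast
  have "0 \<notin> K" "pi \<notin> K" using K(1) by auto
  then have z: "\<eta> 0 = 0" "\<eta> pi = 0" by (simp_all add: K(2))
  have vd: "vector_derivative \<eta> (at t) = E 1 t" for t using E(1) E(2)[of 0 t] by (auto intro!: vector_derivative_at)
  have Ec: "continuous_on UNIV (E n)" for n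
    using E(2) by (auto intro!: continuous_at_imp_continuous_on has_vector_derivative_continuous)
  have bd: "\<exists>C. \<forall>t\<in>{0..pi}. norm (f t) \<le> C" if "continuous_on {0..pi} f" for f :: "real \<Rightarrow> complex"
    using compact_imp_bounded[OF compact_continuous_image[OF that]] unfolding bounded_iff by auto
  have "\<exists>C. \<forall>t\<in>{0..pi}. norm (\<eta> t) \<le> C" by (rule bd) (use continuous_on_subset[OF Ec[of 0]] E(1) in simp)
  then obtain C where C: "\<And>t. t \<in> {0..pi} \<Longrightarrow> norm (\<eta> t) \<le> C" by blast
  have "\<exists>C. \<forall>t\<in>{0..pi}. norm (V t * E 1 t) \<le> C"
    by (rule bd) (intro continuous_on_mult V continuous_on_subset[OF Ec[of 1]] subset_UNIV)
  then obtain C' where C': "\<And>t. t \<in> {0..pi} \<Longrightarrow> norm (V t * E 1 t) \<le> C'" by blast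
  have i1: "integrable leb0 (\<lambda>\<phi>. V \<phi> * E 1 \<phi>)"
  proof (rule F.integrable_const_bound[of _ C'])
    show "AE \<phi> in leb0. norm (V \<phi> * E 1 \<phi>) \<le> C'" using C' by (intro AE_I2) auto
    show "(\<lambda>\<phi>. V \<phi> * E 1 \<phi>) \<in> borel_measurable leb0"
      by (intro continuous_imp_measurable_on_sets_lebesgue continuous_on_mult continuous_on_subset[OF V] continuous_on_subset[OF Ec]) auto
  qed
  have i2: "integrable leb0 (\<lambda>\<phi>. V' \<phi> * \<eta> \<phi>)"
  proof (rule Bochner_Integration.integrable_bound[OF integrable_mult_right[OF integrable_norm[OF V'], of C]])
    have "\<eta> \<in> borel_measurable leb0" using continuous_measurable_lebesgue_on[OF Ec[of 0]] E(1) by simp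
    then show "(\<lambda>\<phi>. V' \<phi> * \<eta> \<phi>) \<in> borel_measurable leb0" using V' by measurable
    show "AE \<phi> in leb0. norm (V' \<phi> * \<eta> \<phi>) \<le> norm (C * norm (V' \<phi>))"
    proof (rule AE_I2)
      fix \<phi> assume "\<phi> \<in> space leb0"
      then have "norm (\<eta> \<phi>) \<le> C" using C by auto
      then have "norm (V' \<phi>) * norm (\<eta> \<phi>) \<le> norm (V' \<phi>) * \<bar>C\<bar>" by (intro mult_left_mono) auto
      then show "norm (V' \<phi> * \<eta> \<phi>) \<le> norm (C * norm (V' \<phi>))" by (simp add: norm_mult abs_mult mult.commute)
    qed
  qed
  have "((\<lambda>\<phi>. V' \<phi> * \<eta> \<phi> + V \<phi> * E 1 \<phi>) has_integral (V pi * \<eta> pi - V 0 * \<eta> 0)) {0..pi}"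
  proof (rule fundamental_theorem_of_calculus_interior_strong[where f="\<lambda>\<phi>. V \<phi> * \<eta> \<phi>" and S=S and a=0 and b=pi])
    fix \<phi> assume p: "\<phi> \<in> {0<..<pi} - S"
    show "((\<lambda>\<phi>. V \<phi> * \<eta> \<phi>) has_vector_derivative V' \<phi> * \<eta> \<phi> + V \<phi> * E 1 \<phi>) (at \<phi>)"
      using has_vector_derivative_mult[OF d[OF p] E(2)[of 0 \<phi>]] E(1) by (simp add: add.commute)
  next
    show "continuous_on {0..pi} (\<lambda>\<phi>. V \<phi> * \<eta> \<phi>)"
      using continuous_on_subset[OF Ec[of 0], of "{0..pi}"] E(1) V by (intro continuous_on_mult) auto
  qed (use S in simp_all)
  then have "integral {0..pi} (\<lambda>\<phi>. V' \<phi> * \<eta> \<phi> + V \<phi> * E 1 \<phi>) = 0" using z by (simp add: integral_unique)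
  then have "(\<integral>\<phi>. V' \<phi> * \<eta> \<phi> + V \<phi> * E 1 \<phi> \<partial>leb0) = 0"
    using lebesgue_integral_eq_integral[OF Bochner_Integration.integrable_add[OF i2 i1]] by (simp add: integral_open_interval_real)
  then have s0: "(\<integral>\<phi>. V \<phi> * E 1 \<phi> \<partial>leb0) = - (\<integral>\<phi>. V' \<phi> * \<eta> \<phi> \<partial>leb0)"
    using i1 i2 by (simp add: eq_neg_iff_add_eq_0 add.commute)
  show "\<exists>I. has_bochner_integral leb0 (\<lambda>\<phi>. V \<phi> * vector_derivative \<eta> (at \<phi>)) (- I) \<and> has_bochner_integral leb0 (\<lambda>\<phi>. V' \<phi> * \<eta> \<phi>) I"
    unfolding vd using i1 i2 s0 by (intro exI[of _ "\<integral>\<phi>. V' \<phi> * \<eta> \<phi> \<partial>leb0"]) (auto simp: has_bochner_integral_iff)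
qed

lemma vspace_of_fun:
  assumes V: "continuous_on {0..pi} V" and S: "finite S"
    and d: "\<And>\<phi>. \<phi> \<in> {0<..<pi} - S \<Longrightarrow> (V has_vector_derivative V' \<phi>) (at \<phi>)" and V': "V' \<in> L2_omega"
  shows "\<exists>v. emb v = abs_hspace V \<and> vderiv v = abs_hspace V' \<and> V \<in> L2_omega \<and> (\<forall>\<phi>\<in>{0..pi}. crep v \<phi> = V \<phi>)"
proof -
  obtain C where "\<forall>x\<in>V ` {0..pi}. norm x \<le> C"
    using compact_imp_bounded[OF compact_continuous_image[OF V]] unfolding bounded_iff by blast
  then have L: "V \<in> L2_omega"
    by (intro L2_omega_bounded[of _ C] continuous_imp_measurable_on_sets_lebesgue continuous_on_subset[OF V]) auto
  have "weak_deriv_fun V V'" by (rule weak_deriv_fun_piecewise[OF V S d L2_omega_integrable_leb(1)[OF V']])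
  then have w: "weak_deriv (abs_hspace V) (abs_hspace V')" by (simp add: weak_deriv.abs_eq L2_omega_relI L V')
  define v where "v = Abs_vspace (abs_hspace V, abs_hspace V')"
  have e: "emb v = abs_hspace V" "vderiv v = abs_hspace V'" unfolding v_def by (rule emb_Abs[OF w], rule vderiv_Abs[OF w])
  have "crep v \<phi> = V \<phi>" if "\<phi> \<in> {0..pi}" for \<phi>
    by (rule crep_unique[OF V _ that]) (simp add: e represents_abs[OF L])
  then show ?thesis using e L by blast
qed

text \<open>
  Since \<open>\<omega> arclen' = 1\<close>, the form \<open>a\<^sub>0\<close> against this function is a difference of two point values: it is
  a Green's function of the angular operator.
\<close>
definition ramp :: "real \<Rightarrow> real \<Rightarrow> complex" where
  "ramp \<psi> \<phi> = (if \<phi> \<le> \<psi> then complex_of_real (arclen \<psi> - arclen \<phi>) else 0)"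

lemma ramp_vspace:
  assumes \<psi>: "\<psi> \<in> {0..pi}"
  shows "\<exists>v. emb v = abs_hspace (ramp \<psi>) \<and> ramp \<psi> \<in> L2_omega \<and> crep v 0 = complex_of_real (arclen \<psi>) \<and> crep v pi = 0 \<and>
    (\<forall>f. form_a0 f v = 4 * (ev 0 f - ev \<psi> f))"
proof -
  define V' where "V' = (\<lambda>\<phi>. if \<phi> \<le> \<psi> then - complex_of_real (1 / omega \<phi>) else 0)"
  have V'L: "V' \<in> L2_omega"
  proof -
    have m: "(\<lambda>\<phi>. complex_of_real (1 / omega \<phi>)) \<in> borel_measurable omega_measure" "integrable omega_measure (\<lambda>\<phi>. (cmod (complex_of_real (1 / omega \<phi>)))\<^sup>2)"
      using L2_omega_inverse_omega by (auto simp: L2_omega_def)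
    have id: "(\<lambda>\<phi>::real. \<phi>) \<in> borel_measurable omega_measure"
      unfolding meas_omega_iff by (rule continuous_measurable_lebesgue_on) (rule continuous_on_id)
    then have s: "{\<phi> \<in> space omega_measure. \<phi> \<le> \<psi>} \<in> sets omega_measure" by measurable
    have m2: "V' \<in> borel_measurable omega_measure"
      unfolding V'_def using s m(1) by (intro measurable_If) auto
    have "integrable omega_measure (\<lambda>\<phi>. (cmod (V' \<phi>))\<^sup>2)"
      by (rule Bochner_Integration.integrable_bound[OF m(2)]) (use m2 in \<open>auto simp: V'_def intro!: AE_I2\<close>)
    then show ?thesis using m2 by (simp add: L2_omega_def)
  qed
  have Vc: "continuous_on {0..pi} (ramp \<psi>)"
  proof -
    have "continuous_on ({0..\<psi>} \<union> {\<psi>..pi}) (ramp \<psi>)"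
      unfolding ramp_def
      by (intro continuous_on_If continuous_intros continuous_on_subset[OF arclen_continuous]) (use \<psi> in auto)
    moreover have "{0..\<psi>} \<union> {\<psi>..pi} = {0..pi}" using \<psi> by auto
    ultimately show ?thesis by simp
  qed
  have d: "(ramp \<psi> has_vector_derivative V' \<phi>) (at \<phi>)" if p: "\<phi> \<in> {0<..<pi} - {\<psi>}" for \<phi>
  proof (cases "\<phi> < \<psi>")
    case True
    have "((\<lambda>\<phi>. complex_of_real (arclen \<psi> - arclen \<phi>)) has_vector_derivative complex_of_real (0 - 1 / omega \<phi>)) (at \<phi>)"
      by (rule bounded_linear.has_vector_derivative[OF bounded_linear_of_real])
        (use p in \<open>auto simp: has_real_derivative_iff_has_vector_derivative[symmetric] intro!: derivative_eq_intros arclen_has_derivative\<close>)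
    then have "(ramp \<psi> has_vector_derivative complex_of_real (0 - 1 / omega \<phi>)) (at \<phi>)"
      by (rule has_vector_derivative_transform_within_open[of _ _ _ "{..<\<psi>}"]) (use True in \<open>auto simp: ramp_def\<close>)
    then show ?thesis using True by (simp add: V'_def)
  next
    case False
    have "((\<lambda>\<phi>. 0) has_vector_derivative (0::complex)) (at \<phi>)" by (rule has_vector_derivative_const)
    then have "(ramp \<psi> has_vector_derivative 0) (at \<phi>)"
      by (rule has_vector_derivative_transform_within_open[of _ _ _ "{\<psi><..}"]) (use False p in \<open>auto simp: ramp_def\<close>)
    then show ?thesis using False p by (simp add: V'_def)
  qed
  obtain v where v: "emb v = abs_hspace (ramp \<psi>)" "vderiv v = abs_hspace V'" "ramp \<psi> \<in> L2_omega" "\<And>\<phi>. \<phi> \<in> {0..pi} \<Longrightarrow> crep v \<phi> = ramp \<psi> \<phi>"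
    using vspace_of_fun[OF Vc finite.insertI[OF finite.emptyI, of \<psi>] d V'L] by blast
  have "form_a0 f v = 4 * (ev 0 f - ev \<psi> f)" for f
  proof -
    obtain G where G: "G \<in> L2_omega" "vderiv f = abs_hspace G" by (rule hspace_exhaust)
    have Gm: "G \<in> borel_measurable leb0" using G by (simp add: L2_omega_def meas_omega_iff)
    have V'm: "V' \<in> borel_measurable leb0" using V'L by (simp add: L2_omega_def meas_omega_iff)
    have "(\<lambda>\<phi>. cnj (V' \<phi>)) \<in> borel_measurable leb0"
      by (rule measurable_compose[OF V'm borel_measurable_continuous_onI[of cnj]]) (auto intro!: continuous_intros)
    then have m: "(\<lambda>\<phi>. G \<phi> * cnj (V' \<phi>)) \<in> borel_measurable leb0" using Gm by measurable
    have eq: "omega \<phi> *\<^sub>R (G \<phi> * cnj (V' \<phi>)) = (if \<phi> \<in> {0..\<psi>} then - G \<phi> else 0)" if "\<phi> \<in> {0<..<pi}" for \<phi>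
      using omega_pos[OF that] that by (auto simp: V'_def scaleR_conv_of_real)
    have i: "integrable leb0 (\<lambda>\<phi>. omega \<phi> *\<^sub>R (G \<phi> * cnj (V' \<phi>)))"
      using L2_omega_mult_cnj[OF G(1) V'L] unfolding integrable_omega_iff(1)[OF m] .
    have "hinner (vderiv f) (vderiv v) = (\<integral>\<phi>. omega \<phi> *\<^sub>R (G \<phi> * cnj (V' \<phi>)) \<partial>leb0)"
      unfolding G v hinner_abs[OF G(1) V'L] by (rule integrable_omega_iff(2)[OF m])
    also have "\<dots> = integral {0<..<pi} (\<lambda>\<phi>. omega \<phi> *\<^sub>R (G \<phi> * cnj (V' \<phi>)))" by (rule lebesgue_integral_eq_integral[OF i]) simp
    also have "\<dots> = integral {0<..<pi} (\<lambda>\<phi>. if \<phi> \<in> {0..\<psi>} then - G \<phi> else 0)"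
      by (rule Henstock_Kurzweil_Integration.integral_cong) (rule eq)
    also have "\<dots> = integral {0..pi} (\<lambda>\<phi>. if \<phi> \<in> {0..\<psi>} then - G \<phi> else 0)" by (simp add: integral_open_interval_real)
    also have "\<dots> = integral ({0..\<psi>} \<inter> {0..pi}) (\<lambda>\<phi>. - G \<phi>)" by (rule integral_restrict_Int)
    also have "{0..\<psi>} \<inter> {0..pi} = {0..\<psi>}" using \<psi> by auto
    also have "integral {0..\<psi>} (\<lambda>\<phi>. - G \<phi>) = ev 0 f - ev \<psi> f"
      using crep_primitive[OF G \<psi>] by simp
    finally show ?thesis by (simp add: form_a0_def)
  qed
  moreover have "crep v 0 = complex_of_real (arclen \<psi>)" "crep v pi = 0" using v(4)[of 0] v(4)[of pi] \<psi> by (auto simp: ramp_def)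
  ultimately show ?thesis using v by blast
qed

lemma one_vspace:
  "\<exists>v. emb v = abs_hspace (\<lambda>_. 1) \<and> (\<lambda>_. 1) \<in> L2_omega \<and> crep v 0 = 1 \<and> crep v pi = 1 \<and> (\<forall>f. form_a0 f v = 0)"
proof -
  have "\<exists>v. emb v = abs_hspace (\<lambda>_. 1) \<and> vderiv v = abs_hspace (\<lambda>_. 0) \<and> (\<lambda>_. 1::complex) \<in> L2_omega \<and> (\<forall>\<phi>\<in>{0..pi}. crep v \<phi> = 1)"
    by (rule vspace_of_fun[of _ "{}"]) (auto intro!: L2_omega_zero has_vector_derivative_const)
  then obtain v where v: "emb v = abs_hspace (\<lambda>_. 1)" "vderiv v = abs_hspace (\<lambda>_. 0)" "(\<lambda>_. 1::complex) \<in> L2_omega" "\<forall>\<phi>\<in>{0..pi}. crep v \<phi> = 1" by blast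
  have "form_a0 f v = 0" for f
  proof -
    obtain G where G: "G \<in> L2_omega" "vderiv f = abs_hspace G" by (rule hspace_exhaust)
    show ?thesis unfolding form_a0_def G v hinner_abs[OF G(1) L2_omega_zero] by simp
  qed
  then show ?thesis using v by auto
qed

section \<open>The mollified weak equation\<close>

lemma norm_complex2: "(norm (z :: complex ^ 2))\<^sup>2 = (cmod (z $ 1))\<^sup>2 + (cmod (z $ 2))\<^sup>2"
  by (simp add: norm_vec_def L2_set_def UNIV_2)

lemma endpoint_trace_nth: "endpoint_trace f $ 1 = ev 0 f" "endpoint_trace f $ 2 = ev pi f"
  by (simp_all add: endpoint_trace_ev vector_2)

lemma bounded_linear_hinner_left: "bounded_linear (\<lambda>f. hinner f h)"
proof (rule bounded_linear_intro)
  show "hinner (r *\<^sub>R x) h = r *\<^sub>R hinner x h" for r x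
    by (simp add: hscale_real(1)[symmetric] hinner_scale_left scaleR_conv_of_real)
  show "norm (hinner x h) \<le> norm x * (2 * norm h)" for x using cmod_hinner_le[of x h] by (simp add: mult_ac)
qed (rule hinner_add_left)

lemma norm_vderiv_le: "norm (vderiv f) \<le> norm f"
  by (rule power2_le_imp_le) (auto simp: power2_norm_eq_inner inner_vspace_alt add_increasing2)

lemma bounded_linear_vderiv: "bounded_linear vderiv"
  by (rule bounded_linear_intro[where K=1]) (auto simp: vspace_ops emb_scaleR norm_vderiv_le)

lemma bounded_linear_form_a0_left: "bounded_linear (\<lambda>f. form_a0 f v)"
  unfolding form_a0_def
  by (intro bounded_linear_const_mult bounded_linear_compose[OF bounded_linear_hinner_left bounded_linear_vderiv])

lemma hinner_scaleR_right: "hinner h (r *\<^sub>R f) = r *\<^sub>R hinner h f"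
  by (metis hinner_commute hscale_real(1) hinner_scale_left complex_cnj_mult complex_cnj_complex_of_real scaleR_conv_of_real)

lemma form_a0_scaleR_right: "form_a0 f (r *\<^sub>R v) = r *\<^sub>R form_a0 f v"
  by (simp add: form_a0_def emb_scaleR hinner_scaleR_right)

lemma cinner2_expand: "cinner2 z y = z $ 1 * cnj (y $ 1) + z $ 2 * cnj (y $ 2)"
  by (simp add: cinner2_def UNIV_2)

lemma cinner2_trace_scaleR: "cinner2 z (endpoint_trace (r *\<^sub>R v)) = r *\<^sub>R cinner2 z (endpoint_trace v)"
  by (simp add: cinner2_expand endpoint_trace_nth crep_scaleR scaleR_conv_of_real algebra_simps)

locale boundary_solution =
  fixes p q :: real and \<Gamma> :: "real \<Rightarrow> complex ^ 2 ^ 2" and w :: "real \<Rightarrow> vspace" and \<mu> :: real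
  assumes pq: "p < q" and sol: "weak_solution {p<..<q} \<Gamma> w" and \<Gamma>: "Linf_bound {p<..<q} \<Gamma> \<mu>" and \<mu>: "0 \<le> \<mu>"
begin

abbreviation J :: "real set" where "J \<equiv> {p<..<q}"
abbreviation lebJ :: "real measure" where "lebJ \<equiv> lebesgue_on J"

definition flux :: "real \<Rightarrow> complex ^ 2" where "flux s = \<Gamma> s *v endpoint_trace (w s)"

lemma w_L2: "bochner_L2 J w" "bochner_L2 J (\<lambda>t. emb (w t))" using sol by (auto simp: weak_solution_def)

lemma ev_w:
  assumes "\<phi> \<in> {0..pi}"
  shows "(\<lambda>s. ev \<phi> (w s)) \<in> borel_measurable lebJ" "integrable lebJ (\<lambda>s. (cmod (ev \<phi> (w s)))\<^sup>2)" "integrable lebJ (\<lambda>s. ev \<phi> (w s))"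
  using bochner_L2_functional[OF w_L2(1) bounded_linear_ev[OF assms]] by auto

lemma norm_w_integrable: "integrable lebJ (\<lambda>s. norm (w s))"
  using bochner_L2_functional(4)[OF w_L2(1) bounded_linear_ev[of 0]] by simp

lemma trace_sq: "integrable lebJ (\<lambda>s. (norm (endpoint_trace (w s)))\<^sup>2)"
  unfolding norm_complex2 endpoint_trace_nth using ev_w(2)[of 0] ev_w(2)[of pi] by simp

lemma flux_measurable: "(\<lambda>s. flux s $ i) \<in> borel_measurable lebJ"
proof -
  have G: "(\<lambda>s. \<Gamma> s $ i $ j) \<in> borel_measurable lebJ" for i j
  proof (rule measurable_compose[of \<Gamma> _ borel])
    show "\<Gamma> \<in> borel_measurable lebJ" using \<Gamma> by (simp add: Linf_bound_def)
    show "(\<lambda>x :: complex ^ 2 ^ 2. x $ i $ j) \<in> borel_measurable borel"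
      by (intro borel_measurable_continuous_onI continuous_intros)
  qed
  have t: "(\<lambda>s. endpoint_trace (w s) $ j) \<in> borel_measurable lebJ" for j :: 2
    using exhaust_2[of j] ev_w(1)[of 0] ev_w(1)[of pi] by (auto simp: endpoint_trace_nth)
  show ?thesis
    unfolding flux_def matrix_vector_mult_def using G t by simp
qed

lemma flux_bound: "AE s in lebJ. norm (flux s) \<le> \<mu> * norm (endpoint_trace (w s))"
proof -
  have "AE s in lebJ. onorm (\<lambda>z. \<Gamma> s *v z) \<le> \<mu>" using \<Gamma> by (simp add: Linf_bound_def)
  then show ?thesis
  proof eventually_elim
    case (elim s)
    have "norm (flux s) \<le> onorm (\<lambda>z. \<Gamma> s *v z) * norm (endpoint_trace (w s))"
      unfolding flux_def by (rule onorm) (rule matrix_vector_mul_bounded_linear)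
    also have "\<dots> \<le> \<mu> * norm (endpoint_trace (w s))" using elim by (intro mult_right_mono) auto
    finally show ?case .
  qed
qed

lemma flux_sq: "integrable lebJ (\<lambda>s. (cmod (flux s $ i))\<^sup>2)" "integrable lebJ (\<lambda>s. flux s $ i)"
proof -
  interpret F: finite_measure lebJ by (rule lebesgue_on_interval_finite)
  have c: "(cmod (z $ i))\<^sup>2 \<le> (norm z)\<^sup>2" for z :: "complex ^ 2"
    using exhaust_2[of i] unfolding norm_complex2 by auto
  show sq: "integrable lebJ (\<lambda>s. (cmod (flux s $ i))\<^sup>2)"
  proof (rule Bochner_Integration.integrable_bound)
    show "integrable lebJ (\<lambda>s. \<mu>\<^sup>2 * (norm (endpoint_trace (w s)))\<^sup>2)" using trace_sq by simp
    show "(\<lambda>s. (cmod (flux s $ i))\<^sup>2) \<in> borel_measurable lebJ" using flux_measurable[of i] by measurable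
    show "AE s in lebJ. norm ((cmod (flux s $ i))\<^sup>2) \<le> norm (\<mu>\<^sup>2 * (norm (endpoint_trace (w s)))\<^sup>2)"
      using flux_bound
    proof eventually_elim
      case (elim s)
      have "(norm (flux s))\<^sup>2 \<le> (\<mu> * norm (endpoint_trace (w s)))\<^sup>2" using elim by (intro power_mono) auto
      from order_trans[OF c[of "flux s"] this] show ?case by (simp add: power_mult_distrib)
    qed
  qed
  show "integrable lebJ (\<lambda>s. flux s $ i)"
  proof (rule Bochner_Integration.integrable_bound)
    show "integrable lebJ (\<lambda>s. 1 + (cmod (flux s $ i))\<^sup>2)" using sq by simp
    have "y \<le> 1 + y\<^sup>2" for y :: real using zero_le_power2[of "y - 1/2"] by (simp add: power2_eq_square algebra_simps)
    then show "AE s in lebJ. norm (flux s $ i) \<le> norm (1 + (cmod (flux s $ i))\<^sup>2)" by (auto intro!: AE_I2)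
  qed (rule flux_measurable)
qed

text \<open>
  The test function \<open>s \<mapsto> D n (t - s) v\<close> separates the variables; every time derivative that falls on it becomes
  one on the mollifier.
\<close>
lemma mollified_weak_form:
  assumes D: "mollifier \<epsilon> D" and t: "{t-\<epsilon>..t+\<epsilon>} \<subseteq> J"
  shows "mollify J D (Suc (Suc n)) (\<lambda>s. hinner (emb (w s)) (emb v)) t + mollify J D (Suc n) (\<lambda>s. hinner (emb (w s)) (emb v)) t
    = mollify J D n (\<lambda>s. form_a0 (w s) v) t + mollify J D n (\<lambda>s. cinner2 (flux s) (endpoint_trace v)) t"
proof -
  obtain wt wtt where wt: "bochner_L2 J wt" "bochner_weak_deriv J (\<lambda>t. emb (w t)) wt" "bochner_L2 J wtt"
     "bochner_weak_deriv J (\<lambda>t. pivot (wt t)) wtt"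
     and weak: "\<And>\<psi> :: real \<Rightarrow> vspace. test_function J \<psi> \<Longrightarrow>
           (\<integral>t. (blinfun_apply (wtt t) (\<psi> t) + hinner (wt t) (emb (\<psi> t)) - form_a0 (w t) (\<psi> t)
                 - cinner2 (\<Gamma> t *v endpoint_trace (w t)) (endpoint_trace (\<psi> t))) \<partial>lebJ) = 0"
    using sol unfolding weak_solution_def by blast
  define \<eta> where "\<eta> k = (\<lambda>s. D k (t - s))" for k
  have te: "test_function J (\<eta> k)" for k unfolding \<eta>_def by (rule mollifier_test_function(1)[OF D t])
  have de: "deriv (\<eta> k) = (\<lambda>s. - \<eta> (Suc k) s)" for k unfolding \<eta>_def by (rule mollifier_test_function(2)[OF D t])
  define T1 where "T1 = (\<lambda>f. hinner f (emb v))"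
  define T2 where "T2 = (\<lambda>F :: vspace \<Rightarrow>\<^sub>L complex. blinfun_apply F v)"
  have T1: "bounded_linear T1" unfolding T1_def by (rule bounded_linear_hinner_left)
  have T2: "bounded_linear T2" unfolding T2_def by (rule blinfun.bounded_linear_left) 
  have T2p: "T2 (pivot h) = T1 h" for h by (simp add: T1_def T2_def pivot_apply)
  have int: "integrable lebJ (\<lambda>s. \<eta> k s *\<^sub>R f s)" if "integrable lebJ f" for f :: "real \<Rightarrow> complex" and k
    unfolding \<eta>_def by (rule mollify_integrable[OF D that])
  have i_wtt: "integrable lebJ (\<lambda>s. T2 (wtt s))" by (rule bochner_L2_functional(3)[OF wt(3) T2])
  have i_wt: "integrable lebJ (\<lambda>s. T1 (wt s))" by (rule bochner_L2_functional(3)[OF wt(1) T1])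
  have i_w: "integrable lebJ (\<lambda>s. T1 (emb (w s)))" by (rule bochner_L2_functional(3)[OF w_L2(2) T1])
  have i_a: "integrable lebJ (\<lambda>s. form_a0 (w s) v)" by (rule bochner_L2_functional(3)[OF w_L2(1) bounded_linear_form_a0_left])
  have i_c: "integrable lebJ (\<lambda>s. cinner2 (flux s) (endpoint_trace v))"
    unfolding cinner2_expand using flux_sq(2)[of 1] flux_sq(2)[of 2] by simp
  have e1: "(\<integral>s. \<eta> (Suc k) s *\<^sub>R T1 (emb (w s)) \<partial>lebJ) = (\<integral>s. \<eta> k s *\<^sub>R T1 (wt s) \<partial>lebJ)" for k
    using bochner_weak_deriv_functional(3)[OF wt(2) T1 te[of k]] unfolding de by simp
  have e2: "(\<integral>s. \<eta> (Suc k) s *\<^sub>R T1 (wt s) \<partial>lebJ) = (\<integral>s. \<eta> k s *\<^sub>R T2 (wtt s) \<partial>lebJ)" for k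
    using bochner_weak_deriv_functional(3)[OF wt(4) T2 te[of k]] unfolding de T2p by simp
  have tv: "test_function J (\<lambda>s. \<eta> n s *\<^sub>R v)"
  proof -
    obtain E where E: "E 0 = \<eta> n" "\<And>m t. (E m has_vector_derivative E (Suc m) t) (at t)"
      using te[of n] unfolding test_function_def smooth_def by blast
    have "smooth (\<lambda>s. \<eta> n s *\<^sub>R v)"
      unfolding smooth_def
    proof (intro exI[of _ "\<lambda>m s. E m s *\<^sub>R v"] conjI allI)
      show "((\<lambda>s. E m s *\<^sub>R v) has_vector_derivative E (Suc m) t *\<^sub>R v) (at t)" for m t
        by (rule bounded_linear.has_vector_derivative[OF bounded_linear_scaleR_left E(2)])
    qed (simp add: E)
    moreover obtain K where "compact K" "K \<subseteq> J" "\<And>t. t \<notin> K \<Longrightarrow> \<eta> n t = 0" using te[of n] unfolding test_function_def by blast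
    ultimately show ?thesis unfolding test_function_def by (auto intro!: exI[of _ K])
  qed
  have "0 = (\<integral>s. (\<eta> n s *\<^sub>R T2 (wtt s) + \<eta> n s *\<^sub>R T1 (wt s) - \<eta> n s *\<^sub>R form_a0 (w s) v
                 - \<eta> n s *\<^sub>R cinner2 (flux s) (endpoint_trace v)) \<partial>lebJ)"
    using weak[OF tv] by (simp add: blinfun.scaleR_right emb_scaleR hinner_scaleR_right form_a0_scaleR_right cinner2_trace_scaleR T1_def T2_def flux_def)
  also have "\<dots> = (\<integral>s. \<eta> n s *\<^sub>R T2 (wtt s) \<partial>lebJ) + (\<integral>s. \<eta> n s *\<^sub>R T1 (wt s) \<partial>lebJ)
      - (\<integral>s. \<eta> n s *\<^sub>R form_a0 (w s) v \<partial>lebJ) - (\<integral>s. \<eta> n s *\<^sub>R cinner2 (flux s) (endpoint_trace v) \<partial>lebJ)"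
    using int[OF i_wtt] int[OF i_wt] int[OF i_a] int[OF i_c] by simp
  also have "(\<integral>s. \<eta> n s *\<^sub>R T2 (wtt s) \<partial>lebJ) = (\<integral>s. \<eta> (Suc (Suc n)) s *\<^sub>R T1 (emb (w s)) \<partial>lebJ)"
    unfolding e1[of "Suc n"] e2[of n] ..
  also have "(\<integral>s. \<eta> n s *\<^sub>R T1 (wt s) \<partial>lebJ) = (\<integral>s. \<eta> (Suc n) s *\<^sub>R T1 (emb (w s)) \<partial>lebJ)"
    unfolding e1[of n] ..
  finally show ?thesis unfolding mollify_def T1_def \<eta>_def by (simp add: algebra_simps)
qed

end

section \<open>Joint regularity of the mollified solution\<close>

lemma mollify_AE_cong:
  fixes k k' :: "real \<Rightarrow> 'b::{banach,second_countable_topology}"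
  assumes D: "mollifier \<epsilon> D" and ae: "AE s in lebesgue_on J. k s = k' s"
    and m: "k \<in> borel_measurable (lebesgue_on J)" "k' \<in> borel_measurable (lebesgue_on J)"
  shows "mollify J D n k t = mollify J D n k' t"
  unfolding mollify_def
proof (rule integral_cong_AE)
  show "AE s in lebesgue_on J. D n (t - s) *\<^sub>R k s = D n (t - s) *\<^sub>R k' s" using ae by eventually_elim simp
qed (intro borel_measurable_scaleR mollifier_measurable[OF D] m)+

text \<open>
  Young's inequality with a kernel of mass 1: Jensen's inequality in the form \<open>\<integral> D (|k| - m)\<^sup>2 \<ge> 0\<close>, followed by
  Fubini's theorem.
\<close>
lemma mollify_square_integral_le:
  fixes k :: "real \<Rightarrow> complex"
  assumes D: "mollifier \<epsilon> D" and k: "integrable (lebesgue_on {p<..<q}) k" "integrable (lebesgue_on {p<..<q}) (\<lambda>s. (cmod (k s))\<^sup>2)"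
    and ab: "a \<le> b" "p + \<epsilon> < a" "b < q - \<epsilon>"
  shows "integral {a..b} (\<lambda>t. (cmod (mollify {p<..<q} D 0 k t))\<^sup>2) \<le> (\<integral>s. (cmod (k s))\<^sup>2 \<partial>lebesgue_on {p<..<q})"
proof -
  let ?J = "{p<..<q}"
  let ?M = "lebesgue_on ?J"
  let ?N = "lebesgue_on {a..b}"
  interpret FM: finite_measure ?M by (rule lebesgue_on_interval_finite)
  interpret FN: finite_measure ?N by (rule finite_measure_lebesgue_on) simp
  interpret P: pair_sigma_finite ?N ?M ..
  define k2 where "k2 = (\<lambda>s. (cmod (k s))\<^sup>2)"
  have ik2: "integrable ?M k2" using k(2) by (simp only: k2_def)
  have e0: "0 < \<epsilon>" by (rule mollifierD(1)[OF D])
  have mc: "continuous_on {a..b} (mollify ?J D 0 f)" if "integrable ?M f" for f :: "real \<Rightarrow> 'z::{banach,second_countable_topology}"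
    using mollify_has_derivative[OF D that] by (auto intro!: continuous_at_imp_continuous_on has_vector_derivative_continuous)
  have pt: "(cmod (mollify ?J D 0 k t))\<^sup>2 \<le> mollify ?J D 0 k2 t" if t: "t \<in> {a..b}" for t
  proof -
    have sub: "{t-\<epsilon>..t+\<epsilon>} \<subseteq> ?J" using t ab by auto
    note one = mollifier_integral_one[OF D sub]
    have i1: "integrable ?M (\<lambda>s. D 0 (t - s) *\<^sub>R k s)" by (rule mollify_integrable[OF D k(1)])
    have i2: "integrable ?M (\<lambda>s. D 0 (t - s) *\<^sub>R k2 s)" by (rule mollify_integrable[OF D ik2])
    have i3: "integrable ?M (\<lambda>s. D 0 (t - s) * cmod (k s))" using mollify_integrable[OF D integrable_norm[OF k(1)], of 0 t] by simp
    define m where "m = (\<integral>s. D 0 (t - s) * cmod (k s) \<partial>?M)"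
    have "cmod (mollify ?J D 0 k t) \<le> (\<integral>s. norm (D 0 (t - s) *\<^sub>R k s) \<partial>?M)"
      unfolding mollify_def by (rule integral_norm_bound)
    also have "\<dots> = m" unfolding m_def using mollifierD(4)[OF D] by simp
    finally have le: "cmod (mollify ?J D 0 k t) \<le> m" .
    have "0 \<le> (\<integral>s. D 0 (t - s) * (cmod (k s) - m)\<^sup>2 \<partial>?M)" using mollifierD(4)[OF D] by (intro integral_nonneg_AE AE_I2) auto
    also have "\<dots> = (\<integral>s. D 0 (t - s) *\<^sub>R k2 s - (2 * m) * (D 0 (t - s) * cmod (k s)) + m\<^sup>2 * D 0 (t - s) \<partial>?M)"
      by (rule Bochner_Integration.integral_cong) (auto simp: k2_def power2_eq_square algebra_simps)
    also have "\<dots> = mollify ?J D 0 k2 t - (2 * m) * m + m\<^sup>2 * 1"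
      using i2 i3 one by (simp add: mollify_def m_def)
    finally have "m\<^sup>2 \<le> mollify ?J D 0 k2 t" by (simp add: power2_eq_square)
    moreover have "(cmod (mollify ?J D 0 k t))\<^sup>2 \<le> m\<^sup>2" using le by (intro power_mono) auto
    ultimately show ?thesis by linarith
  qed
  have "integral {a..b} (\<lambda>t. (cmod (mollify ?J D 0 k t))\<^sup>2) \<le> integral {a..b} (mollify ?J D 0 k2)"
    by (intro integral_le integrable_continuous_interval continuous_intros mc k ik2 pt)
  also have "\<dots> \<le> (\<integral>s. k2 s \<partial>?M)"
  proof -
    define f where "f = (\<lambda>t s. D 0 (t - s) * k2 s)"
    obtain C where C: "0 < C" "\<And>t. \<bar>D 0 t\<bar> \<le> C" using mollifier_bounded[OF D] by blast
    have mk [measurable]: "k2 \<in> borel_measurable ?M" using ik2 by simp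
    have mf: "case_prod f \<in> borel_measurable (?N \<Otimes>\<^sub>M ?M)"
    proof -
      have [measurable]: "(\<lambda>x::real. x) \<in> borel_measurable ?M" "(\<lambda>x::real. x) \<in> borel_measurable ?N"
        by (rule continuous_measurable_lebesgue_on, rule continuous_on_id)+
      have "(\<lambda>z. fst z - snd z) \<in> borel_measurable (?N \<Otimes>\<^sub>M ?M)" by measurable
      then have "(\<lambda>z. D 0 (fst z - snd z)) \<in> borel_measurable (?N \<Otimes>\<^sub>M ?M)"
        by (rule measurable_compose) (rule borel_measurable_continuous_onI[OF mollifierD(6)[OF D]])
      then show ?thesis unfolding f_def case_prod_unfold by measurable
    qed
    have fn: "0 \<le> f t s" for t s using mollifierD(4)[OF D] by (simp add: f_def k2_def)
    have i1: "integrable ?M (\<lambda>s. f t s)" for t unfolding f_def using mollify_integrable[OF D ik2, of 0 t] by simp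
    have eqm: "(\<integral>s. f t s \<partial>?M) = mollify ?J D 0 k2 t" for t by (simp add: f_def mollify_def)
    have im: "integrable ?N (mollify ?J D 0 k2)"
    proof -
      obtain B where "\<forall>x\<in>mollify ?J D 0 k2 ` {a..b}. norm x \<le> B"
        using compact_imp_bounded[OF compact_continuous_image[OF mc[OF ik2]]] unfolding bounded_iff by blast
      then show ?thesis
        by (intro FN.integrable_const_bound[of _ B]) (auto intro!: AE_I2 continuous_imp_measurable_on_sets_lebesgue mc[OF ik2])
    qed
    have int: "integrable (?N \<Otimes>\<^sub>M ?M) (case_prod f)"
      by (rule P.Fubini_integrable[OF mf]) (use fn im eqm i1 in auto)
    have "integral {a..b} (mollify ?J D 0 k2) = (\<integral>t. mollify ?J D 0 k2 t \<partial>?N)"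
      by (rule lebesgue_integral_eq_integral[OF im, symmetric]) simp
    also have "\<dots> = (\<integral>t. (\<integral>s. f t s \<partial>?M) \<partial>?N)" by (simp add: eqm)
    also have "\<dots> = (\<integral>s. (\<integral>t. f t s \<partial>?N) \<partial>?M)" by (rule P.Fubini_integral[OF int, symmetric])
    also have "\<dots> \<le> (\<integral>s. k2 s \<partial>?M)"
    proof (rule integral_mono')
      show "integrable ?M k2" by (rule ik2)
      fix s
      show "0 \<le> k2 s" by (simp add: k2_def)
      have iD: "(\<lambda>t. D 0 (t - s)) integrable_on {c..d}" for c d
        by (intro integrable_continuous_interval continuous_on_compose2[OF mollifierD(6)[OF D, of UNIV]]) (auto intro!: continuous_intros)
      have "(\<integral>t. D 0 (t - s) \<partial>?N) \<le> 1"
      proof -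
        have iN: "integrable ?N (\<lambda>t. D 0 (t - s))"
          using C(2) by (intro FN.integrable_const_bound[of _ C] AE_I2 continuous_imp_measurable_on_sets_lebesgue continuous_on_compose2[OF mollifierD(6)[OF D, of UNIV]])
            (auto intro!: continuous_intros)
        have "(\<integral>t. D 0 (t - s) \<partial>?N) = integral {a..b} (\<lambda>t. D 0 (t - s))" by (rule lebesgue_integral_eq_integral[OF iN]) simp
        also have "\<dots> \<le> integral {min a (s-\<epsilon>)..max b (s+\<epsilon>)} (\<lambda>t. D 0 (t - s))"
          using mollifierD(4)[OF D] iD by (intro integral_subset_le) auto
        also have "\<dots> = 1"
        proof (rule integral_unique)
          have "(D 0 has_integral 1) (cbox (-\<epsilon>) \<epsilon>)" using mollifierD(5)[OF D] by simp
          from has_integral_affinity'[OF this, of 1 "-s"]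
          have "((\<lambda>t. D 0 (t - s)) has_integral 1) {s-\<epsilon>..s+\<epsilon>}" by (simp add: add.commute)
          then show "((\<lambda>t. D 0 (t - s)) has_integral 1) {min a (s-\<epsilon>)..max b (s+\<epsilon>)}"
            by (rule has_integral_on_superset) (auto intro!: mollifierD(3)[OF D])
        qed
        finally show ?thesis .
      qed
      then have "(\<integral>t. D 0 (t - s) \<partial>?N) * k2 s \<le> 1 * k2 s" by (rule mult_right_mono) (simp add: k2_def)
      then show "(\<integral>t. f t s \<partial>?N) \<le> k2 s" by (simp add: f_def)
    qed
    finally show ?thesis .
  qed
  finally show ?thesis by (simp add: k2_def)
qed

context boundary_solution
begin

lemma mollify_jointly_continuous:
  assumes D: "mollifier \<epsilon> D" and K: "\<And>\<phi>. \<phi> \<in> {0..pi} \<Longrightarrow> bounded_linear (K \<phi>)"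
    and C: "\<And>\<phi> f. \<phi> \<in> {0..pi} \<Longrightarrow> cmod (K \<phi> f) \<le> C * norm f" and c: "\<And>f. continuous_on {0..pi} (\<lambda>\<phi>. K \<phi> f)"
  shows "continuous_on (UNIV \<times> {0..pi}) (\<lambda>z. mollify J D n (\<lambda>s. K (snd z) (w s)) (fst z))"
  unfolding continuous_on_sequentially
proof (intro allI ballI impI)
  fix z :: "nat \<Rightarrow> real \<times> real" and z0
  assume z0: "z0 \<in> UNIV \<times> {0..pi}" and z: "(\<forall>i. z i \<in> UNIV \<times> {0..pi}) \<and> z \<longlonglongrightarrow> z0"
  have zs: "snd z0 \<in> {0..pi}" "\<And>i. snd (z i) \<in> {0..pi}" using z0 z by (auto simp: mem_Times_iff)
  obtain B where B: "0 < B" "\<And>t. \<bar>D n t\<bar> \<le> B" using mollifier_bounded[OF D] by blast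
  have Km: "(\<lambda>s. K \<phi> (w s)) \<in> borel_measurable lebJ" if "\<phi> \<in> {0..pi}" for \<phi>
    using bochner_L2_functional(1)[OF w_L2(1) K[OF that]] .
  have C0: "0 \<le> C"
  proof (rule ccontr)
    assume "\<not> 0 \<le> C"
    obtain v where "emb v = abs_hspace (\<lambda>_. 1)" "crep v 0 = 1" using one_vspace by blast
    then have "v \<noteq> 0" using linear_0[OF bounded_linear.linear[OF bounded_linear_ev[of 0]]] by (metis atLeastAtMost_iff order_refl pi_ge_zero zero_neq_one)
    then have "C * norm v < 0" using \<open>\<not> 0 \<le> C\<close> by (simp add: mult_neg_pos)
    then show False using C[of 0 v] by (smt (verit) atLeastAtMost_iff norm_ge_zero pi_ge_zero)
  qed
  show "((\<lambda>z. mollify J D n (\<lambda>s. K (snd z) (w s)) (fst z)) \<circ> z) \<longlonglongrightarrow> mollify J D n (\<lambda>s. K (snd z0) (w s)) (fst z0)"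
    unfolding o_def mollify_def
  proof (rule integral_dominated_convergence[where w="\<lambda>s. B * (C * norm (w s))"])
    show "(\<lambda>s. D n (fst z0 - s) *\<^sub>R K (snd z0) (w s)) \<in> borel_measurable lebJ"
      by (intro borel_measurable_scaleR mollifier_measurable[OF D] Km zs)
    show "(\<lambda>s. D n (fst (z i) - s) *\<^sub>R K (snd (z i)) (w s)) \<in> borel_measurable lebJ" for i
      by (intro borel_measurable_scaleR mollifier_measurable[OF D] Km zs)
    show "integrable lebJ (\<lambda>s. B * (C * norm (w s)))" using norm_w_integrable by simp
    show "AE s in lebJ. (\<lambda>i. D n (fst (z i) - s) *\<^sub>R K (snd (z i)) (w s)) \<longlonglongrightarrow> D n (fst z0 - s) *\<^sub>R K (snd z0) (w s)"
    proof (rule AE_I2)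
      fix s
      have 1: "(\<lambda>i. D n (fst (z i) - s)) \<longlonglongrightarrow> D n (fst z0 - s)"
      proof (rule continuous_on_tendsto_compose[OF mollifierD(6)[OF D, of UNIV]])
        show "(\<lambda>i. fst (z i) - s) \<longlonglongrightarrow> fst z0 - s" using z by (intro tendsto_intros) auto
      qed auto
      have 2: "(\<lambda>i. K (snd (z i)) (w s)) \<longlonglongrightarrow> K (snd z0) (w s)"
        by (rule continuous_on_tendsto_compose[OF c[of "w s"], where g="\<lambda>i. snd (z i)"]) (use zs z in \<open>auto intro!: tendsto_snd always_eventually\<close>)
      show "(\<lambda>i. D n (fst (z i) - s) *\<^sub>R K (snd (z i)) (w s)) \<longlonglongrightarrow> D n (fst z0 - s) *\<^sub>R K (snd z0) (w s)"
        by (rule tendsto_scaleR[OF 1 2])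
    qed
    show "AE s in lebJ. norm (D n (fst (z i) - s) *\<^sub>R K (snd (z i)) (w s)) \<le> B * (C * norm (w s))" for i
      using B C[OF zs(2)] C0 by (intro AE_I2) (auto intro!: mult_mono)
  qed
qed

definition W :: "(nat \<Rightarrow> real \<Rightarrow> real) \<Rightarrow> nat \<Rightarrow> real \<Rightarrow> real \<Rightarrow> complex" where
  "W D n t \<phi> = mollify J D n (\<lambda>s. ev \<phi> (w s)) t"

lemma W_continuous:
  assumes "mollifier \<epsilon> D"
  shows "continuous_on (UNIV \<times> {0..pi}) (\<lambda>z. W D n (fst z) (snd z))"
proof -
  obtain C where C: "\<forall>f. \<forall>\<phi>\<in>{0..pi}. cmod (crep f \<phi>) \<le> C * norm f" using crep_bounded by blast
  show ?thesis
    unfolding W_def by (rule mollify_jointly_continuous[OF assms bounded_linear_ev, where C=C]) (use C crep_props(1) in auto)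
qed

lemma W_continuous_slice: "mollifier \<epsilon> D \<Longrightarrow> continuous_on {0..pi} (W D n t)"
proof -
  assume D: "mollifier \<epsilon> D"
  have p: "continuous_on {0..pi} (\<lambda>\<phi>. (t, \<phi>))" by (intro continuous_on_Pair continuous_on_const continuous_on_id)
  show ?thesis using continuous_on_compose2[OF W_continuous[OF D, of n] p] by auto
qed

lemma W_has_derivative:
  "mollifier \<epsilon> D \<Longrightarrow> \<phi> \<in> {0..pi} \<Longrightarrow> ((\<lambda>t. W D n t \<phi>) has_vector_derivative W D (Suc n) t \<phi>) (at t)"
  unfolding W_def by (rule mollify_has_derivative[OF _ ev_w(3)])

text \<open>
  A Caratheodory function (measurable in \<open>s\<close>, continuous in \<open>\<phi>\<close>) is a pointwise limit of functions that are
  piecewise constant in \<open>\<phi>\<close>, which makes it jointly measurable.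
\<close>
lemma ev_jointly_measurable: "(\<lambda>z. ev (snd z) (w (fst z))) \<in> borel_measurable (lebJ \<Otimes>\<^sub>M leb0)"
proof -
  define g where "g n \<phi> = of_int \<lfloor>real (Suc n) * \<phi>\<rfloor> / real (Suc n)" for n and \<phi> :: real
  have g: "g n \<phi> \<in> {0..pi}" if "\<phi> \<in> {0<..<pi}" for n \<phi>
  proof -
    have "0 \<le> \<lfloor>real (Suc n) * \<phi>\<rfloor>" using that by simp
    moreover have "of_int \<lfloor>real (Suc n) * \<phi>\<rfloor> \<le> real (Suc n) * \<phi>" by linarith
    ultimately have "0 \<le> g n \<phi>" "g n \<phi> \<le> \<phi>" by (simp_all add: g_def field_simps)
    then show ?thesis using that by auto
  qed
  have gl: "(\<lambda>n. g n \<phi>) \<longlonglongrightarrow> \<phi>" for \<phi>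
  proof (rule LIMSEQ_I)
    fix r :: real assume r: "0 < r"
    obtain N where N: "1 / real (Suc N) < r" using r nat_approx_posE by blast
    show "\<exists>no. \<forall>n\<ge>no. norm (g n \<phi> - \<phi>) < r"
    proof (intro exI[of _ N] allI impI)
      fix n assume "N \<le> n"
      have "\<bar>of_int \<lfloor>real (Suc n) * \<phi>\<rfloor> - real (Suc n) * \<phi>\<bar> \<le> 1" by linarith
      moreover have "(g n \<phi> - \<phi>) * real (Suc n) = of_int \<lfloor>real (Suc n) * \<phi>\<rfloor> - real (Suc n) * \<phi>"
        by (simp add: g_def left_diff_distrib del: of_nat_Suc)
      ultimately have "\<bar>(g n \<phi> - \<phi>) * real (Suc n)\<bar> \<le> 1" by (simp only:)
      then have "\<bar>g n \<phi> - \<phi>\<bar> * real (Suc n) \<le> 1" by (simp only: abs_mult abs_of_nat)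
      then have "\<bar>g n \<phi> - \<phi>\<bar> \<le> 1 / real (Suc n)" by (subst pos_le_divide_eq) simp_all
      also have "\<dots> \<le> 1 / real (Suc N)" using \<open>N \<le> n\<close> by (simp add: field_simps)
      finally show "norm (g n \<phi> - \<phi>) < r" using N by simp
    qed
  qed
  have id0 [measurable]: "(\<lambda>x::real. x) \<in> borel_measurable leb0"
    by (rule continuous_measurable_lebesgue_on) (rule continuous_on_id)
  \<comment> \<open>\<open>c\<close> keeps the grid points inside \<open>[0, \<pi>]\<close>, where point evaluations are linear and bounded\<close>
  define c where "c \<phi> = max 0 (min pi \<phi>)" for \<phi>
  have c: "c \<phi> \<in> {0..pi}" for \<phi> by (auto simp: c_def)
  have cid: "c \<phi> = \<phi>" if "\<phi> \<in> {0..pi}" for \<phi> using that by (auto simp: c_def)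
  have m: "(\<lambda>z. ev (c (g n (snd z))) (w (fst z))) \<in> borel_measurable (lebJ \<Otimes>\<^sub>M leb0)" for n
  proof -
    have "(\<lambda>z. (\<lambda>i z. ev (c (of_int i / real (Suc n))) (w (fst z))) \<lfloor>real (Suc n) * snd z\<rfloor> z) \<in> borel_measurable (lebJ \<Otimes>\<^sub>M leb0)"
    proof (rule measurable_compose_countable[where f="\<lambda>i z. ev (c (of_int i / real (Suc n))) (w (fst z))" and g="\<lambda>z. \<lfloor>real (Suc n) * snd z\<rfloor>"])
      show "(\<lambda>z. ev (c (of_int i / real (Suc n))) (w (fst z))) \<in> borel_measurable (lebJ \<Otimes>\<^sub>M leb0)" for i :: int
        by (rule measurable_compose[OF measurable_fst]) (rule ev_w(1)[OF c])
      show "(\<lambda>z. \<lfloor>real (Suc n) * snd z\<rfloor>) \<in> lebJ \<Otimes>\<^sub>M leb0 \<rightarrow>\<^sub>M count_space UNIV" by measurable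
    qed
    then show ?thesis by (simp add: g_def)
  qed
  show ?thesis
  proof (rule borel_measurable_LIMSEQ_metric[OF m])
    fix z assume "z \<in> space (lebJ \<Otimes>\<^sub>M leb0)"
    then have s: "snd z \<in> {0<..<pi}" by (auto simp: space_pair_measure)
    have eq: "c (g n (snd z)) = g n (snd z)" for n by (rule cid[OF g[OF s]])
    show "(\<lambda>n. ev (c (g n (snd z))) (w (fst z))) \<longlonglongrightarrow> ev (snd z) (w (fst z))"
      unfolding eq by (rule continuous_on_tendsto_compose[OF crep_props(1) gl]) (use s g[OF s] in \<open>auto intro!: always_eventually\<close>)
  qed
qed

lemma mollify_hinner:
  assumes D: "mollifier \<epsilon> D" and H: "H \<in> L2_omega"
  shows "mollify J D n (\<lambda>s. hinner (emb (w s)) (abs_hspace H)) t = (\<integral>\<phi>. omega \<phi> *\<^sub>R (W D n t \<phi> * cnj (H \<phi>)) \<partial>leb0)"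
proof -
  interpret FM: finite_measure lebJ by (rule lebesgue_on_interval_finite)
  interpret FN: finite_measure leb0 by (rule lebesgue_on_interval_finite)
  interpret P: pair_sigma_finite lebJ leb0 ..
  obtain C where C: "0 < C" "\<And>f \<phi>. \<phi> \<in> {0..pi} \<Longrightarrow> cmod (crep f \<phi>) \<le> C * norm f" using crep_bounded by blast
  obtain B where B: "0 < B" "\<And>t. \<bar>D n t\<bar> \<le> B" using mollifier_bounded[OF D] by blast
  define f where "f = (\<lambda>s \<phi>. D n (t - s) *\<^sub>R (omega \<phi> *\<^sub>R (ev \<phi> (w s) * cnj (H \<phi>))))"
  have Hm [measurable]: "H \<in> borel_measurable leb0" using H by (simp add: L2_omega_def meas_omega_iff)
  have cH [measurable]: "(\<lambda>\<phi>. cnj (H \<phi>)) \<in> borel_measurable leb0"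
    by (rule measurable_compose[OF Hm borel_measurable_continuous_onI[of cnj]]) (auto intro!: continuous_intros)
  note [measurable] = mollifier_measurable[OF D, of n t J] omega_meas_leb ev_jointly_measurable
  have mf: "case_prod f \<in> borel_measurable (lebJ \<Otimes>\<^sub>M leb0)"
    unfolding f_def case_prod_unfold
    by (intro borel_measurable_scaleR borel_measurable_times ev_jointly_measurable
        measurable_compose[OF measurable_fst mollifier_measurable[OF D]]
        measurable_compose[OF measurable_snd omega_meas_leb] measurable_compose[OF measurable_snd cH])
  have in_: "integrable leb0 (\<lambda>\<phi>. f s \<phi>)" for s
    unfolding f_def by (intro integrable_scaleR_right hinner_emb(2)[OF H])
  have Hi: "integrable leb0 (\<lambda>\<phi>. cmod (H \<phi>))" by (rule integrable_norm[OF L2_omega_integrable_leb(1)[OF H]])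
  have int: "integrable (lebJ \<Otimes>\<^sub>M leb0) (case_prod f)"
  proof (rule P.Fubini_integrable[OF mf])
    show "AE s in lebJ. integrable leb0 (\<lambda>\<phi>. case_prod f (s, \<phi>))" using in_ by simp
    show "integrable lebJ (\<lambda>s. \<integral>\<phi>. norm (case_prod f (s, \<phi>)) \<partial>leb0)"
    proof (rule Bochner_Integration.integrable_bound)
      show "integrable lebJ (\<lambda>s. norm (w s) * (B * C * (\<integral>\<phi>. cmod (H \<phi>) \<partial>leb0)))" using norm_w_integrable by simp
      show "(\<lambda>s. \<integral>\<phi>. norm (case_prod f (s, \<phi>)) \<partial>leb0) \<in> borel_measurable lebJ" using mf by measurable
      show "AE s in lebJ. norm (\<integral>\<phi>. norm (case_prod f (s, \<phi>)) \<partial>leb0) \<le> norm (norm (w s) * (B * C * (\<integral>\<phi>. cmod (H \<phi>) \<partial>leb0)))"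
      proof (rule AE_I2)
        fix s
        have "(\<integral>\<phi>. norm (case_prod f (s, \<phi>)) \<partial>leb0) \<le> (\<integral>\<phi>. norm (w s) * (B * C) * cmod (H \<phi>) \<partial>leb0)"
        proof (rule integral_mono)
          show "integrable leb0 (\<lambda>\<phi>. norm (case_prod f (s, \<phi>)))" using integrable_norm[OF in_[of s]] by simp
          show "integrable leb0 (\<lambda>\<phi>. norm (w s) * (B * C) * cmod (H \<phi>))" using Hi by simp
          fix \<phi> assume "\<phi> \<in> space leb0"
          then have p: "\<phi> \<in> {0<..<pi}" by simp
          have "norm (case_prod f (s, \<phi>)) = \<bar>D n (t - s)\<bar> * (omega \<phi> * (cmod (ev \<phi> (w s)) * cmod (H \<phi>)))"
            using abs_of_pos[OF omega_pos[OF p]] by (simp add: f_def norm_mult abs_mult)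
          also have "\<dots> \<le> B * (1 * ((C * norm (w s)) * cmod (H \<phi>)))"
            using B C p omega_pos[OF p] omega_le_1 by (intro mult_mono) (auto intro!: mult_nonneg_nonneg)
          finally show "norm (case_prod f (s, \<phi>)) \<le> norm (w s) * (B * C) * cmod (H \<phi>)" by (simp add: mult_ac)
        qed
        also have "\<dots> = norm (w s) * (B * C * (\<integral>\<phi>. cmod (H \<phi>) \<partial>leb0))" by simp
        finally show "norm (\<integral>\<phi>. norm (case_prod f (s, \<phi>)) \<partial>leb0) \<le> norm (norm (w s) * (B * C * (\<integral>\<phi>. cmod (H \<phi>) \<partial>leb0)))"
          using B C by (simp add: integral_nonneg_AE abs_mult)
      qed
    qed
  qed
  have "mollify J D n (\<lambda>s. hinner (emb (w s)) (abs_hspace H)) t = (\<integral>s. (\<integral>\<phi>. f s \<phi> \<partial>leb0) \<partial>lebJ)"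
    unfolding mollify_def f_def hinner_emb(1)[OF H] by (simp del: scaleR_scaleR)
  also have "\<dots> = (\<integral>\<phi>. (\<integral>s. f s \<phi> \<partial>lebJ) \<partial>leb0)" by (rule P.Fubini_integral[OF int, symmetric])
  also have "\<dots> = (\<integral>\<phi>. omega \<phi> *\<^sub>R (W D n t \<phi> * cnj (H \<phi>)) \<partial>leb0)"
  proof (rule Bochner_Integration.integral_cong[OF refl])
    fix \<phi> assume "\<phi> \<in> space leb0"
    then have p: "\<phi> \<in> {0..pi}" by auto
    have i: "integrable lebJ (\<lambda>s. D n (t - s) *\<^sub>R ev \<phi> (w s))" by (rule mollify_integrable[OF D ev_w(3)[OF p]])
    have "(\<integral>s. f s \<phi> \<partial>lebJ) = (\<integral>s. (D n (t - s) *\<^sub>R ev \<phi> (w s)) * (omega \<phi> *\<^sub>R cnj (H \<phi>)) \<partial>lebJ)"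
      by (rule Bochner_Integration.integral_cong) (auto simp: f_def scaleR_conv_of_real)
    also have "\<dots> = W D n t \<phi> * (omega \<phi> *\<^sub>R cnj (H \<phi>))" unfolding W_def mollify_def using i by (simp del: scaleR_scaleR mult_scaleR_left mult_scaleR_right)
    finally show "(\<integral>s. f s \<phi> \<partial>lebJ) = omega \<phi> *\<^sub>R (W D n t \<phi> * cnj (H \<phi>))" by simp
  qed
  finally show ?thesis .
qed

end

section \<open>The mollified solution is classical\<close>

lemma continuous_L2_omega:
  fixes g :: "real \<Rightarrow> complex"
  assumes "continuous_on {0..pi} g"
  shows "g \<in> L2_omega" "g \<in> borel_measurable leb0"
proof -
  obtain C where "\<forall>x\<in>g ` {0..pi}. norm x \<le> C"
    using compact_imp_bounded[OF compact_continuous_image[OF assms]] unfolding bounded_iff by blast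
  moreover show "g \<in> borel_measurable leb0"
    by (intro continuous_imp_measurable_on_sets_lebesgue continuous_on_subset[OF assms]) auto
  ultimately show "g \<in> L2_omega" by (intro L2_omega_bounded[of _ C]) auto
qed

lemma omega_integral_clip:
  fixes g :: "real \<Rightarrow> complex"
  assumes g: "continuous_on {0..pi} g" and H: "H \<in> L2_omega" and \<psi>: "\<psi> \<in> {0..pi}"
    and c: "\<And>\<phi>. \<phi> \<in> {0<..<pi} \<Longrightarrow> H \<phi> = (if \<phi> \<le> \<psi> then complex_of_real (c \<phi>) else 0)"
  shows "(\<integral>\<phi>. omega \<phi> *\<^sub>R (g \<phi> * cnj (H \<phi>)) \<partial>leb0) = integral {0..\<psi>} (\<lambda>\<phi>. (omega \<phi> * c \<phi>) *\<^sub>R g \<phi>)"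
proof -
  note gL = continuous_L2_omega[OF g]
  have Hm: "H \<in> borel_measurable leb0" using H by (simp add: L2_omega_def meas_omega_iff)
  have "(\<lambda>\<phi>. cnj (H \<phi>)) \<in> borel_measurable leb0"
    by (rule measurable_compose[OF Hm borel_measurable_continuous_onI[of cnj]]) (auto intro!: continuous_intros)
  then have m: "(\<lambda>\<phi>. g \<phi> * cnj (H \<phi>)) \<in> borel_measurable leb0" using gL(2) by measurable
  have i: "integrable leb0 (\<lambda>\<phi>. omega \<phi> *\<^sub>R (g \<phi> * cnj (H \<phi>)))"
    using L2_omega_mult_cnj[OF gL(1) H] unfolding integrable_omega_iff(1)[OF m] .
  have eq: "omega \<phi> *\<^sub>R (g \<phi> * cnj (H \<phi>)) = (if \<phi> \<in> {0..\<psi>} then (omega \<phi> * c \<phi>) *\<^sub>R g \<phi> else 0)" if "\<phi> \<in> {0<..<pi}" for \<phi>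
    using that by (simp add: c scaleR_conv_of_real)
  have "(\<integral>\<phi>. omega \<phi> *\<^sub>R (g \<phi> * cnj (H \<phi>)) \<partial>leb0) = integral {0<..<pi} (\<lambda>\<phi>. omega \<phi> *\<^sub>R (g \<phi> * cnj (H \<phi>)))"
    by (rule lebesgue_integral_eq_integral[OF i]) simp
  also have "\<dots> = integral {0<..<pi} (\<lambda>\<phi>. if \<phi> \<in> {0..\<psi>} then (omega \<phi> * c \<phi>) *\<^sub>R g \<phi> else 0)"
    by (rule Henstock_Kurzweil_Integration.integral_cong) (rule eq)
  also have "\<dots> = integral {0..pi} (\<lambda>\<phi>. if \<phi> \<in> {0..\<psi>} then (omega \<phi> * c \<phi>) *\<^sub>R g \<phi> else 0)"
    by (simp add: integral_open_interval_real)
  also have "\<dots> = integral ({0..\<psi>} \<inter> {0..pi}) (\<lambda>\<phi>. (omega \<phi> * c \<phi>) *\<^sub>R g \<phi>)" by (rule integral_restrict_Int)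
  also have "{0..\<psi>} \<inter> {0..pi} = {0..\<psi>}" using \<psi> by auto
  finally show ?thesis .
qed

lemma primitive_has_derivative:
  fixes g :: "real \<Rightarrow> 'b::banach"
  assumes "continuous_on {a..b} g" "x \<in> {a<..<b}"
  shows "((\<lambda>u. integral {a..u} g) has_vector_derivative g x) (at x)"
proof -
  have "((\<lambda>u. integral {a..u} g) has_vector_derivative g x) (at x within {a..b})"
    by (rule integral_has_vector_derivative[OF assms(1)]) (use assms in auto)
  moreover have "at x within {a..b} = at x" using assms by (intro at_within_interior) auto
  ultimately show ?thesis by simp
qed

text \<open>Rescaling to the unit interval moves the variable endpoint into the integrand.\<close>
lemma primitive_jointly_continuous:
  fixes K :: "real \<Rightarrow> real \<Rightarrow> 'b::euclidean_space"
  assumes K: "continuous_on (UNIV \<times> {0..b}) (\<lambda>z. K (fst z) (snd z))"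
  shows "continuous_on (UNIV \<times> {0..b}) (\<lambda>z. integral {0..snd z} (K (fst z)))"
proof -
  have eq: "integral {0..y} (K t) = y *\<^sub>R integral {0..1} (\<lambda>r. K t (y * r))" if y: "y \<in> {0..b}" for t y
  proof (cases "y = 0")
    case False
    then have y0: "0 < y" using y by auto
    have "continuous_on {0..y} (\<lambda>s. K t s)"
      by (rule continuous_on_compose2[OF K, of _ "\<lambda>s. (t, s)", simplified]) (use y in \<open>auto intro!: continuous_on_Pair continuous_on_const continuous_on_id\<close>)
    then have "K t integrable_on {0..y}" by (rule integrable_continuous_interval)
    then have "(K t has_integral integral {0..y} (K t)) (cbox 0 y)" by (simp add: integrable_integral)
    from has_integral_affinity'[OF this y0, of 0]
    have "((\<lambda>r. K t (y * r)) has_integral (1 / y) *\<^sub>R integral {0..y} (K t)) {0..1}" using y0 by (simp add: divide_inverse)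
    then show ?thesis using y0 by (simp add: integral_unique)
  qed simp
  have "continuous_on (UNIV \<times> {0..b}) (\<lambda>z. integral (cbox 0 1) (\<lambda>r. K (fst z) (snd z * r)))"
  proof (rule integral_continuous_on_param)
    have c: "continuous_on ((UNIV \<times> {0..b}) \<times> cbox (0::real) 1) (\<lambda>q. (fst (fst q), snd (fst q) * snd q))"
      by (intro continuous_intros)
    have sub: "(\<lambda>q. (fst (fst q), snd (fst q) * snd q)) ` ((UNIV \<times> {0..b}) \<times> cbox (0::real) 1) \<subseteq> (UNIV :: real set) \<times> {0..b}"
    proof clarsimp
      fix x y :: real assume "0 \<le> x" "x \<le> b" "0 \<le> y" "y \<le> 1"
      then have "x * y \<le> b * 1" by (intro mult_mono) auto
      then show "x * y \<le> b" by simp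
    qed
    have "continuous_on ((UNIV \<times> {0..b}) \<times> cbox (0::real) 1) (\<lambda>q. K (fst (fst q)) (snd (fst q) * snd q))"
      using continuous_on_compose2[OF K c sub] by simp
    then show "continuous_on ((UNIV \<times> {0..b}) \<times> cbox (0::real) 1) (\<lambda>(z, r). K (fst z) (snd z * r))" by (simp add: case_prod_unfold)
  qed
  then have "continuous_on (UNIV \<times> {0..b}) (\<lambda>z. snd z *\<^sub>R integral {0..1} (\<lambda>r. K (fst z) (snd z * r)))"
    by (intro continuous_intros) simp
  then show ?thesis by (rule continuous_on_eq) (auto simp: eq)
qed

lemma primitive_parameter_derivative:
  fixes K :: "real \<Rightarrow> real \<Rightarrow> 'b::euclidean_space"
  assumes K: "continuous_on (UNIV \<times> {0..b}) (\<lambda>z. K (fst z) (snd z))" and K': "continuous_on (UNIV \<times> {0..b}) (\<lambda>z. K' (fst z) (snd z))"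
    and d: "\<And>t s. s \<in> {0..b} \<Longrightarrow> ((\<lambda>t. K t s) has_vector_derivative K' t s) (at t)" and y: "y \<in> {0..b}"
  shows "((\<lambda>t. integral {0..y} (K t)) has_vector_derivative integral {0..y} (K' t)) (at t)"
proof -
  have "((\<lambda>t. integral (cbox 0 y) (K t)) has_vector_derivative integral (cbox 0 y) (K' t)) (at t within UNIV)"
  proof (rule leibniz_rule_vector_derivative)
    show "K t integrable_on cbox 0 y" for t
    proof -
      have "continuous_on {0..y} (\<lambda>s. K t s)"
        by (rule continuous_on_compose2[OF K, of _ "\<lambda>s. (t, s)", simplified]) (use y in \<open>auto intro!: continuous_on_Pair continuous_on_const continuous_on_id\<close>)
      then show ?thesis by (simp add: integrable_continuous_interval)
    qed
    show "continuous_on (UNIV \<times> cbox 0 y) (\<lambda>(x, t). K' x t)"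
      unfolding case_prod_unfold by (rule continuous_on_subset[OF K']) (use y in auto)
  qed (use d y in auto)
  then show ?thesis by simp
qed

context boundary_solution
begin

definition weighted_primitive :: "(nat \<Rightarrow> real \<Rightarrow> real) \<Rightarrow> nat \<Rightarrow> real \<Rightarrow> real \<Rightarrow> complex" where
  "weighted_primitive D n t \<phi> = integral {0..\<phi>} (\<lambda>s. omega s *\<^sub>R W D n t s)"

text \<open>The quantity \<open>omega \<phi>\<close> times the \<open>\<phi>\<close>-derivative of \<open>W\<close>, obtained from the equation by integrating from the endpoint \<open>0\<close>.\<close>
definition P :: "(nat \<Rightarrow> real \<Rightarrow> real) \<Rightarrow> nat \<Rightarrow> real \<Rightarrow> real \<Rightarrow> complex" where
  "P D n t \<phi> = (mollify J D n (\<lambda>s. flux s $ 1) t - weighted_primitive D (Suc (Suc n)) t \<phi> - weighted_primitive D (Suc n) t \<phi>) / 4"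

lemma omega_W_continuous:
  assumes "mollifier \<epsilon> D"
  shows "continuous_on (UNIV \<times> {0..pi}) (\<lambda>z. omega (snd z) *\<^sub>R W D n (fst z) (snd z))"
proof -
  have "continuous_on (UNIV \<times> {0..pi}) (\<lambda>z::real \<times> real. omega (snd z))"
    by (rule continuous_on_compose2[OF omega_continuous[of UNIV]]) (auto intro!: continuous_intros)
  then show ?thesis by (intro continuous_on_scaleR W_continuous[OF assms])
qed

lemma weighted_primitive_continuous: "mollifier \<epsilon> D \<Longrightarrow> continuous_on (UNIV \<times> {0..pi}) (\<lambda>z. weighted_primitive D n (fst z) (snd z))"
  unfolding weighted_primitive_def by (rule primitive_jointly_continuous[OF omega_W_continuous])

lemma weighted_primitive_has_derivative:
  assumes D: "mollifier \<epsilon> D" and \<phi>: "\<phi> \<in> {0..pi}"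
  shows "((\<lambda>t. weighted_primitive D n t \<phi>) has_vector_derivative weighted_primitive D (Suc n) t \<phi>) (at t)"
  unfolding weighted_primitive_def
  by (rule primitive_parameter_derivative[OF omega_W_continuous[OF D] omega_W_continuous[OF D] _ \<phi>])
    (rule bounded_linear.has_vector_derivative[OF bounded_linear_scaleR_right W_has_derivative[OF D]])

lemma P_continuous:
  assumes D: "mollifier \<epsilon> D"
  shows "continuous_on (UNIV \<times> {0..pi}) (\<lambda>z. P D n (fst z) (snd z))"
proof -
  have "continuous_on UNIV (mollify J D n (\<lambda>s. flux s $ 1))"
    using mollify_has_derivative[OF D flux_sq(2)] by (auto intro!: continuous_at_imp_continuous_on has_vector_derivative_continuous)
  then have "continuous_on (UNIV \<times> {0..pi}) (\<lambda>z::real \<times> real. mollify J D n (\<lambda>s. flux s $ 1) (fst z))"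
    by (rule continuous_on_compose2) (auto intro!: continuous_intros)
  then show ?thesis unfolding P_def by (intro continuous_intros weighted_primitive_continuous[OF D]) auto
qed

lemma P_has_derivative_t:
  assumes D: "mollifier \<epsilon> D" and \<phi>: "\<phi> \<in> {0..pi}"
  shows "((\<lambda>t. P D n t \<phi>) has_vector_derivative P D (Suc n) t \<phi>) (at t)"
proof -
  have "((\<lambda>t. mollify J D n (\<lambda>s. flux s $ 1) t - weighted_primitive D (Suc (Suc n)) t \<phi> - weighted_primitive D (Suc n) t \<phi>) has_vector_derivative
     (mollify J D (Suc n) (\<lambda>s. flux s $ 1) t - weighted_primitive D (Suc (Suc (Suc n))) t \<phi> - weighted_primitive D (Suc (Suc n)) t \<phi>)) (at t)"
    by (intro has_vector_derivative_diff mollify_has_derivative[OF D flux_sq(2)] weighted_primitive_has_derivative[OF D \<phi>])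
  from bounded_linear.has_vector_derivative[OF bounded_linear_divide this, of 4]
  show ?thesis by (simp add: P_def)
qed

lemma P_has_derivative:
  assumes D: "mollifier \<epsilon> D" and \<phi>: "\<phi> \<in> {0<..<pi}"
  shows "(P D n t has_vector_derivative - (omega \<phi> / 4) *\<^sub>R (W D (Suc (Suc n)) t \<phi> + W D (Suc n) t \<phi>)) (at \<phi>)"
proof -
  have I: "(weighted_primitive D m t has_vector_derivative omega \<phi> *\<^sub>R W D m t \<phi>) (at \<phi>)" for m
    unfolding weighted_primitive_def[abs_def]
    by (rule primitive_has_derivative[OF _ \<phi>]) (intro continuous_on_scaleR omega_continuous W_continuous_slice[OF D])
  have "((\<lambda>\<phi>. mollify J D n (\<lambda>s. flux s $ 1) t - weighted_primitive D (Suc (Suc n)) t \<phi> - weighted_primitive D (Suc n) t \<phi>) has_vector_derivative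
     (0 - omega \<phi> *\<^sub>R W D (Suc (Suc n)) t \<phi> - omega \<phi> *\<^sub>R W D (Suc n) t \<phi>)) (at \<phi>)"
    by (intro has_vector_derivative_diff has_vector_derivative_const I)
  from bounded_linear.has_vector_derivative[OF bounded_linear_divide this, of 4]
  also have "(0 - omega \<phi> *\<^sub>R W D (Suc (Suc n)) t \<phi> - omega \<phi> *\<^sub>R W D (Suc n) t \<phi>) / 4
     = - (omega \<phi> / 4) *\<^sub>R (W D (Suc (Suc n)) t \<phi> + W D (Suc n) t \<phi>)"
    by (simp add: scaleR_conv_of_real field_simps)
  finally show ?thesis by (simp only: P_def[abs_def])
qed

text \<open>
  The mollified weak equation tested with a ramp. Its right-hand side contains \<open>W\<close> at the single angle \<open>\<phi>\<close>,
  while the left-hand side is a primitive in \<open>\<phi>\<close>: this is how \<open>W\<close> becomes differentiable in the angle.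
\<close>
lemma ramp_identity:
  assumes D: "mollifier \<epsilon> D" and t: "{t-\<epsilon>..t+\<epsilon>} \<subseteq> J" and \<phi>: "\<phi> \<in> {0..pi}"
  defines "R \<equiv> \<lambda>n \<phi>. integral {0..\<phi>} (\<lambda>s. (omega s * (arclen \<phi> - arclen s)) *\<^sub>R W D n t s)"
  shows "R (Suc (Suc n)) \<phi> + R (Suc n) \<phi> = 4 * (W D n t 0 - W D n t \<phi>) + arclen \<phi> *\<^sub>R mollify J D n (\<lambda>s. flux s $ 1) t"
proof -
  obtain v where v: "emb v = abs_hspace (ramp \<phi>)" "ramp \<phi> \<in> L2_omega" "crep v 0 = of_real (arclen \<phi>)" "crep v pi = 0"
     "\<And>f. form_a0 f v = 4 * (ev 0 f - ev \<phi> f)" using ramp_vspace[OF \<phi>] by blast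
  have h: "mollify J D m (\<lambda>s. hinner (emb (w s)) (emb v)) t = R m \<phi>" for m
    unfolding v(1) mollify_hinner[OF D v(2)] R_def
    by (rule omega_integral_clip[OF W_continuous_slice[OF D] v(2) \<phi>]) (simp add: ramp_def)
  have i: "integrable lebJ (\<lambda>s. D n (t - s) *\<^sub>R ev \<phi> (w s))" if "\<phi> \<in> {0..pi}" for \<phi>
    by (rule mollify_integrable[OF D ev_w(3)[OF that]])
  have a: "mollify J D n (\<lambda>s. form_a0 (w s) v) t = 4 * (W D n t 0 - W D n t \<phi>)"
  proof -
    have "mollify J D n (\<lambda>s. form_a0 (w s) v) t = (\<integral>s. 4 * (D n (t - s) *\<^sub>R ev 0 (w s) - D n (t - s) *\<^sub>R ev \<phi> (w s)) \<partial>lebJ)"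
      unfolding mollify_def v(5) by (rule Bochner_Integration.integral_cong) (auto simp: scaleR_right_diff_distrib)
    also have "\<dots> = 4 * (\<integral>s. D n (t - s) *\<^sub>R ev 0 (w s) - D n (t - s) *\<^sub>R ev \<phi> (w s) \<partial>lebJ)"
      by (rule integral_mult_right_zero)
    also have "\<dots> = 4 * (W D n t 0 - W D n t \<phi>)" using i[of 0] i[OF \<phi>] by (simp add: W_def mollify_def)
    finally show ?thesis .
  qed
  have b: "mollify J D n (\<lambda>s. cinner2 (flux s) (endpoint_trace v)) t = arclen \<phi> *\<^sub>R mollify J D n (\<lambda>s. flux s $ 1) t"
  proof -
    have "mollify J D n (\<lambda>s. cinner2 (flux s) (endpoint_trace v)) t = (\<integral>s. arclen \<phi> *\<^sub>R (D n (t - s) *\<^sub>R flux s $ 1) \<partial>lebJ)"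
      unfolding mollify_def cinner2_expand endpoint_trace_nth v
      by (rule Bochner_Integration.integral_cong) (auto simp: scaleR_conv_of_real)
    also have "\<dots> = arclen \<phi> *\<^sub>R mollify J D n (\<lambda>s. flux s $ 1) t"
      unfolding mollify_def by (simp del: scaleR_scaleR)
    finally show ?thesis .
  qed
  show ?thesis using mollified_weak_form[OF D t, of n v] unfolding h a b .
qed

lemma W_has_derivative_angle:
  assumes D: "mollifier \<epsilon> D" and t: "{t-\<epsilon>..t+\<epsilon>} \<subseteq> J" and \<phi>: "\<phi> \<in> {0<..<pi}"
  shows "(W D n t has_vector_derivative (1 / omega \<phi>) *\<^sub>R P D n t \<phi>) (at \<phi>)"
proof -
  define G where "G = mollify J D n (\<lambda>s. flux s $ 1) t"
  define R where "R n \<phi> = integral {0..\<phi>} (\<lambda>s. (omega s * (arclen \<phi> - arclen s)) *\<^sub>R W D n t s)" for n \<phi>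
  define Q where "Q n \<phi> = integral {0..\<phi>} (\<lambda>s. (omega s * arclen s) *\<^sub>R W D n t s)" for n \<phi>
  have c1: "continuous_on {0..pi} (\<lambda>s. omega s *\<^sub>R W D n t s)" for n
    by (intro continuous_on_scaleR omega_continuous W_continuous_slice[OF D])
  have c2: "continuous_on {0..pi} (\<lambda>s. (omega s * arclen s) *\<^sub>R W D n t s)" for n
    by (intro continuous_on_scaleR continuous_on_mult omega_continuous arclen_continuous W_continuous_slice[OF D])
  have R: "R n \<psi> = arclen \<psi> *\<^sub>R weighted_primitive D n t \<psi> - Q n \<psi>" if "\<psi> \<in> {0..pi}" for n \<psi>
  proof -
    have i1: "(\<lambda>s. omega s *\<^sub>R W D n t s) integrable_on {0..\<psi>}" 
      by (intro integrable_continuous_interval continuous_on_subset[OF c1]) (use that in auto)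
    have i2: "(\<lambda>s. (omega s * arclen s) *\<^sub>R W D n t s) integrable_on {0..\<psi>}" 
      by (intro integrable_continuous_interval continuous_on_subset[OF c2]) (use that in auto)
    have "R n \<psi> = integral {0..\<psi>} (\<lambda>s. arclen \<psi> *\<^sub>R (omega s *\<^sub>R W D n t s) - (omega s * arclen s) *\<^sub>R W D n t s)"
      unfolding R_def by (rule Henstock_Kurzweil_Integration.integral_cong) (simp add: algebra_simps)
    also have "\<dots> = integral {0..\<psi>} (\<lambda>s. arclen \<psi> *\<^sub>R (omega s *\<^sub>R W D n t s)) - Q n \<psi>"
      unfolding Q_def by (rule Henstock_Kurzweil_Integration.integral_diff) (intro integrable_cmul i1 i2)+
    finally show ?thesis unfolding weighted_primitive_def by (simp only: integral_cmul)
  qed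
  have I: "(weighted_primitive D m t has_vector_derivative omega \<phi> *\<^sub>R W D m t \<phi>) (at \<phi>)" for m
    unfolding weighted_primitive_def[abs_def] by (rule primitive_has_derivative[OF c1 \<phi>])
  have Q: "(Q m has_vector_derivative (omega \<phi> * arclen \<phi>) *\<^sub>R W D m t \<phi>) (at \<phi>)" for m
    unfolding Q_def[abs_def] by (rule primitive_has_derivative[OF c2 \<phi>])
  have A: "(arclen has_vector_derivative 1 / omega \<phi>) (at \<phi>)"
    using arclen_has_derivative[OF \<phi>] by (simp add: has_real_derivative_iff_has_vector_derivative)
  have dR: "((\<lambda>\<psi>. arclen \<psi> *\<^sub>R weighted_primitive D m t \<psi> - Q m \<psi>) has_vector_derivative (1 / omega \<phi>) *\<^sub>R weighted_primitive D m t \<phi>) (at \<phi>)" for m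
  proof -
    have "((\<lambda>\<psi>. arclen \<psi> *\<^sub>R weighted_primitive D m t \<psi> - Q m \<psi>) has_vector_derivative
       (arclen \<phi> *\<^sub>R (omega \<phi> *\<^sub>R W D m t \<phi>) + (1 / omega \<phi>) *\<^sub>R weighted_primitive D m t \<phi>) - (omega \<phi> * arclen \<phi>) *\<^sub>R W D m t \<phi>) (at \<phi>)"
      by (intro has_vector_derivative_diff has_vector_derivative_scaleR Q I arclen_has_derivative[OF \<phi>])
    then show ?thesis by (simp add: mult.commute)
  qed
  define V where "V \<psi> = W D n t 0 + (arclen \<psi> *\<^sub>R G - (arclen \<psi> *\<^sub>R weighted_primitive D (Suc (Suc n)) t \<psi> - Q (Suc (Suc n)) \<psi>)
     - (arclen \<psi> *\<^sub>R weighted_primitive D (Suc n) t \<psi> - Q (Suc n) \<psi>)) / 4" for \<psi>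
  have V: "W D n t \<psi> = V \<psi>" if \<psi>: "\<psi> \<in> {0..pi}" for \<psi>
    using ramp_identity[OF D t \<psi>, of n] R[OF \<psi>] unfolding V_def R_def[symmetric] G_def[symmetric]
    by (simp add: field_simps)
  have "(V has_vector_derivative 0 + ((1 / omega \<phi>) *\<^sub>R G - (1 / omega \<phi>) *\<^sub>R weighted_primitive D (Suc (Suc n)) t \<phi> - (1 / omega \<phi>) *\<^sub>R weighted_primitive D (Suc n) t \<phi>) / 4) (at \<phi>)"
    unfolding V_def[abs_def]
    by (intro has_vector_derivative_add has_vector_derivative_const bounded_linear.has_vector_derivative[OF bounded_linear_divide]
      has_vector_derivative_diff dR bounded_linear.has_vector_derivative[OF bounded_linear_scaleR_left A])
  also have "0 + ((1 / omega \<phi>) *\<^sub>R G - (1 / omega \<phi>) *\<^sub>R weighted_primitive D (Suc (Suc n)) t \<phi> - (1 / omega \<phi>) *\<^sub>R weighted_primitive D (Suc n) t \<phi>) / 4 = (1 / omega \<phi>) *\<^sub>R P D n t \<phi>"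
    by (simp add: P_def G_def scaleR_conv_of_real right_diff_distrib diff_divide_distrib)
  finally show ?thesis
    by (rule has_vector_derivative_transform_within_open[of _ _ _ "{0<..<pi}"]) (use \<phi> in \<open>auto simp: V\<close>)
qed

text \<open>The mollified weak equation tested with the constant function.\<close>
lemma weighted_primitive_pi:
  assumes D: "mollifier \<epsilon> D" and t: "{t-\<epsilon>..t+\<epsilon>} \<subseteq> J"
  shows "weighted_primitive D (Suc (Suc n)) t pi + weighted_primitive D (Suc n) t pi = mollify J D n (\<lambda>s. flux s $ 1) t + mollify J D n (\<lambda>s. flux s $ 2) t"
proof -
  obtain v where v: "emb v = abs_hspace (\<lambda>_. 1)" "(\<lambda>_. 1) \<in> L2_omega" "crep v 0 = 1" "crep v pi = 1" "\<And>f. form_a0 f v = 0"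
    using one_vspace by blast
  have h: "mollify J D m (\<lambda>s. hinner (emb (w s)) (emb v)) t = weighted_primitive D m t pi" for m
    unfolding v(1) mollify_hinner[OF D v(2)] weighted_primitive_def
    by (subst omega_integral_clip[OF W_continuous_slice[OF D] v(2), of pi "\<lambda>_. 1"]) auto
  have b: "mollify J D n (\<lambda>s. cinner2 (flux s) (endpoint_trace v)) t = mollify J D n (\<lambda>s. flux s $ 1) t + mollify J D n (\<lambda>s. flux s $ 2) t"
    unfolding mollify_def cinner2_expand endpoint_trace_nth v
    using mollify_integrable[OF D flux_sq(2)[of 1], of n t] mollify_integrable[OF D flux_sq(2)[of 2], of n t]
    by (simp add: scaleR_right_distrib)
  show ?thesis using mollified_weak_form[OF D t, of n v] unfolding h b v(5) by (simp add: mollify_def)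
qed

lemma P_endpoints:
  assumes D: "mollifier \<epsilon> D" and t: "{t-\<epsilon>..t+\<epsilon>} \<subseteq> J"
  shows "P D n t 0 = mollify J D n (\<lambda>s. flux s $ 1) t / 4" "P D n t pi = - mollify J D n (\<lambda>s. flux s $ 2) t / 4"
proof -
  show "P D n t 0 = mollify J D n (\<lambda>s. flux s $ 1) t / 4" by (simp add: P_def weighted_primitive_def)
  have "P D n t pi = (mollify J D n (\<lambda>s. flux s $ 1) t - (weighted_primitive D (Suc (Suc n)) t pi + weighted_primitive D (Suc n) t pi)) / 4"
    by (simp add: P_def)
  then show "P D n t pi = - mollify J D n (\<lambda>s. flux s $ 2) t / 4" unfolding weighted_primitive_pi[OF D t] by simp
qed

text \<open>
  The mollified solution at time \<open>t\<close> is an average of values of the continuous representative near \<open>t\<close>. The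
  estimate is scalar: test with \<open>h\<close>, the difference itself. With \<open>u = 0\<close> it bounds the norm by the supremum. The factor 2
  is the constant in \<open>cmod_hinner_le\<close>.
\<close>
lemma norm_W_near:
  assumes D: "mollifier \<epsilon> D" and t: "{t-\<epsilon>..t+\<epsilon>} \<subseteq> J"
    and e: "\<And>s. s \<in> J \<Longrightarrow> \<bar>s - t\<bar> \<le> \<epsilon> \<Longrightarrow> norm (cont_rep J w s - u) \<le> e"
  shows "norm (abs_hspace (W D 0 t) - u) \<le> 2 * e"
proof -
  have WL: "W D 0 t \<in> L2_omega" by (rule continuous_L2_omega(1)[OF W_continuous_slice[OF D]])
  obtain wt where wt: "bochner_L2 J wt" "bochner_weak_deriv J (\<lambda>t. emb (w t)) wt" using sol unfolding weak_solution_def by blast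
  note cr = cont_rep_props[OF pq w_L2(2) wt]
  define h where "h = abs_hspace (W D 0 t) - u"
  obtain H where H: "H \<in> L2_omega" "h = abs_hspace H" by (rule hspace_exhaust)
  have e0: "0 \<le> e"
  proof -
    have "t \<in> J" using t mollifierD(1)[OF D] by (auto simp: subset_iff)
    then show ?thesis using e[of t] mollifierD(1)[OF D] by (auto intro: order_trans[OF norm_ge_zero])
  qed
  define k where "k s = hinner (emb (w s)) h" for s
  define k' where "k' s = hinner (cont_rep J w s) h" for s
  have ae: "AE s in lebJ. k s = k' s" using cr(2) by eventually_elim (simp add: k_def k'_def)
  have ki: "integrable lebJ k" unfolding k_def[abs_def] by (rule bochner_L2_functional(3)[OF w_L2(2) bounded_linear_hinner_left])
  have k'm: "k' \<in> borel_measurable lebJ"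
  proof (rule continuous_imp_measurable_on_sets_lebesgue)
    show "continuous_on J k'" unfolding k'_def[abs_def]
      by (intro bounded_linear.continuous_on[OF bounded_linear_hinner_left] continuous_on_subset[OF cr(1)]) auto
  qed simp
  have k'i: "integrable lebJ k'"
    using ki integrable_cong_AE[OF borel_measurable_integrable[OF ki] k'm ae] by simp
  have "mollify J D 0 k t = mollify J D 0 k' t" by (rule mollify_AE_cong[OF D ae borel_measurable_integrable[OF ki] k'm])
  moreover have "norm (mollify J D 0 k' t - hinner u h) \<le> 2 * (e * norm h)"
  proof (rule mollify_near[OF D t _ k'i])
    fix s assume s: "s \<in> J" "\<bar>s - t\<bar> \<le> \<epsilon>"
    have "k' s - hinner u h = hinner (cont_rep J w s - u) h"
      unfolding k'_def using linear_diff[OF bounded_linear.linear[OF bounded_linear_hinner_left[of h]]] by simp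
    also have "cmod \<dots> \<le> 2 * (norm (cont_rep J w s - u) * norm h)" by (rule cmod_hinner_le)
    also have "\<dots> \<le> 2 * (e * norm h)" using e[OF s] by (intro mult_left_mono mult_right_mono) auto
    finally show "norm (k' s - hinner u h) \<le> 2 * (e * norm h)" .
  qed simp
  moreover have "mollify J D 0 k t = hinner (abs_hspace (W D 0 t)) h"
  proof -
    have Hm: "H \<in> borel_measurable leb0" using H by (simp add: L2_omega_def meas_omega_iff)
    have "(\<lambda>\<phi>. cnj (H \<phi>)) \<in> borel_measurable leb0"
      by (rule measurable_compose[OF Hm borel_measurable_continuous_onI[of cnj]]) (auto intro!: continuous_intros)
    then have m: "(\<lambda>\<phi>. W D 0 t \<phi> * cnj (H \<phi>)) \<in> borel_measurable leb0"
      using continuous_L2_omega(2)[OF W_continuous_slice[OF D]] by measurable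
    show ?thesis unfolding k_def[abs_def] H(2) mollify_hinner[OF D H(1)] hinner_abs[OF WL H(1)] integrable_omega_iff(2)[OF m] ..
  qed
  ultimately have "cmod (hinner (abs_hspace (W D 0 t)) h - hinner u h) \<le> 2 * (e * norm h)" by simp
  also have "hinner (abs_hspace (W D 0 t)) h - hinner u h = hinner h h"
    unfolding h_def using linear_diff[OF bounded_linear.linear[OF bounded_linear_hinner_left[of "abs_hspace (W D 0 t) - u"]]] by simp
  finally have "cmod (hinner h h) \<le> 2 * (e * norm h)" .
  moreover have "(norm h)\<^sup>2 \<le> cmod (hinner h h)" unfolding power2_norm_eq_inner inner_hspace_def by (rule complex_Re_le_cmod)
  ultimately have "norm h * norm h \<le> (2 * e) * norm h" by (simp add: power2_eq_square)
  then show ?thesis unfolding h_def[symmetric] using e0 by (cases "norm h = 0") auto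
qed

end

section \<open>The arc-length coordinate\<close>

definition total_arclen where "total_arclen = arclen pi"

definition angle :: "real \<Rightarrow> real" where "angle = inv_into {0..pi} arclen"

lemma arclen_inj: "inj_on arclen {0..pi}"
  by (rule linorder_inj_onI') (metis arclen_strict_mono atLeastAtMost_iff less_irrefl)

lemma arclen_mono: "0 \<le> u \<Longrightarrow> u \<le> v \<Longrightarrow> v \<le> pi \<Longrightarrow> arclen u \<le> arclen v"
  using arclen_strict_mono[of u v] by (cases "u = v") auto

lemma arclen_image: "arclen ` {0..pi} = {0..total_arclen}"
proof
  show "arclen ` {0..pi} \<subseteq> {0..total_arclen}" unfolding total_arclen_def using arclen_mono[of 0] arclen_mono[of _ pi] by auto
  show "{0..total_arclen} \<subseteq> arclen ` {0..pi}"
  proof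
    fix x assume "x \<in> {0..total_arclen}"
    then obtain \<phi> where "0 \<le> \<phi>" "\<phi> \<le> pi" "arclen \<phi> = x" using IVT'[of arclen 0 x pi] arclen_continuous by (auto simp: total_arclen_def)
    then show "x \<in> arclen ` {0..pi}" by auto
  qed
qed

lemma total_arclen_pos: "0 < total_arclen" unfolding total_arclen_def using arclen_strict_mono[of 0 pi] by simp

lemma angle_arclen: "\<phi> \<in> {0..pi} \<Longrightarrow> angle (arclen \<phi>) = \<phi>"
  unfolding angle_def by (rule inv_into_f_f[OF arclen_inj])

lemma arclen_angle: "x \<in> {0..total_arclen} \<Longrightarrow> arclen (angle x) = x"
  unfolding angle_def arclen_image[symmetric] by (rule f_inv_into_f)

lemma angle_mem: "x \<in> {0..total_arclen} \<Longrightarrow> angle x \<in> {0..pi}"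
  unfolding angle_def arclen_image[symmetric] by (rule inv_into_into)

lemma angle_0: "angle 0 = 0" using angle_arclen[of 0] by simp
lemma angle_total_arclen: "angle total_arclen = pi" using angle_arclen[of pi] by (simp add: total_arclen_def)

lemma angle_less: "0 \<le> x \<Longrightarrow> x < y \<Longrightarrow> y \<le> total_arclen \<Longrightarrow> angle x < angle y"
  using arclen_mono[of "angle y" "angle x"] angle_mem[of x] angle_mem[of y] arclen_angle[of x] arclen_angle[of y] by fastforce

lemma angle_le: "0 \<le> x \<Longrightarrow> x \<le> y \<Longrightarrow> y \<le> total_arclen \<Longrightarrow> angle x \<le> angle y"
  using angle_less[of x y] by (cases "x = y") auto

lemma angle_mem_open: "x \<in> {0<..<total_arclen} \<Longrightarrow> angle x \<in> {0<..<pi}"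
  using angle_less[of 0 x] angle_less[of x total_arclen] by (simp add: angle_0 angle_total_arclen)

lemma angle_continuous: "continuous_on {0..total_arclen} angle"
  unfolding arclen_image[symmetric] by (rule continuous_on_inv[OF arclen_continuous]) (auto simp: angle_arclen)

lemma angle_has_derivative:
  assumes "x \<in> {0<..<total_arclen}"
  shows "(angle has_real_derivative omega (angle x)) (at x)"
proof -
  note am = angle_mem_open[OF assms]
  have "(angle has_real_derivative inverse (1 / omega (angle x))) (at x)"
  proof (rule DERIV_inverse_function[where f=arclen and g=angle and x=x, OF arclen_has_derivative[OF am]])
    show "1 / omega (angle x) \<noteq> 0" using omega_pos[OF am] by simp
    show "0 < x" "x < total_arclen" using assms by auto
    show "isCont angle x"
      using continuous_on_interior[OF angle_continuous, of x] assms by simp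
  qed (simp add: arclen_angle)
  then show ?thesis by simp
qed

lemma angle_half: "angle (total_arclen / 2) = pi / 2"
proof -
  have half: "pi - pi/2 = pi/2" by (simp add: field_simps)
  have "arclen (pi - pi/2) = arclen pi - arclen (pi/2)" by (rule arclen_reflect) simp
  then have m: "arclen (pi / 2) = total_arclen / 2" unfolding total_arclen_def half by linarith
  have "angle (arclen (pi / 2)) = pi / 2" by (rule angle_arclen) simp
  then show ?thesis unfolding m .
qed

lemma omega_sq: "\<phi> \<in> {0..pi} \<Longrightarrow> (omega \<phi>)\<^sup>2 = sin \<phi>"
  unfolding omega_def by (simp add: sin_ge_zero)

lemma weighted_integral_angle:
  assumes g: "continuous_on {0..pi} g" and x: "x \<in> {0..total_arclen}"
  shows "integral {0..x} (\<lambda>y. sin (angle y) / 4 * g (angle y)) = integral {0..angle x} (\<lambda>\<phi>. omega \<phi> * g \<phi>) / 4"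
proof -
  have c: "continuous_on {0..pi} (\<lambda>\<phi>. omega \<phi> * g \<phi>)" by (intro continuous_on_mult omega_continuous g)
  define F where "F u = integral {0..u} (\<lambda>\<phi>. omega \<phi> * g \<phi>)" for u
  have Fc: "continuous_on {0..pi} F" unfolding F_def[abs_def]
    by (rule indefinite_integral_continuous_1[OF integrable_continuous_interval[OF c]])
  have "((\<lambda>y. sin (angle y) / 4 * g (angle y)) has_integral F (angle x) / 4 - F (angle 0) / 4) {0..x}"
  proof (rule fundamental_theorem_of_calculus_interior)
    show "continuous_on {0..x} (\<lambda>y. F (angle y) / 4)"
      by (intro continuous_intros continuous_on_compose2[OF Fc] continuous_on_subset[OF angle_continuous]) (use x angle_mem in auto)
    fix y assume y: "y \<in> {0<..<x}"
    then have y': "y \<in> {0<..<total_arclen}" using x by auto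
    note am = angle_mem_open[OF y']
    have "(F has_real_derivative omega (angle y) * g (angle y)) (at (angle y))"
      using primitive_has_derivative[OF c am] unfolding F_def[abs_def] has_real_derivative_iff_has_vector_derivative .
    from DERIV_chain2[OF this angle_has_derivative[OF y']]
    have "((\<lambda>y. F (angle y)) has_real_derivative omega (angle y) * g (angle y) * omega (angle y)) (at y)" .
    then have "((\<lambda>y. F (angle y) / 4) has_real_derivative omega (angle y) * g (angle y) * omega (angle y) / 4) (at y)"
      by (rule DERIV_cdivide)
    moreover have "omega (angle y) * g (angle y) * omega (angle y) / 4 = sin (angle y) / 4 * g (angle y)"
      using omega_sq[of "angle y"] am by (simp add: power2_eq_square)
    ultimately show "((\<lambda>y. F (angle y) / 4) has_vector_derivative sin (angle y) / 4 * g (angle y)) (at y)"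
      by (simp add: has_real_derivative_iff_has_vector_derivative)
  qed (use x in auto)
  from integral_unique[OF this] show ?thesis unfolding angle_0 F_def by simp
qed

text \<open>
  The first-order form of the equation together with all its time derivatives: \<open>A n\<close> and \<open>B n\<close> stand for the
  \<open>n\<close>-th time derivatives of \<open>w\<close> and \<open>\<omega> w\<^sub>\<phi>\<close>. In this form no second derivative in the angle has to be named,
  and the reflection \<open>\<phi> \<mapsto> \<pi> - \<phi>\<close> only changes the sign of \<open>B\<close>.
\<close>
definition angular_system :: "real \<Rightarrow> (nat \<Rightarrow> real \<Rightarrow> real \<Rightarrow> real) \<Rightarrow> (nat \<Rightarrow> real \<Rightarrow> real \<Rightarrow> real) \<Rightarrow> bool" where
  "angular_system T A B \<longleftrightarrow>
    (\<forall>n. continuous_on (UNIV \<times> {0..pi}) (\<lambda>z. A n (fst z) (snd z)) \<and> continuous_on (UNIV \<times> {0..pi}) (\<lambda>z. B n (fst z) (snd z))) \<and>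
    (\<forall>n t. \<forall>\<phi>\<in>{0..pi}. ((\<lambda>t. A n t \<phi>) has_real_derivative A (Suc n) t \<phi>) (at t) \<and> ((\<lambda>t. B n t \<phi>) has_real_derivative B (Suc n) t \<phi>) (at t)) \<and>
    (\<forall>n. \<forall>t\<in>{-T..T}. \<forall>\<phi>\<in>{0<..<pi}. (A n t has_real_derivative B n t \<phi> / omega \<phi>) (at \<phi>) \<and>
       (B n t has_real_derivative - (omega \<phi> / 4) * (A (Suc (Suc n)) t \<phi> + A (Suc n) t \<phi>)) (at \<phi>))"

text \<open>In the arc-length coordinate \<open>B 0\<close> becomes the plain \<open>x\<close>-derivative of \<open>A 0\<close>.\<close>
lemma angular_system_elliptic:
  assumes sys: "angular_system T A B" and L: "0 < L" "L < total_arclen"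
  shows "elliptic_solution T L (\<lambda>x. sin (angle x) / 4) (\<lambda>t x. A 0 t (angle x)) (\<lambda>t x. A 1 t (angle x)) (\<lambda>t x. B 0 t (angle x))
    (\<lambda>t x. A 2 t (angle x)) (\<lambda>t x. - (omega (angle x))\<^sup>2 / 4 * (A 2 t (angle x) + A 1 t (angle x))) (\<lambda>t x. B 1 t (angle x))"
proof -
  have s: "continuous_on (UNIV \<times> {0..pi}) (\<lambda>z. A n (fst z) (snd z))" "continuous_on (UNIV \<times> {0..pi}) (\<lambda>z. B n (fst z) (snd z))"
    "\<phi> \<in> {0..pi} \<Longrightarrow> ((\<lambda>t. A n t \<phi>) has_real_derivative A (Suc n) t \<phi>) (at t)"
    "\<phi> \<in> {0..pi} \<Longrightarrow> ((\<lambda>t. B n t \<phi>) has_real_derivative B (Suc n) t \<phi>) (at t)"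
    "t \<in> {-T..T} \<Longrightarrow> \<phi> \<in> {0<..<pi} \<Longrightarrow> (A n t has_real_derivative B n t \<phi> / omega \<phi>) (at \<phi>)"
    "t \<in> {-T..T} \<Longrightarrow> \<phi> \<in> {0<..<pi} \<Longrightarrow> (B n t has_real_derivative - (omega \<phi> / 4) * (A (Suc (Suc n)) t \<phi> + A (Suc n) t \<phi>)) (at \<phi>)"
    for n t \<phi> using sys by (auto simp: angular_system_def)
  have am: "angle x \<in> {0..pi}" if "x \<in> {0..L}" for x using that L by (intro angle_mem) auto
  have ao: "angle x \<in> {0<..<pi}" if "x \<in> {0<..<L}" for x using that L by (intro angle_mem_open) auto
  have cangle: "continuous_on (cbox (-T,0) (T,L)) (\<lambda>q. angle (snd q))"
    by (rule continuous_on_compose2[OF angle_continuous]) (use L in \<open>auto simp: mem_rect intro!: continuous_intros\<close>)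
  have cp: "continuous_on (cbox (-T,0) (T,L)) (\<lambda>q. (fst q, angle (snd q)))" by (intro continuous_on_Pair cangle continuous_intros)
  have sub: "(\<lambda>q. (fst q, angle (snd q))) ` cbox (-T,0) (T,L) \<subseteq> UNIV \<times> {0..pi}"
  proof (rule image_subsetI)
    fix q assume "q \<in> cbox (-T,0) (T,L)"
    then have "snd q \<in> {0..L}" by (simp add: mem_rect)
    then show "(fst q, angle (snd q)) \<in> UNIV \<times> {0..pi}" using am by simp
  qed
  have cA: "cont2 T L (\<lambda>t x. A n t (angle x))" and cB: "cont2 T L (\<lambda>t x. B n t (angle x))" for n
    unfolding cont2_def using continuous_on_compose2[OF s(1) cp sub] continuous_on_compose2[OF s(2) cp sub] by simp_all
  have co: "continuous_on (cbox (-T,0) (T,L)) (\<lambda>q. omega (angle (snd q)))"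
    by (rule continuous_on_compose2[OF omega_continuous[of UNIV] cangle]) simp
  have cU: "cont2 T L (\<lambda>t x. - (omega (angle x))\<^sup>2 / 4 * (A 2 t (angle x) + A 1 t (angle x)))"
    unfolding cont2_def by (intro continuous_intros co cA[unfolded cont2_def]) simp
  have dA: "((\<lambda>x. A n t (angle x)) has_real_derivative B n t (angle x)) (at x)" 
    and dB: "((\<lambda>x. B n t (angle x)) has_real_derivative - (omega (angle x))\<^sup>2 / 4 * (A (Suc (Suc n)) t (angle x) + A (Suc n) t (angle x))) (at x)" 
    if t: "t \<in> {-T..T}" and x: "x \<in> {0<..<L}" for n t x
  proof -
    have x': "x \<in> {0<..<total_arclen}" using x L by auto
    note o = omega_pos[OF ao[OF x]]
    show "((\<lambda>x. A n t (angle x)) has_real_derivative B n t (angle x)) (at x)"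
      using DERIV_chain2[OF s(5)[OF t ao[OF x]] angle_has_derivative[OF x']] o by simp
    show "((\<lambda>x. B n t (angle x)) has_real_derivative - (omega (angle x))\<^sup>2 / 4 * (A (Suc (Suc n)) t (angle x) + A (Suc n) t (angle x))) (at x)"
      using DERIV_chain2[OF s(6)[OF t ao[OF x]] angle_has_derivative[OF x']] by (simp add: power2_eq_square mult_ac)
  qed
  show ?thesis
    unfolding elliptic_solution_def
  proof (intro conjI ballI cA cB cU)
    fix t x assume t: "t \<in> {-T..T}" and x: "x \<in> {0<..<L}"
    show "((\<lambda>x. A 0 t (angle x)) has_real_derivative B 0 t (angle x)) (at x)" by (rule dA[OF t x])
    show "((\<lambda>x. A 1 t (angle x)) has_real_derivative B 1 t (angle x)) (at x)" by (rule dA[OF t x])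
    show "((\<lambda>x. B 0 t (angle x)) has_real_derivative - (omega (angle x))\<^sup>2 / 4 * (A 2 t (angle x) + A 1 t (angle x))) (at x)"
      using dB[OF t x, of 0] by (simp add: numeral_2_eq_2)
  next
    fix t x assume x: "x \<in> {0..L}"
    show "((\<lambda>t. A 0 t (angle x)) has_real_derivative A 1 t (angle x)) (at t)" using s(3)[OF am[OF x], of 0] by simp
    show "((\<lambda>t. A 1 t (angle x)) has_real_derivative A 2 t (angle x)) (at t)" using s(3)[OF am[OF x], of 1] by (simp add: numeral_2_eq_2)
    show "((\<lambda>t. B 0 t (angle x)) has_real_derivative B 1 t (angle x)) (at t)" using s(4)[OF am[OF x], of 0] by simp
    show "- (omega (angle x))\<^sup>2 / 4 * (A 2 t (angle x) + A 1 t (angle x)) + sin (angle x) / 4 * (A 2 t (angle x) + A 1 t (angle x)) = 0"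
      by (simp add: omega_sq[OF am[OF x]])
  qed
qed

text \<open>
  The data at \<open>\<phi> = 0\<close> control the left half. The coefficient \<open>a = sin \<phi> / 4\<close> increases up to the
  midpoint, where the sign condition of the Carleman estimate is strict, so it persists slightly beyond; the
  cutoffs are placed there.
\<close>
lemma angular_system_holder:
  "\<exists>T C \<theta>. 1 < T \<and> 0 < C \<and> 0 < \<theta> \<and> \<theta> < 1 \<and>
    (\<forall>A B M \<delta>. angular_system T A B \<longrightarrow> 0 \<le> M \<longrightarrow> 0 \<le> \<delta> \<longrightarrow>
      (\<forall>t\<in>{-T..T}. integral {0..pi} (\<lambda>\<phi>. omega \<phi> * (A 0 t \<phi>)\<^sup>2) \<le> 4 * M\<^sup>2) \<longrightarrow>
      integral {-T..T} (\<lambda>t. (A 0 t 0)\<^sup>2 + (B 0 t 0)\<^sup>2) \<le> \<delta>\<^sup>2 \<longrightarrow>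
      integral {0..pi/2} (\<lambda>\<phi>. omega \<phi> * (A 0 0 \<phi>)\<^sup>2) \<le> C * M powr (2*(1-\<theta>)) * \<delta> powr (2*\<theta>))"
proof -
  define a where "a = (\<lambda>x. sin (angle x) / 4)"
  define a' where "a' = (\<lambda>x. cos (angle x) * omega (angle x) / 4)"
  \<comment> \<open>the sign condition \<open>- a/4 \<le> a' (B - x)\<close> with \<open>B = total_arclen + 1\<close>, after division by \<open>\<omega>/4\<close>\<close>
  define k where "k = (\<lambda>x. cos (angle x) * (total_arclen + 1 - x) + omega (angle x) / 4)"
  have oa: "continuous_on {0..total_arclen} (\<lambda>x. omega (angle x))"
    by (rule continuous_on_compose2[OF omega_continuous[of UNIV] angle_continuous]) simp
  have ac: "continuous_on {0..total_arclen} a" "continuous_on {0..total_arclen} a'" and kc: "continuous_on {0..total_arclen} k"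
    unfolding a_def a'_def k_def by (intro continuous_intros angle_continuous oa; simp)+
  have X2: "total_arclen/2 \<in> {0..total_arclen}" using total_arclen_pos by auto
  have "k (total_arclen/2) = 1/4" by (simp add: k_def angle_half omega_def)
  then obtain \<eta> where \<eta>: "0 < \<eta>" "\<And>x. x \<in> {0..total_arclen} \<Longrightarrow> dist x (total_arclen/2) < \<eta> \<Longrightarrow> dist (k x) (k (total_arclen/2)) < 1/4"
    using kc X2 unfolding continuous_on_iff by (metis zero_less_divide_1_iff zero_less_numeral)
  define e where "e = min \<eta> (total_arclen/2) / 2"
  have e: "0 < e" "e < \<eta>" "e < total_arclen/2" using \<eta>(1) total_arclen_pos by (auto simp: e_def)
  define x3 where "x3 = total_arclen/2 + e"
  define x2 where "x2 = total_arclen/2 + e/2"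
  define L where "L = (x3 + total_arclen) / 2"
  have xs: "0 < total_arclen/2" "total_arclen/2 < x2" "x2 < x3" "x3 < L" "L < total_arclen" using e total_arclen_pos by (auto simp: x2_def x3_def L_def field_simps)
  have sub: "{0..L} \<subseteq> {0..total_arclen}" using xs by auto
  have nn: "0 \<le> k x" if "x \<in> {0..x3}" for x
  proof (cases "x \<le> total_arclen/2")
    case True
    then have "angle x \<le> pi/2" using angle_le[of x "total_arclen/2"] angle_half that xs by auto
    moreover have "0 \<le> angle x" using angle_mem[of x] that xs by auto
    ultimately have "0 \<le> cos (angle x)" by (intro cos_ge_zero) auto
    moreover have "0 \<le> omega (angle x)" using angle_mem[of x] that xs by (intro omega_nonneg) auto
    ultimately show ?thesis unfolding k_def using that xs by (intro add_nonneg_nonneg mult_nonneg_nonneg) auto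
  next
    case False
    then have "dist (k x) (k (total_arclen/2)) < 1/4" using that xs e by (intro \<eta>(2)) (auto simp: dist_real_def x3_def)
    then show ?thesis unfolding \<open>k (total_arclen/2) = 1/4\<close> dist_real_def by linarith
  qed
  obtain x0 where x0: "x0 \<in> {x2..L}" "\<And>y. y \<in> {x2..L} \<Longrightarrow> a x0 \<le> a y"
    using continuous_attains_inf[of "{x2..L}" a] continuous_on_subset[OF ac(1), of "{x2..L}"] xs by auto
  have a0: "0 < a x0"
  proof -
    have "x0 \<in> {0<..<total_arclen}" using x0(1) xs by auto
    from angle_mem_open[OF this] show ?thesis by (auto simp: a_def intro: sin_gt_zero)
  qed
  have am: "angle x \<in> {0..pi}" if "x \<in> {0..L}" for x using that xs by (intro angle_mem) auto
  have "\<exists>T C \<theta>. 1 < T \<and> 0 < C \<and> 0 < \<theta> \<and> \<theta> < 1 \<and>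
    (\<forall>U Ut Ux Utt Uxx Uxt M \<delta>. elliptic_solution T L a U Ut Ux Utt Uxx Uxt \<longrightarrow> 0 \<le> M \<longrightarrow> 0 \<le> \<delta> \<longrightarrow>
      (\<forall>t\<in>{-T..T}. integral {0..L} (\<lambda>x. a x * (U t x)\<^sup>2) \<le> M\<^sup>2) \<longrightarrow>
      integral {-T..T} (\<lambda>t. (U t 0)\<^sup>2 + (Ux t 0)\<^sup>2) \<le> \<delta>\<^sup>2 \<longrightarrow>
      integral {0..total_arclen/2} (\<lambda>x. a x * (U 0 x)\<^sup>2) \<le> C * M powr (2*(1-\<theta>)) * \<delta> powr (2*\<theta>))"
  proof (rule sideways_holder[where a'=a' and B="total_arclen+1" and \<alpha>="a x0" and ?x2.0=x2 and ?x3.0=x3])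
    fix x assume x: "x \<in> {0<..<L}"
    then have x': "x \<in> {0<..<total_arclen}" using xs by auto
    show "(a has_real_derivative a' x) (at x)" unfolding a_def a'_def
      by (rule derivative_eq_intros angle_has_derivative[OF x'] refl | simp)+
  next
    fix x assume x: "x \<in> {0..L}"
    have s0: "0 \<le> sin (angle x)" using am[OF x] by (intro sin_ge_zero) auto
    have "(a' x)\<^sup>2 = (cos (angle x))\<^sup>2 * sin (angle x) / 16" unfolding a'_def
      by (simp add: power_mult_distrib power_divide omega_sq[OF am[OF x]])
    also have "\<dots> \<le> 1 * sin (angle x) / 16" using s0 by (intro divide_right_mono mult_right_mono) (auto simp: abs_square_le_1)
    finally show "0 \<le> a x \<and> a x \<le> 1/4 \<and> (a' x)\<^sup>2 \<le> a x / 4" using s0 by (auto simp: a_def)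
  next
    fix x assume x: "x \<in> {0..x3}"
    then have xL: "x \<in> {0..L}" using xs by auto
    have "0 \<le> omega (angle x) * k x / 4" using nn[OF x] omega_nonneg[OF am[OF xL]] by simp
    also have "\<dots> = a' x * (total_arclen + 1 - x) + (omega (angle x))\<^sup>2 / 16" by (simp add: k_def a'_def field_simps power2_eq_square)
    finally show "- a x / 4 \<le> a' x * (total_arclen + 1 - x)" using omega_sq[OF am[OF xL]] by (simp add: a_def)
  next
    fix x assume "x \<in> {x2..L}"
    then show "a x0 \<le> a x" by (rule x0(2))
  qed (use xs a0 continuous_on_subset[OF ac(1) sub] continuous_on_subset[OF ac(2) sub] in \<open>auto simp: a_def angle_0\<close>)
  then obtain T C \<theta> where TC: "1 < T \<and> 0 < C \<and> 0 < \<theta> \<and> \<theta> < 1 \<and>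
    (\<forall>U Ut Ux Utt Uxx Uxt M \<delta>. elliptic_solution T L a U Ut Ux Utt Uxx Uxt \<longrightarrow> 0 \<le> M \<longrightarrow> 0 \<le> \<delta> \<longrightarrow>
      (\<forall>t\<in>{-T..T}. integral {0..L} (\<lambda>x. a x * (U t x)\<^sup>2) \<le> M\<^sup>2) \<longrightarrow>
      integral {-T..T} (\<lambda>t. (U t 0)\<^sup>2 + (Ux t 0)\<^sup>2) \<le> \<delta>\<^sup>2 \<longrightarrow>
      integral {0..total_arclen/2} (\<lambda>x. a x * (U 0 x)\<^sup>2) \<le> C * M powr (2*(1-\<theta>)) * \<delta> powr (2*\<theta>))"
    by (elim exE)
  note est = TC[THEN conjunct2, THEN conjunct2, THEN conjunct2, THEN conjunct2, rule_format]
  have main: "integral {0..pi/2} (\<lambda>\<phi>. omega \<phi> * (A 0 0 \<phi>)\<^sup>2) \<le> (4*C) * M powr (2*(1-\<theta>)) * \<delta> powr (2*\<theta>)"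
    if sys: "angular_system T A B" and M: "0 \<le> M" and \<delta>: "0 \<le> \<delta>"
      and h: "\<And>t. t \<in> {-T..T} \<Longrightarrow> integral {0..pi} (\<lambda>\<phi>. omega \<phi> * (A 0 t \<phi>)\<^sup>2) \<le> 4 * M\<^sup>2"
      and b: "integral {-T..T} (\<lambda>t. (A 0 t 0)\<^sup>2 + (B 0 t 0)\<^sup>2) \<le> \<delta>\<^sup>2" for A B M \<delta>
  proof -
    have jc: "continuous_on (UNIV \<times> {0..pi}) (\<lambda>z. A 0 (fst z) (snd z))" using sys by (auto simp: angular_system_def)
    have Ac: "continuous_on {0..pi} (\<lambda>\<phi>. (A 0 t \<phi>)\<^sup>2)" for t
    proof -
      have "continuous_on {0..pi} (\<lambda>\<phi>. (t, \<phi>))" by (intro continuous_on_Pair continuous_on_const continuous_on_id)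
      from continuous_on_compose2[OF jc this] show ?thesis by (auto intro!: continuous_intros)
    qed
    have oc: "continuous_on {0..pi} (\<lambda>\<phi>. omega \<phi> * (A 0 t \<phi>)\<^sup>2)" for t by (intro continuous_on_mult omega_continuous Ac)
    have conv: "integral {0..x} (\<lambda>y. a y * (A 0 t (angle y))\<^sup>2) = integral {0..angle x} (\<lambda>\<phi>. omega \<phi> * (A 0 t \<phi>)\<^sup>2) / 4" if "x \<in> {0..total_arclen}" for x t
      unfolding a_def by (rule weighted_integral_angle[OF Ac that])
    have "integral {0..total_arclen/2} (\<lambda>x. a x * (A 0 0 (angle x))\<^sup>2) \<le> C * M powr (2*(1-\<theta>)) * \<delta> powr (2*\<theta>)"
    proof (rule est[OF angular_system_elliptic[OF sys, of L, folded a_def] M \<delta>])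
      show "integral {0..L} (\<lambda>x. a x * (A 0 t (angle x))\<^sup>2) \<le> M\<^sup>2" if t: "t \<in> {-T..T}" for t
      proof -
        have Lm: "L \<in> {0..total_arclen}" using xs by auto
        have "integral {0..angle L} (\<lambda>\<phi>. omega \<phi> * (A 0 t \<phi>)\<^sup>2) \<le> integral {0..pi} (\<lambda>\<phi>. omega \<phi> * (A 0 t \<phi>)\<^sup>2)"
        proof (rule integral_subset_le)
          show "{0..angle L} \<subseteq> {0..pi}" using angle_mem[OF Lm] by auto
          then show "(\<lambda>\<phi>. omega \<phi> * (A 0 t \<phi>)\<^sup>2) integrable_on {0..angle L}"
            by (intro integrable_continuous_interval continuous_on_subset[OF oc])
          show "(\<lambda>\<phi>. omega \<phi> * (A 0 t \<phi>)\<^sup>2) integrable_on {0..pi}" by (rule integrable_continuous_interval[OF oc])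
        qed (auto intro!: mult_nonneg_nonneg omega_nonneg)
        then show ?thesis unfolding conv[OF Lm] using h[OF t] by linarith
      qed
    qed (use xs b in \<open>auto simp: angle_0\<close>)
    then show ?thesis unfolding conv[OF X2] angle_half by simp
  qed
  show ?thesis
  proof (rule exI[of _ T], rule exI[of _ "4*C"], rule exI[of _ \<theta>], intro conjI allI impI)
    show "0 < 4 * C" using TC by simp
  next
    fix A B M \<delta>
    assume "angular_system T A B" "0 \<le> M" "0 \<le> \<delta>" and m: "\<forall>t\<in>{-T..T}. integral {0..pi} (\<lambda>\<phi>. omega \<phi> * (A 0 t \<phi>)\<^sup>2) \<le> 4 * M\<^sup>2"
      and "integral {-T..T} (\<lambda>t. (A 0 t 0)\<^sup>2 + (B 0 t 0)\<^sup>2) \<le> \<delta>\<^sup>2"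
    then show "integral {0..pi/2} (\<lambda>\<phi>. omega \<phi> * (A 0 0 \<phi>)\<^sup>2) \<le> 4 * C * M powr (2*(1-\<theta>)) * \<delta> powr (2*\<theta>)"
      by (intro main) (auto dest: bspec[OF m])
  qed (use TC in auto)
qed

section \<open>Both halves of the interval and the limit of vanishing mollification\<close>

lemma integral_reflect_half:
  fixes f :: "real \<Rightarrow> real"
  assumes "continuous_on {0..pi} f"
  shows "integral {0..pi} f = integral {0..pi/2} f + integral {0..pi/2} (\<lambda>\<phi>. f (pi - \<phi>))"
proof -
  have c: "f integrable_on {0..pi}" by (rule integrable_continuous_interval[OF assms])
  have "f integrable_on {pi/2..pi}" by (rule integrable_on_subinterval[OF c]) auto
  then have "(f has_integral integral {pi/2..pi} f) {pi/2..pi}" by (rule integrable_integral)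
  then have "((\<lambda>x. f (- x)) has_integral integral {pi/2..pi} f) (cbox (-pi) (-(pi/2)))" by (simp only: has_integral_reflect_real cbox_interval)
  from has_integral_affinity'[OF this, of 1 "-pi"]
  have "((\<lambda>x. f (pi - x)) has_integral integral {pi/2..pi} f) {0..pi/2}" by (simp add: field_simps)
  then have "integral {0..pi/2} (\<lambda>\<phi>. f (pi - \<phi>)) = integral {pi/2..pi} f" by (rule integral_unique)
  moreover have "integral {0..pi/2} f + integral {pi/2..pi} f = integral {0..pi} f"
    by (rule Henstock_Kurzweil_Integration.integral_combine[OF _ _ c]) auto
  ultimately show ?thesis by simp
qed

lemma angular_system_reflect:
  assumes sys: "angular_system T A B"
  shows "angular_system T (\<lambda>n t \<phi>. A n t (pi - \<phi>)) (\<lambda>n t \<phi>. - B n t (pi - \<phi>))"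
proof -
  have s: "continuous_on (UNIV \<times> {0..pi}) (\<lambda>z. A n (fst z) (snd z))" "continuous_on (UNIV \<times> {0..pi}) (\<lambda>z. B n (fst z) (snd z))"
    "\<phi> \<in> {0..pi} \<Longrightarrow> ((\<lambda>t. A n t \<phi>) has_real_derivative A (Suc n) t \<phi>) (at t)"
    "\<phi> \<in> {0..pi} \<Longrightarrow> ((\<lambda>t. B n t \<phi>) has_real_derivative B (Suc n) t \<phi>) (at t)"
    "t \<in> {-T..T} \<Longrightarrow> \<phi> \<in> {0<..<pi} \<Longrightarrow> (A n t has_real_derivative B n t \<phi> / omega \<phi>) (at \<phi>)"
    "t \<in> {-T..T} \<Longrightarrow> \<phi> \<in> {0<..<pi} \<Longrightarrow> (B n t has_real_derivative - (omega \<phi> / 4) * (A (Suc (Suc n)) t \<phi> + A (Suc n) t \<phi>)) (at \<phi>)"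
    for n t \<phi> using sys by (auto simp: angular_system_def)
  have m: "pi - \<phi> \<in> {0..pi}" if "\<phi> \<in> {0..pi}" for \<phi> using that by auto
  have mo: "pi - \<phi> \<in> {0<..<pi}" if "\<phi> \<in> {0<..<pi}" for \<phi> using that by auto
  have cp: "continuous_on (UNIV \<times> {0..pi}) (\<lambda>z::real \<times> real. (fst z, pi - snd z))" by (intro continuous_intros)
  have sub: "(\<lambda>z::real \<times> real. (fst z, pi - snd z)) ` (UNIV \<times> {0..pi}) \<subseteq> UNIV \<times> {0..pi}" by auto
  have dr: "((\<lambda>\<phi>. pi - \<phi>) has_real_derivative - 1) (at \<phi>)" for \<phi> by (auto intro!: derivative_eq_intros)
  show ?thesis
    unfolding angular_system_def
  proof (intro conjI allI ballI)
    show "continuous_on (UNIV \<times> {0..pi}) (\<lambda>z. A n (fst z) (pi - snd z))" for n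
      using continuous_on_compose2[OF s(1) cp sub] by simp
    show "continuous_on (UNIV \<times> {0..pi}) (\<lambda>z. - B n (fst z) (pi - snd z))" for n
      using continuous_on_compose2[OF s(2) cp sub] by (intro continuous_intros) simp
  next
    fix n t \<phi> assume p: "\<phi> \<in> {0..pi}"
    show "((\<lambda>t. A n t (pi - \<phi>)) has_real_derivative A (Suc n) t (pi - \<phi>)) (at t)" by (rule s(3)[OF m[OF p]])
    show "((\<lambda>t. - B n t (pi - \<phi>)) has_real_derivative - B (Suc n) t (pi - \<phi>)) (at t)" by (rule DERIV_minus[OF s(4)[OF m[OF p]]])
  next
    fix n t \<phi> assume t: "t \<in> {-T..T}" and p: "\<phi> \<in> {0<..<pi}"
    show "((\<lambda>\<phi>. A n t (pi - \<phi>)) has_real_derivative - B n t (pi - \<phi>) / omega \<phi>) (at \<phi>)"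
      using DERIV_chain2[OF s(5)[OF t mo[OF p]] dr] by (simp add: omega_reflect)
    show "((\<lambda>\<phi>. - B n t (pi - \<phi>)) has_real_derivative - (omega \<phi> / 4) * (A (Suc (Suc n)) t (pi - \<phi>) + A (Suc n) t (pi - \<phi>))) (at \<phi>)"
      using DERIV_minus[OF DERIV_chain2[OF s(6)[OF t mo[OF p]] dr]] by (simp add: omega_reflect)
  qed
qed

context boundary_solution
begin

lemma mollified_angular_system:
  fixes R :: "complex \<Rightarrow> real"
  assumes D: "mollifier \<epsilon> D" and R: "bounded_linear R" and T: "p + \<epsilon> < - T" "T < q - \<epsilon>"
  shows "angular_system T (\<lambda>n t \<phi>. R (W D n t \<phi>)) (\<lambda>n t \<phi>. R (P D n t \<phi>))"
  unfolding angular_system_def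
proof (intro conjI allI ballI)
  show "continuous_on (UNIV \<times> {0..pi}) (\<lambda>z. R (W D n (fst z) (snd z)))"
    "continuous_on (UNIV \<times> {0..pi}) (\<lambda>z. R (P D n (fst z) (snd z)))" for n
    by (intro bounded_linear.continuous_on[OF R] W_continuous[OF D] P_continuous[OF D])+
next
  fix n t \<phi> assume p: "\<phi> \<in> {0..pi}"
  show "((\<lambda>t. R (W D n t \<phi>)) has_real_derivative R (W D (Suc n) t \<phi>)) (at t)"
    "((\<lambda>t. R (P D n t \<phi>)) has_real_derivative R (P D (Suc n) t \<phi>)) (at t)"
    unfolding has_real_derivative_iff_has_vector_derivative
    by (intro bounded_linear.has_vector_derivative[OF R] W_has_derivative[OF D p] P_has_derivative_t[OF D p])+
next
  fix n t \<phi> assume t: "t \<in> {-T..T}" and p: "\<phi> \<in> {0<..<pi}"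
  have tJ: "{t-\<epsilon>..t+\<epsilon>} \<subseteq> J" using t T by auto
  note sc = linear_scale[OF bounded_linear.linear[OF R]] and ad = linear_add[OF bounded_linear.linear[OF R]]
  show "((\<lambda>\<phi>. R (W D n t \<phi>)) has_real_derivative R (P D n t \<phi>) / omega \<phi>) (at \<phi>)"
    using bounded_linear.has_vector_derivative[OF R W_has_derivative_angle[OF D tJ p, of n]]
    unfolding has_real_derivative_iff_has_vector_derivative sc by simp
  show "((\<lambda>\<phi>. R (P D n t \<phi>)) has_real_derivative - (omega \<phi> / 4) * (R (W D (Suc (Suc n)) t \<phi>) + R (W D (Suc n) t \<phi>))) (at \<phi>)"
    using bounded_linear.has_vector_derivative[OF R P_has_derivative[OF D p, of n t]]
    unfolding has_real_derivative_iff_has_vector_derivative sc ad by simp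
qed

lemma norm_W_integral:
  assumes D: "mollifier \<epsilon> D"
  shows "(norm (abs_hspace (W D n t)))\<^sup>2 = integral {0..pi} (\<lambda>\<phi>. omega \<phi> * (cmod (W D n t \<phi>))\<^sup>2)"
proof -
  note c = W_continuous_slice[OF D, of n t]
  have m: "(\<lambda>\<phi>. (cmod (W D n t \<phi>))\<^sup>2) \<in> borel_measurable leb0" using continuous_L2_omega(2)[OF c] by measurable
  have L: "W D n t \<in> L2_omega" by (rule continuous_L2_omega(1)[OF c])
  then have i: "integrable leb0 (\<lambda>\<phi>. omega \<phi> *\<^sub>R (cmod (W D n t \<phi>))\<^sup>2)"
    using integrable_omega_iff(1)[OF m] by (simp add: L2_omega_def)
  have "(norm (abs_hspace (W D n t)))\<^sup>2 = (\<integral>\<phi>. omega \<phi> *\<^sub>R (cmod (W D n t \<phi>))\<^sup>2 \<partial>leb0)"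
    unfolding norm_abs_hspace[OF L] by (rule integrable_omega_iff(2)[OF m])
  also have "\<dots> = integral {0<..<pi} (\<lambda>\<phi>. omega \<phi> *\<^sub>R (cmod (W D n t \<phi>))\<^sup>2)" by (rule lebesgue_integral_eq_integral[OF i]) simp
  finally show ?thesis by (simp add: integral_open_interval_real)
qed

text \<open>\<open>R\<close> is the real or the imaginary part, as the interior estimate is about real functions.\<close>
lemma component_integral_le:
  fixes R :: "complex \<Rightarrow> real"
  assumes D: "mollifier \<epsilon> D" and R: "bounded_linear R" "\<And>z. \<bar>R z\<bar> \<le> cmod z"
    and M: "norm (abs_hspace (W D 0 t)) \<le> 2 * M"
  shows "integral {0..pi} (\<lambda>\<phi>. omega \<phi> * (R (W D 0 t \<phi>))\<^sup>2) \<le> 4 * M\<^sup>2"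
proof -
  note c = W_continuous_slice[OF D, of 0 t]
  have "integral {0..pi} (\<lambda>\<phi>. omega \<phi> * (R (W D 0 t \<phi>))\<^sup>2) \<le> integral {0..pi} (\<lambda>\<phi>. omega \<phi> * (cmod (W D 0 t \<phi>))\<^sup>2)"
  proof (rule integral_le)
    fix \<phi> assume "\<phi> \<in> {0..pi}"
    then show "omega \<phi> * (R (W D 0 t \<phi>))\<^sup>2 \<le> omega \<phi> * (cmod (W D 0 t \<phi>))\<^sup>2"
      using omega_nonneg R(2) by (intro mult_left_mono abs_le_square_iff[THEN iffD1]) auto
  qed (intro integrable_continuous_interval continuous_intros omega_continuous bounded_linear.continuous_on[OF R(1)] c)+
  also have "\<dots> = (norm (abs_hspace (W D 0 t)))\<^sup>2" by (rule norm_W_integral[OF D, symmetric])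
  also have "\<dots> \<le> (2 * M)\<^sup>2" using M by (intro power_mono) auto
  finally show ?thesis by (simp add: power_mult_distrib)
qed

definition trace_energy :: real where "trace_energy = (\<integral>s. (norm (endpoint_trace (w s)))\<^sup>2 \<partial>lebJ)"

text \<open>The factor \<open>1 + \<mu>\<^sup>2\<close> arises here: at either endpoint \<open>P\<close> is, up to sign, a quarter of the mollified flux.\<close>
lemma boundary_data_le:
  fixes R :: "complex \<Rightarrow> real"
  assumes D: "mollifier \<epsilon> D" and R: "bounded_linear R" "\<And>z. \<bar>R z\<bar> \<le> cmod z" and T: "0 < T" "p + \<epsilon> < - T" "T < q - \<epsilon>"
    and b: "b = 0 \<and> i = (1::2) \<or> b = pi \<and> i = 2"
  shows "integral {-T..T} (\<lambda>t. (R (W D 0 t b))\<^sup>2 + (R (P D 0 t b))\<^sup>2) \<le> (1 + \<mu>\<^sup>2) * trace_energy"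
proof -
  have bm: "b \<in> {0..pi}" using b by auto
  define F where "F = (\<lambda>s. flux s $ i)"
  define E where "E = (\<lambda>s. ev b (w s))"
  have iE: "integrable lebJ E" "integrable lebJ (\<lambda>s. (cmod (E s))\<^sup>2)" unfolding E_def using ev_w[OF bm] by auto
  have iF: "integrable lebJ F" "integrable lebJ (\<lambda>s. (cmod (F s))\<^sup>2)" unfolding F_def using flux_sq by auto
  have mc: "continuous_on {-T..T} (mollify J D 0 f)" if "integrable lebJ f" for f :: "real \<Rightarrow> complex"
    using mollify_has_derivative[OF D that] by (auto intro!: continuous_at_imp_continuous_on has_vector_derivative_continuous)
  have WE: "W D 0 t b = mollify J D 0 E t" for t by (simp add: W_def E_def)
  have PF: "cmod (P D 0 t b) \<le> cmod (mollify J D 0 F t)" if t: "t \<in> {-T..T}" for t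
  proof -
    have tJ: "{t-\<epsilon>..t+\<epsilon>} \<subseteq> J" using t T by auto
    have "cmod (P D 0 t b) = cmod (mollify J D 0 F t) / 4"
      using b P_endpoints[OF D tJ, of 0] unfolding F_def by (elim disjE) (auto simp only: norm_divide norm_minus_cancel norm_numeral)
    then show ?thesis using norm_ge_zero[of "mollify J D 0 F t"] by linarith
  qed
  have Wc: "continuous_on {-T..T} (\<lambda>t. R (W D 0 t b))" unfolding WE by (intro bounded_linear.continuous_on[OF R(1)] mc iE)
  have Pc: "continuous_on {-T..T} (\<lambda>t. R (P D 0 t b))"
    using P_has_derivative_t[OF D bm, of 0]
    by (intro bounded_linear.continuous_on[OF R(1)]) (auto intro!: continuous_at_imp_continuous_on has_vector_derivative_continuous)
  have "integral {-T..T} (\<lambda>t. (R (W D 0 t b))\<^sup>2 + (R (P D 0 t b))\<^sup>2)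
     \<le> integral {-T..T} (\<lambda>t. (cmod (mollify J D 0 E t))\<^sup>2 + (cmod (mollify J D 0 F t))\<^sup>2)"
  proof (rule integral_le)
    fix t assume t: "t \<in> {-T..T}"
    have "\<bar>R (P D 0 t b)\<bar> \<le> cmod (mollify J D 0 F t)" using R(2)[of "P D 0 t b"] PF[OF t] by linarith
    then show "(R (W D 0 t b))\<^sup>2 + (R (P D 0 t b))\<^sup>2 \<le> (cmod (mollify J D 0 E t))\<^sup>2 + (cmod (mollify J D 0 F t))\<^sup>2"
      using R(2)[of "W D 0 t b"] unfolding WE by (intro add_mono abs_le_square_iff[THEN iffD1]) auto
  qed (intro integrable_continuous_interval continuous_intros Wc Pc mc iE iF)+
  also have "\<dots> = integral {-T..T} (\<lambda>t. (cmod (mollify J D 0 E t))\<^sup>2) + integral {-T..T} (\<lambda>t. (cmod (mollify J D 0 F t))\<^sup>2)"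
    by (rule Henstock_Kurzweil_Integration.integral_add) (intro integrable_continuous_interval continuous_intros mc iE iF)+
  also have "\<dots> \<le> (\<integral>s. (cmod (E s))\<^sup>2 \<partial>lebJ) + (\<integral>s. (cmod (F s))\<^sup>2 \<partial>lebJ)"
    using T by (intro add_mono mollify_square_integral_le[OF D] iE iF) auto
  also have "\<dots> \<le> trace_energy + \<mu>\<^sup>2 * trace_energy"
  proof (rule add_mono)
    show "(\<integral>s. (cmod (E s))\<^sup>2 \<partial>lebJ) \<le> trace_energy" unfolding trace_energy_def
    proof (rule integral_mono[OF iE(2) trace_sq])
      show "(cmod (E s))\<^sup>2 \<le> (norm (endpoint_trace (w s)))\<^sup>2" for s
        using b unfolding norm_complex2 endpoint_trace_nth E_def by auto
    qed
    have "(\<integral>s. (cmod (F s))\<^sup>2 \<partial>lebJ) \<le> (\<integral>s. \<mu>\<^sup>2 * (norm (endpoint_trace (w s)))\<^sup>2 \<partial>lebJ)"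
    proof (rule integral_mono_AE[OF iF(2)])
      show "AE s in lebJ. (cmod (F s))\<^sup>2 \<le> \<mu>\<^sup>2 * (norm (endpoint_trace (w s)))\<^sup>2"
        using flux_bound
      proof eventually_elim
        case (elim s)
        have "(cmod (F s))\<^sup>2 \<le> (norm (flux s))\<^sup>2" using b unfolding norm_complex2 F_def by auto
        also have "\<dots> \<le> (\<mu> * norm (endpoint_trace (w s)))\<^sup>2" using elim by (intro power_mono) auto
        finally show ?case by (simp add: power_mult_distrib)
      qed
    qed (use trace_sq in simp)
    then show "(\<integral>s. (cmod (F s))\<^sup>2 \<partial>lebJ) \<le> \<mu>\<^sup>2 * trace_energy" by (simp add: trace_energy_def)
  qed
  finally show ?thesis by (simp add: algebra_simps)
qed

text \<open>Four applications of the half-interval estimate: real and imaginary part, left and right half.\<close>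
lemma mollified_holder:
  assumes D: "mollifier \<epsilon> D" and T: "0 < T" "p + \<epsilon> < - T" "T < q - \<epsilon>" and M: "0 \<le> M"
    and near: "\<And>t. t \<in> {-T..T} \<Longrightarrow> norm (abs_hspace (W D 0 t)) \<le> 2 * M"
    and est: "\<And>A B \<delta>. angular_system T A B \<Longrightarrow> 0 \<le> \<delta> \<Longrightarrow>
      (\<And>t. t \<in> {-T..T} \<Longrightarrow> integral {0..pi} (\<lambda>\<phi>. omega \<phi> * (A 0 t \<phi>)\<^sup>2) \<le> 4 * M\<^sup>2) \<Longrightarrow>
      integral {-T..T} (\<lambda>t. (A 0 t 0)\<^sup>2 + (B 0 t 0)\<^sup>2) \<le> \<delta>\<^sup>2 \<Longrightarrow>
      integral {0..pi/2} (\<lambda>\<phi>. omega \<phi> * (A 0 0 \<phi>)\<^sup>2) \<le> N * \<delta> powr r"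
  shows "(norm (abs_hspace (W D 0 0)))\<^sup>2 \<le> 4 * (N * sqrt ((1 + \<mu>\<^sup>2) * trace_energy) powr r)"
proof -
  define \<delta> where "\<delta> = sqrt ((1 + \<mu>\<^sup>2) * trace_energy)"
  have te: "0 \<le> trace_energy" by (simp add: trace_energy_def)
  have \<delta>: "0 \<le> \<delta>" "\<delta>\<^sup>2 = (1 + \<mu>\<^sup>2) * trace_energy" using te by (auto simp: \<delta>_def)
  have comp: "integral {0..pi} (\<lambda>\<phi>. omega \<phi> * (R (W D 0 0 \<phi>))\<^sup>2) \<le> 2 * (N * \<delta> powr r)"
    if R: "bounded_linear R" "\<And>z. \<bar>R z\<bar> \<le> cmod z" for R :: "complex \<Rightarrow> real"
  proof -
    have c: "continuous_on {0..pi} (\<lambda>\<phi>. omega \<phi> * (R (W D 0 t \<phi>))\<^sup>2)" for t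
      by (intro continuous_intros omega_continuous bounded_linear.continuous_on[OF R(1)] W_continuous_slice[OF D])
    note sys = mollified_angular_system[OF D R(1) T(2,3)]
    note bd = component_integral_le[OF D R near]
    have left: "integral {0..pi/2} (\<lambda>\<phi>. omega \<phi> * (R (W D 0 0 \<phi>))\<^sup>2) \<le> N * \<delta> powr r"
      by (rule est[OF sys \<delta>(1) bd]) (use boundary_data_le[OF D R T, of 0 1] \<delta>(2) in auto)
    have right: "integral {0..pi/2} (\<lambda>\<phi>. omega \<phi> * (R (W D 0 0 (pi - \<phi>)))\<^sup>2) \<le> N * \<delta> powr r"
    proof (rule est[OF angular_system_reflect[OF sys] \<delta>(1)])
      fix t assume t: "t \<in> {-T..T}"
      have "((\<lambda>\<phi>. omega \<phi> * (R (W D 0 t \<phi>))\<^sup>2) has_integral integral {0..pi} (\<lambda>\<phi>. omega \<phi> * (R (W D 0 t \<phi>))\<^sup>2)) {0..pi}"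
        by (rule integrable_integral[OF integrable_continuous_interval[OF c]])
      then have "((\<lambda>\<phi>. omega (- \<phi>) * (R (W D 0 t (- \<phi>)))\<^sup>2) has_integral integral {0..pi} (\<lambda>\<phi>. omega \<phi> * (R (W D 0 t \<phi>))\<^sup>2)) (cbox (- pi) (- 0))"
        by (simp only: has_integral_reflect_real[of "\<lambda>\<phi>. omega \<phi> * (R (W D 0 t \<phi>))\<^sup>2"] cbox_interval)
      from has_integral_affinity'[OF this, of 1 "-pi"]
      have "((\<lambda>\<phi>. omega (pi - \<phi>) * (R (W D 0 t (pi - \<phi>)))\<^sup>2) has_integral integral {0..pi} (\<lambda>\<phi>. omega \<phi> * (R (W D 0 t \<phi>))\<^sup>2)) {0..pi}"
        by simp
      then show "integral {0..pi} (\<lambda>\<phi>. omega \<phi> * (R (W D 0 t (pi - \<phi>)))\<^sup>2) \<le> 4 * M\<^sup>2"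
        using bd[OF t] by (simp add: omega_reflect integral_unique)
    qed (use boundary_data_le[OF D R T, of pi 2] \<delta>(2) in auto)
    show ?thesis using integral_reflect_half[OF c, of 0] left right by (simp add: omega_reflect)
  qed
  have i: "(\<lambda>\<phi>. omega \<phi> * (R (W D 0 0 \<phi>))\<^sup>2) integrable_on {0..pi}" if "bounded_linear R" for R :: "complex \<Rightarrow> real"
    by (intro integrable_continuous_interval continuous_intros omega_continuous bounded_linear.continuous_on[OF that] W_continuous_slice[OF D])
  have "(norm (abs_hspace (W D 0 0)))\<^sup>2 = integral {0..pi} (\<lambda>\<phi>. omega \<phi> * (Re (W D 0 0 \<phi>))\<^sup>2 + omega \<phi> * (Im (W D 0 0 \<phi>))\<^sup>2)"
    unfolding norm_W_integral[OF D] by (simp only: cmod_power2 distrib_left)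
  also have "\<dots> = integral {0..pi} (\<lambda>\<phi>. omega \<phi> * (Re (W D 0 0 \<phi>))\<^sup>2) + integral {0..pi} (\<lambda>\<phi>. omega \<phi> * (Im (W D 0 0 \<phi>))\<^sup>2)"
    by (rule Henstock_Kurzweil_Integration.integral_add) (intro i bounded_linear_Re bounded_linear_Im)+
  also have "\<dots> \<le> 4 * (N * \<delta> powr r)"
    using comp[OF bounded_linear_Re abs_Re_le_cmod] comp[OF bounded_linear_Im abs_Im_le_cmod] by linarith
  finally show ?thesis unfolding \<delta>_def .
qed

lemma cont_rep_continuous: "continuous_on {p..q} (cont_rep J w)"
proof -
  obtain wt where wt: "bochner_L2 J wt" "bochner_weak_deriv J (\<lambda>t. emb (w t)) wt" using sol unfolding weak_solution_def by blast
  show ?thesis by (rule cont_rep_props(1)[OF pq w_L2(2) wt])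
qed

text \<open>
  Mollification with vanishing \<open>\<epsilon>\<close>. Neither side of the estimate depends on the mollifier
  except through the slice at time 0, which converges in norm.
\<close>
lemma cont_rep_holder:
  assumes T: "0 < T" "p < - T" "T < q" and M: "\<And>t. t \<in> J \<Longrightarrow> norm (cont_rep J w t) \<le> M"
    and est: "\<And>A B \<delta>. angular_system T A B \<Longrightarrow> 0 \<le> \<delta> \<Longrightarrow>
      (\<And>t. t \<in> {-T..T} \<Longrightarrow> integral {0..pi} (\<lambda>\<phi>. omega \<phi> * (A 0 t \<phi>)\<^sup>2) \<le> 4 * M\<^sup>2) \<Longrightarrow>
      integral {-T..T} (\<lambda>t. (A 0 t 0)\<^sup>2 + (B 0 t 0)\<^sup>2) \<le> \<delta>\<^sup>2 \<Longrightarrow>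
      integral {0..pi/2} (\<lambda>\<phi>. omega \<phi> * (A 0 0 \<phi>)\<^sup>2) \<le> N * \<delta> powr r"
  shows "(norm (cont_rep J w 0))\<^sup>2 \<le> 4 * (N * sqrt ((1 + \<mu>\<^sup>2) * trace_energy) powr r)"
proof -
  define K where "K = 4 * (N * sqrt ((1 + \<mu>\<^sup>2) * trace_energy) powr r)"
  have z: "0 \<in> J" using T by auto
  have M0: "0 \<le> M" using M[OF z] by (rule order_trans[OF norm_ge_zero])
  have approx: "\<exists>y. y\<^sup>2 \<le> K \<and> 0 \<le> y \<and> norm (cont_rep J w 0) \<le> y + e" if e: "0 < e" for e
  proof -
    have "isCont (cont_rep J w) 0" using continuous_on_interior[OF cont_rep_continuous, of 0] z by simp
    then obtain \<eta> where \<eta>: "0 < \<eta>" "\<And>s. dist s 0 < \<eta> \<Longrightarrow> dist (cont_rep J w s) (cont_rep J w 0) < e/2"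
      unfolding continuous_at_eps_delta using e by (metis half_gt_zero)
    define m where "m = min \<eta> (min (- T - p) (q - T))"
    have m: "0 < m" "m \<le> \<eta>" "m \<le> - T - p" "m \<le> q - T" using \<eta>(1) T by (auto simp: m_def)
    define \<epsilon> where "\<epsilon> = m / 2"
    have \<epsilon>: "0 < \<epsilon>" "\<epsilon> < \<eta>" "p + \<epsilon> < - T" "T < q - \<epsilon>" using m unfolding \<epsilon>_def by linarith+
    obtain D where D: "mollifier \<epsilon> D" using mollifier_exists[OF \<epsilon>(1)] by blast
    have sub: "{t-\<epsilon>..t+\<epsilon>} \<subseteq> J" if "t \<in> {-T..T}" for t using that \<epsilon> by auto
    have "(norm (abs_hspace (W D 0 0)))\<^sup>2 \<le> K" unfolding K_def
    proof (rule mollified_holder[where N=N and r=r, OF D T(1) \<epsilon>(3,4) M0])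
      fix t assume "t \<in> {-T..T}"
      from norm_W_near[OF D sub[OF this], of 0 M] show "norm (abs_hspace (W D 0 t)) \<le> 2 * M" using M by simp
    qed (fact est)
    moreover have "norm (abs_hspace (W D 0 0) - cont_rep J w 0) \<le> 2 * (e/2)"
    proof (rule norm_W_near[OF D sub])
      fix s assume "s \<in> J" "\<bar>s - 0\<bar> \<le> \<epsilon>"
      then show "norm (cont_rep J w s - cont_rep J w 0) \<le> e/2" using \<eta>(2)[of s] \<epsilon>(2) by (simp add: dist_norm)
    qed (use T in auto)
    moreover have "norm (cont_rep J w 0) \<le> norm (abs_hspace (W D 0 0)) + norm (abs_hspace (W D 0 0) - cont_rep J w 0)"
      using norm_triangle_ineq4[of "abs_hspace (W D 0 0)" "abs_hspace (W D 0 0) - cont_rep J w 0"] by simp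
    ultimately show ?thesis by (intro exI[of _ "norm (abs_hspace (W D 0 0))"]) auto
  qed
  have "norm (cont_rep J w 0) \<le> sqrt K"
  proof (rule field_le_epsilon)
    fix e :: real assume "0 < e"
    from approx[OF this] obtain y where y: "y\<^sup>2 \<le> K" "0 \<le> y" "norm (cont_rep J w 0) \<le> y + e" by blast
    then have "y \<le> sqrt K" by (intro real_le_rsqrt)
    then show "norm (cont_rep J w 0) \<le> sqrt K + e" using y(3) by simp
  qed
  moreover have "0 \<le> K" using approx[of 1] by (metis zero_le_power2 order_trans zero_less_one)
  ultimately show ?thesis unfolding K_def[symmetric] using power_mono[of "norm (cont_rep J w 0)" "sqrt K" 2] by simp
qed

end

theorem corollary11p4:
  shows "\<exists>d C\<^sub>1 \<theta> :: real. d > 1 \<and> C\<^sub>1 > 0 \<and> 0 < \<theta> \<and> \<theta> < 1 \<and>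
    (\<forall>(\<mu> :: real) (\<Gamma> :: real \<Rightarrow> complex ^ 2 ^ 2) (w :: real \<Rightarrow> vspace).
       \<mu> \<ge> 0 \<longrightarrow> Linf_bound (J_int d) \<Gamma> \<mu> \<longrightarrow> weak_solution (J_int d) \<Gamma> w \<longrightarrow>
       (norm (cont_rep (J_int d) w 0))\<^sup>2 \<le>
         C\<^sub>1 * exp (C\<^sub>1 * (1 + \<mu>\<^sup>2)) *
         sup_norm d w powr (2 * (1 - \<theta>)) * trace_norm d w powr (2 * \<theta>))"
proof -
  obtain T C \<theta> where TC: "1 < T \<and> 0 < C \<and> 0 < \<theta> \<and> \<theta> < 1 \<and>
    (\<forall>A B M \<delta>. angular_system T A B \<longrightarrow> 0 \<le> M \<longrightarrow> 0 \<le> \<delta> \<longrightarrow>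
      (\<forall>t\<in>{-T..T}. integral {0..pi} (\<lambda>\<phi>. omega \<phi> * (A 0 t \<phi>)\<^sup>2) \<le> 4 * M\<^sup>2) \<longrightarrow>
      integral {-T..T} (\<lambda>t. (A 0 t 0)\<^sup>2 + (B 0 t 0)\<^sup>2) \<le> \<delta>\<^sup>2 \<longrightarrow>
      integral {0..pi/2} (\<lambda>\<phi>. omega \<phi> * (A 0 0 \<phi>)\<^sup>2) \<le> C * M powr (2*(1-\<theta>)) * \<delta> powr (2*\<theta>))"
    using angular_system_holder by (elim exE)
  note est = TC[THEN conjunct2, THEN conjunct2, THEN conjunct2, THEN conjunct2, rule_format]
  \<comment> \<open>the interval \<open>(-d, 1+d)\<close> contains \<open>[-T, T]\<close> with room for the mollifier on both sides\<close>
  define d where "d = T + 1"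
  define C1 where "C1 = max 1 (4 * C)"
  have C1: "1 \<le> C1" "4 * C \<le> C1" by (auto simp: C1_def)
  have main: "(norm (cont_rep (J_int d) w 0))\<^sup>2 \<le> C1 * exp (C1 * (1 + \<mu>\<^sup>2)) * sup_norm d w powr (2 * (1 - \<theta>)) * trace_norm d w powr (2 * \<theta>)"
    if \<mu>: "0 \<le> \<mu>" and \<Gamma>: "Linf_bound (J_int d) \<Gamma> \<mu>" and sol: "weak_solution (J_int d) \<Gamma> w" for \<mu> \<Gamma> w
  proof -
    have Jd: "J_int d = {-d<..<1+d}" by (simp add: J_int_def)
    interpret boundary_solution "-d" "1+d" \<Gamma> w \<mu>
    proof
      show "-d < 1 + d" using TC by (simp add: d_def)
    qed (use \<mu> \<Gamma> sol in \<open>simp_all only: Jd\<close>)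
    define M where "M = sup_norm d w"
    define \<tau> where "\<tau> = trace_norm d w"
    have te: "0 \<le> trace_energy" by (simp add: trace_energy_def)
    have \<tau>: "\<tau> = sqrt trace_energy" by (simp add: \<tau>_def trace_norm_def trace_energy_def Jd)
    have bdd: "bdd_above ((\<lambda>t. norm (cont_rep J w t)) ` J)"
    proof (rule bdd_above_mono)
      have "compact ((\<lambda>t. norm (cont_rep J w t)) ` {-d..1+d})"
        by (intro compact_continuous_image continuous_on_norm cont_rep_continuous) simp
      then show "bdd_above ((\<lambda>t. norm (cont_rep J w t)) ` {-d..1+d})" by (intro bounded_imp_bdd_above compact_imp_bounded)
    qed auto
    have Ms: "norm (cont_rep J w t) \<le> M" if "t \<in> J" for t
      unfolding M_def sup_norm_def Jd by (rule cSUP_upper[OF that bdd])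
    have "0 \<in> J" using TC by (auto simp: d_def)
    then have M0: "0 \<le> M" using Ms by (meson norm_ge_zero order_trans)
    have "(norm (cont_rep J w 0))\<^sup>2 \<le> 4 * ((C * M powr (2*(1-\<theta>))) * sqrt ((1 + \<mu>\<^sup>2) * trace_energy) powr (2*\<theta>))"
    proof (rule cont_rep_holder[where T=T and M=M])
      show "0 < T" "- d < - T" "T < 1 + d" using TC by (auto simp: d_def)
    qed (use Ms est M0 in auto)
    also have "sqrt ((1 + \<mu>\<^sup>2) * trace_energy) powr (2*\<theta>) = (1 + \<mu>\<^sup>2) powr \<theta> * \<tau> powr (2*\<theta>)"
    proof -
      have "sqrt (1 + \<mu>\<^sup>2) powr (2*\<theta>) = (1 + \<mu>\<^sup>2) powr \<theta>"
        by (simp add: powr_half_sqrt[symmetric] powr_powr add_nonneg_nonneg)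
      then show ?thesis using te by (simp add: real_sqrt_mult \<tau> powr_mult)
    qed
    also have "4 * ((C * M powr (2*(1-\<theta>))) * ((1 + \<mu>\<^sup>2) powr \<theta> * \<tau> powr (2*\<theta>)))
        = (4 * C) * (1 + \<mu>\<^sup>2) powr \<theta> * (M powr (2*(1-\<theta>)) * \<tau> powr (2*\<theta>))" by (simp add: mult_ac)
    \<comment> \<open>\<open>(1 + \<mu>\<^sup>2)\<^sup>\<theta> \<le> 1 + \<mu>\<^sup>2 \<le> exp (1 + \<mu>\<^sup>2)\<close> and \<open>C1 \<ge> 1\<close>\<close>
    also have "\<dots> \<le> C1 * exp (C1 * (1 + \<mu>\<^sup>2)) * (M powr (2*(1-\<theta>)) * \<tau> powr (2*\<theta>))"
    proof (intro mult_right_mono mult_mono C1)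
      have "(1 + \<mu>\<^sup>2) powr \<theta> \<le> (1 + \<mu>\<^sup>2) powr 1" using TC by (intro powr_mono) auto
      also have "\<dots> = 1 + \<mu>\<^sup>2" by (simp add: add_nonneg_nonneg)
      also have "\<dots> \<le> 1 * (1 + \<mu>\<^sup>2)" by simp
      also have "\<dots> \<le> C1 * (1 + \<mu>\<^sup>2)" using C1(1) by (intro mult_right_mono) auto
      also have "\<dots> \<le> exp (C1 * (1 + \<mu>\<^sup>2))" using exp_ge_add_one_self[of "C1 * (1 + \<mu>\<^sup>2)"] by linarith
      finally show "(1 + \<mu>\<^sup>2) powr \<theta> \<le> exp (C1 * (1 + \<mu>\<^sup>2))" .
    qed (use C1 in auto)
    finally show ?thesis unfolding M_def \<tau>_def Jd by (simp add: mult.assoc)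
  qed
  show ?thesis
  proof (rule exI[of _ d], rule exI[of _ C1], rule exI[of _ \<theta>], intro conjI allI impI)
    show "1 < d" "0 < C1" "0 < \<theta>" "\<theta> < 1" using TC C1 by (auto simp: d_def)
  qed (rule main)
qed

end
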